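(* Let $n, d\ge 1$, let $\{f_0,\ldots,f_\ell\}$ be a basis of the $\mathbb{Q}_p$-vector space $\mathbb{Q}_p[x_0,\ldots,x_n]_{(d)}$ of homogeneous polynomials of degree $d$, and for every $i=1,\ldots,n$ consider the random polynomial $$F_i(x)=\sum_{k=0}^{\ell}\xi_{i,k}f_k(x),$$ where $\{\xi_{i,k}\}_{i=1,\ldots,n,\ k=0,\ldots,\ell}$ is a family of independent random variables uniformly distributed in $\mathbb{Z}_p$. Let $\nu(\mathbb{P}^n)\subset\mathbb{P}^\ell$ be the image of the map $\nu:\mathbb{P}^n\to\mathbb{P}^\ell$, $\nu([x])=[f_0(x),\ldots,f_\ell(x)]$. Then the expectation of the number of solutions in $\mathbb{P}^n$ of the random system $F_1=\cdots=F_n=0$ equals $$\mathbb{E}\#\{F_1=\cdots=F_n=0\}=\frac{\mathrm{vol}_n(\nu(\mathbb{P}^n))}{\mathrm{vol}_n(\mathbb{P}^n)}.$$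
   Context: Let $p$ be a prime, $|p|_p=p^{-1}$, $\|(a_0,\ldots,a_N)\|_p=\max_i|a_i|_p$. "Uniformly distributed in $\mathbb{Z}_p$" means according to Haar probability measure. $\mathbb{P}^N$ denotes $\mathbb{P}^N(\mathbb{Q}_p)$; $S^N=\{a\in\mathbb{Q}_p^{N+1}:\|a\|_p=1\}$, $\varphi:S^N\to\mathbb{P}^N$ is the natural projection. Metric on $\mathbb{P}^N$: $d(x,y)=\|\hat x\wedge\hat y\|_p$ for any $\hat x\in\varphi^{-1}(x)$, $\hat y\in\varphi^{-1}(y)$ (maximal absolute value of $2\times2$ minors); $B(x,r)=\{y:d(x,y)\le r\}$. Measure on $\mathbb{P}^N$: $\mu(U)=\frac{1}{1-p^{-1}}\mu(\varphi^{-1}(U))$, where on $\mathbb{Q}_p^{N+1}$ $\mu$ is the Haar measure with $\mu(\mathbb{Z}_p^{N+1})=1$. For an algebraic set $Y\subseteq\mathbb{P}^N$ of dimension $k$, $\mathrm{vol}_k(Y)=\lim_{m\to\infty}p^{m(N-k)}\mu\big(\bigcup_{x\in Y}B(x,p^{-m})\big)$ (the limit exists and is finite); the same formula is used for $\nu(\mathbb{P}^n)\subset\mathbb{P}^\ell$ with $k=n$, $N=\ell$. In particular $\mathrm{vol}_n(\mathbb{P}^n)=\frac{1-p^{-(n+1)}}{1-p^{-1}}$. *)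

theory Defs
  imports "HOL-Probability.Probability" "HOL-Library.Poly_Mapping"
    "HOL-Computational_Algebra.Primes"
begin

section \<open>The field of p-adic numbers\<close>

text \<open>A prime is represented by a type of prime cardinality: throughout, p is \<open>CARD('p)\<close>.\<close>

class prime_card = finite +
  assumes prime_card: "prime (CARD('a))"

subsection \<open>The p-adic absolute value on the rationals\<close>

definition rat_abs :: "'p::prime_card itself \<Rightarrow> rat \<Rightarrow> real" where
  "rat_abs _ x = (if x = 0 then 0 else
     (case quotient_of x of (a, b) \<Rightarrow>
       real CARD('p) powi (int (multiplicity (int CARD('p)) b) - int (multiplicity (int CARD('p)) a))))"

lemma prime_elem_card: "prime_elem (int CARD('p::prime_card))"
  using prime_card[where 'a = 'p] by (simp add: prime_imp_prime_elem)

lemma card_gt_1: "1 < real CARD('p::prime_card)"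
  using prime_card[where 'a = 'p] prime_gt_1_nat by simp

lemma rat_abs_Fract:
  assumes "a \<noteq> 0" "b \<noteq> 0"
  shows "rat_abs TYPE('p::prime_card) (Fract a b) =
    real CARD('p) powi (int (multiplicity (int CARD('p)) b) - int (multiplicity (int CARD('p)) a))"
proof -
  let ?v = "multiplicity (int CARD('p))"
  obtain a' b' where q: "quotient_of (Fract a b) = (a', b')" by (cases "quotient_of (Fract a b)")
  have b': "b' > 0" using quotient_of_denom_pos[OF q] .
  have eq: "Fract a b = Fract a' b'" using q by (simp add: Fract_of_int_quotient quotient_of_div)
  have a': "a' \<noteq> 0" using eq assms b' by (metis eq_rat(1) less_irrefl mult_eq_0_iff)
  have cr: "a * b' = a' * b" using eq assms(2) b' by (simp add: eq_rat)
  have "?v (a * b') = ?v a + ?v b'" "?v (a' * b) = ?v a' + ?v b"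
    using assms a' b' by (simp_all add: prime_elem_multiplicity_mult_distrib[OF prime_elem_card])
  then have "?v a + ?v b' = ?v a' + ?v b" using cr by simp
  then have "int (?v b') - int (?v a') = int (?v b) - int (?v a)" by linarith
  moreover have "Fract a b \<noteq> 0" using assms by (simp add: Zero_rat_def eq_rat)
  ultimately show ?thesis by (simp add: rat_abs_def q)
qed

lemma rat_abs_0 [simp]: "rat_abs TYPE('p::prime_card) 0 = 0"
  by (simp add: rat_abs_def)

lemma rat_abs_pos: "x \<noteq> 0 \<Longrightarrow> 0 < rat_abs TYPE('p::prime_card) x"
  using card_gt_1[where 'p = 'p] by (auto simp: rat_abs_def split: prod.split intro!: zero_less_power_int)

lemma rat_abs_nonneg [simp]: "0 \<le> rat_abs TYPE('p::prime_card) x"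
  using rat_abs_pos[of x, where 'p = 'p] by (cases "x = 0") auto

lemma rat_abs_mult: "rat_abs TYPE('p::prime_card) (x * y) = rat_abs TYPE('p) x * rat_abs TYPE('p) y"
proof (cases "x = 0 \<or> y = 0")
  case False
  obtain a b where x: "x = Fract a b" "b \<noteq> 0" by (cases x) auto
  obtain c d where y: "y = Fract c d" "d \<noteq> 0" by (cases y) auto
  have nz: "a \<noteq> 0" "c \<noteq> 0" using False x y by (auto simp: rat_number_collapse)
  have p: "real CARD('p) \<noteq> 0" using card_gt_1[where 'p = 'p] by simp
  show ?thesis
    using x y nz by (simp add: rat_abs_Fract prime_elem_multiplicity_mult_distrib[OF prime_elem_card]
        power_int_add[symmetric] p) (simp add: algebra_simps)
qed auto

lemma rat_abs_1 [simp]: "rat_abs TYPE('p::prime_card) 1 = 1"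
  using rat_abs_Fract[of 1 1, where 'p = 'p] by (simp add: One_rat_def)

lemma rat_abs_minus [simp]: "rat_abs TYPE('p::prime_card) (- x) = rat_abs TYPE('p) x"
proof -
  have "rat_abs TYPE('p) (-1) * rat_abs TYPE('p) (-1) = 1"
    using rat_abs_mult[of "-1" "-1", where 'p = 'p] by simp
  then have "rat_abs TYPE('p) (-1) = 1"
    by (metis mult_nonneg_nonneg rat_abs_nonneg square_eq_1_iff abs_of_nonneg abs_minus_cancel abs_one)
  then show ?thesis using rat_abs_mult[of "-1" x, where 'p = 'p] by simp
qed

lemma rat_abs_inverse: "rat_abs TYPE('p::prime_card) (inverse x) = inverse (rat_abs TYPE('p) x)"
proof (cases "x = 0")
  case False
  then have "rat_abs TYPE('p) x * rat_abs TYPE('p) (inverse x) = 1"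
    by (simp flip: rat_abs_mult)
  then show ?thesis by (metis inverse_unique)
qed auto

lemma rat_abs_ultra: "rat_abs TYPE('p::prime_card) (x + y) \<le> max (rat_abs TYPE('p) x) (rat_abs TYPE('p) y)"
proof (cases "x = 0 \<or> y = 0 \<or> x + y = 0")
  case False
  let ?v = "multiplicity (int CARD('p))"
  obtain a b where x: "x = Fract a b" "b \<noteq> 0" by (cases x) auto
  obtain c d where y: "y = Fract c d" "d \<noteq> 0" by (cases y) auto
  define u v w where "u = a * d" and "v = c * b" and "w = b * d"
  have w: "w \<noteq> 0" using x y by (simp add: w_def)
  have xu: "x = Fract u w" and yv: "y = Fract v w"
    using x y by (simp_all add: u_def v_def w_def eq_rat)
  have xy: "x + y = Fract (u + v) w" using xu yv w by (simp add: eq_rat algebra_simps)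
  have nz: "u \<noteq> 0" "v \<noteq> 0" "u + v \<noteq> 0"
    using False xu yv xy w by (auto simp: rat_number_collapse)
  have "int CARD('p) ^ min (?v u) (?v v) dvd u + v"
    by (intro dvd_add multiplicity_dvd') auto
  then have "min (?v u) (?v v) \<le> ?v (u + v)"
    using nz(3) prime_elem_card[where 'p = 'p]
    by (intro multiplicity_geI) (auto simp: prime_elem_not_unit)
  then have "int (?v w) - int (?v (u + v)) \<le> max (int (?v w) - int (?v u)) (int (?v w) - int (?v v))"
    by linarith
  then have "real CARD('p) powi (int (?v w) - int (?v (u + v)))
      \<le> real CARD('p) powi (max (int (?v w) - int (?v u)) (int (?v w) - int (?v v)))"
    using card_gt_1[where 'p = 'p] by (intro power_int_increasing) auto
  then show ?thesis
    unfolding xy unfolding xu yv using nz w by (auto simp: rat_abs_Fract max_def split: if_splits)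
qed (auto simp: max_def)

lemma rat_abs_triangle: "rat_abs TYPE('p::prime_card) (x + y) \<le> rat_abs TYPE('p) x + rat_abs TYPE('p) y"
  using rat_abs_ultra[of x y, where 'p = 'p] rat_abs_nonneg[of x, where 'p = 'p]
    rat_abs_nonneg[of y, where 'p = 'p] by linarith

lemma rat_abs_minus_commute: "rat_abs TYPE('p::prime_card) (x - y) = rat_abs TYPE('p) (y - x)"
  using rat_abs_minus[of "x - y", where 'p = 'p] by simp

lemma rat_abs_diff: "\<bar>rat_abs TYPE('p::prime_card) x - rat_abs TYPE('p) y\<bar> \<le> rat_abs TYPE('p) (x - y)"
  using rat_abs_triangle[of "x - y" y, where 'p = 'p] rat_abs_triangle[of "y - x" x, where 'p = 'p]
    rat_abs_minus_commute[of x y, where 'p = 'p] by simp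


subsection \<open>Completion\<close>

definition padic_null :: "'p::prime_card itself \<Rightarrow> (nat \<Rightarrow> rat) \<Rightarrow> bool" where
  "padic_null t X \<longleftrightarrow> (\<lambda>n. rat_abs t (X n)) \<longlonglongrightarrow> 0"

definition padic_cauchy :: "'p::prime_card itself \<Rightarrow> (nat \<Rightarrow> rat) \<Rightarrow> bool" where
  "padic_cauchy t X \<longleftrightarrow> (\<forall>e>0. \<exists>k. \<forall>m\<ge>k. \<forall>n\<ge>k. rat_abs t (X m - X n) < e)"

definition padic_rel :: "'p::prime_card itself \<Rightarrow> (nat \<Rightarrow> rat) \<Rightarrow> (nat \<Rightarrow> rat) \<Rightarrow> bool" where
  "padic_rel t X Y \<longleftrightarrow> padic_cauchy t X \<and> padic_cauchy t Y \<and> padic_null t (\<lambda>n. X n - Y n)"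

lemma padic_null_le:
  assumes "padic_null TYPE('p::prime_card) X" "eventually (\<lambda>n. rat_abs TYPE('p) (Y n) \<le> C * rat_abs TYPE('p) (X n)) sequentially"
  shows "padic_null TYPE('p) Y"
proof -
  have "(\<lambda>n. C * rat_abs TYPE('p) (X n)) \<longlonglongrightarrow> 0"
    using tendsto_mult_right_zero assms(1) unfolding padic_null_def by blast
  then show ?thesis
    unfolding padic_null_def by (rule Lim_null_comparison[rotated]) (use assms(2) in simp)
qed

lemma padic_null_0 [simp]: "padic_null TYPE('p::prime_card) (\<lambda>n. 0)"
  by (simp add: padic_null_def)

lemma padic_null_add:
  assumes "padic_null TYPE('p::prime_card) X" "padic_null TYPE('p) Y"
  shows "padic_null TYPE('p) (\<lambda>n. X n + Y n)"
proof -
  have "(\<lambda>n. rat_abs TYPE('p) (X n) + rat_abs TYPE('p) (Y n)) \<longlonglongrightarrow> 0"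
    using tendsto_add assms unfolding padic_null_def by fastforce
  then show ?thesis
    unfolding padic_null_def by (rule Lim_null_comparison[rotated]) (simp add: rat_abs_triangle)
qed

lemma padic_null_minus: "padic_null TYPE('p::prime_card) X \<Longrightarrow> padic_null TYPE('p) (\<lambda>n. - X n)"
  by (simp add: padic_null_def)

lemma padic_cauchy_const [simp]: "padic_cauchy TYPE('p::prime_card) (\<lambda>n. c)"
  by (simp add: padic_cauchy_def)

lemma padic_cauchy_minus: "padic_cauchy TYPE('p::prime_card) X \<Longrightarrow> padic_cauchy TYPE('p) (\<lambda>n. - X n)"
  by (simp add: padic_cauchy_def) (metis rat_abs_minus_commute)

lemma padic_cauchy_add:
  assumes "padic_cauchy TYPE('p::prime_card) X" "padic_cauchy TYPE('p) Y"
  shows "padic_cauchy TYPE('p) (\<lambda>n. X n + Y n)"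
  unfolding padic_cauchy_def
proof (intro allI impI)
  fix e :: real assume e: "e > 0"
  obtain k where k: "\<And>m n. m \<ge> k \<Longrightarrow> n \<ge> k \<Longrightarrow> rat_abs TYPE('p) (X m - X n) < e"
    using assms(1) e unfolding padic_cauchy_def by meson
  obtain l where l: "\<And>m n. m \<ge> l \<Longrightarrow> n \<ge> l \<Longrightarrow> rat_abs TYPE('p) (Y m - Y n) < e"
    using assms(2) e unfolding padic_cauchy_def by meson
  have "rat_abs TYPE('p) (X m + Y m - (X n + Y n)) < e" if "m \<ge> max k l" "n \<ge> max k l" for m n
    using rat_abs_ultra[of "X m - X n" "Y m - Y n", where 'p = 'p] k[of m n] l[of m n] that
    by (simp add: algebra_simps)
  then show "\<exists>k. \<forall>m\<ge>k. \<forall>n\<ge>k. rat_abs TYPE('p) (X m + Y m - (X n + Y n)) < e" by blast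
qed

lemma padic_cauchy_bounded:
  assumes "padic_cauchy TYPE('p::prime_card) X"
  shows "\<exists>C>0. \<forall>n. rat_abs TYPE('p) (X n) \<le> C"
proof -
  obtain k where k: "\<And>m n. m \<ge> k \<Longrightarrow> n \<ge> k \<Longrightarrow> rat_abs TYPE('p) (X m - X n) < 1"
    using assms unfolding padic_cauchy_def by (meson zero_less_one)
  define C where "C = 1 + (\<Sum>i\<le>k. rat_abs TYPE('p) (X i))"
  have le: "rat_abs TYPE('p) (X i) \<le> C - 1" if "i \<le> k" for i
    unfolding C_def using that member_le_sum[of i "{..k}" "\<lambda>i. rat_abs TYPE('p) (X i)"] by simp
  have "rat_abs TYPE('p) (X n) \<le> C" for n
  proof (cases "n \<le> k")
    case False
    then show ?thesis
      using rat_abs_triangle[of "X n - X k" "X k", where 'p = 'p] k[of n k] le[of k] by simp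
  qed (use le[of n] in simp)
  moreover have "C > 0" by (simp add: C_def add_pos_nonneg sum_nonneg)
  ultimately show ?thesis by blast
qed

lemma padic_cauchy_mult:
  assumes "padic_cauchy TYPE('p::prime_card) X" "padic_cauchy TYPE('p) Y"
  shows "padic_cauchy TYPE('p) (\<lambda>n. X n * Y n)"
  unfolding padic_cauchy_def
proof (intro allI impI)
  fix e :: real assume e: "e > 0"
  obtain C where C: "C > 0" "\<And>n. rat_abs TYPE('p) (X n) \<le> C"
    using padic_cauchy_bounded[OF assms(1)] by blast
  obtain D where D: "D > 0" "\<And>n. rat_abs TYPE('p) (Y n) \<le> D"
    using padic_cauchy_bounded[OF assms(2)] by blast
  have "e / D > 0" "e / C > 0" using e C D by auto
  then obtain k l where
    k: "\<And>m n. m \<ge> k \<Longrightarrow> n \<ge> k \<Longrightarrow> rat_abs TYPE('p) (X m - X n) < e / D" and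
    l: "\<And>m n. m \<ge> l \<Longrightarrow> n \<ge> l \<Longrightarrow> rat_abs TYPE('p) (Y m - Y n) < e / C"
    using assms unfolding padic_cauchy_def by meson
  have "rat_abs TYPE('p) (X m * Y m - X n * Y n) < e" if "m \<ge> max k l" "n \<ge> max k l" for m n
  proof -
    have eq: "X m * Y m - X n * Y n = X m * (Y m - Y n) + (X m - X n) * Y n"
      by (simp add: algebra_simps)
    have "rat_abs TYPE('p) (X m) * rat_abs TYPE('p) (Y m - Y n) \<le> C * rat_abs TYPE('p) (Y m - Y n)"
      using C by (simp add: mult_right_mono)
    also have "\<dots> < C * (e / C)" using l[of m n] that C by (intro mult_strict_left_mono) auto
    finally have 1: "rat_abs TYPE('p) (X m * (Y m - Y n)) < e" using C by (simp add: rat_abs_mult)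
    have "rat_abs TYPE('p) (X m - X n) * rat_abs TYPE('p) (Y n) \<le> rat_abs TYPE('p) (X m - X n) * D"
      using D by (simp add: mult_left_mono)
    also have "\<dots> < (e / D) * D" using k[of m n] that D by (intro mult_strict_right_mono) auto
    finally have 2: "rat_abs TYPE('p) ((X m - X n) * Y n) < e" using D by (simp add: rat_abs_mult)
    show ?thesis unfolding eq using rat_abs_ultra 1 2 by (metis max_less_iff_conj order_le_less_trans)
  qed
  then show "\<exists>k. \<forall>m\<ge>k. \<forall>n\<ge>k. rat_abs TYPE('p) (X m * Y m - X n * Y n) < e" by blast
qed

lemma padic_null_mult:
  assumes "padic_cauchy TYPE('p::prime_card) X" "padic_null TYPE('p) Y"
  shows "padic_null TYPE('p) (\<lambda>n. X n * Y n)"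
proof -
  obtain C where "\<And>n. rat_abs TYPE('p) (X n) \<le> C"
    using padic_cauchy_bounded[OF assms(1)] by blast
  then have "eventually (\<lambda>n. rat_abs TYPE('p) (X n * Y n) \<le> C * rat_abs TYPE('p) (Y n)) sequentially"
    by (simp add: rat_abs_mult mult_right_mono)
  then show ?thesis by (rule padic_null_le[OF assms(2)])
qed

lemma padic_cauchy_not_null:
  assumes "padic_cauchy TYPE('p::prime_card) X" "\<not> padic_null TYPE('p) X"
  shows "\<exists>b>0. \<exists>k. \<forall>n\<ge>k. b \<le> rat_abs TYPE('p) (X n)"
proof -
  obtain r where r: "r > 0" "\<And>k. \<exists>n\<ge>k. \<not> rat_abs TYPE('p) (X n) < r"
    using assms(2) unfolding padic_null_def LIMSEQ_def by auto
  obtain k where k: "\<And>m n. m \<ge> k \<Longrightarrow> n \<ge> k \<Longrightarrow> rat_abs TYPE('p) (X m - X n) < r / 2"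
    using assms(1) r(1) unfolding padic_cauchy_def by (meson half_gt_zero)
  obtain m where m: "m \<ge> k" "rat_abs TYPE('p) (X m) \<ge> r" using r(2)[of k] by auto
  have "r / 2 \<le> rat_abs TYPE('p) (X n)" if "n \<ge> k" for n
    using rat_abs_triangle[of "X m - X n" "X n", where 'p = 'p] k[of m n] that m by simp
  then show ?thesis using r(1) by (intro exI[of _ "r / 2"]) auto
qed

lemma padic_cauchy_inverse:
  assumes "padic_cauchy TYPE('p::prime_card) X" "\<not> padic_null TYPE('p) X"
  shows "padic_cauchy TYPE('p) (\<lambda>n. inverse (X n))"
  unfolding padic_cauchy_def
proof (intro allI impI)
  fix e :: real assume e: "e > 0"
  obtain b k where b: "b > 0" "\<And>n. n \<ge> k \<Longrightarrow> b \<le> rat_abs TYPE('p) (X n)"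
    using padic_cauchy_not_null[OF assms] by blast
  have "e * (b * b) > 0" using e b by simp
  then obtain l where l: "\<And>m n. m \<ge> l \<Longrightarrow> n \<ge> l \<Longrightarrow> rat_abs TYPE('p) (X m - X n) < e * (b * b)"
    using assms(1) unfolding padic_cauchy_def by meson
  have "rat_abs TYPE('p) (inverse (X m) - inverse (X n)) < e" if mn: "m \<ge> max k l" "n \<ge> max k l" for m n
  proof -
    have nz: "X m \<noteq> 0" "X n \<noteq> 0" using b(1) b(2)[of m] b(2)[of n] mn by auto
    have pos: "rat_abs TYPE('p) (X m) > 0" "rat_abs TYPE('p) (X n) > 0" using nz rat_abs_pos by auto
    have eq: "inverse (X m) - inverse (X n) = (X n - X m) * (inverse (X m) * inverse (X n))"
      using nz by (simp add: field_simps)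
    have "b * b \<le> rat_abs TYPE('p) (X m) * rat_abs TYPE('p) (X n)"
      using b mn by (intro mult_mono) auto
    then have "rat_abs TYPE('p) (X n - X m) < e * (rat_abs TYPE('p) (X m) * rat_abs TYPE('p) (X n))"
      using l[of n m] mn e by (smt (verit) max.bounded_iff mult_left_mono)
    then show ?thesis
      unfolding eq rat_abs_mult rat_abs_inverse using pos by (simp add: field_simps)
  qed
  then show "\<exists>k. \<forall>m\<ge>k. \<forall>n\<ge>k. rat_abs TYPE('p) (inverse (X m) - inverse (X n)) < e" by blast
qed

lemma padic_null_diff_inverse:
  assumes X: "padic_cauchy TYPE('p::prime_card) X" "\<not> padic_null TYPE('p) X"
    and Y: "padic_cauchy TYPE('p) Y" "\<not> padic_null TYPE('p) Y"
    and XY: "padic_null TYPE('p) (\<lambda>n. X n - Y n)"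
  shows "padic_null TYPE('p) (\<lambda>n. inverse (X n) - inverse (Y n))"
proof -
  obtain b k where b: "b > 0" "\<And>n. n \<ge> k \<Longrightarrow> b \<le> rat_abs TYPE('p) (X n)"
    using padic_cauchy_not_null[OF X] by blast
  obtain c l where c: "c > 0" "\<And>n. n \<ge> l \<Longrightarrow> c \<le> rat_abs TYPE('p) (Y n)"
    using padic_cauchy_not_null[OF Y] by blast
  have nz: "X n \<noteq> 0" "Y n \<noteq> 0" if "n \<ge> max k l" for n
    using b(1) c(1) b(2)[of n] c(2)[of n] that by force+
  have cau: "padic_cauchy TYPE('p) (\<lambda>n. - (inverse (X n) * inverse (Y n)))"
    by (intro padic_cauchy_minus padic_cauchy_mult padic_cauchy_inverse X Y)
  have "padic_null TYPE('p) (\<lambda>n. - (inverse (X n) * inverse (Y n)) * (X n - Y n))"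
    by (rule padic_null_mult[OF cau XY])
  moreover have "eventually (\<lambda>n. rat_abs TYPE('p) (inverse (X n) - inverse (Y n))
      \<le> 1 * rat_abs TYPE('p) (- (inverse (X n) * inverse (Y n)) * (X n - Y n))) sequentially"
    unfolding eventually_sequentially
  proof (intro exI[of _ "max k l"] allI impI)
    fix n assume "max k l \<le> n"
    then have "inverse (X n) - inverse (Y n) = - (inverse (X n) * inverse (Y n)) * (X n - Y n)"
      using nz[of n] by (simp add: field_simps)
    then show "rat_abs TYPE('p) (inverse (X n) - inverse (Y n))
      \<le> 1 * rat_abs TYPE('p) (- (inverse (X n) * inverse (Y n)) * (X n - Y n))" by simp
  qed
  ultimately show ?thesis by (rule padic_null_le)
qed

lemma part_equivp_padic_rel: "part_equivp (padic_rel TYPE('p::prime_card))"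
proof (rule part_equivpI)
  show "\<exists>X. padic_rel TYPE('p) X X"
    by (rule exI[of _ "\<lambda>n. 0"]) (simp add: padic_rel_def)
  show "symp (padic_rel TYPE('p))"
    by (rule sympI) (auto simp: padic_rel_def padic_null_def rat_abs_minus_commute[where 'p = 'p])
  show "transp (padic_rel TYPE('p))"
    by (rule transpI) (use padic_null_add[where 'p = 'p] in \<open>force simp: padic_rel_def\<close>)
qed

text \<open>
  Classes of p-adic Cauchy sequences of rationals modulo null sequences. The quotient is set up by
  hand because the prime enters the relation only through \<open>TYPE('p)\<close>, not through the type of
  the sequences.
\<close>

typedef ('p::prime_card) padic =
  "{A. \<exists>X. padic_rel TYPE('p) X X \<and> A = Collect (padic_rel TYPE('p) X)}"
  by (rule exI[of _ "Collect (padic_rel TYPE('p) (\<lambda>n. 0))"]) (auto simp: padic_rel_def intro!: exI[of _ "\<lambda>n. 0"])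

definition abs_padic :: "(nat \<Rightarrow> rat) \<Rightarrow> 'p::prime_card padic" where
  "abs_padic X = Abs_padic (Collect (padic_rel TYPE('p) X))"

definition rep_padic :: "'p::prime_card padic \<Rightarrow> nat \<Rightarrow> rat" where
  "rep_padic x = (SOME X. X \<in> Rep_padic x)"

definition cr_padic :: "(nat \<Rightarrow> rat) \<Rightarrow> 'p::prime_card padic \<Rightarrow> bool" where
  "cr_padic \<equiv> \<lambda>X x. padic_rel TYPE('p) X X \<and> abs_padic X = x"

lemma Quotient_padic:
  "Quotient (padic_rel TYPE('p::prime_card)) (abs_padic :: _ \<Rightarrow> 'p padic) rep_padic cr_padic"
proof -
  interpret quot_type "padic_rel TYPE('p)" "Abs_padic :: _ \<Rightarrow> 'p padic" Rep_padic
    using Rep_padic Abs_padic_inverse Rep_padic_inverse Rep_padic_inject part_equivp_padic_rel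
    by unfold_locales (auto, (blast+)?)
  have "Quotient3 (padic_rel TYPE('p)) (abs_padic :: _ \<Rightarrow> 'p padic) rep_padic"
    using Quotient unfolding abs_def rep_def abs_padic_def[abs_def] rep_padic_def[abs_def] by simp
  then show ?thesis by (rule Quotient3_to_Quotient) (rule cr_padic_def)
qed

setup_lifting Quotient_padic

instantiation padic :: (prime_card) field
begin

lift_definition zero_padic :: "'a padic" is "\<lambda>n. 0"
  by (simp add: padic_rel_def)

lift_definition one_padic :: "'a padic" is "\<lambda>n. 1"
  by (simp add: padic_rel_def)

lift_definition plus_padic :: "'a padic \<Rightarrow> 'a padic \<Rightarrow> 'a padic" is "\<lambda>X Y n. X n + Y n"
  unfolding padic_rel_def add_diff_add by (simp add: padic_cauchy_add padic_null_add)

lift_definition uminus_padic :: "'a padic \<Rightarrow> 'a padic" is "\<lambda>X n. - X n"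
  unfolding padic_rel_def minus_diff_minus by (simp add: padic_cauchy_minus padic_null_minus del: minus_diff_eq)

lift_definition times_padic :: "'a padic \<Rightarrow> 'a padic \<Rightarrow> 'a padic" is "\<lambda>X Y n. X n * Y n"
proof -
  fix X X' Y Y' assume "padic_rel TYPE('a) X X'" "padic_rel TYPE('a) Y Y'"
  then have c: "padic_cauchy TYPE('a) X" "padic_cauchy TYPE('a) X'" "padic_cauchy TYPE('a) Y" "padic_cauchy TYPE('a) Y'"
    and n: "padic_null TYPE('a) (\<lambda>n. X n - X' n)" "padic_null TYPE('a) (\<lambda>n. Y n - Y' n)"
    by (auto simp: padic_rel_def)
  have "padic_null TYPE('a) (\<lambda>n. X n * (Y n - Y' n) + Y' n * (X n - X' n))"
    by (intro padic_null_add padic_null_mult c n)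
  moreover have "(\<lambda>n. X n * (Y n - Y' n) + Y' n * (X n - X' n)) = (\<lambda>n. X n * Y n - X' n * Y' n)"
    by (auto simp: algebra_simps)
  ultimately show "padic_rel TYPE('a) (\<lambda>n. X n * Y n) (\<lambda>n. X' n * Y' n)"
    using c by (simp add: padic_rel_def padic_cauchy_mult)
qed

lift_definition inverse_padic :: "'a padic \<Rightarrow> 'a padic"
  is "\<lambda>X. if padic_null TYPE('a) X then (\<lambda>n. 0) else (\<lambda>n. inverse (X n))"
proof -
  fix X Y assume "padic_rel TYPE('a) X Y"
  then have X: "padic_cauchy TYPE('a) X" and Y: "padic_cauchy TYPE('a) Y"
    and XY: "padic_null TYPE('a) (\<lambda>n. X n - Y n)"
    by (simp_all add: padic_rel_def)
  have "padic_null TYPE('a) X \<longleftrightarrow> padic_null TYPE('a) Y"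
    using padic_null_add[OF XY, of Y] padic_null_add[OF padic_null_minus[OF XY], of X] by auto
  then show "padic_rel TYPE('a)
      (if padic_null TYPE('a) X then (\<lambda>n. 0) else (\<lambda>n. inverse (X n)))
      (if padic_null TYPE('a) Y then (\<lambda>n. 0) else (\<lambda>n. inverse (Y n)))"
    using X Y XY by (simp add: padic_rel_def padic_cauchy_inverse padic_null_diff_inverse)
qed

definition "x - y = x + - y" for x y :: "'a padic"

definition "x div y = x * inverse y" for x y :: "'a padic"

instance
proof
  fix a b c :: "'a padic"
  note [simp] = padic_rel_def padic_cauchy_add padic_cauchy_mult padic_cauchy_minus
  show "a + b = b + a" by transfer (simp add: ac_simps)
  show "(a + b) + c = a + (b + c)" by transfer (simp add: ac_simps)
  show "0 + a = a" by transfer simp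
  show "- a + a = 0" by transfer simp
  show "a - b = a + - b" by (rule minus_padic_def)
  show "(a * b) * c = a * (b * c)" by transfer (simp add: ac_simps)
  show "a * b = b * a" by transfer (simp add: ac_simps)
  show "1 * a = a" by transfer simp
  show "(a + b) * c = a * c + b * c" by transfer (simp add: distrib_right)
  show "(0 :: 'a padic) \<noteq> 1" by transfer (simp add: padic_null_def LIMSEQ_const_iff)
  have "padic_null TYPE('a) (\<lambda>n. inverse (X n) * X n - 1)"
    if X: "padic_cauchy TYPE('a) X" "\<not> padic_null TYPE('a) X" for X
  proof -
    obtain b k where b: "b > 0" "\<And>n. n \<ge> k \<Longrightarrow> b \<le> rat_abs TYPE('a) (X n)"
      using padic_cauchy_not_null[OF X] by blast
    have "rat_abs TYPE('a) (inverse (X n) * X n - 1) = 0" if "n \<ge> k" for n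
      using b(1) b(2)[OF that] by (cases "X n = 0") auto
    then show ?thesis
      unfolding padic_null_def by (intro tendsto_eventually) (auto simp: eventually_sequentially)
  qed
  then show "a \<noteq> 0 \<Longrightarrow> inverse a * a = 1" by transfer (auto simp: padic_cauchy_inverse)
  show "a div b = a * inverse b" by (rule divide_padic_def)
  show "inverse (0 :: 'a padic) = 0" by transfer simp
qed

end

lemma padic_cauchy_tendsto:
  assumes "padic_cauchy TYPE('p::prime_card) X"
  shows "(\<lambda>n. rat_abs TYPE('p) (X n)) \<longlonglongrightarrow> lim (\<lambda>n. rat_abs TYPE('p) (X n))"
proof -
  have "Cauchy (\<lambda>n. rat_abs TYPE('p) (X n))"
    unfolding Cauchy_def dist_real_def
    using assms rat_abs_diff[where 'p = 'p] unfolding padic_cauchy_def by (meson order_le_less_trans)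
  then show ?thesis by (simp add: Cauchy_convergent_iff convergent_LIMSEQ_iff)
qed

text \<open>The overloaded \<open>norm\<close> is reserved for real normed vector spaces.\<close>

lift_definition padic_abs :: "'p::prime_card padic \<Rightarrow> real" is "\<lambda>X. lim (\<lambda>n. rat_abs TYPE('p) (X n))"
proof -
  fix X Y assume "padic_rel TYPE('p) X Y"
  then have X: "padic_cauchy TYPE('p) X" and Y: "padic_cauchy TYPE('p) Y"
    and XY: "padic_null TYPE('p) (\<lambda>n. X n - Y n)"
    by (simp_all add: padic_rel_def)
  have "(\<lambda>n. rat_abs TYPE('p) (X n) - rat_abs TYPE('p) (Y n)) \<longlonglongrightarrow> 0"
    using XY unfolding padic_null_def
    by (rule Lim_null_comparison[rotated]) (simp add: rat_abs_diff)
  then have "(\<lambda>n. rat_abs TYPE('p) (Y n)) \<longlonglongrightarrow> lim (\<lambda>n. rat_abs TYPE('p) (X n))"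
    using tendsto_diff[OF padic_cauchy_tendsto[OF X]] by fastforce
  then show "lim (\<lambda>n. rat_abs TYPE('p) (X n)) = lim (\<lambda>n. rat_abs TYPE('p) (Y n))"
    by (simp add: limI)
qed

instantiation padic :: (prime_card) metric_space
begin

definition dist_padic :: "'a padic \<Rightarrow> 'a padic \<Rightarrow> real" where
  "dist_padic x y = padic_abs (x - y)"

definition uniformity_padic :: "('a padic \<times> 'a padic) filter" where
  "uniformity_padic = (INF e\<in>{0<..}. principal {(x, y). dist x y < e})"

definition open_padic :: "'a padic set \<Rightarrow> bool" where
  "open_padic U \<longleftrightarrow> (\<forall>x\<in>U. eventually (\<lambda>(x', y). x' = x \<longrightarrow> y \<in> U) uniformity)"

instance
proof
  have eq0: "padic_abs z = 0 \<longleftrightarrow> z = 0" for z :: "'a padic"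
  proof transfer
    fix X assume "padic_rel TYPE('a) X X"
    then have X: "padic_cauchy TYPE('a) X" by (simp add: padic_rel_def)
    have "lim (\<lambda>n. rat_abs TYPE('a) (X n)) = 0 \<longleftrightarrow> padic_null TYPE('a) X"
      using padic_cauchy_tendsto[OF X] by (auto simp: padic_null_def dest: limI)
    then show "lim (\<lambda>n. rat_abs TYPE('a) (X n)) = 0 \<longleftrightarrow> padic_rel TYPE('a) X (\<lambda>n. 0)"
      using X by (simp add: padic_rel_def)
  qed
  have tri: "padic_abs (u + v) \<le> padic_abs u + padic_abs v" for u v :: "'a padic"
  proof transfer
    fix X Y assume "padic_rel TYPE('a) X X" "padic_rel TYPE('a) Y Y"
    then have X: "padic_cauchy TYPE('a) X" and Y: "padic_cauchy TYPE('a) Y"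
      by (simp_all add: padic_rel_def)
    show "lim (\<lambda>n. rat_abs TYPE('a) (X n + Y n))
        \<le> lim (\<lambda>n. rat_abs TYPE('a) (X n)) + lim (\<lambda>n. rat_abs TYPE('a) (Y n))"
      using padic_cauchy_tendsto[OF padic_cauchy_add[OF X Y]]
        tendsto_add[OF padic_cauchy_tendsto[OF X] padic_cauchy_tendsto[OF Y]]
      by (rule LIMSEQ_le) (simp add: rat_abs_triangle)
  qed
  have neg: "padic_abs (- u) = padic_abs u" for u :: "'a padic"
    by transfer simp
  fix x y z :: "'a padic"
  show "dist x y = 0 \<longleftrightarrow> x = y" by (simp add: dist_padic_def eq0)
  show "dist x y \<le> dist x z + dist y z"
    using tri[of "x - z" "z - y"] neg[of "z - y"] by (simp add: dist_padic_def)
qed (rule uniformity_padic_def open_padic_def)+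

end

lemma padic_abs_mult: "padic_abs (x * y) = padic_abs x * padic_abs y" for x y :: "'p::prime_card padic"
proof transfer
  fix X Y assume "padic_rel TYPE('p) X X" "padic_rel TYPE('p) Y Y"
  then have "padic_cauchy TYPE('p) X" "padic_cauchy TYPE('p) Y"
    by (simp_all add: padic_rel_def)
  then show "lim (\<lambda>n. rat_abs TYPE('p) (X n * Y n))
      = lim (\<lambda>n. rat_abs TYPE('p) (X n)) * lim (\<lambda>n. rat_abs TYPE('p) (Y n))"
    by (intro limI) (simp add: rat_abs_mult tendsto_mult padic_cauchy_tendsto)
qed

lemma padic_abs_ultra: "padic_abs (x + y) \<le> max (padic_abs x) (padic_abs y)" for x y :: "'p::prime_card padic"
proof transfer
  fix X Y assume "padic_rel TYPE('p) X X" "padic_rel TYPE('p) Y Y"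
  then have X: "padic_cauchy TYPE('p) X" and Y: "padic_cauchy TYPE('p) Y"
    by (simp_all add: padic_rel_def)
  show "lim (\<lambda>n. rat_abs TYPE('p) (X n + Y n))
      \<le> max (lim (\<lambda>n. rat_abs TYPE('p) (X n))) (lim (\<lambda>n. rat_abs TYPE('p) (Y n)))"
    using padic_cauchy_tendsto[OF padic_cauchy_add[OF X Y]]
      tendsto_max[OF padic_cauchy_tendsto[OF X] padic_cauchy_tendsto[OF Y]]
    by (rule LIMSEQ_le) (simp add: rat_abs_ultra)
qed

lemma padic_abs_eq_0 [simp]: "padic_abs x = 0 \<longleftrightarrow> x = 0"
  using dist_eq_0_iff[of x 0] by (simp add: dist_padic_def)

lemma padic_abs_nonneg [simp]: "0 \<le> padic_abs x"
  using zero_le_dist[of x 0] by (simp add: dist_padic_def)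

lemma padic_abs_1 [simp]: "padic_abs (1 :: 'a::prime_card padic) = 1"
proof -
  have "padic_abs (1 :: 'a padic) * padic_abs (1 :: 'a padic) = padic_abs (1 :: 'a padic) * 1"
    using padic_abs_mult[of "1 :: 'a padic" 1] by simp
  then show ?thesis unfolding mult_cancel_left by simp
qed

lemma padic_abs_of_nat: "padic_abs (of_nat m :: 'p::prime_card padic) = rat_abs TYPE('p) (of_nat m)"
proof -
  have rel: "padic_rel TYPE('p) (\<lambda>n. c) (\<lambda>n. c)" for c
    by (simp add: padic_rel_def)
  have "(of_nat m :: 'p padic) = abs_padic (\<lambda>n. of_nat m)"
  proof (induction m)
    case 0
    show ?case by (simp add: zero_padic_def)
  next
    case (Suc m)
    then show ?case
      by (simp add: one_padic.abs_eq plus_padic.abs_eq[OF rel rel])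
  qed
  then show ?thesis by (simp add: padic_abs.abs_eq[OF rel] limI)
qed

lemma padic_abs_p: "padic_abs (of_nat CARD('p) :: 'p::prime_card padic) = 1 / real CARD('p)"
proof -
  have "multiplicity (int CARD('p)) (int CARD('p)) = 1"
    using prime_elem_card[where 'p = 'p] by (intro multiplicity_self) (auto simp: prime_elem_not_unit)
  moreover have "(of_nat CARD('p) :: rat) = Fract (int CARD('p)) 1"
    by (simp add: Fract_of_nat_eq)
  ultimately show ?thesis
    using rat_abs_Fract[of "int CARD('p)" 1, where 'p = 'p] card_gt_1[where 'p = 'p]
    by (simp add: padic_abs_of_nat power_int_minus divide_simps)
qed

lemma padic_abs_range:
  assumes "(x :: 'p::prime_card padic) \<noteq> 0"
  shows "\<exists>k. padic_abs x = real CARD('p) powi k"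
  using assms
proof transfer
  fix X assume "padic_rel TYPE('p) X X" "\<not> padic_rel TYPE('p) X (\<lambda>n. 0)"
  then have X: "padic_cauchy TYPE('p) X" "\<not> padic_null TYPE('p) X" by (auto simp: padic_rel_def)
  obtain b k where b: "b > 0" "\<And>n. n \<ge> k \<Longrightarrow> b \<le> rat_abs TYPE('p) (X n)"
    using padic_cauchy_not_null[OF X] by blast
  obtain l where l: "\<And>m n. m \<ge> l \<Longrightarrow> n \<ge> l \<Longrightarrow> rat_abs TYPE('p) (X m - X n) < b"
    using X(1) b(1) unfolding padic_cauchy_def by meson
  define N where "N = max k l"
  have "rat_abs TYPE('p) (X n) = rat_abs TYPE('p) (X N)" if "n \<ge> N" for n
  proof -
    have "rat_abs TYPE('p) (X n - X N) < rat_abs TYPE('p) (X N)"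
      "rat_abs TYPE('p) (X N - X n) < rat_abs TYPE('p) (X n)"
      using l[of n N] l[of N n] b(2)[of n] b(2)[of N] that by (auto simp: N_def)
    then show ?thesis
      using rat_abs_ultra[of "X n - X N" "X N", where 'p = 'p]
        rat_abs_ultra[of "X N - X n" "X n", where 'p = 'p] by simp
  qed
  then have "eventually (\<lambda>n. rat_abs TYPE('p) (X n) = rat_abs TYPE('p) (X N)) sequentially"
    unfolding eventually_sequentially by blast
  then have "lim (\<lambda>n. rat_abs TYPE('p) (X n)) = rat_abs TYPE('p) (X N)"
    by (intro limI tendsto_eventually)
  moreover have "X N \<noteq> 0" using b(1) b(2)[of N] by (auto simp: N_def)
  ultimately show "\<exists>k. lim (\<lambda>n. rat_abs TYPE('p) (X n)) = real CARD('p) powi k"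
    by (auto simp: rat_abs_def split: prod.split)
qed


section \<open>Haar measure\<close>

text \<open>
  The translation-invariant Borel measure giving mass 1 to \<open>U\<close>. It is used only for the groups
  \<open>'p padic\<close> and \<open>'p padic ^ 'n\<close> and their unit balls, which are compact and open, so that
  such a measure exists and is unique.
\<close>

definition haar_measure :: "'a::{topological_space, ab_group_add} set \<Rightarrow> 'a measure" where
  "haar_measure U = (THE M. sets M = sets borel \<and> (\<forall>a. distr M borel ((+) a) = M) \<and> emeasure M U = 1)"

definition padic_int :: "'p::prime_card padic set" where
  "padic_int = {x. padic_abs x \<le> 1}"

definition padic_uniform :: "'p::prime_card padic measure" where
  "padic_uniform = uniform_measure (haar_measure padic_int) padic_int"

definition vec_abs :: "'p::prime_card padic ^ 'n::finite \<Rightarrow> real" where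
  "vec_abs x = Max (range (\<lambda>i. padic_abs (x $ i)))"

definition haar_vec :: "('p::prime_card padic ^ 'n::finite) measure" where
  "haar_vec = haar_measure {x. vec_abs x \<le> 1}"


section \<open>Projective space\<close>

text \<open>
  Coordinates are indexed by a finite type \<open>'n\<close>, so that points live in projective space of
  dimension \<open>CARD('n) - 1\<close>. A point is the set of its nonzero coordinate vectors.
\<close>

definition proj_class :: "'a::field ^ 'n::finite \<Rightarrow> ('a ^ 'n) set" where
  "proj_class x = {c *s x | c. c \<noteq> 0}"

definition proj_space :: "('a::field ^ 'n::finite) set set" where
  "proj_space = proj_class ` (- {0})"

definition unit_sphere :: "('p::prime_card padic ^ 'n::finite) set" where
  "unit_sphere = {a. vec_abs a = 1}"

definition wedge_abs :: "'p::prime_card padic ^ 'n::finite \<Rightarrow> 'p padic ^ 'n \<Rightarrow> real" where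
  "wedge_abs x y = Max (range (\<lambda>(i, j). padic_abs (x $ i * y $ j - x $ j * y $ i)))"

definition proj_dist :: "('p::prime_card padic ^ 'n::finite) set \<Rightarrow> ('p padic ^ 'n) set \<Rightarrow> real" where
  "proj_dist X Y = wedge_abs (SOME x. x \<in> unit_sphere \<and> proj_class x = X)
                             (SOME y. y \<in> unit_sphere \<and> proj_class y = Y)"

definition proj_ball :: "('p::prime_card padic ^ 'n::finite) set \<Rightarrow> real \<Rightarrow> ('p padic ^ 'n) set set" where
  "proj_ball X r = {Y \<in> proj_space. proj_dist X Y \<le> r}"

definition proj_measure :: "('p::prime_card padic ^ 'n::finite) set set \<Rightarrow> real" where
  "proj_measure U = 1 / (1 - 1 / real CARD('p)) * measure haar_vec {a \<in> unit_sphere. proj_class a \<in> U}"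

definition proj_vol :: "nat \<Rightarrow> ('p::prime_card padic ^ 'n::finite) set set \<Rightarrow> real" where
  "proj_vol k Y = lim (\<lambda>m. real CARD('p) powi (int m * (int CARD('n) - 1 - int k)) *
     proj_measure (\<Union>X\<in>Y. proj_ball X (real CARD('p) powi (- int m))))"

lemma proj_class_scale:
  assumes "b \<noteq> 0"
  shows "proj_class (b *s v) = proj_class v"
proof -
  have sub: "proj_class (c *s w) \<subseteq> proj_class w" if "c \<noteq> 0" for c :: 'a and w :: "'a ^ 'b"
    using that by (force simp: proj_class_def)
  show ?thesis
    using sub[OF assms, of v] sub[of "inverse b" "b *s v"] assms by simp
qed

lemma vec_abs_scale: "vec_abs (c *s x) = padic_abs c * vec_abs x"
proof -
  have "Max ((*) (padic_abs c) ` range (\<lambda>i. padic_abs (x $ i))) = padic_abs c * Max (range (\<lambda>i. padic_abs (x $ i)))"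
    by (rule mono_Max_commute[symmetric]) (auto intro!: monoI mult_left_mono)
  then show ?thesis
    by (simp add: vec_abs_def padic_abs_mult image_image)
qed

lemma vec_abs_attained: "\<exists>i. vec_abs x = padic_abs (x $ i)"
proof -
  have "vec_abs x \<in> range (\<lambda>i. padic_abs (x $ i))"
    unfolding vec_abs_def by (rule Max_in) auto
  then show ?thesis by auto
qed

lemma vec_abs_ge: "padic_abs (x $ i) \<le> vec_abs x"
  unfolding vec_abs_def by (rule Max_ge) auto

lemma proj_space_eq_sphere: "proj_space = proj_class ` (unit_sphere :: ('p::prime_card padic ^ 'n::finite) set)"
proof (intro equalityI subsetI)
  fix X assume "X \<in> (proj_space :: ('p padic ^ 'n) set set)"
  then obtain x where x: "x \<noteq> 0" "X = proj_class x" by (auto simp: proj_space_def)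
  obtain i where i: "vec_abs x = padic_abs (x $ i)" using vec_abs_attained by blast
  obtain j where "x $ j \<noteq> 0" using x(1) by (auto simp: vec_eq_iff)
  then have nz: "x $ i \<noteq> 0" using vec_abs_ge[of x j] i padic_abs_nonneg[of "x $ j"]
    by (metis padic_abs_eq_0 order_antisym)
  define y where "y = inverse (x $ i) *s x"
  have "padic_abs (inverse (x $ i)) * padic_abs (x $ i) = 1"
    using nz by (simp flip: padic_abs_mult)
  then have "y \<in> unit_sphere" by (simp add: y_def unit_sphere_def vec_abs_scale i)
  moreover have "proj_class y = X"
    using nz by (simp add: y_def x(2) proj_class_scale)
  ultimately show "X \<in> proj_class ` unit_sphere" by blast
next
  fix X assume "X \<in> proj_class ` (unit_sphere :: ('p padic ^ 'n) set)"
  then obtain x :: "'p padic ^ 'n" where x: "vec_abs x = 1" "X = proj_class x"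
    unfolding unit_sphere_def by blast
  have "vec_abs (0 :: 'p padic ^ 'n) = 0" by (simp add: vec_abs_def)
  then have "x \<noteq> 0" using x(1) by force
  then show "X \<in> proj_space" unfolding proj_space_def x(2) by blast
qed

lemma wedge_abs_scale: "wedge_abs (c *s x) (e *s y) = padic_abs c * padic_abs e * wedge_abs x y"
proof -
  let ?f = "\<lambda>(i, j). padic_abs (x $ i * y $ j - x $ j * y $ i)"
  have "Max ((*) (padic_abs c * padic_abs e) ` range ?f) = padic_abs c * padic_abs e * Max (range ?f)"
    by (rule mono_Max_commute[symmetric]) (auto intro!: monoI mult_left_mono)
  moreover have "(\<lambda>(i, j). padic_abs ((c *s x) $ i * (e *s y) $ j - (c *s x) $ j * (e *s y) $ i))
      = (\<lambda>z. padic_abs c * padic_abs e * ?f z)"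
  proof (rule ext, clarify)
    fix i j
    have "(c *s x) $ i * (e *s y) $ j - (c *s x) $ j * (e *s y) $ i = c * e * (x $ i * y $ j - x $ j * y $ i)"
      by (simp add: algebra_simps)
    then show "padic_abs ((c *s x) $ i * (e *s y) $ j - (c *s x) $ j * (e *s y) $ i)
        = padic_abs c * padic_abs e * padic_abs (x $ i * y $ j - x $ j * y $ i)"
      by (simp only: padic_abs_mult)
  qed
  ultimately show ?thesis
    by (simp only: wedge_abs_def image_image)
qed

text \<open>The distance does not depend on the chosen representatives in the unit sphere.\<close>

lemma proj_dist_eq:
  assumes "x \<in> unit_sphere" "y \<in> unit_sphere"
  shows "proj_dist (proj_class x) (proj_class y) = wedge_abs x y"
proof -
  have *: "\<exists>c. padic_abs c = 1 \<and> (SOME z. z \<in> unit_sphere \<and> proj_class z = proj_class u) = c *s u"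
    if u: "u \<in> unit_sphere" for u :: "'a padic ^ 'b"
  proof -
    define z where "z = (SOME z. z \<in> unit_sphere \<and> proj_class z = proj_class u)"
    have z: "z \<in> unit_sphere \<and> proj_class z = proj_class u"
      unfolding z_def by (rule someI[of _ u]) (use u in simp)
    have "z \<in> proj_class z" unfolding proj_class_def by (auto intro!: exI[of _ 1])
    then obtain c where c: "z = c *s u" using z by (auto simp: proj_class_def)
    then have "padic_abs c = 1" using z u by (simp add: unit_sphere_def vec_abs_scale)
    then show ?thesis unfolding z_def[symmetric] using c by (intro exI[of _ c]) simp
  qed
  obtain c where "padic_abs c = 1"
    and "(SOME z. z \<in> unit_sphere \<and> proj_class z = proj_class x) = c *s x"
    using *[OF assms(1)] by (elim exE conjE)
  moreover obtain e where "padic_abs e = 1"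
    and "(SOME z. z \<in> unit_sphere \<and> proj_class z = proj_class y) = e *s y"
    using *[OF assms(2)] by (elim exE conjE)
  ultimately show ?thesis by (simp add: proj_dist_def wedge_abs_scale)
qed


section \<open>Homogeneous polynomials\<close>

text \<open>Polynomials in the variables indexed by \<open>'n\<close>, as finitely supported functions on monomials.\<close>

type_synonym ('a, 'n) mpoly = "('n \<Rightarrow>\<^sub>0 nat) \<Rightarrow>\<^sub>0 'a"

definition mpoly_scale :: "'a::field \<Rightarrow> ('a, 'n) mpoly \<Rightarrow> ('a, 'n) mpoly" where
  "mpoly_scale c q = Poly_Mapping.map ((*) c) q"

definition mpoly_eval :: "('a::field, 'n::finite) mpoly \<Rightarrow> 'a ^ 'n \<Rightarrow> 'a" where
  "mpoly_eval q x = (\<Sum>m\<in>Poly_Mapping.keys q. Poly_Mapping.lookup q m * (\<Prod>i\<in>UNIV. x $ i ^ Poly_Mapping.lookup m i))"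

definition homogeneous :: "nat \<Rightarrow> ('a::field, 'n::finite) mpoly set" where
  "homogeneous d = {q. \<forall>m\<in>Poly_Mapping.keys q. (\<Sum>i\<in>UNIV. Poly_Mapping.lookup m i) = d}"

lemma lookup_mpoly_scale: "Poly_Mapping.lookup (mpoly_scale c q) m = c * Poly_Mapping.lookup q m"
  by (simp add: mpoly_scale_def Poly_Mapping.map.rep_eq when_def)

interpretation mpoly: vector_space "mpoly_scale :: 'a::field \<Rightarrow> ('a, 'n) mpoly \<Rightarrow> ('a, 'n) mpoly"
  by unfold_locales (auto intro!: poly_mapping_eqI simp: lookup_mpoly_scale lookup_add algebra_simps)

lemma mpoly_eval_scale_vec:
  assumes "q \<in> homogeneous d"
  shows "mpoly_eval q (c *s x) = c ^ d * mpoly_eval q x"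
  unfolding mpoly_eval_def sum_distrib_left
proof (rule sum.cong)
  fix m assume "m \<in> Poly_Mapping.keys q"
  then have "(\<Sum>i\<in>UNIV. Poly_Mapping.lookup m i) = d" using assms by (simp add: homogeneous_def)
  then have "(\<Prod>i\<in>UNIV. c ^ Poly_Mapping.lookup m i) = c ^ d" by (simp flip: power_sum)
  then show "Poly_Mapping.lookup q m * (\<Prod>i\<in>UNIV. (c *s x) $ i ^ Poly_Mapping.lookup m i) = c ^ d * (Poly_Mapping.lookup q m * (\<Prod>i\<in>UNIV. x $ i ^ Poly_Mapping.lookup m i))"
    by (simp add: power_mult_distrib prod.distrib)
qed simp

text \<open>
  The map \<open>[x] \<mapsto> [f\<^sub>0(x), \<dots>, f\<^sub>\<ell>(x)]\<close>, for homogeneous polynomials of the same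
  degree without common zeros.
\<close>

definition proj_map :: "('l::finite \<Rightarrow> ('a::field, 'n::finite) mpoly) \<Rightarrow> ('a ^ 'n) set \<Rightarrow> ('a ^ 'l) set" where
  "proj_map f X = the_elem ((\<lambda>x. proj_class (\<chi> k. mpoly_eval (f k) x)) ` X)"

lemma proj_map_eq:
  assumes "\<And>k. f k \<in> homogeneous d"
  shows "proj_map f (proj_class x) = proj_class (\<chi> k. mpoly_eval (f k) x)"
proof -
  let ?g = "\<lambda>x. \<chi> k. mpoly_eval (f k) x"
  have g: "?g (c *s x) = c ^ d *s ?g x" for c
    by (simp add: vec_eq_iff mpoly_eval_scale_vec[OF assms])
  have "(\<lambda>x. proj_class (?g x)) ` proj_class x = {proj_class (?g x)}"
    by (auto simp: proj_class_def[of x] g proj_class_scale intro!: image_eqI[of _ _ x] exI[of _ 1])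
  then show ?thesis by (simp add: proj_map_def)
qed

definition proj_zeros :: "'i set \<Rightarrow> ('i \<Rightarrow> ('a::field, 'n::finite) mpoly) \<Rightarrow> ('a ^ 'n) set set" where
  "proj_zeros I F = {X \<in> proj_space. \<forall>x\<in>X. \<forall>i\<in>I. mpoly_eval (F i) x = 0}"

end

theory Submission
  imports Defs
begin

text \<open>
  For each \<open>m\<close> the balls of radius \<open>p\<^sup>-\<^sup>m\<close> partition projective space. Hence \<open>vol\<^sub>n\<close> of the Veronese
  variety is the limit of \<open>a\<^sub>m p\<^sup>-\<^sup>m\<^sup>n\<close>, where \<open>a\<^sub>m\<close> counts the balls meeting it, and the number of zeros of
  the system is the increasing limit of the number of balls that contain one. A ball around a point of
  the variety contains a zero with almost the same probability as the corresponding ball of the tangent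
  space: Newton's iteration matches the two events unless the linear forms are degenerate in the tangent
  directions, and conditionally on a near zero this has small probability. Since the law of the
  coefficients is invariant under integral changes of coordinates, and \<open>n\<close> linear forms on an
  \<open>n\<close>-dimensional projective space almost surely have exactly one zero, the probability for a tangent
  space is \<open>1 / b\<^sub>m\<close>, where \<open>b\<^sub>m\<close> counts all balls of \<open>P\<^sup>n\<close>. So the expectation is the limit of
  \<open>a\<^sub>m / b\<^sub>m\<close>.
\<close>

section \<open>Balls of p-adic numbers and vectors\<close>

text \<open>About p^(mn) balls meet the image and each is hit with probability about p^(-mn), so an
  error of p^-k per ball would be useless: it has to be p^-k relative to p^(-mn). For this reason
  the exceptional event is always taken jointly with the forms being small at the centre of the
  ball. That smallness contributes the factor p^(-mn), degeneracy contributes p^-k, and the sum over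
  all balls is bounded independently of m. First m, then k tends to infinity. Finiteness of the zero
  set is not presupposed: the number of zeros is a supremum of ball counts in the extended reals.
  Nor is the existence of the limit in \<open>proj_vol\<close>: the mean counts increase and stay
  bounded, and the comparison carries their limit over to the ratio of ball counts. All losses of
  precision, from the coefficients of the f's and from recovering monomials out of the f's, are
  gathered in one exponent c that is the same at every point.\<close>

lemma padic_abs_0 [simp]: "padic_abs 0 = 0"
  by (subst padic_abs_eq_0) (rule refl)

lemma padic_abs_minus [simp]: "padic_abs (- x) = padic_abs x"
proof -
  have "padic_abs (-1 :: 'a padic) * padic_abs (-1 :: 'a padic) = 1"
    by (simp flip: padic_abs_mult)
  then have "padic_abs (-1 :: 'a padic) = 1"
    by (metis padic_abs_nonneg abs_of_nonneg abs_1 abs_minus_cancel square_eq_1_iff)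
  then show ?thesis using padic_abs_mult[of "-1" x] by simp
qed

lemma padic_abs_inverse: "padic_abs (inverse x) = inverse (padic_abs x)"
proof (cases "x = 0")
  case False
  then have "padic_abs x * padic_abs (inverse x) = 1" by (simp flip: padic_abs_mult)
  then show ?thesis by (metis inverse_unique)
qed auto

text \<open>
  Balls around 0 are indexed by the exponent \<open>k\<close> of their radius \<open>p\<^sup>-\<^sup>k\<close>, so that ultrametric estimates
  become linear arithmetic on integers.
\<close>

definition pb :: "int \<Rightarrow> 'p::prime_card padic set" where
  "pb k = {x. padic_abs x \<le> real CARD('p) powi (- k)}"

lemma card_powi_pos [simp]: "0 < real CARD('p::prime_card) powi k"
  using card_gt_1[where 'p = 'p] by (intro zero_less_power_int) auto

lemma card_powi_le_iff [simp]:
  "real CARD('p::prime_card) powi a \<le> real CARD('p) powi b \<longleftrightarrow> a \<le> b"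
  using card_gt_1[where 'p = 'p]
  by (meson linorder_not_le order_less_imp_le power_int_increasing power_int_strict_increasing order.strict_iff_not)

lemma pb_0 [simp]: "0 \<in> pb k"
  by (simp add: pb_def less_imp_le)

lemma pb_minus [simp]: "- x \<in> pb k \<longleftrightarrow> x \<in> pb k"
  by (simp add: pb_def)

lemma pb_add: "x \<in> pb k \<Longrightarrow> y \<in> pb k \<Longrightarrow> x + y \<in> pb k"
  using padic_abs_ultra[of x y] by (auto simp: pb_def)

lemma pb_diff: "x \<in> pb k \<Longrightarrow> y \<in> pb k \<Longrightarrow> x - y \<in> pb k"
  using pb_add[of x k "- y"] by simp

lemma pb_diff_commute: "x - y \<in> pb k \<longleftrightarrow> y - x \<in> pb k"
  using pb_minus[of "x - y" k] by simp

lemma pb_sum: "(\<And>i. i \<in> I \<Longrightarrow> f i \<in> pb k) \<Longrightarrow> sum f I \<in> pb k"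
  by (induction I rule: infinite_finite_induct) (auto intro: pb_add)

lemma pb_mult:
  fixes x :: "'p::prime_card padic"
  assumes "x \<in> pb a" "y \<in> pb b"
  shows "x * y \<in> pb (a + b)"
proof -
  have "padic_abs x * padic_abs y \<le> real CARD('p) powi (- a) * real CARD('p) powi (- b)"
    using assms by (intro mult_mono) (auto simp: pb_def less_imp_le)
  also have "\<dots> = real CARD('p) powi (- (a + b))"
    using card_gt_1[where 'p = 'p] by (simp flip: power_int_add)
  finally show ?thesis by (simp add: pb_def padic_abs_mult)
qed

lemma pb_mult': "x \<in> pb a \<Longrightarrow> y \<in> pb b \<Longrightarrow> c \<le> a + b \<Longrightarrow> x * y \<in> pb c"
  using pb_mult[of x a y b] by (auto simp: pb_def intro: order_trans)

lemma pb_anti: "x \<in> pb a \<Longrightarrow> b \<le> a \<Longrightarrow> x \<in> pb b"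
  by (auto simp: pb_def intro: order_trans)

lemma pb_1 [simp]: "1 \<in> pb k \<longleftrightarrow> k \<le> 0"
  using card_powi_le_iff[of 0 "- k", where 'p = 'a] by (simp add: pb_def)

lemma pb_power: "x \<in> pb 0 \<Longrightarrow> x ^ n \<in> pb 0"
  by (induction n) (auto intro: pb_mult'[of _ 0 _ 0])

lemma padic_abs_divide: "padic_abs (x / y) = padic_abs x / padic_abs y"
  by (simp add: divide_inverse padic_abs_mult padic_abs_inverse)

lemma pb_exact:
  fixes x :: "'p::prime_card padic"
  assumes "x \<noteq> 0"
  obtains k where "\<And>j. x \<in> pb j \<longleftrightarrow> j \<le> k"
proof -
  obtain k where "padic_abs x = real CARD('p) powi k" using padic_abs_range[OF assms] by blast
  then show thesis by (intro that[of "- k"]) (auto simp: pb_def)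
qed

text \<open>The standard way to prove an exact equation here: an identity modulo every high power of
  p is an identity. The starting exponent \<open>m\<close> is free, since estimates often hold only
  from some precision on.\<close>

lemma pb_all_zero:
  assumes "\<And>k. k \<ge> m \<Longrightarrow> x \<in> pb k"
  shows "x = 0"
proof (rule ccontr)
  assume "x \<noteq> 0"
  then obtain k where k: "\<And>j. x \<in> pb j \<longleftrightarrow> j \<le> k" using pb_exact by blast
  show False using assms[of "max m (k + 1)"] k by simp
qed

text \<open>Absolute values are discrete, so missing the ball of exponent k + 1 means having
  valuation at most k. In particular \<open>x \<in> pb 0\<close> with \<open>x \<notin> pb 1\<close>
  is how units are expressed throughout.\<close>

lemma pb_inverse:
  assumes "x \<notin> pb (k + 1)"
  shows "inverse x \<in> pb (- k)"
proof -
  have nz: "x \<noteq> 0" using assms by auto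
  obtain j where j: "padic_abs x = real CARD('a) powi j" using padic_abs_range[OF nz] by blast
  then have "- k \<le> j" using assms by (simp add: pb_def)
  then show ?thesis by (simp add: pb_def padic_abs_inverse j flip: power_int_minus)
qed

lemma pb_ex: "\<exists>k\<le>0. x \<in> pb k"
proof (cases "x = 0")
  case False
  then obtain k where "\<And>j. x \<in> pb j \<longleftrightarrow> j \<le> k" using pb_exact by blast
  then show ?thesis by (intro exI[of _ "min k 0"]) auto
qed auto

lemma pb_unit_mult_iff:
  assumes "u \<in> pb 0" "u \<notin> pb 1"
  shows "u * x \<in> pb k \<longleftrightarrow> x \<in> pb k"
proof
  have u: "u \<noteq> 0" and iu: "inverse u \<in> pb 0" using assms pb_inverse[of u 0] by auto
  assume "u * x \<in> pb k"
  then have "inverse u * (u * x) \<in> pb k" using iu pb_mult'[OF iu, of "u * x" k k] by simp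
  then show "x \<in> pb k" using u by (simp flip: mult.assoc)
qed (use assms pb_mult'[of u 0 x k k] in auto)

definition pp :: "'p::prime_card padic" where "pp = of_nat CARD('p)"

lemma pp_pow: "padic_abs (pp powi k :: 'p::prime_card padic) = real CARD('p) powi (- k)"
proof -
  have nat: "padic_abs (pp ^ n :: 'p padic) = (1 / real CARD('p)) ^ n" for n
    by (induction n) (auto simp: padic_abs_mult pp_def padic_abs_p)
  show ?thesis
    by (cases "k \<ge> 0") (auto simp: power_int_def nat padic_abs_inverse padic_abs_divide power_divide field_simps power_inverse)
qed

lemma pp_nz [simp]: "(pp :: 'p::prime_card padic) \<noteq> 0"
  using padic_abs_p[where 'p = 'p] by (auto simp: pp_def)

lemma pp_pow_in [simp]: "pp powi k \<in> pb j \<longleftrightarrow> j \<le> k"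
  by (simp add: pb_def pp_pow)

lemma pp_mult_iff: "pp powi k * x \<in> pb j \<longleftrightarrow> x \<in> pb (j - k)"
proof
  assume "pp powi k * x \<in> pb j"
  then have "pp powi (- k) * (pp powi k * x) \<in> pb (j - k)"
    by (rule pb_mult'[where a = "-k" and b = j, rotated]) auto
  then show "x \<in> pb (j - k)" by (simp add: power_int_minus flip: mult.assoc)
qed (rule pb_mult'[where a = "k" and b = "j - k"], auto)

lemma dist_padic_pb: "x - y \<in> pb k \<longleftrightarrow> dist x y \<le> real CARD('p) powi (- k)" for x y :: "'p::prime_card padic"
  by (simp add: pb_def dist_padic_def)

lemma card_powi_small:
  assumes "e > 0"
  obtains k :: nat where "real CARD('p::prime_card) powi (- int k) < e"
proof -
  obtain k where "inverse (real CARD('p)) ^ k < e"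
    using real_arch_pow_inv[OF assms, of "inverse (real CARD('p))"] card_gt_1[where 'p = 'p]
    by (auto simp: field_simps)
  then show thesis by (intro that[of k]) (simp add: power_int_minus power_inverse)
qed

section \<open>Integers, rationals and residues modulo powers of p\<close>

lemma of_int_in_pb0: "(of_int m :: 'p::prime_card padic) \<in> pb 0"
proof -
  have "(of_nat n :: 'p padic) \<in> pb 0" for n
    by (induction n) (auto intro: pb_add)
  then show ?thesis by (cases m rule: int_cases2) auto
qed

lemma of_nat_in_pb0 [simp]: "(of_nat m :: 'p::prime_card padic) \<in> pb 0"
  using of_int_in_pb0[of "int m"] by simp

text \<open>Links balls with divisibility, so that residues can be counted. For the harder direction
  the exact power of p is split off from \<open>m\<close>: the cofactor is prime to p, and a Bezout
  relation shows that it is a p-adic unit.\<close>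

lemma of_int_pb_iff: "(of_int m :: 'p::prime_card padic) \<in> pb (int s) \<longleftrightarrow> int CARD('p) ^ s dvd m"
proof
  assume "int CARD('p) ^ s dvd m"
  then obtain t where "m = int CARD('p) ^ s * t" by blast
  then have "(of_int m :: 'p padic) = pp powi (int s) * of_int t" by (simp add: pp_def)
  then show "(of_int m :: 'p padic) \<in> pb (int s)" by (simp only: pp_mult_iff of_int_in_pb0 diff_self)
next
  assume *: "(of_int m :: 'p padic) \<in> pb (int s)"
  show "int CARD('p) ^ s dvd m"
  proof (cases "m = 0")
    case False
    obtain t where t: "m = int CARD('p) ^ multiplicity (int CARD('p)) m * t" "\<not> int CARD('p) dvd t"
      using multiplicity_decompose'[of m "int CARD('p)"] False prime_elem_card[where 'p = 'p]
      by (metis prime_elem_not_unit)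
    have "coprime (int CARD('p)) t"
      using t(2) prime_imp_coprime[of "int CARD('p)" t] prime_card[where 'a = 'p] by simp
    then obtain u v where uv: "u * int CARD('p) + v * t = 1" by (metis bezout_int coprime_imp_gcd_eq_1)
    have "(of_int t :: 'p padic) \<notin> pb 1"
    proof
      assume "(of_int t :: 'p padic) \<in> pb 1"
      moreover have "(of_nat CARD('p) :: 'p padic) \<in> pb 1"
        using pp_pow_in[of 1 1, where 'a = 'p] by (simp add: pp_def)
      ultimately have "of_int u * of_nat CARD('p) + of_int v * of_int t \<in> (pb 1 :: 'p padic set)"
        by (intro pb_add pb_mult'[OF of_int_in_pb0, of _ 1]) auto
      also have "of_int u * of_nat CARD('p) + of_int v * of_int t = (of_int (u * int CARD('p) + v * t) :: 'p padic)"
        by simp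
      finally show False unfolding uv by simp
    qed
    moreover have "(of_int m :: 'p padic) = pp powi (int (multiplicity (int CARD('p)) m)) * of_int t"
      by (subst t(1)) (simp add: pp_def)
    ultimately have "int s - int (multiplicity (int CARD('p)) m) \<le> 0"
      using * by (metis pb_anti pp_mult_iff int_one_le_iff_zero_less linorder_not_le)
    then show ?thesis by (intro multiplicity_dvd') simp
  qed auto
qed

lemma of_nat_diff_pb:
  fixes a b :: nat
  assumes "(of_nat a - of_nat b :: 'p::prime_card padic) \<in> pb (int s)" "a < CARD('p) ^ s" "b < CARD('p) ^ s"
  shows "a = b"
proof -
  have "(of_int (int a - int b) :: 'p padic) \<in> pb (int s)" using assms by simp
  then have "int CARD('p) ^ s dvd int a - int b" by (simp only: of_int_pb_iff)
  then have "int a mod int CARD('p) ^ s = int b mod int CARD('p) ^ s" by (simp add: mod_eq_dvd_iff)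
  then have "int (a mod CARD('p) ^ s) = int (b mod CARD('p) ^ s)" by (simp add: zmod_int)
  then show ?thesis using assms by simp
qed

definition padic_rat :: "rat \<Rightarrow> 'p::prime_card padic" where
  "padic_rat r = abs_padic (\<lambda>n. r)"

lemma padic_rel_const: "padic_rel TYPE('p::prime_card) (\<lambda>n. c) (\<lambda>n. c)"
  by (simp add: padic_rel_def)

lemma padic_rat_diff: "padic_rat a - padic_rat b = (padic_rat (a - b) :: 'p::prime_card padic)"
  unfolding padic_rat_def minus_padic_def
  by (simp add: uminus_padic.abs_eq[OF padic_rel_const] plus_padic.abs_eq[OF padic_rel_const padic_rel_const])

lemma padic_rat_mult: "padic_rat a * padic_rat b = (padic_rat (a * b) :: 'p::prime_card padic)"
  unfolding padic_rat_def
  by (simp add: times_padic.abs_eq[OF padic_rel_const padic_rel_const])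

lemma padic_abs_rat: "padic_abs (padic_rat r :: 'p::prime_card padic) = rat_abs TYPE('p) r"
  unfolding padic_rat_def by (simp add: padic_abs.abs_eq[OF padic_rel_const] limI)

lemma padic_rat_of_int: "padic_rat (of_int m) = (of_int m :: 'p::prime_card padic)"
proof -
  have nat: "padic_rat (of_nat n) = (of_nat n :: 'p padic)" for n
  proof (induction n)
    case 0
    show ?case by (simp add: padic_rat_def zero_padic_def)
  next
    case (Suc n)
    then show ?case
      by (simp add: padic_rat_def one_padic.abs_eq plus_padic.abs_eq[OF padic_rel_const padic_rel_const, symmetric]
          flip: one_padic.abs_eq)
  qed
  obtain a b where m: "m = int a - int b" by (cases m rule: int_diff_cases) auto
  show ?thesis unfolding m by (simp add: nat flip: padic_rat_diff)
qed

lemma padic_abs_diff_abs_le: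
  fixes X :: "nat \<Rightarrow> rat"
  assumes X: "padic_cauchy TYPE('p::prime_card) X"
    and le: "\<And>n. n \<ge> m \<Longrightarrow> rat_abs TYPE('p) (X n - r) \<le> e"
  shows "padic_abs (abs_padic X - padic_rat r :: 'p padic) \<le> e"
proof -
  have rel: "padic_rel TYPE('p) X X" using X by (simp add: padic_rel_def)
  have rel2: "padic_rel TYPE('p) (\<lambda>n. X n - r) (\<lambda>n. X n - r)"
    using padic_cauchy_add[OF X padic_cauchy_const[of "-r"]] by (simp add: padic_rel_def)
  have eq: "abs_padic X - padic_rat r = (abs_padic (\<lambda>n. X n - r) :: 'p padic)"
    unfolding padic_rat_def minus_padic_def
    by (simp add: uminus_padic.abs_eq[OF padic_rel_const] plus_padic.abs_eq[OF rel padic_rel_const])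
  have "(\<lambda>n. rat_abs TYPE('p) (X n - r)) \<longlonglongrightarrow> lim (\<lambda>n. rat_abs TYPE('p) (X n - r))"
    using rel2 by (intro padic_cauchy_tendsto) (simp add: padic_rel_def)
  then have "lim (\<lambda>n. rat_abs TYPE('p) (X n - r)) \<le> e"
    by (rule LIMSEQ_le_const2) (use le in blast)
  then show ?thesis unfolding eq by (simp add: padic_abs.abs_eq[OF rel2])
qed

lemma padic_rat_dense: "\<exists>r. x - padic_rat r \<in> pb k" for x :: "'p::prime_card padic"
proof -
  define X where "X = rep_padic x"
  have x: "abs_padic X = x" using Quotient_abs_rep[OF Quotient_padic] by (simp add: X_def)
  have "padic_rel TYPE('p) X X" using Quotient_rep_reflp[OF Quotient_padic] by (simp add: X_def)
  then have X: "padic_cauchy TYPE('p) X" by (simp add: padic_rel_def)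
  obtain N where N: "\<And>m n. m \<ge> N \<Longrightarrow> n \<ge> N \<Longrightarrow> rat_abs TYPE('p) (X m - X n) < real CARD('p) powi (- k)"
    using X card_powi_pos[where 'p = 'p] unfolding padic_cauchy_def by meson
  have "padic_abs (abs_padic X - padic_rat (X N) :: 'p padic) \<le> real CARD('p) powi (- k)"
    using N[of _ N] by (intro padic_abs_diff_abs_le[OF X, of N]) (simp add: less_imp_le)
  then show ?thesis unfolding x by (auto simp: pb_def)
qed

text \<open>Approximate \<open>x\<close> by a rational a/b in lowest terms. Integrality of a/b keeps
  p out of b, so b is invertible modulo p^s, and the residue of a/b is the desired natural
  number.\<close>

lemma padic_residue:
  fixes x :: "'p::prime_card padic"
  assumes x: "x \<in> pb 0"
  shows "\<exists>n < CARD('p) ^ s. x - of_nat n \<in> pb (int s)"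
proof -
  let ?p = "int CARD('p)"
  obtain r where r: "x - padic_rat r \<in> pb (int s)" using padic_rat_dense by blast
  have r0: "(padic_rat r :: 'p padic) \<in> pb 0"
    using pb_diff[OF x pb_anti[OF r, of 0]] by simp
  obtain a b where q: "quotient_of r = (a, b)" by (cases "quotient_of r")
  have b: "b > 0" "coprime a b" using q quotient_of_denom_pos quotient_of_coprime by auto
  have "r * of_int b = of_int a" using quotient_of_div[OF q] b by simp
  then have rb: "padic_rat r * of_int b = (of_int a :: 'p padic)"
    by (metis padic_rat_mult padic_rat_of_int)
  have nd: "\<not> ?p dvd b"
  proof
    assume d: "?p dvd b"
    then have "(of_int b :: 'p padic) \<in> pb 1" using of_int_pb_iff[of b 1, where 'p = 'p] by simp
    then have "(of_int a :: 'p padic) \<in> pb 1" using pb_mult'[OF r0, of "of_int b" 1 1] rb by simp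
    then have "?p dvd a" using of_int_pb_iff[of a 1, where 'p = 'p] by simp
    then have "is_unit ?p" using b(2) d by (meson coprime_common_divisor)
    then show False using prime_elem_card[where 'p = 'p] by (simp add: prime_elem_not_unit)
  qed
  then have "coprime (?p ^ s) b"
    using prime_imp_coprime[of ?p b] prime_card[where 'a = 'p] by simp
  then obtain u v where uv: "u * ?p ^ s + v * b = 1" by (metis bezout_int coprime_imp_gcd_eq_1)
  \<comment> \<open>\<open>v\<close> inverts \<open>b\<close> modulo p^s by the Bezout relation, so
    \<open>n\<close> represents a/b there.\<close>
  define n where "n = nat ((a * v) mod ?p ^ s)"
  have ps: "?p ^ s > 0" by simp
  have n: "int n = (a * v) mod ?p ^ s" using ps by (simp add: n_def)
  then have "int n < int (CARD('p) ^ s)" using ps by simp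
  then have n_lt: "n < CARD('p) ^ s" by linarith
  have "?p ^ s dvd a * v - int n" unfolding n by (simp add: minus_mod_eq_mult_div)
  then have 1: "?p ^ s dvd b * (a * v - int n)" by simp
  have "b * (a * v - int n) = (a - b * int n) - a * u * ?p ^ s"
  proof -
    have "a * (u * ?p ^ s + v * b) = a" using uv by simp
    then show ?thesis by (simp add: algebra_simps)
  qed
  then have "a - b * int n = b * (a * v - int n) + a * u * ?p ^ s" by simp
  then have "?p ^ s dvd a - b * int n" using 1 by simp
  then have "(of_int (a - b * int n) :: 'p padic) \<in> pb (int s)" by (simp only: of_int_pb_iff)
  moreover have "(of_int (a - b * int n) :: 'p padic) = of_int b * (padic_rat r - of_nat n)"
    by (simp add: algebra_simps flip: rb)
  moreover have "(of_int b :: 'p padic) \<notin> pb 1" using nd of_int_pb_iff[of b 1, where 'p = 'p] by simp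
  ultimately have "padic_rat r - of_nat n \<in> (pb (int s) :: 'p padic set)"
    using pb_unit_mult_iff[OF of_int_in_pb0] by metis
  from pb_add[OF r this] have "x - of_nat n \<in> pb (int s)" by simp
  then show ?thesis using n_lt by blast
qed

text \<open>Completeness with a rate, the form that digit expansions and Newton's iteration need.
  Rounding the m-th term to a rational of the same precision yields a Cauchy sequence of rationals,
  and the p-adic number it represents is the limit.\<close>

lemma padic_limit:
  fixes X :: "nat \<Rightarrow> 'p::prime_card padic"
  assumes "\<And>m. X (Suc m) - X m \<in> pb (int m + a)"
  shows "\<exists>L. \<forall>m. L - X m \<in> pb (int m + a)"
proof -
  have step: "X k - X m \<in> pb (int m + a)" if "m \<le> k" for m k
    using that
  proof (induction k rule: dec_induct)
    case (step k)
    have "X (Suc k) - X k \<in> pb (int m + a)" using pb_anti[OF assms[of k]] step by simp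
    from pb_add[OF this step.IH] show ?case by simp
  qed simp
  define r where "r m = (SOME r. X m - padic_rat r \<in> pb (int m + a))" for m
  have r: "X m - padic_rat (r m) \<in> pb (int m + a)" for m
    unfolding r_def by (rule someI_ex) (rule padic_rat_dense)
  have rr: "rat_abs TYPE('p) (r k - r m) \<le> real CARD('p) powi (- (int m + a))" if "m \<le> k" for m k
  proof -
    have "X m - padic_rat (r m) - (X k - padic_rat (r k)) + (X k - X m) \<in> pb (int m + a)"
      using that by (intro pb_add pb_diff r step pb_anti[OF r[of k]]) auto
    then have "(padic_rat (r k - r m) :: 'p padic) \<in> pb (int m + a)"
      by (simp add: flip: padic_rat_diff)
    then show ?thesis by (simp add: pb_def padic_abs_rat)
  qed
  have cau: "padic_cauchy TYPE('p) r"
    unfolding padic_cauchy_def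
  proof (intro allI impI)
    fix e :: real assume "e > 0"
    then obtain k where k: "real CARD('p) powi (- int k) < e" by (rule card_powi_small)
    \<comment> \<open>The offset \<open>a\<close> may be negative; the extra
      \<open>nat (- a)\<close> absorbs it.\<close>
    define M where "M = k + nat (- a)"
    have le: "real CARD('p) powi (- (int m + a)) < e" if "m \<ge> M" for m
      using that by (intro le_less_trans[OF _ k]) (auto simp: M_def)
    have "rat_abs TYPE('p) (r m - r n) < e" if "m \<ge> M" "n \<ge> M" for m n
      using rr[of m n] rr[of n m] le[of m] le[of n] that rat_abs_minus_commute[of "r m" "r n", where 'p = 'p]
      by (cases "m \<le> n") auto
    then show "\<exists>k. \<forall>m\<ge>k. \<forall>n\<ge>k. rat_abs TYPE('p) (r m - r n) < e" by blast
  qed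
  have "(abs_padic r - X m :: 'p padic) \<in> pb (int m + a)" for m
  proof -
    have "(abs_padic r - padic_rat (r m) :: 'p padic) \<in> pb (int m + a)"
      using padic_abs_diff_abs_le[OF cau rr] by (simp add: pb_def)
    from pb_diff[OF this r[of m]] show ?thesis by simp
  qed
  then show ?thesis by blast
qed

text \<open>Completeness reduces compactness of the unit polydisc to closedness and total
  boundedness.\<close>

instance padic :: (prime_card) complete_space
proof
  fix X :: "nat \<Rightarrow> 'a padic"
  assume X: "Cauchy X"
  have "\<exists>N. \<forall>i\<ge>N. \<forall>j\<ge>N. X i - X j \<in> pb (int m)" for m
    using X card_powi_pos[of "- int m", where 'p = 'a]
    unfolding Cauchy_def dist_padic_pb by (meson less_imp_le)
  then obtain N where N: "\<And>m i j. i \<ge> N m \<Longrightarrow> j \<ge> N m \<Longrightarrow> X i - X j \<in> pb (int m)" by metis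
  \<comment> \<open>Partial sums make the thresholds monotone, so consecutive terms of the
    subsequence are close at every level.\<close>
  define g where "g m = (\<Sum>i\<le>m. N i)" for m
  have g: "g m \<ge> N m" for m unfolding g_def by (rule member_le_sum) auto
  have gS: "g (Suc m) \<ge> g m" for m by (simp add: g_def)
  have "X (g (Suc m)) - X (g m) \<in> pb (int m + 0)" for m
    using N[of m "g (Suc m)" "g m"] g gS[of m] by (simp add: order_trans)
  then obtain L where L: "\<And>m. L - X (g m) \<in> pb (int m + 0)" using padic_limit[of "\<lambda>m. X (g m)" 0] by blast
  have "X \<longlonglongrightarrow> L"
  proof (rule metric_LIMSEQ_I)
    fix e :: real assume "e > 0"
    then obtain k where k: "real CARD('a) powi (- int k) < e" by (rule card_powi_small)
    have "dist (X n) L < e" if "n \<ge> g k" for n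
    proof -
      have "X n - X (g k) \<in> pb (int k)" using N[of k n "g k"] g[of k] that by simp
      then have "X n - X (g k) - (L - X (g k)) \<in> pb (int k)" using L[of k] pb_diff[of "X n - X (g k)" "int k" "L - X (g k)"] by simp
      then have "X n - L \<in> pb (int k)" by simp
      then show ?thesis using k unfolding dist_padic_pb by simp
    qed
    then show "\<exists>no. \<forall>n\<ge>no. dist (X n) L < e" by blast
  qed
  then show "convergent X" by (rule convergentI)
qed

section \<open>Vectors: polydiscs, residues and compactness\<close>

definition vpb :: "int \<Rightarrow> ('p::prime_card padic ^ 'n::finite) set" where
  "vpb k = {x. \<forall>i. x $ i \<in> pb k}"

lemma vpb_nth: "x \<in> vpb k \<Longrightarrow> x $ i \<in> pb k"
  by (simp add: vpb_def)

lemma vpbI: "(\<And>i. x $ i \<in> pb k) \<Longrightarrow> x \<in> vpb k"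
  by (simp add: vpb_def)

lemma vpb_0 [simp]: "0 \<in> vpb k"
  by (simp add: vpb_def)

lemma vpb_minus [simp]: "- x \<in> vpb k \<longleftrightarrow> x \<in> vpb k"
  by (simp add: vpb_def)

lemma vpb_add: "x \<in> vpb k \<Longrightarrow> y \<in> vpb k \<Longrightarrow> x + y \<in> vpb k"
  by (auto simp: vpb_def intro: pb_add)

lemma vpb_diff: "x \<in> vpb k \<Longrightarrow> y \<in> vpb k \<Longrightarrow> x - y \<in> vpb k"
  by (auto simp: vpb_def intro: pb_diff)

lemma vpb_diff_commute: "x - y \<in> vpb k \<longleftrightarrow> y - x \<in> vpb k"
  using vpb_minus[of "x - y" k] by simp

lemma vpb_anti: "x \<in> vpb a \<Longrightarrow> b \<le> a \<Longrightarrow> x \<in> vpb b"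
  by (auto simp: vpb_def intro: pb_anti)

lemma vpb_scale: "c \<in> pb a \<Longrightarrow> x \<in> vpb b \<Longrightarrow> k \<le> a + b \<Longrightarrow> c *s x \<in> vpb k"
  by (auto simp: vpb_def intro: pb_mult')

lemma vpb_pp_iff: "pp powi k *s x \<in> vpb j \<longleftrightarrow> x \<in> vpb (j - k)"
  by (simp add: vpb_def pp_mult_iff)

lemma vpb_exact:
  assumes "x \<noteq> 0"
  obtains k where "\<And>j. x \<in> vpb j \<longleftrightarrow> j \<le> k"
proof -
  have "x \<in> vpb j \<longleftrightarrow> vec_abs x \<le> real CARD('a) powi (- j)" for j
    by (auto simp: vpb_def pb_def vec_abs_def)
  moreover obtain i where i: "vec_abs x = padic_abs (x $ i)" using vec_abs_attained by blast
  ultimately have *: "x \<in> vpb j \<longleftrightarrow> x $ i \<in> pb j" for j by (simp add: pb_def)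
  have "x $ i \<noteq> 0"
  proof
    assume "x $ i = 0"
    then have "x $ l = 0" for l using * pb_all_zero[of 0 "x $ l"] by (auto dest: vpb_nth)
    then show False using assms by (simp add: vec_eq_iff)
  qed
  then obtain k where "\<And>j. x $ i \<in> pb j \<longleftrightarrow> j \<le> k" using pb_exact by blast
  then show thesis using that * by simp
qed

lemma vpb_notin: "x \<notin> vpb k \<longleftrightarrow> (\<exists>i. x $ i \<notin> pb k)"
  by (simp add: vpb_def)

lemma vpb_ex: "\<exists>k\<le>0. x \<in> vpb k"
proof (cases "x = 0")
  case False
  then obtain k where "\<And>j. x \<in> vpb j \<longleftrightarrow> j \<le> k" using vpb_exact by blast
  then show ?thesis by (intro exI[of _ "min k 0"]) auto
qed auto

lemma vec_abs_le_iff: "vec_abs x \<le> real CARD('p) powi (- k) \<longleftrightarrow> x \<in> vpb k"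
  for x :: "'p::prime_card padic ^ 'n::finite"
  by (auto simp: vpb_def pb_def vec_abs_def)

lemma vec_abs_le_1_iff: "vec_abs x \<le> 1 \<longleftrightarrow> x \<in> vpb 0"
  using vec_abs_le_iff[of x 0] by simp

lemma dist_vec_vpb:
  fixes x y :: "'p::prime_card padic ^ 'n::finite"
  assumes "x - y \<in> vpb k"
  shows "dist x y \<le> real CARD('n) * real CARD('p) powi (- k)"
proof -
  have "dist x y \<le> (\<Sum>i\<in>UNIV. dist (x $ i) (y $ i))"
    unfolding dist_vec_def by (rule L2_set_le_sum) simp
  also have "\<dots> \<le> (\<Sum>i\<in>(UNIV :: 'n set). real CARD('p) powi (- k))"
    using assms by (intro sum_mono) (auto simp: vpb_def simp flip: dist_padic_pb)
  finally show ?thesis by simp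
qed

lemma vpb_small:
  assumes "e > 0"
  obtains s where "\<And>x y :: 'p::prime_card padic ^ 'n::finite. x - y \<in> vpb (int s) \<Longrightarrow> dist x y < e"
proof -
  have "e / real CARD('n) > 0" using assms by simp
  then obtain s where s: "real CARD('p) powi (- int s) < e / real CARD('n)" by (rule card_powi_small)
  have "dist x y < e" if "x - y \<in> vpb (int s)" for x y :: "'p padic ^ 'n"
    using dist_vec_vpb[OF that] s by (simp add: field_simps)
  then show thesis by (rule that)
qed

lemma open_vec_coset: "open {x. x - a \<in> vpb k}" for a :: "'p::prime_card padic ^ 'n::finite"
  unfolding open_dist
proof (intro ballI exI[of _ "real CARD('p) powi (- k)"] conjI allI impI)
  fix x y assume x: "x \<in> {x. x - a \<in> vpb k}" and d: "dist y x < real CARD('p) powi (- k)"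
  have "dist (y $ i) (x $ i) \<le> real CARD('p) powi (- k)" for i
    using dist_vec_nth_le[of y i x] d by linarith
  then have "y - x \<in> vpb k" by (simp add: vpb_def dist_padic_pb)
  then have "(y - x) + (x - a) \<in> vpb k" using x by (intro vpb_add) auto
  then show "y \<in> {x. x - a \<in> vpb k}" by simp
qed simp

lemma open_vec_base:
  fixes A :: "('p::prime_card padic ^ 'n::finite) set"
  assumes "open A" "a \<in> A"
  shows "\<exists>s. {x. x - a \<in> vpb (int s)} \<subseteq> A"
proof -
  obtain e where e: "e > 0" "\<And>x. dist x a < e \<Longrightarrow> x \<in> A" using assms unfolding open_dist by blast
  from e(1) obtain s where "\<And>x y :: 'p padic ^ 'n. x - y \<in> vpb (int s) \<Longrightarrow> dist x y < e"
    using vpb_small by blast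
  then show ?thesis using e(2) by blast
qed

lemma open_padic_coset: "open {x. x - a \<in> pb k}" for a :: "'p::prime_card padic"
  unfolding open_dist
proof (intro ballI exI[of _ "real CARD('p) powi (- k)"] conjI allI impI)
  fix x y assume x: "x \<in> {x. x - a \<in> pb k}" and d: "dist y x < real CARD('p) powi (- k)"
  have "y - x \<in> pb k" using d by (simp add: dist_padic_pb)
  then have "(y - x) + (x - a) \<in> pb k" using x by (intro pb_add) auto
  then show "y \<in> {x. x - a \<in> pb k}" by simp
qed simp

lemma open_padic_base:
  fixes A :: "'p::prime_card padic set"
  assumes "open A" "a \<in> A"
  shows "\<exists>s. {x. x - a \<in> pb (int s)} \<subseteq> A"
proof -
  obtain e where e: "e > 0" "\<And>x. dist x a < e \<Longrightarrow> x \<in> A" using assms unfolding open_dist by blast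
  from e(1) obtain s where s: "real CARD('p) powi (- int s) < e" by (rule card_powi_small)
  have "{x. x - a \<in> pb (int s)} \<subseteq> A" using e(2) s by (auto simp: dist_padic_pb)
  then show ?thesis by blast
qed

definition residues :: "nat \<Rightarrow> ('p::prime_card padic ^ 'n::finite) set" where
  "residues s = (\<lambda>g. \<chi> i. of_nat (g i)) ` (UNIV \<rightarrow>\<^sub>E {..<CARD('p) ^ s})"

lemma finite_residues [simp]: "finite (residues s)"
  unfolding residues_def by (intro finite_imageI finite_PiE) auto

lemma residues_in_vpb: "r \<in> residues s \<Longrightarrow> r \<in> vpb 0"
  by (auto simp: residues_def vpb_def)

lemma residues_diff:
  assumes "r \<in> residues s" "r' \<in> residues s" "r - r' \<in> vpb (int s)"
  shows "r = r'"
proof -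
  obtain g h where g: "g \<in> UNIV \<rightarrow>\<^sub>E {..<CARD('a) ^ s}" "r = (\<chi> i. of_nat (g i))"
    and h: "h \<in> UNIV \<rightarrow>\<^sub>E {..<CARD('a) ^ s}" "r' = (\<chi> i. of_nat (h i))"
    using assms by (auto simp: residues_def)
  have "g i = h i" for i
    by (rule of_nat_diff_pb[of _ _ s, where 'p = 'a]) (use g h assms(3) in \<open>auto simp: vpb_def PiE_iff\<close>)
  then show ?thesis using g h by simp
qed

lemma residues_ex:
  fixes x :: "'p::prime_card padic ^ 'n::finite"
  assumes "x \<in> vpb 0"
  shows "\<exists>r\<in>residues s. x - r \<in> vpb (int s)"
proof -
  have "\<forall>i. \<exists>n < CARD('p) ^ s. x $ i - of_nat n \<in> pb (int s)"
    using assms padic_residue by (auto simp: vpb_def)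
  then obtain g where g: "\<And>i. g i < CARD('p) ^ s" "\<And>i. x $ i - of_nat (g i) \<in> pb (int s)" by metis
  then show ?thesis
    by (intro bexI[of _ "\<chi> i. of_nat (g i)"]) (auto simp: residues_def vpb_def intro!: image_eqI[of _ _ g])
qed

lemma card_residues: "card (residues s :: ('p::prime_card padic ^ 'n::finite) set) = CARD('p) ^ (s * CARD('n))"
proof -
  have "inj_on (\<lambda>g. (\<chi> i. of_nat (g i)) :: 'p padic ^ 'n) (UNIV \<rightarrow>\<^sub>E {..<CARD('p) ^ s})"
  proof (rule inj_onI)
    fix g h assume gh: "g \<in> UNIV \<rightarrow>\<^sub>E {..<CARD('p) ^ s}" "h \<in> UNIV \<rightarrow>\<^sub>E {..<CARD('p) ^ s}"
      and "((\<chi> i. of_nat (g i)) :: 'p padic ^ 'n) = (\<chi> i. of_nat (h i))"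
    then have eq: "(of_nat (g i) :: 'p padic) = of_nat (h i)" for i by (simp add: vec_eq_iff)
    show "g = h"
    proof
      fix i show "g i = h i"
        by (rule of_nat_diff_pb[of _ _ s, where 'p = 'p]) (use gh eq[of i] in \<open>auto simp: PiE_iff\<close>)
    qed
  qed
  then have "card (residues s :: ('p padic ^ 'n) set) = card ((UNIV :: 'n set) \<rightarrow>\<^sub>E {..<CARD('p) ^ s})"
    unfolding residues_def by (rule card_image)
  then show ?thesis by (simp add: card_PiE power_mult)
qed

text \<open>Exact zeros are later extracted from approximate ones by compactness, which starts here.
  The complement of the polydisc is a union of its cosets, and the residue vectors are finite nets
  of every precision.\<close>

lemma compact_vpb0: "compact (vpb 0 :: ('p::prime_card padic ^ 'n::finite) set)"
proof -
  have cl: "closed (vpb 0 :: ('p padic ^ 'n) set)"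
  proof -
    have "- vpb 0 = \<Union>((\<lambda>a :: 'p padic ^ 'n. {x. x - a \<in> vpb 0}) ` (- vpb 0))"
    proof (intro equalityI subsetI)
      fix x assume "x \<in> \<Union>((\<lambda>a :: 'p padic ^ 'n. {x. x - a \<in> vpb 0}) ` (- vpb 0))"
      then obtain a where a: "x - a \<in> vpb 0" "a \<notin> vpb 0" by blast
      have "x \<in> vpb 0 \<Longrightarrow> a \<in> vpb 0" using vpb_diff[OF _ a(1)] by fastforce
      then show "x \<in> - vpb 0" using a(2) by auto
    next
      fix x :: "'p padic ^ 'n" assume "x \<in> - vpb 0"
      then show "x \<in> \<Union>((\<lambda>a. {x. x - a \<in> vpb 0}) ` (- vpb 0))" by (intro UN_I[of x]) auto
    qed
    moreover have "open (\<Union>((\<lambda>a :: 'p padic ^ 'n. {x. x - a \<in> vpb 0}) ` (- vpb 0)))"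
      by (intro open_UN ballI open_vec_coset)
    ultimately have "open (- vpb 0 :: ('p padic ^ 'n) set)" by simp
    then show ?thesis by (simp add: closed_def)
  qed
  have tb: "\<forall>e>0. \<exists>k. finite k \<and> (vpb 0 :: ('p padic ^ 'n) set) \<subseteq> (\<Union>x\<in>k. ball x e)"
  proof (intro allI impI)
    fix e :: real assume "e > 0"
    then obtain s where s: "\<And>x y :: 'p padic ^ 'n. x - y \<in> vpb (int s) \<Longrightarrow> dist x y < e"
      using vpb_small by blast
    have "(vpb 0 :: ('p padic ^ 'n) set) \<subseteq> (\<Union>x\<in>residues s. ball x e)"
    proof
      fix x :: "'p padic ^ 'n" assume "x \<in> vpb 0"
      then obtain r where r: "r \<in> residues s" "x - r \<in> vpb (int s)" using residues_ex by blast
      show "x \<in> (\<Union>x\<in>residues s. ball x e)"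
        using r(1) s[OF r(2)] by (intro UN_I[of r]) (simp_all add: dist_commute)
    qed
    then show "\<exists>k. finite k \<and> (vpb 0 :: ('p padic ^ 'n) set) \<subseteq> (\<Union>x\<in>k. ball x e)" 
      by (intro exI[of _ "residues s"] conjI finite_residues)
  qed
  show ?thesis unfolding compact_eq_totally_bounded complete_eq_closed by (rule conjI[OF cl tb])
qed

section \<open>Haar measure from a filtration by open subgroups\<close>

text \<open>An abstraction of p^s Z_p in Q_p and of its vector analogue that serves both at once.
  The cosets of the open subgroups \<open>B s\<close> form a base, and \<open>R s\<close> represents
  \<open>B 0\<close> modulo \<open>B s\<close>. A measure is therefore controlled by its values on
  cosets, and these are forced by counting.\<close>

locale ball_filtration =
  fixes B :: "nat \<Rightarrow> 'a::{topological_space, ab_group_add} set" and R :: "nat \<Rightarrow> 'a set"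
  assumes zero: "0 \<in> B s"
    and diff: "x \<in> B s \<Longrightarrow> y \<in> B s \<Longrightarrow> x - y \<in> B s"
    and anti: "s \<le> t \<Longrightarrow> B t \<subseteq> B s"
    and open_coset: "open {x. x - a \<in> B s}"
    and base: "open A \<Longrightarrow> a \<in> A \<Longrightarrow> \<exists>s. {x. x - a \<in> B s} \<subseteq> A"
    and finite_R: "finite (R s)"
    and R_sub: "R s \<subseteq> B 0"
    and R_ex: "x \<in> B 0 \<Longrightarrow> \<exists>r\<in>R s. x - r \<in> B s"
    and R_unique: "r \<in> R s \<Longrightarrow> r' \<in> R s \<Longrightarrow> r - r' \<in> B s \<Longrightarrow> r = r'"
    and countable_reps: "\<exists>C. countable C \<and> (\<forall>x. \<exists>r\<in>C. x - r \<in> B 0)"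
begin

definition coset :: "'a \<Rightarrow> nat \<Rightarrow> 'a set" where
  "coset a s = {x. x - a \<in> B s}"

text \<open>Only cosets inside \<open>B 0\<close> are mentioned: at level 0 there is one of them, of
  mass 1, so everything outside is null.\<close>

definition uniform :: "'a measure \<Rightarrow> bool" where
  "uniform Q \<longleftrightarrow> prob_space Q \<and> sets Q = sets borel \<and>
     (\<forall>a\<in>B 0. \<forall>s. emeasure Q (coset a s) = ennreal (1 / real (card (R s))))"

lemma minus: "x \<in> B s \<Longrightarrow> - x \<in> B s"
  using diff[OF zero] by fastforce

lemma add: "x \<in> B s \<Longrightarrow> y \<in> B s \<Longrightarrow> x + y \<in> B s"
  using diff[of x s "- y"] minus by simp

lemma diff_commute: "x - y \<in> B s \<longleftrightarrow> y - x \<in> B s"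
  using minus[of "x - y" s] minus[of "y - x" s] by auto

lemma trans: "x - y \<in> B s \<Longrightarrow> y - z \<in> B s \<Longrightarrow> x - z \<in> B s"
  using add[of "x - y" s "y - z"] by simp

lemma self_in_coset [simp]: "a \<in> coset a s"
  by (simp add: coset_def zero)

lemma coset_0 [simp]: "coset 0 s = B s"
  by (simp add: coset_def)

lemma coset_eq: "b \<in> coset a s \<Longrightarrow> coset b s = coset a s"
  using trans diff_commute unfolding coset_def by blast

lemma coset_mono: "s \<le> t \<Longrightarrow> coset a t \<subseteq> coset a s"
  using anti unfolding coset_def by blast

lemma coset_sub_B0:
  assumes "a \<in> B 0"
  shows "coset a s \<subseteq> B 0"
proof
  fix x assume "x \<in> coset a s"
  then have "x - a \<in> B 0" using anti[of 0 s] by (auto simp: coset_def)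
  from add[OF this assms] show "x \<in> B 0" by simp
qed

lemma coset_disjoint_B0:
  assumes "a \<notin> B 0"
  shows "coset a s \<inter> B 0 = {}"
proof (rule ccontr)
  assume "coset a s \<inter> B 0 \<noteq> {}"
  then obtain x where x: "x - a \<in> B 0" "x \<in> B 0" using anti[of 0 s] by (auto simp: coset_def)
  from diff[OF x(2,1)] show False using assms by simp
qed

lemma R_nonempty: "R s \<noteq> {}"
  using R_ex[OF zero] by blast

lemma card_R_pos: "card (R s) > 0"
  using R_nonempty finite_R card_gt_0_iff by blast

lemma countable_cosets: "countable (range (\<lambda>a. coset a s))"
proof -
  obtain C where C: "countable C" "\<And>x. \<exists>r\<in>C. x - r \<in> B 0" using countable_reps by blast
  have "range (\<lambda>a. coset a s) \<subseteq> (\<lambda>(r, r'). coset (r + r') s) ` (C \<times> R s)"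
  proof
    fix X assume "X \<in> range (\<lambda>a. coset a s)"
    then obtain a where a: "X = coset a s" by blast
    obtain r where r: "r \<in> C" "a - r \<in> B 0" using C(2) by blast
    obtain r' where r': "r' \<in> R s" "a - r - r' \<in> B s" using R_ex[OF r(2)] by blast
    have "a \<in> coset (r + r') s" using r'(2) by (simp add: coset_def algebra_simps)
    then have "X = coset (r + r') s" unfolding a by (rule coset_eq)
    then show "X \<in> (\<lambda>(r, r'). coset (r + r') s) ` (C \<times> R s)" using r(1) r'(1) by force
  qed
  moreover have "countable (C \<times> R s)" using C(1) finite_R[of s] by (simp add: countable_finite)
  ultimately show ?thesis by (meson countable_image countable_subset)
qed

text \<open>The empty set is included because two cosets are either nested or disjoint; with it they
  form a pi-system.\<close>

definition gen :: "'a set set" where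
  "gen = insert {} (\<Union>s. range (\<lambda>a. coset a s))"

lemma countable_gen: "countable gen"
  unfolding gen_def using countable_cosets by auto

lemma coset_in_gen: "coset a s \<in> gen"
  by (auto simp: gen_def)

lemma coset_Int: "coset a s \<inter> coset b t \<in> gen"
proof (cases "coset a s \<inter> coset b t = {}")
  case False
  then obtain x where x: "coset x s = coset a s" "coset x t = coset b t" using coset_eq by blast
  have "coset x s \<inter> coset x t = coset x (max s t)"
    using coset_mono[of s t x] coset_mono[of t s x] by (cases "s \<le> t") (auto simp: max_def)
  then show ?thesis using x coset_in_gen by metis
qed (simp add: gen_def)

lemma Int_stable_gen: "Int_stable gen"
proof (rule Int_stableI)
  fix X Y assume "X \<in> gen" "Y \<in> gen"
  then consider "X \<inter> Y = {}" | a s b t where "X = coset a s" "Y = coset b t"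
    unfolding gen_def by blast
  then show "X \<inter> Y \<in> gen"
  proof cases
    case 1
    then show ?thesis by (simp add: gen_def)
  qed (simp add: coset_Int)
qed

lemma open_gen: "X \<in> gen \<Longrightarrow> open X"
  using open_coset by (auto simp: gen_def coset_def)

text \<open>Every open set is the union of the cosets it contains, and there are only countably many
  cosets altogether.\<close>

lemma sets_borel_gen: "sets (borel :: 'a measure) = sigma_sets UNIV gen"
proof -
  have "A \<in> sigma_sets UNIV gen" if A: "open A" for A
  proof -
    have "A = \<Union>{K \<in> gen. K \<subseteq> A}"
    proof (intro equalityI subsetI)
      fix x assume "x \<in> A"
      then obtain s where "coset x s \<subseteq> A" using base[OF A] by (auto simp: coset_def)
      then show "x \<in> \<Union>{K \<in> gen. K \<subseteq> A}" using coset_in_gen[of x s] by (intro UnionI[of "coset x s"]) auto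
    qed auto
    moreover have "\<Union>{K \<in> gen. K \<subseteq> A} \<in> sigma_sets UNIV gen"
      by (rule sigma_sets_UNION) (use countable_gen in \<open>auto intro: countable_subset\<close>)
    ultimately show ?thesis by simp
  qed
  then have "sigma_sets UNIV (Collect open) = sigma_sets UNIV gen"
    using open_gen by (intro sigma_sets_eqI) auto
  then show ?thesis by (simp add: borel_def)
qed

lemma coset_borel [measurable, simp]: "coset a s \<in> sets borel"
  using open_coset by (simp add: coset_def)

lemma B_borel [measurable, simp]: "B s \<in> sets borel"
  using coset_borel[of 0 s] by simp

lemma measurable_cosetI:
  assumes "\<And>a s. f -` coset a s \<inter> space M \<in> sets M"
  shows "f \<in> measurable M borel"
proof (rule measurable_sigma_sets[OF sets_borel_gen])
  fix Y assume "Y \<in> gen"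
  then show "f -` Y \<inter> space M \<in> sets M" using assms by (auto simp: gen_def)
qed auto

lemma measurable_translation [measurable]: "(+) a \<in> measurable borel borel" for a :: 'a
proof (rule measurable_cosetI)
  fix b s
  have "(+) a -` coset b s = coset (b - a) s" by (auto simp: coset_def algebra_simps)
  then show "(+) a -` coset b s \<inter> space borel \<in> sets borel" by simp
qed

lemma measure_coset_eqI:
  assumes "sets M = sets borel" "sets N = sets borel"
    and "\<And>a s. emeasure M (coset a s) = emeasure N (coset a s)"
    and "\<And>a s. emeasure M (coset a s) \<noteq> \<infinity>"
  shows "M = N"
proof -
  obtain C where C: "countable C" "\<And>x. \<exists>r\<in>C. x - r \<in> B 0" using countable_reps by blast
  have ne: "C \<noteq> {}" using C(2) by blast
  define A where "A i = coset (from_nat_into C i) 0" for i :: nat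
  show ?thesis
  proof (rule measure_eqI_generator_eq[OF Int_stable_gen, where \<Omega> = UNIV and A = A])
    show "(\<Union>i. A i) = UNIV"
    proof (intro equalityI subsetI)
      fix x :: 'a
      obtain r where r: "r \<in> C" "x - r \<in> B 0" using C(2) by blast
      obtain i where "from_nat_into C i = r" using from_nat_into_surj[OF C(1) r(1)] by blast
      then show "x \<in> (\<Union>i. A i)" using r(2) by (auto simp: A_def coset_def)
    qed auto
    show "range A \<subseteq> gen" using coset_in_gen by (auto simp: A_def)
    show "emeasure M X = emeasure N X" if "X \<in> gen" for X
      using that assms(3) by (auto simp: gen_def)
    show "sets M = sigma_sets UNIV gen" "sets N = sigma_sets UNIV gen"
      using assms(1,2) sets_borel_gen by auto
    show "emeasure M (A i) \<noteq> \<infinity>" for i using assms(4) by (simp add: A_def)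
  qed auto
qed

lemma B0_partition:
  assumes "sets M = sets borel"
  shows "emeasure M (B 0) = (\<Sum>r\<in>R s. emeasure M (coset r s))"
proof -
  have "B 0 = (\<Union>r\<in>R s. coset r s)"
    using coset_sub_B0 R_sub R_ex by (auto simp: coset_def)
  moreover have "disjoint_family_on (\<lambda>r. coset r s) (R s)"
    unfolding disjoint_family_on_def
  proof (intro ballI impI)
    fix r r' assume r: "r \<in> R s" "r' \<in> R s" "r \<noteq> r'"
    show "coset r s \<inter> coset r' s = {}"
    proof (rule ccontr)
      assume "coset r s \<inter> coset r' s \<noteq> {}"
      then obtain x where "x - r \<in> B s" "x - r' \<in> B s" by (auto simp: coset_def)
      then have "r - r' \<in> B s" using trans diff_commute by blast
      then show False using R_unique r by blast
    qed
  qed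
  ultimately show ?thesis using finite_R assms by (subst sum_emeasure) auto
qed

lemma uniformI:
  assumes "prob_space Q" "sets Q = sets borel" "emeasure Q (B 0) = 1"
    and eq: "\<And>a b s. a \<in> B 0 \<Longrightarrow> b \<in> B 0 \<Longrightarrow> emeasure Q (coset a s) = emeasure Q (coset b s)"
  shows "uniform Q"
  unfolding uniform_def
proof (intro conjI ballI allI assms)
  fix a s assume a: "a \<in> B 0"
  interpret prob_space Q by fact
  have "1 = (\<Sum>r\<in>R s. emeasure Q (coset r s))" using B0_partition[OF assms(2)] assms(3) by simp
  also have "\<dots> = (\<Sum>r\<in>R s. emeasure Q (coset a s))" using R_sub a by (intro sum.cong eq) auto
  also have "\<dots> = ennreal (real (card (R s)) * measure Q (coset a s))"
    by (simp add: emeasure_eq_measure ennreal_mult ennreal_of_nat_eq_real_of_nat)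
  finally have "real (card (R s)) * measure Q (coset a s) = 1"
    by (metis ennreal_eq_1)
  then show "emeasure Q (coset a s) = ennreal (1 / real (card (R s)))"
    using card_R_pos[of s] by (simp add: emeasure_eq_measure field_simps)
qed

text \<open>Lower bounds suffice: \<open>card (R s)\<close> disjoint cosets share a total mass of at
  most 1, so none can exceed its share. In the digit model this leaves a single inclusion to
  verify.\<close>

lemma uniformI_ge:
  assumes Q: "prob_space Q" "sets Q = sets borel"
    and ge: "\<And>a s. a \<in> B 0 \<Longrightarrow> 1 / real (card (R s)) \<le> measure Q (coset a s)"
  shows "uniform Q"
  unfolding uniform_def
proof (intro conjI ballI allI Q)
  fix a s assume a: "a \<in> B 0"
  interpret prob_space Q by fact
  obtain r where r: "r \<in> R s" "a \<in> coset r s" using R_ex[OF a] by (auto simp: coset_def)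
  have "emeasure Q (B 0) = ennreal (\<Sum>r\<in>R s. measure Q (coset r s))"
    using B0_partition[OF Q(2)] by (simp add: emeasure_eq_measure sum_ennreal)
  then have le: "(\<Sum>r\<in>R s. measure Q (coset r s)) \<le> 1"
    by (simp add: emeasure_eq_measure sum_nonneg ennreal_inj) (metis prob_le_1)
  have "(\<Sum>r'\<in>R s - {r}. 1 / real (card (R s))) \<le> (\<Sum>r'\<in>R s - {r}. measure Q (coset r' s))"
    using R_sub by (intro sum_mono ge) auto
  then have "measure Q (coset r s) \<le> 1 - real (card (R s) - 1) / real (card (R s))"
    using le r(1) finite_R by (simp add: sum.remove[of "R s" r])
  also have "\<dots> = 1 / real (card (R s))" using card_R_pos[of s] by (simp add: of_nat_diff field_simps)
  finally have "measure Q (coset a s) = 1 / real (card (R s))"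
    using ge[OF a, of s] coset_eq[OF r(2)] by simp
  then show "emeasure Q (coset a s) = ennreal (1 / real (card (R s)))"
    by (simp add: emeasure_eq_measure)
qed

lemma card_R0: "card (R 0) = 1"
proof -
  obtain r where "r \<in> R 0" using R_nonempty by blast
  then have "R 0 = {r}" using R_unique R_sub diff by blast
  then show ?thesis by simp
qed

lemma uniform_B0: "uniform Q \<Longrightarrow> emeasure Q (B 0) = 1"
  unfolding uniform_def using zero[of 0] card_R0 by (metis coset_0 ennreal_1 div_by_1 of_nat_1)

lemma uniform_outside:
  assumes Q: "uniform Q" and a: "a \<notin> B 0"
  shows "emeasure Q (coset a s) = 0"
proof -
  interpret prob_space Q using Q by (simp add: uniform_def)
  have s: "sets Q = sets borel" using Q by (simp add: uniform_def)
  have "measure Q (coset a s) + measure Q (B 0) = measure Q (coset a s \<union> B 0)"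
    using coset_disjoint_B0[OF a] s by (intro finite_measure_Union[symmetric]) auto
  also have "\<dots> \<le> 1" by simp
  finally have "measure Q (coset a s) + measure Q (B 0) \<le> 1" .
  moreover have "measure Q (B 0) = 1" using uniform_B0[OF Q] by (simp add: emeasure_eq_measure)
  ultimately show ?thesis by (simp add: emeasure_eq_measure measure_le_0_iff)
qed

lemma uniform_unique:
  assumes "uniform Q" "uniform Q'"
  shows "Q = Q'"
proof (rule measure_coset_eqI)
  fix a s
  show "emeasure Q (coset a s) = emeasure Q' (coset a s)"
    using assms uniform_outside by (cases "a \<in> B 0") (auto simp: uniform_def)
  interpret prob_space Q using assms by (simp add: uniform_def)
  show "emeasure Q (coset a s) \<noteq> \<infinity>" by simp
qed (use assms in \<open>auto simp: uniform_def\<close>)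

lemma uniform_translation:
  assumes Q: "uniform Q" and a: "a \<in> B 0"
  shows "distr Q borel ((+) a) = Q"
proof (rule uniform_unique[OF _ Q])
  interpret prob_space Q using Q by (simp add: uniform_def)
  have s: "sets Q = sets borel" using Q by (simp add: uniform_def)
  have m: "(+) a \<in> measurable Q borel" using measurable_translation[of a] by (simp add: measurable_cong_sets[OF s refl])
  show "uniform (distr Q borel ((+) a))"
    unfolding uniform_def
  proof (intro conjI ballI allI prob_space_distr m)
    fix b s assume b: "b \<in> B 0"
    have "(+) a -` coset b s = coset (b - a) s" by (auto simp: coset_def algebra_simps)
    moreover have "b - a \<in> B 0" using a b diff by blast
    ultimately show "emeasure (distr Q borel ((+) a)) (coset b s) = ennreal (1 / real (card (R s)))"
      using Q sets_eq_imp_space_eq[OF s] by (simp add: emeasure_distr[OF m] uniform_def)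
  qed simp
qed

definition translation_invariant :: "'a measure \<Rightarrow> bool" where
  "translation_invariant M \<longleftrightarrow>
     sets M = sets borel \<and> (\<forall>a. distr M borel ((+) a) = M) \<and> emeasure M (B 0) = 1"

text \<open>Invariance gives all cosets of level \<open>s\<close> the same mass, and
  \<open>card (R s)\<close> of them fill \<open>B 0\<close>, which has mass 1.\<close>

lemma invariant_coset:
  assumes M: "translation_invariant M"
  shows "emeasure M (coset a s) = ennreal (1 / real (card (R s)))"
proof -
  have s: "sets M = sets borel" using M by (simp add: translation_invariant_def)
  have m: "(+) a \<in> measurable M borel" for a
    using measurable_translation[of a] by (simp add: measurable_cong_sets[OF s refl])
  have eq: "emeasure M (coset b s) = emeasure M (B s)" for b
  proof -
    have "emeasure M (coset b s) = emeasure (distr M borel ((+) b)) (coset b s)"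
      using M by (simp add: translation_invariant_def)
    also have "\<dots> = emeasure M ((+) b -` coset b s \<inter> space M)"
      by (rule emeasure_distr[OF m]) simp
    also have "(+) b -` coset b s \<inter> space M = B s"
      using sets_eq_imp_space_eq[OF s] by (auto simp: coset_def)
    finally show ?thesis .
  qed
  have "1 = (\<Sum>r\<in>R s. emeasure M (coset r s))"
    using B0_partition[OF s] M by (simp add: translation_invariant_def)
  then have one: "of_nat (card (R s)) * emeasure M (B s) = 1" by (simp add: eq)
  have "emeasure M (B s) = emeasure M (B s) * (of_nat (card (R s)) * ennreal (1 / real (card (R s))))"
    using card_R_pos[of s] by (simp add: ennreal_of_nat_eq_real_of_nat flip: ennreal_mult)
  also have "\<dots> = ennreal (1 / real (card (R s)))"
    using one by (metis mult.assoc mult.commute mult_1)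
  finally show ?thesis by (simp add: eq)
qed

lemma invariant_unique:
  assumes "translation_invariant M" "translation_invariant N"
  shows "M = N"
  using assms invariant_coset by (intro measure_coset_eqI) (auto simp: translation_invariant_def)

text \<open>A copy of the uniform law is placed on every coset of \<open>B 0\<close>: counting
  measure on a set \<open>I\<close> of coset representatives times \<open>Q\<close>, pushed forward
  by addition.\<close>

lemma invariant_exists:
  assumes Q: "uniform Q"
  shows "\<exists>M. translation_invariant M"
proof -
  interpret prob_space Q using Q by (simp add: uniform_def)
  have s: "sets Q = sets borel" using Q by (simp add: uniform_def)
  obtain C where C: "countable C" "\<And>x. \<exists>r\<in>C. x - r \<in> B 0" using countable_reps by blast
  \<comment> \<open>The choice depends only on the coset of \<open>x\<close>, so the range of
    \<open>rep\<close> meets each coset of \<open>B 0\<close> exactly once.\<close>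
  define rep where "rep x = (SOME y. y - x \<in> B 0)" for x
  have rep: "rep x - x \<in> B 0" for x
    unfolding rep_def by (rule someI[of _ x]) (simp add: zero)
  have rep_cong: "rep x = rep y" if "x - y \<in> B 0" for x y
    unfolding rep_def using that trans diff_commute by (intro arg_cong[where f = Eps]) blast
  define I where "I = range rep"
  have "I \<subseteq> rep ` C" unfolding I_def using C(2) rep_cong by blast
  then have I: "countable I" using C(1) countable_subset by blast
  have I_eq: "r = rep a" if rI: "r \<in> I" and ra: "a - r \<in> B 0" for r a
  proof -
    obtain x where x: "r = rep x" using rI by (auto simp: I_def)
    have "a - x \<in> B 0" using trans[OF ra, of x] rep[of x] x by simp
    then show ?thesis using rep_cong x by simp
  qed
  interpret cs: sigma_finite_measure "count_space I" by (rule sigma_finite_measure_count_space_countable[OF I])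
  define M where "M = distr (count_space I \<Otimes>\<^sub>M Q) borel (\<lambda>(a, x). a + x)"
  have m: "(\<lambda>(a, x). a + x) \<in> measurable (count_space I \<Otimes>\<^sub>M Q) borel"
    by (rule measurable_pair_measure_countable1[OF I])
      (use measurable_translation in \<open>simp add: measurable_cong_sets[OF s refl]\<close>)
  have val: "emeasure M (coset a k) = ennreal (1 / real (card (R k)))" for a k
  proof -
    have "emeasure M (coset a k) =
        emeasure (count_space I \<Otimes>\<^sub>M Q) ((\<lambda>(a, x). a + x) -` coset a k \<inter> space (count_space I \<Otimes>\<^sub>M Q))"
      unfolding M_def by (rule emeasure_distr[OF m]) simp
    also have "\<dots> = (\<integral>\<^sup>+r. emeasure Q (Pair r -` ((\<lambda>(a, x). a + x) -` coset a k \<inter> space (count_space I \<Otimes>\<^sub>M Q))) \<partial>count_space I)"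
      using measurable_sets[OF m, of "coset a k"] by (intro emeasure_pair_measure_alt) simp
    \<comment> \<open>Only the representative of the coset of \<open>a\<close> contributes; for
      every other one the shifted coset misses \<open>B 0\<close>.\<close>
    also have "\<dots> = (\<integral>\<^sup>+r. ennreal (1 / real (card (R k))) * indicator {rep a} r \<partial>count_space I)"
    proof (rule nn_integral_cong)
      fix r assume "r \<in> space (count_space I)"
      then have r: "r \<in> I" by simp
      have "Pair r -` ((\<lambda>(a, x). a + x) -` coset a k \<inter> space (count_space I \<Otimes>\<^sub>M Q)) = coset (a - r) k"
        using r sets_eq_imp_space_eq[OF s] by (auto simp: space_pair_measure coset_def algebra_simps)
      moreover have "emeasure Q (coset (a - r) k) = ennreal (1 / real (card (R k))) * indicator {rep a} r"
      proof (cases "a - r \<in> B 0")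
        case True
        then show ?thesis using Q I_eq[OF r True] by (auto simp: uniform_def)
      next
        case False
        then have "r \<noteq> rep a" using rep[of a] diff_commute by blast
        then show ?thesis using uniform_outside[OF Q False] by simp
      qed
      ultimately show "emeasure Q (Pair r -` ((\<lambda>(a, x). a + x) -` coset a k \<inter> space (count_space I \<Otimes>\<^sub>M Q)))
          = ennreal (1 / real (card (R k))) * indicator {rep a} r" by simp
    qed
    also have "\<dots> = ennreal (1 / real (card (R k)))"
      by (subst nn_integral_cmult_indicator) (auto simp: I_def)
    finally show ?thesis .
  qed
  have sM: "sets M = sets borel" by (simp add: M_def)
  have mM: "(+) a \<in> measurable M borel" for a
    using measurable_translation[of a] by (simp add: measurable_cong_sets[OF sM refl])
  have "distr M borel ((+) a) = M" for a
  proof (rule measure_coset_eqI)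
    fix b k
    have "(+) a -` coset b k \<inter> space M = coset (b - a) k"
      using sets_eq_imp_space_eq[OF sM] by (auto simp: coset_def algebra_simps)
    then show "emeasure (distr M borel ((+) a)) (coset b k) = emeasure M (coset b k)"
      by (simp add: emeasure_distr[OF mM] val)
    then show "emeasure (distr M borel ((+) a)) (coset b k) \<noteq> \<infinity>" by (simp add: val)
  qed (simp_all add: sM)
  moreover have "emeasure M (B 0) = 1" using val[of 0 0] by (simp add: card_R0)
  ultimately show ?thesis using sM unfolding translation_invariant_def by blast
qed

text \<open>Existence and uniqueness together make the definite description in
  \<open>haar_measure\<close> denote.\<close>

lemma haar_measure_invariant:
  assumes "uniform Q"
  shows "translation_invariant (haar_measure (B 0))"
proof -
  obtain M where M: "translation_invariant M" using invariant_exists[OF assms] by blast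
  have "haar_measure (B 0) = (THE M. translation_invariant M)"
    by (simp add: haar_measure_def translation_invariant_def)
  also have "\<dots> = M" using M invariant_unique by (intro the_equality) auto
  finally show ?thesis using M by simp
qed

lemma haar_measure_coset:
  assumes "uniform Q"
  shows "emeasure (haar_measure (B 0)) (coset a s) = ennreal (1 / real (card (R s)))"
  by (rule invariant_coset[OF haar_measure_invariant[OF assms]])

lemma sets_haar_measure:
  assumes "uniform Q"
  shows "sets (haar_measure (B 0)) = sets borel"
  using haar_measure_invariant[OF assms] by (simp add: translation_invariant_def)

lemma uniform_measure_haar:
  assumes Q: "uniform Q"
  shows "uniform_measure (haar_measure (B 0)) (B 0) = Q"
proof (rule uniform_unique[OF _ Q])
  let ?H = "haar_measure (B 0)"
  have s: "sets ?H = sets borel" by (rule sets_haar_measure[OF Q])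
  have one: "emeasure ?H (B 0) = 1"
    using haar_measure_invariant[OF Q] by (simp add: translation_invariant_def)
  show "uniform (uniform_measure ?H (B 0))"
    unfolding uniform_def
  proof (intro conjI ballI allI)
    show "prob_space (uniform_measure ?H (B 0))"
      by (rule prob_space_uniform_measure) (simp_all add: one)
    fix a k assume a: "a \<in> B 0"
    have "B 0 \<inter> coset a k = coset a k" using coset_sub_B0[OF a] by blast
    then show "emeasure (uniform_measure ?H (B 0)) (coset a k) = ennreal (1 / real (card (R k)))"
      using s one haar_measure_coset[OF Q, of a k] by (subst emeasure_uniform_measure) (auto simp: divide_ennreal_def)
  qed (simp add: s)
qed

end

section \<open>Uniform p-adic numbers and vectors\<close>

lemma countable_padic_reps: "\<exists>C. countable C \<and> (\<forall>x :: 'p::prime_card padic. \<exists>r\<in>C. x - r \<in> pb 0)"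
proof (intro exI conjI allI)
  show "countable (range (padic_rat :: rat \<Rightarrow> 'p padic))" by simp
  show "\<exists>r\<in>range padic_rat. x - r \<in> pb 0" for x :: "'p padic" using padic_rat_dense[of x 0] by blast
qed

interpretation pad: ball_filtration
  "\<lambda>s. pb (int s) :: 'p::prime_card padic set" "\<lambda>s. of_nat ` {..<CARD('p) ^ s}"
proof
  show "\<exists>C. countable C \<and> (\<forall>x. \<exists>r\<in>C. x - r \<in> (pb (int 0) :: 'p padic set))"
    using countable_padic_reps by simp
  show "\<exists>r\<in>of_nat ` {..<CARD('p) ^ s}. x - r \<in> pb (int s)" if "x \<in> pb (int 0)" for x :: "'p padic" and s
    using padic_residue[of x s] that by auto
  show "r = r'" if "r \<in> of_nat ` {..<CARD('p) ^ s}" "r' \<in> of_nat ` {..<CARD('p) ^ s}" "r - r' \<in> pb (int s)"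
    for r r' :: "'p padic" and s
    using that of_nat_diff_pb[where 'p = 'p] by blast
qed (use open_padic_base open_padic_coset in \<open>auto intro: pb_diff pb_anti\<close>)

interpretation pvec: ball_filtration
  "\<lambda>s. vpb (int s) :: ('p::prime_card padic ^ 'n::finite) set" residues
proof
  show "\<exists>C. countable C \<and> (\<forall>x. \<exists>r\<in>C. x - r \<in> (vpb (int 0) :: ('p padic ^ 'n) set))"
  proof (intro exI conjI allI)
    show "countable (range (\<lambda>g. (\<chi> i. padic_rat (g i)) :: 'p padic ^ 'n))" by simp
    fix x :: "'p padic ^ 'n"
    have "\<forall>i. \<exists>r. x $ i - padic_rat r \<in> pb 0" using padic_rat_dense by blast
    then obtain g where "\<And>i. x $ i - padic_rat (g i) \<in> pb 0" by metis
    then show "\<exists>r\<in>range (\<lambda>g. \<chi> i. padic_rat (g i)). x - r \<in> vpb (int 0)"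
      by (intro bexI[of _ "\<chi> i. padic_rat (g i)"]) (auto simp: vpb_def)
  qed
  show "residues s \<subseteq> (vpb (int 0) :: ('p padic ^ 'n) set)" for s using residues_in_vpb by auto
  show "\<exists>r\<in>residues s. x - r \<in> vpb (int s)" if "x \<in> vpb (int 0)" for x :: "'p padic ^ 'n" and s
    using residues_ex[of x s] that by simp
  show "r = r'" if "r \<in> residues s" "r' \<in> residues s" "r - r' \<in> vpb (int s)" for r r' :: "'p padic ^ 'n" and s
    using residues_diff that by blast
qed (use open_vec_base open_vec_coset in \<open>auto intro: vpb_diff vpb_anti\<close>)

lemma pvec_coset_eq: "pvec.coset a s = {x. \<forall>i. x $ i - a $ i \<in> pb (int s)}"
  unfolding pvec.coset_def by (simp add: vpb_def)

lemma pp_power_in [simp]: "pp ^ n \<in> pb j \<longleftrightarrow> j \<le> int n"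
  using pp_pow_in[of "int n" j] by simp

lemma digit_expansion: "(\<Sum>i<s. (n div b ^ i mod b) * b ^ i) = n mod b ^ s" for n b :: nat
proof (induction s)
  case (Suc s)
  have "n mod (b ^ s * b) = b ^ s * (n div b ^ s mod b) + n mod b ^ s" by (rule mod_mult2_eq)
  then show ?case using Suc by (simp add: mult.commute)
qed simp

lemma card_of_nat_image: "card ((of_nat :: nat \<Rightarrow> 'p::prime_card padic) ` {..<CARD('p) ^ s}) = CARD('p) ^ s"
proof -
  have "inj_on (of_nat :: nat \<Rightarrow> 'p padic) {..<CARD('p) ^ s}"
    using of_nat_diff_pb[where 'p = 'p] by (intro inj_onI) (metis diff_self pb_0 lessThan_iff)
  then show ?thesis by (simp add: card_image)
qed

text \<open>The uniform law is that of a p-adic number with independent uniform digits.\<close>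

lemma pad_uniform_exists: "\<exists>Q :: 'p::prime_card padic measure. pad.uniform Q"
proof -
  define \<mu> where "\<mu> = measure_pmf (pmf_of_set {..<CARD('p)})"
  define D where "D = (\<Pi>\<^sub>M i\<in>(UNIV :: nat set). \<mu>)"
  interpret \<mu>: prob_space \<mu> unfolding \<mu>_def by (rule measure_pmf.prob_space_axioms)
  interpret D: product_prob_space "\<lambda>_. \<mu>" "UNIV :: nat set" ..
  have spD: "space D = UNIV" by (auto simp: D_def space_PiM \<mu>_def)
  have comp [measurable]: "(\<lambda>d. d i) \<in> measurable D (count_space UNIV)" for i
  proof -
    have "(\<lambda>d. d i) \<in> measurable D \<mu>" unfolding D_def by (rule measurable_component_singleton) simp
    then show ?thesis by (simp add: \<mu>_def)
  qed
  define T :: "(nat \<Rightarrow> nat) \<Rightarrow> nat \<Rightarrow> 'p padic" where "T d m = (\<Sum>i<m. of_nat (d i) * pp ^ i)" for d m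
  define val where "val d = (SOME L. \<forall>m. L - T d m \<in> pb (int m + 0))" for d
  have "\<exists>L. \<forall>m. L - T d m \<in> pb (int m + 0)" for d
  proof (rule padic_limit)
    fix m
    have "of_nat (d m) * pp powi (int m) \<in> (pb (int m + 0) :: 'p padic set)"
      by (rule pb_mult'[OF of_nat_in_pb0, of _ "int m"]) auto
    then show "T d (Suc m) - T d m \<in> pb (int m + 0)" by (simp add: T_def)
  qed
  from someI_ex[OF this] have val: "val d - T d m \<in> pb (int m)" for d m
    unfolding val_def by simp
  \<comment> \<open>The first \<open>s\<close> digits decide the coset of level \<open>s\<close>,
    because the tail of the series is divisible by p^s.\<close>
  have vimg: "val -` pad.coset a s = {d. T d s - a \<in> pb (int s)}" for a s
  proof (intro equalityI subsetI)
    fix d assume "d \<in> val -` pad.coset a s"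
    then have "val d - a \<in> pb (int s)" by (simp add: pad.coset_def)
    from pb_diff[OF this val[of d s]] show "d \<in> {d. T d s - a \<in> pb (int s)}" by simp
  next
    fix d assume "d \<in> {d. T d s - a \<in> pb (int s)}"
    then show "d \<in> val -` pad.coset a s" using pb_add[OF val[of d s], of "T d s - a"] by (simp add: pad.coset_def)
  qed
  have mval: "val \<in> measurable D borel"
  proof (rule pad.measurable_cosetI)
    fix a :: "'p padic" and s
    let ?L = "{e :: nat list. length e = s \<and> T (\<lambda>i. e ! i) s - a \<in> pb (int s)}"
    \<comment> \<open>The digit space consists of all sequences of naturals, so the event is split
      over lists of naturals of length \<open>s\<close>, a countable family of cylinders.\<close>
    have "{d. T d s - a \<in> pb (int s)} = (\<Union>e\<in>?L. {d \<in> space D. \<forall>i\<in>{..<s}. d i = e ! i})"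
    proof (intro equalityI subsetI)
      fix d assume d: "d \<in> {d. T d s - a \<in> pb (int s)}"
      have "T (\<lambda>i. map d [0..<s] ! i) s = T d s" unfolding T_def by (intro sum.cong) auto
      then show "d \<in> (\<Union>e\<in>?L. {d \<in> space D. \<forall>i\<in>{..<s}. d i = e ! i})"
        using d by (intro UN_I[of "map d [0..<s]"]) (auto simp: spD)
    next
      fix d assume "d \<in> (\<Union>e\<in>?L. {d \<in> space D. \<forall>i\<in>{..<s}. d i = e ! i})"
      then obtain e where e: "e \<in> ?L" "\<forall>i\<in>{..<s}. d i = e ! i" by blast
      have "T (\<lambda>i. e ! i) s = T d s" unfolding T_def using e(2) by (intro sum.cong) auto
      then show "d \<in> {d. T d s - a \<in> pb (int s)}" using e(1) by simp
    qed
    also have "\<dots> \<in> sets D"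
    proof (intro sets.countable_UN' countableI_type image_subsetI)
      show "{d \<in> space D. \<forall>i\<in>{..<s}. d i = e ! i} \<in> sets D" for e by measurable
    qed
    finally show "val -` pad.coset a s \<inter> space D \<in> sets D" by (simp add: vimg spD)
  qed
  have "pad.uniform (distr D borel val)"
  proof (rule pad.uniformI_ge)
    show "prob_space (distr D borel val)"
      using mval D.P.prob_space_axioms by (simp add: prob_space.prob_space_distr D_def)
    fix a :: "'p padic" and s
    assume "a \<in> pb (int 0)"
    then obtain n where n: "n < CARD('p) ^ s" "a - of_nat n \<in> pb (int s)" using padic_residue[of a s] by auto
    \<comment> \<open>The base-p digits of \<open>n\<close>; the sequences that begin with them form
      a cylinder of mass p^-s inside the coset.\<close>
    define e where "e i = n div CARD('p) ^ i mod CARD('p)" for i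
    have p: "CARD('p) > 0" by simp
    have sub: "{d \<in> space D. \<forall>i\<in>{..<s}. d i \<in> {e i}} \<subseteq> val -` pad.coset a s \<inter> space D"
    proof
      fix d assume "d \<in> {d \<in> space D. \<forall>i\<in>{..<s}. d i \<in> {e i}}"
      then have "T d s = (\<Sum>i<s. of_nat (e i * CARD('p) ^ i))"
        unfolding T_def by (intro sum.cong) (auto simp: pp_def)
      also have "\<dots> = of_nat n"
        unfolding of_nat_sum[symmetric] e_def digit_expansion using n(1) by simp
      finally show "d \<in> val -` pad.coset a s \<inter> space D"
        using n(2) by (simp add: vimg spD pb_diff_commute)
    qed
    have "emeasure D {d \<in> space D. \<forall>i\<in>{..<s}. d i \<in> {e i}} = (\<Prod>i<s. emeasure \<mu> {e i})"
      unfolding D_def by (rule D.emeasure_PiM_Collect) (auto simp: \<mu>_def)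
    also have "\<dots> = (\<Prod>i<s. ennreal (1 / real CARD('p)))"
      using p by (intro prod.cong) (auto simp: \<mu>_def emeasure_pmf_single pmf_of_set e_def lessThan_empty_iff)
    also have "\<dots> = ennreal (1 / real CARD('p) ^ s)"
      by (simp add: ennreal_power power_divide)
    finally have "measure D {d \<in> space D. \<forall>i\<in>{..<s}. d i \<in> {e i}} = 1 / real CARD('p) ^ s"
      by (simp add: measure_def)
    then have "1 / real (CARD('p) ^ s) \<le> measure D (val -` pad.coset a s \<inter> space D)"
      using D.P.finite_measure_mono[of "{d \<in> space D. \<forall>i\<in>{..<s}. d i \<in> {e i}}" "val -` pad.coset a s \<inter> space D"]
        sub measurable_sets[OF mval, of "pad.coset a s"]
      by (simp add: D_def)
    then show "1 / real (card ((of_nat :: nat \<Rightarrow> 'p padic) ` {..<CARD('p) ^ s})) \<le> measure (distr D borel val) (pad.coset a s)"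
      by (simp add: measure_distr[OF mval] card_of_nat_image)
  qed simp
  then show ?thesis by blast
qed

lemma padic_int_eq: "padic_int = pb 0"
  by (simp add: padic_int_def pb_def)

lemma uniform_padic_uniform: "pad.uniform (padic_uniform :: 'p::prime_card padic measure)"
proof -
  obtain Q :: "'p padic measure" where Q: "pad.uniform Q" using pad_uniform_exists by blast
  then show ?thesis using pad.uniform_measure_haar[OF Q] by (simp add: padic_uniform_def padic_int_eq)
qed

lemma sets_padic_uniform [measurable_cong, simp]: "sets (padic_uniform :: 'p::prime_card padic measure) = sets borel"
  using uniform_padic_uniform[where 'p = 'p] by (simp add: pad.uniform_def)

lemma space_padic_uniform [simp]: "space padic_uniform = UNIV"
  using sets_eq_imp_space_eq[OF sets_padic_uniform] by simp

lemma prob_space_padic_uniform: "prob_space (padic_uniform :: 'p::prime_card padic measure)"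
  using uniform_padic_uniform[where 'p = 'p] by (simp add: pad.uniform_def)

lemma emeasure_padic_uniform:
  assumes "a \<in> pb 0"
  shows "emeasure (padic_uniform :: 'p::prime_card padic measure) {x. x - a \<in> pb (int k)} = ennreal (1 / real CARD('p) ^ k)"
  using uniform_padic_uniform[where 'p = 'p] assms by (simp add: pad.uniform_def pad.coset_def card_of_nat_image)

lemma pb_coset_borel [measurable, simp]: "{x. x - a \<in> pb (int k)} \<in> sets borel"
  using pad.coset_borel[of a k] by (simp add: pad.coset_def)

section \<open>Uniform vectors and their images under additive maps\<close>

definition vec_uniform :: "('p::prime_card padic ^ 'n::finite) measure" where
  "vec_uniform = distr (\<Pi>\<^sub>M i\<in>(UNIV :: 'n set). padic_uniform) borel vec_lambda"

lemma measurable_vec_lambda_padic [measurable]: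
  "vec_lambda \<in> measurable (\<Pi>\<^sub>M i\<in>(UNIV :: 'n::finite set). (borel :: 'p::prime_card padic measure)) borel"
proof (rule pvec.measurable_cosetI)
  fix a :: "'p padic ^ 'n" and s
  have "vec_lambda -` pvec.coset a s \<inter> space (\<Pi>\<^sub>M i\<in>UNIV. borel) = (\<Pi>\<^sub>E i\<in>UNIV. {x. x - a $ i \<in> pb (int s)})"
    by (auto simp: pvec_coset_eq space_PiM)
  also have "\<dots> \<in> sets (\<Pi>\<^sub>M i\<in>UNIV. borel)" by (intro sets_PiM_I_finite) auto
  finally show "vec_lambda -` pvec.coset a s \<inter> space (\<Pi>\<^sub>M i\<in>UNIV. borel) \<in> sets (\<Pi>\<^sub>M i\<in>UNIV. (borel :: 'p padic measure))" .
qed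

lemma sets_PiM_padic_uniform: "sets (\<Pi>\<^sub>M i\<in>I. padic_uniform) = sets (\<Pi>\<^sub>M i\<in>I. borel)"
  by (rule sets_PiM_cong) auto

lemma box_borel [measurable, simp]: "{x :: 'p::prime_card padic ^ 'n::finite. \<forall>i. x $ i - a $ i \<in> pb (int (k i))} \<in> sets borel"
proof -
  have "open {x :: 'p padic ^ 'n. \<forall>i. x $ i - a $ i \<in> pb (int (k i))}"
  proof -
    have "open ((\<lambda>x :: 'p padic ^ 'n. x $ i) -` {y. y - a $ i \<in> pb (int (k i))})" for i
      by (rule open_vimage[OF open_padic_coset]) (intro continuous_intros)
    then have "open (\<Inter>i. (\<lambda>x :: 'p padic ^ 'n. x $ i) -` {y. y - a $ i \<in> pb (int (k i))})"
      by (intro open_INT) auto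
    also have "(\<Inter>i. (\<lambda>x :: 'p padic ^ 'n. x $ i) -` {y. y - a $ i \<in> pb (int (k i))})
        = {x. \<forall>i. x $ i - a $ i \<in> pb (int (k i))}" by auto
    finally show ?thesis .
  qed
  then show ?thesis by simp
qed

text \<open>Each coordinate has its own precision: the later volume and degeneracy computations
  reduce to such boxes by surjective integral maps.\<close>

lemma emeasure_vec_uniform_box:
  assumes "a \<in> vpb 0"
  shows "emeasure vec_uniform {x :: 'p::prime_card padic ^ 'n::finite. \<forall>i. x $ i - a $ i \<in> pb (int (k i))}
    = ennreal (1 / real CARD('p) ^ (\<Sum>i\<in>UNIV. k i))"
proof -
  interpret prob_space "padic_uniform :: 'p padic measure" by (rule prob_space_padic_uniform)
  interpret P: product_prob_space "\<lambda>_. padic_uniform :: 'p padic measure" "UNIV :: 'n set" ..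
  have m: "vec_lambda \<in> measurable (\<Pi>\<^sub>M i\<in>(UNIV :: 'n set). (padic_uniform :: 'p padic measure)) borel"
    using measurable_vec_lambda_padic by (simp add: measurable_cong_sets[OF sets_PiM_padic_uniform refl])
  have "vec_lambda -` {x. \<forall>i. x $ i - a $ i \<in> pb (int (k i))} \<inter> space (\<Pi>\<^sub>M i\<in>UNIV. padic_uniform)
      = (\<Pi>\<^sub>E i\<in>UNIV. {x. x - a $ i \<in> pb (int (k i))})"
    by (auto simp: space_PiM)
  then have "emeasure vec_uniform {x. \<forall>i. x $ i - a $ i \<in> pb (int (k i))} =
      emeasure (\<Pi>\<^sub>M i\<in>UNIV. padic_uniform) (\<Pi>\<^sub>E i\<in>UNIV. {x. x - a $ i \<in> pb (int (k i))})"
    unfolding vec_uniform_def by (subst emeasure_distr[OF m]) auto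
  also have "\<dots> = (\<Prod>i\<in>UNIV. ennreal (1 / real CARD('p) ^ k i))"
    using assms by (subst P.emeasure_PiM) (auto simp: emeasure_padic_uniform vpb_nth)
  also have "\<dots> = ennreal (1 / real CARD('p) ^ (\<Sum>i\<in>UNIV. k i))"
    by (subst prod_ennreal) (auto simp: power_sum prod_dividef)
  finally show ?thesis .
qed

lemma uniform_vec_uniform: "pvec.uniform (vec_uniform :: ('p::prime_card padic ^ 'n::finite) measure)"
  unfolding pvec.uniform_def
proof (intro conjI ballI allI)
  interpret prob_space "padic_uniform :: 'p padic measure" by (rule prob_space_padic_uniform)
  interpret P: product_prob_space "\<lambda>_. padic_uniform :: 'p padic measure" "UNIV :: 'n set" ..
  have m: "vec_lambda \<in> measurable (\<Pi>\<^sub>M i\<in>(UNIV :: 'n set). (padic_uniform :: 'p padic measure)) borel"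
    using measurable_vec_lambda_padic by (simp add: measurable_cong_sets[OF sets_PiM_padic_uniform refl])
  show "prob_space (vec_uniform :: ('p padic ^ 'n) measure)"
    unfolding vec_uniform_def by (rule P.P.prob_space_distr[OF m])
  show "sets vec_uniform = sets (borel :: ('p padic ^ 'n) measure)" by (simp add: vec_uniform_def)
  fix a :: "'p padic ^ 'n" and s
  assume a: "a \<in> vpb (int 0)"
  show "emeasure vec_uniform (pvec.coset a s) = ennreal (1 / real (card (residues s :: ('p padic ^ 'n) set)))"
    using emeasure_vec_uniform_box[of a "\<lambda>_. s"] a by (simp add: pvec_coset_eq card_residues mult.commute)
qed

lemma haar_vec_eq: "haar_vec = haar_measure (vpb 0)"
  by (simp add: haar_vec_def vec_abs_le_1_iff)

lemma emeasure_haar_vec_coset: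
  "emeasure haar_vec {x. x - a \<in> vpb (int s)} = ennreal (1 / real CARD('p) ^ (s * CARD('n)))"
  for a :: "'p::prime_card padic ^ 'n::finite"
  using pvec.haar_measure_coset[OF uniform_vec_uniform, of a s]
  by (simp add: haar_vec_eq card_residues pvec.coset_def)

lemma sets_haar_vec [simp]: "sets haar_vec = sets borel"
  using pvec.sets_haar_measure[OF uniform_vec_uniform] by (simp add: haar_vec_eq)

lemma sets_vec_uniform [measurable_cong, simp]: "sets (vec_uniform :: ('p::prime_card padic ^ 'n::finite) measure) = sets borel"
  using uniform_vec_uniform[where 'p = 'p and 'n = 'n] by (simp add: pvec.uniform_def)

lemma space_vec_uniform [simp]: "space vec_uniform = UNIV"
  using sets_eq_imp_space_eq[OF sets_vec_uniform] by simp

lemma prob_space_vec_uniform: "prob_space (vec_uniform :: ('p::prime_card padic ^ 'n::finite) measure)"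
  using uniform_vec_uniform[where 'p = 'p and 'n = 'n] by (simp add: pvec.uniform_def)

lemma vec_uniform_integral: "emeasure vec_uniform (vpb 0) = 1"
  using pvec.uniform_B0[OF uniform_vec_uniform] by simp

lemma uniform_measure_haar_vec: "uniform_measure haar_vec (vpb 0) = vec_uniform"
  using pvec.uniform_measure_haar[OF uniform_vec_uniform] by (simp add: haar_vec_eq)

lemma haar_vec_subset:
  assumes "A \<subseteq> vpb 0" "A \<in> sets borel"
  shows "emeasure haar_vec A = emeasure vec_uniform A"
proof -
  have "emeasure haar_vec (vpb 0 :: ('a padic ^ 'b) set) = 1"
    using emeasure_haar_vec_coset[of 0 0] by simp
  moreover have "emeasure vec_uniform A = emeasure (uniform_measure haar_vec (vpb 0)) A"
    by (simp add: uniform_measure_haar_vec)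
  moreover have "vpb 0 \<inter> A = A" using assms by blast
  ultimately show ?thesis
    using assms pvec.B_borel[of 0] by (subst (asm) emeasure_uniform_measure) (auto simp: divide_ennreal_def)
qed

lemma vpb_borel [measurable, simp]: "(vpb k :: ('p::prime_card padic ^ 'n::finite) set) \<in> sets borel"
  using open_vec_coset[where 'p = 'p and 'n = 'n, of 0 k] by simp

text \<open>Integrality makes the preimage of a coset a union of cosets, hence open.\<close>

lemma measurable_additive:
  fixes \<phi> :: "'p::prime_card padic ^ 'l::finite \<Rightarrow> 'p padic ^ 'm::finite"
  assumes add: "\<And>x y. \<phi> (x + y) = \<phi> x + \<phi> y" and int: "\<And>x s. x \<in> vpb (int s) \<Longrightarrow> \<phi> x \<in> vpb (int s)"
  shows "\<phi> \<in> borel_measurable borel"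
proof (rule pvec.measurable_cosetI)
  fix a s
  have "\<phi> -` pvec.coset a s = (\<Union>x\<in>\<phi> -` pvec.coset a s. {y. y - x \<in> vpb (int s)})"
  proof (intro equalityI subsetI)
    fix y assume "y \<in> (\<Union>x\<in>\<phi> -` pvec.coset a s. {y. y - x \<in> vpb (int s)})"
    then obtain x where x: "\<phi> x - a \<in> vpb (int s)" "y - x \<in> vpb (int s)" by (auto simp: pvec.coset_def)
    have "\<phi> y = \<phi> (y - x) + \<phi> x" by (simp flip: add)
    then have "\<phi> y - a = \<phi> (y - x) + (\<phi> x - a)" by simp
    then show "y \<in> \<phi> -` pvec.coset a s" using vpb_add[OF int[OF x(2)] x(1)] by (simp add: pvec.coset_def add_diff_eq)
  next
    fix y assume "y \<in> \<phi> -` pvec.coset a s"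
    then show "y \<in> (\<Union>x\<in>\<phi> -` pvec.coset a s. {y. y - x \<in> vpb (int s)})" by (intro UN_I[of y]) auto
  qed
  moreover have "open (\<Union>x\<in>\<phi> -` pvec.coset a s. {y. y - x \<in> vpb (int s)})"
    by (intro open_UN ballI open_vec_coset)
  ultimately show "\<phi> -` pvec.coset a s \<inter> space borel \<in> sets borel" by simp
qed

text \<open>A surjective homomorphism carries Haar measure to Haar measure: the preimages of two
  cosets of the same level differ by a translation that preserves the source law. All changes of
  coordinates in the argument go through this fact.\<close>

lemma distr_vec_uniform:
  fixes \<phi> :: "'p::prime_card padic ^ 'l::finite \<Rightarrow> 'p padic ^ 'm::finite"
  assumes add: "\<And>x y. \<phi> (x + y) = \<phi> x + \<phi> y" and int: "\<And>x s. x \<in> vpb (int s) \<Longrightarrow> \<phi> x \<in> vpb (int s)"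
    and surj: "\<And>b. b \<in> vpb 0 \<Longrightarrow> \<exists>a\<in>vpb 0. \<phi> a = b"
  shows "distr vec_uniform borel \<phi> = vec_uniform"
proof (rule pvec.uniform_unique[OF pvec.uniformI uniform_vec_uniform])
  interpret prob_space "vec_uniform :: ('p padic ^ 'l) measure" by (rule prob_space_vec_uniform)
  have m0: "\<phi> \<in> borel_measurable borel" by (rule measurable_additive[of \<phi>, OF add int])
  then have m: "\<phi> \<in> borel_measurable vec_uniform" by (simp add: measurable_cong_sets[OF sets_vec_uniform refl])
  show P: "prob_space (distr vec_uniform borel \<phi>)" by (rule prob_space_distr[OF m])
  have "emeasure vec_uniform (vpb 0 :: ('p padic ^ 'l) set) \<le> emeasure vec_uniform (\<phi> -` vpb 0)"
    using int[of _ 0] measurable_sets[OF m, of "vpb 0"]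
    by (intro emeasure_mono) auto
  then have "1 \<le> emeasure vec_uniform (\<phi> -` vpb 0)" by (simp add: vec_uniform_integral)
  then have "emeasure vec_uniform (\<phi> -` vpb 0) = 1"
    by (metis antisym emeasure_le_1)
  then show "emeasure (distr vec_uniform borel \<phi>) (vpb (int 0)) = 1"
    by (simp add: emeasure_distr[OF m])
  fix b b' :: "'p padic ^ 'm" and s
  assume b: "b \<in> vpb (int 0)" "b' \<in> vpb (int 0)"
  then obtain a where a: "a \<in> vpb 0" "\<phi> a = b - b'" using surj vpb_diff by (metis of_nat_0)
  let ?A = "\<phi> -` pvec.coset b s"
  have A: "?A \<in> sets borel" using measurable_sets[OF m0, of "pvec.coset b s"] by simp
  have ma: "(+) a \<in> measurable vec_uniform borel"
    using pvec.measurable_translation[of a] by (simp add: measurable_cong_sets[OF sets_vec_uniform refl])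
  have "emeasure vec_uniform ?A = emeasure (distr vec_uniform borel ((+) a)) ?A"
    using pvec.uniform_translation[OF uniform_vec_uniform, of a] a(1) by simp
  also have "\<dots> = emeasure vec_uniform ((+) a -` ?A)"
    using A by (simp add: emeasure_distr[OF ma])
  also have "(+) a -` ?A = \<phi> -` pvec.coset b' s"
    by (auto simp: pvec.coset_def add a(2) algebra_simps)
  finally show "emeasure (distr vec_uniform borel \<phi>) (pvec.coset b s) = emeasure (distr vec_uniform borel \<phi>) (pvec.coset b' s)"
    by (simp add: emeasure_distr[OF m])
qed simp

section \<open>Values of random linear forms\<close>

definition dot :: "'a::comm_ring_1 ^ 'n::finite \<Rightarrow> 'a ^ 'n \<Rightarrow> 'a" where
  "dot x y = (\<Sum>i\<in>UNIV. x $ i * y $ i)"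

lemma dot_add_left: "dot (x + y) z = dot x z + dot y z"
  by (simp add: dot_def sum.distrib algebra_simps)

lemma dot_add_right: "dot z (x + y) = dot z x + dot z y"
  by (simp add: dot_def sum.distrib algebra_simps)

lemma dot_scale_right: "dot z (c *s x) = c * dot z x"
  by (simp add: dot_def sum_distrib_left algebra_simps)

lemma dot_diff_right: "dot z (x - y) = dot z x - dot z y"
  by (simp add: dot_def sum_subtractf algebra_simps)

lemma dot_0_right [simp]: "dot z 0 = 0"
  by (simp add: dot_def)

lemma dot_axis [simp]: "dot x (axis i 1) = x $ i"
  by (simp add: dot_def axis_def if_distrib[of "\<lambda>y. _ * y"] cong: if_cong)

lemma dot_pb: "x \<in> vpb a \<Longrightarrow> y \<in> vpb b \<Longrightarrow> k \<le> a + b \<Longrightarrow> dot x y \<in> pb k"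
  unfolding dot_def by (intro pb_sum) (auto intro: pb_mult' vpb_nth)

text \<open>The conditions on the coordinates \<open>l\<close> and \<open>l'\<close> make the pair
  of values at \<open>y\<close> and \<open>w\<close> a surjection onto integral pairs. The two
  values are thus independent and uniform, and the probabilities multiply.\<close>

lemma emeasure_vec_uniform_dot2:
  fixes y w :: "'p::prime_card padic ^ 'l::finite"
  assumes y: "y \<in> vpb 0" "y $ l = 1" and w: "w \<in> vpb 0" "w $ l = 0" "w $ l' = 1"
  shows "{x. dot x y \<in> pb (int r) \<and> dot x w \<in> pb (int k)} \<in> sets borel"
    and "emeasure vec_uniform {x. dot x y \<in> pb (int r) \<and> dot x w \<in> pb (int k)} = ennreal (1 / real CARD('p) ^ (r + k))"
proof -
  define \<phi> :: "'p padic ^ 'l \<Rightarrow> 'p padic ^ bool" where "\<phi> x = (\<chi> b. if b then dot x y else dot x w)" for x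
  define \<kappa> where "\<kappa> b = (if b then r else k)" for b
  have add: "\<phi> (x + z) = \<phi> x + \<phi> z" for x z by (simp add: \<phi>_def vec_eq_iff dot_add_left)
  have int: "x \<in> vpb (int s) \<Longrightarrow> \<phi> x \<in> vpb (int s)" for x s
    using y(1) w(1) by (auto simp: \<phi>_def intro!: vpbI dot_pb[of _ "int s" _ 0])
  have m: "\<phi> \<in> borel_measurable borel" by (rule measurable_additive[of \<phi>, OF add int])
  then have m': "\<phi> \<in> borel_measurable vec_uniform" by (simp add: measurable_cong_sets[OF sets_vec_uniform refl])
  have ll': "l \<noteq> l'" using w by auto
  have surj: "\<exists>a\<in>vpb 0. \<phi> a = b" if b: "b \<in> vpb 0" for b
  proof
    \<comment> \<open>The system is triangular: \<open>axis l' 1\<close> sets the value at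
      \<open>w\<close>, and \<open>axis l 1\<close> then corrects the value at \<open>y\<close>
      without disturbing the other, as \<open>w $ l = 0\<close>.\<close>
    define \<beta> where "\<beta> = b $ True - b $ False * y $ l'"
    let ?a = "b $ False *s axis l' 1 + \<beta> *s axis l 1 :: 'p padic ^ 'l"
    have ax: "axis i 1 \<in> vpb 0" for i :: 'l by (auto simp: vpb_def axis_def)
    have "\<beta> \<in> pb 0"
      unfolding \<beta>_def using b y by (intro pb_diff pb_mult'[of _ 0 _ 0]) (auto intro: vpb_nth)
    then show "?a \<in> vpb 0" using b ax by (intro vpb_add vpb_scale[of _ 0 _ 0]) (auto intro: vpb_nth)
    have "dot (c *s axis i 1) z = c * z $ i" for c i and z :: "'p padic ^ 'l"
      by (simp add: dot_def axis_def if_distrib[of "\<lambda>u. _ * u"] if_distrib[of "\<lambda>u. u * _"] cong: if_cong)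
    then have "\<phi> ?a $ c = b $ c" for c
      using y w by (cases c) (simp_all add: \<phi>_def dot_add_left, simp add: \<beta>_def)
    then show "\<phi> ?a = b" by (simp add: vec_eq_iff)
  qed
  have eq: "distr vec_uniform borel \<phi> = vec_uniform" by (rule distr_vec_uniform[of \<phi>, OF add int surj])
  have pre: "{x. dot x y \<in> pb (int r) \<and> dot x w \<in> pb (int k)} = \<phi> -` {z. \<forall>b. z $ b - 0 $ b \<in> pb (int (\<kappa> b))}"
    by (auto simp: \<phi>_def \<kappa>_def all_bool_eq)
  show "{x. dot x y \<in> pb (int r) \<and> dot x w \<in> pb (int k)} \<in> sets borel"
    unfolding pre using measurable_sets[OF m box_borel[of 0 \<kappa>]] by simp
  have "emeasure vec_uniform {x. dot x y \<in> pb (int r) \<and> dot x w \<in> pb (int k)} =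
      emeasure (distr vec_uniform borel \<phi>) {z. \<forall>b. z $ b - 0 $ b \<in> pb (int (\<kappa> b))}"
    unfolding pre by (subst emeasure_distr[OF m' box_borel]) simp
  also have "\<dots> = ennreal (1 / real CARD('p) ^ (r + k))"
    unfolding eq by (subst emeasure_vec_uniform_box) (auto simp: UNIV_bool \<kappa>_def add.commute)
  finally show "emeasure vec_uniform {x. dot x y \<in> pb (int r) \<and> dot x w \<in> pb (int k)} = ennreal (1 / real CARD('p) ^ (r + k))" .
qed

section \<open>Balls in projective space\<close>

text \<open>Projective distance at most p^-m, written homogeneously so that both arguments can be
  rescaled freely without passing to representatives on the sphere.\<close>

definition near :: "nat \<Rightarrow> 'p::prime_card padic ^ 'n::finite \<Rightarrow> 'p padic ^ 'n \<Rightarrow> bool" where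
  "near m x y \<longleftrightarrow> wedge_abs x y \<le> real CARD('p) powi (- int m) * vec_abs x * vec_abs y"

lemma wedge_abs_le_iff: "wedge_abs x y \<le> real CARD('p) powi (- k) \<longleftrightarrow> (\<forall>i j. x $ i * y $ j - x $ j * y $ i \<in> pb k)"
  for x y :: "'p::prime_card padic ^ 'n::finite"
  by (auto simp: wedge_abs_def pb_def)

lemma unit_sphere_iff: "x \<in> unit_sphere \<longleftrightarrow> x \<in> vpb 0 \<and> x \<notin> vpb 1"
  for x :: "'p::prime_card padic ^ 'n::finite"
proof
  assume "x \<in> unit_sphere"
  then have "vec_abs x = 1" by (simp add: unit_sphere_def)
  then show "x \<in> vpb 0 \<and> x \<notin> vpb 1"
    using vec_abs_le_iff[of x 0] vec_abs_le_iff[of x 1] card_gt_1[where 'p = 'p]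
    by (simp add: power_int_minus field_simps)
next
  assume x: "x \<in> vpb 0 \<and> x \<notin> vpb 1"
  obtain i where i: "vec_abs x = padic_abs (x $ i)" using vec_abs_attained by blast
  have "x $ i \<noteq> 0"
  proof
    assume "x $ i = 0"
    then have "vec_abs x \<le> real CARD('p) powi (- 1)" by (simp add: i less_imp_le)
    then show False using x vec_abs_le_iff[of x 1] by simp
  qed
  then obtain k where k: "padic_abs (x $ i) = real CARD('p) powi k" using padic_abs_range by blast
  then have "k \<le> 0" "\<not> k \<le> -1"
    using x vec_abs_le_iff[of x 0] vec_abs_le_iff[of x 1] card_powi_le_iff[of k 0, where 'p = 'p]
      card_powi_le_iff[of k "-1", where 'p = 'p] i by simp_all
  then have "k = 0" by simp
  then show "x \<in> unit_sphere" using i k by (simp add: unit_sphere_def)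
qed

lemma near_unit:
  assumes "x \<in> unit_sphere" "y \<in> unit_sphere"
  shows "near m x y \<longleftrightarrow> (\<forall>i j. x $ i * y $ j - x $ j * y $ i \<in> pb (int m))"
  using assms wedge_abs_le_iff[of x y "int m"] by (simp add: near_def unit_sphere_def)

lemma near_scale_left [simp]: "c \<noteq> 0 \<Longrightarrow> near m (c *s x) y \<longleftrightarrow> near m x y"
  using wedge_abs_scale[of c x 1 y]
  by (simp add: near_def vec_abs_scale less_le) (simp add: mult.assoc mult.left_commute)

lemma near_scale_right [simp]: "c \<noteq> 0 \<Longrightarrow> near m x (c *s y) \<longleftrightarrow> near m x y"
  using wedge_abs_scale[of 1 x c y]
  by (simp add: near_def vec_abs_scale less_le) (simp add: mult.assoc mult.left_commute)

lemma wedge_abs_commute: "wedge_abs x y = wedge_abs y x"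
proof -
  have "range (\<lambda>(i, j). padic_abs (x $ i * y $ j - x $ j * y $ i)) = range (\<lambda>(i, j). padic_abs (y $ i * x $ j - y $ j * x $ i))"
  proof -
    have "padic_abs (x $ i * y $ j - x $ j * y $ i) = padic_abs (y $ j * x $ i - y $ i * x $ j)" for i j
      by (simp add: mult.commute)
    then show ?thesis by (auto simp: image_iff)
  qed
  then show ?thesis by (simp add: wedge_abs_def)
qed

lemma near_commute: "near m x y \<longleftrightarrow> near m y x"
  by (simp add: near_def wedge_abs_commute[of x y] mult.commute mult.left_commute)

lemma near_refl [simp]: "near m x x"
proof -
  have "wedge_abs x x = 0" by (simp add: wedge_abs_def mult.commute image_constant_conv)
  moreover have "0 \<le> vec_abs x" using vec_abs_attained[of x] by auto
  ultimately show ?thesis by (simp add: near_def less_imp_le)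
qed

text \<open>Passes to an affine chart: after division by a coordinate of largest absolute value that
  coordinate is 1 and the others are integral.\<close>

lemma normalise_ex:
  fixes y :: "'p::prime_card padic ^ 'n::finite"
  assumes "y \<noteq> 0"
  obtains c l where "c \<noteq> 0" "(c *s y) $ l = 1" "c *s y \<in> vpb 0"
proof -
  obtain k where k: "\<And>j. y \<in> vpb j \<longleftrightarrow> j \<le> k" using vpb_exact[OF assms] by blast
  obtain l where l: "y $ l \<notin> pb (k + 1)" using k[of "k + 1"] by (auto simp: vpb_def)
  then have nz: "y $ l \<noteq> 0" by auto
  have "inverse (y $ l) *s y \<in> vpb 0"
    using k[of k] by (intro vpb_scale[OF pb_inverse[OF l]]) auto
  then show thesis using nz by (intro that[of "inverse (y $ l)" l]) auto
qed

lemma normal_in_sphere: "y \<in> vpb 0 \<Longrightarrow> y $ l = 1 \<Longrightarrow> y \<in> unit_sphere"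
  by (auto simp: unit_sphere_iff dest!: vpb_nth[of _ 1 l])

text \<open>In a chart the minors become linear: those involving index \<open>l\<close> are the
  coordinates of the residual, and all others are combinations of them. Closeness of points turns
  into a congruence modulo p^m.\<close>

lemma near_normal:
  assumes y: "y \<in> vpb 0" "y $ l = 1" and x: "x \<in> unit_sphere"
  shows "near m x y \<longleftrightarrow> x - x $ l *s y \<in> vpb (int m)"
  unfolding near_unit[OF x normal_in_sphere[OF y]]
proof
  assume "\<forall>i j. x $ i * y $ j - x $ j * y $ i \<in> pb (int m)"
  then have "x $ i * y $ l - x $ l * y $ i \<in> pb (int m)" for i by blast
  then show "x - x $ l *s y \<in> vpb (int m)" using y by (simp add: vpb_def)
next
  assume *: "x - x $ l *s y \<in> vpb (int m)"
  show "\<forall>i j. x $ i * y $ j - x $ j * y $ i \<in> pb (int m)"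
  proof (intro allI)
    fix i j
    have "(x - x $ l *s y) $ i * y $ j - (x - x $ l *s y) $ j * y $ i \<in> pb (int m)"
      using * y by (intro pb_diff pb_mult'[of _ "int m" _ 0] vpb_nth) auto
    then show "x $ i * y $ j - x $ j * y $ i \<in> pb (int m)" by (simp add: algebra_simps)
  qed
qed

text \<open>Modulo p^m both \<open>x\<close> and \<open>z\<close> are multiples of the normalised
  \<open>y\<close>, so all their minors vanish there.\<close>

lemma near_trans:
  fixes x y z :: "'p::prime_card padic ^ 'n::finite"
  assumes nz: "x \<noteq> 0" "y \<noteq> 0" "z \<noteq> 0" and xy: "near m x y" and yz: "near m y z"
  shows "near m x z"
proof -
  obtain c l where y: "c \<noteq> 0" "(c *s y) $ l = 1" "c *s y \<in> vpb 0" using normalise_ex[OF nz(2)] .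
  obtain a i where x: "a \<noteq> 0" "(a *s x) $ i = 1" "a *s x \<in> vpb 0" using normalise_ex[OF nz(1)] .
  obtain b j where z: "b \<noteq> 0" "(b *s z) $ j = 1" "b *s z \<in> vpb 0" using normalise_ex[OF nz(3)] .
  define X Y Z where "X = a *s x" and "Y = c *s y" and "Z = b *s z"
  note x = x[folded X_def] and y = y[folded Y_def] and z = z[folded Z_def]
  have X: "X \<in> unit_sphere" and Z: "Z \<in> unit_sphere" using x z normal_in_sphere by blast+
  have "near m X Y" "near m Z Y" using xy yz x y z by (simp_all add: X_def Y_def Z_def near_commute)
  then have e: "X - X $ l *s Y \<in> vpb (int m)" "Z - Z $ l *s Y \<in> vpb (int m)"
    using near_normal[OF y(3,2)] X Z by blast+
  have "X $ i * Z $ j - X $ j * Z $ i \<in> pb (int m)" for i j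
  proof -
    define u v where "u = X - X $ l *s Y" and "v = Z - Z $ l *s Y"
    have X': "X $ i = u $ i + X $ l * Y $ i" "X $ j = u $ j + X $ l * Y $ j"
      and Z': "Z $ i = v $ i + Z $ l * Y $ i" "Z $ j = v $ j + Z $ l * Y $ j" by (simp_all add: u_def v_def)
    have "X $ i * Z $ j - X $ j * Z $ i =
       (u $ i * Z $ j - u $ j * Z $ i) + X $ l * (Y $ i * v $ j - Y $ j * v $ i)"
      by (subst X'(1), subst X'(2)) (simp add: Z' algebra_simps)
    also have "\<dots> \<in> pb (int m)"
      using e x y z unfolding u_def[symmetric] v_def[symmetric]
      by (intro pb_add pb_diff pb_mult'[of "u $ _" "int m" _ 0] pb_mult'[of _ 0 _ "int m"] vpb_nth) auto
    finally show ?thesis .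
  qed
  then have "near m X Z" using near_unit[OF X Z] by blast
  then show ?thesis using x z by (simp add: X_def Z_def)
qed

lemma proj_class_in_space: "x \<noteq> 0 \<Longrightarrow> proj_class x \<in> proj_space"
  by (auto simp: proj_space_def)

lemma proj_space_cases:
  assumes "X \<in> proj_space"
  obtains x where "x \<noteq> 0" "X = proj_class x"
  using assms by (auto simp: proj_space_def)

lemma proj_class_eq_iff: "proj_class x = proj_class y \<longleftrightarrow> (\<exists>c. c \<noteq> 0 \<and> x = c *s y)"
proof
  assume "proj_class x = proj_class y"
  moreover have "x \<in> proj_class x" by (auto simp: proj_class_def intro!: exI[of _ 1])
  ultimately show "\<exists>c. c \<noteq> 0 \<and> x = c *s y" by (auto simp: proj_class_def)
qed (auto simp: proj_class_scale)

lemma unit_representative: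
  assumes "x \<noteq> 0"
  obtains c where "c \<noteq> 0" "c *s x \<in> unit_sphere"
proof -
  obtain c l where "c \<noteq> 0" "(c *s x) $ l = 1" "c *s x \<in> vpb 0" using normalise_ex[OF assms] .
  then show thesis using normal_in_sphere that by blast
qed

lemma proj_dist_le_iff:
  fixes x y :: "'p::prime_card padic ^ 'n::finite"
  assumes "x \<noteq> 0" "y \<noteq> 0"
  shows "proj_dist (proj_class x) (proj_class y) \<le> real CARD('p) powi (- int m) \<longleftrightarrow> near m x y"
proof -
  obtain c where c: "c \<noteq> 0" "c *s x \<in> unit_sphere" using unit_representative[OF assms(1)] .
  obtain e where e: "e \<noteq> 0" "e *s y \<in> unit_sphere" using unit_representative[OF assms(2)] .
  have "proj_dist (proj_class x) (proj_class y) = wedge_abs (c *s x) (e *s y)"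
    using proj_dist_eq[OF c(2) e(2)] c e by (simp add: proj_class_scale)
  also have "\<dots> \<le> real CARD('p) powi (- int m) \<longleftrightarrow> near m (c *s x) (e *s y)"
    using c e by (simp add: near_def unit_sphere_def)
  finally show ?thesis using c e by simp
qed

definition pcls :: "nat \<Rightarrow> ('p::prime_card padic ^ 'n::finite) set \<Rightarrow> ('p padic ^ 'n) set set" where
  "pcls m X = proj_ball X (real CARD('p) powi (- int m))"

lemma pcls_iff:
  assumes "x \<noteq> 0" "y \<noteq> 0"
  shows "proj_class y \<in> pcls m (proj_class x) \<longleftrightarrow> near m x y"
  using assms proj_dist_le_iff[OF assms] by (simp add: pcls_def proj_ball_def proj_class_in_space)

lemma pcls_subset: "pcls m X \<subseteq> proj_space"
  by (auto simp: pcls_def proj_ball_def)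

text \<open>Balls of equal radius coincide or are disjoint, so counting balls is counting classes of
  \<open>near\<close>.\<close>

lemma pcls_eq_iff:
  fixes x y :: "'p::prime_card padic ^ 'n::finite"
  assumes "x \<noteq> 0" "y \<noteq> 0"
  shows "pcls m (proj_class x) = pcls m (proj_class y) \<longleftrightarrow> near m x y"
proof
  assume eq: "pcls m (proj_class x) = pcls m (proj_class y)"
  have "proj_class y \<in> pcls m (proj_class y)" using assms by (simp add: pcls_iff)
  then show "near m x y" unfolding eq[symmetric] pcls_iff[OF assms] .
next
  assume n: "near m x y"
  have "proj_class z \<in> pcls m (proj_class x) \<longleftrightarrow> proj_class z \<in> pcls m (proj_class y)" if "z \<noteq> 0" for z
    using that assms n near_trans near_commute by (simp add: pcls_iff) blast
  then show "pcls m (proj_class x) = pcls m (proj_class y)"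
    using pcls_subset[of m] by (blast elim: proj_space_cases dest: subsetD)
qed

text \<open>The cone over a ball is straightened by the shear that moves \<open>y\<close> to the
  axis \<open>l\<close>. The shear preserves the uniform law, and the image is a box with exponent t
  in one coordinate and m in all others.\<close>

lemma emeasure_cone_ball:
  fixes y :: "'p::prime_card padic ^ 'n::finite"
  assumes y: "y \<in> vpb 0" "y $ l = 1"
  shows "{a. a $ l \<in> pb (int t) \<and> a - a $ l *s y \<in> vpb (int m)} \<in> sets borel"
    and "emeasure vec_uniform {a. a $ l \<in> pb (int t) \<and> a - a $ l *s y \<in> vpb (int m)}
      = ennreal (1 / real CARD('p) ^ (t + m * (CARD('n) - 1)))"
proof -
  define \<phi> :: "'p padic ^ 'n \<Rightarrow> 'p padic ^ 'n" where "\<phi> a = a - a $ l *s y + a $ l *s axis l 1" for a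
  define \<kappa> where "\<kappa> i = (if i = l then t else m)" for i
  have ax: "axis l 1 \<in> (vpb 0 :: ('p padic ^ 'n) set)" by (auto simp: vpb_def axis_def)
  have add: "\<phi> (x + z) = \<phi> x + \<phi> z" for x z by (simp add: \<phi>_def vec_eq_iff algebra_simps)
  have int: "x \<in> vpb (int s) \<Longrightarrow> \<phi> x \<in> vpb (int s)" for x s
    unfolding \<phi>_def using y(1) ax by (intro vpb_add vpb_diff vpb_scale[of _ "int s" _ 0]) (auto intro: vpb_nth)
  have comp: "\<phi> a $ i = (if i = l then a $ l else (a - a $ l *s y) $ i)" for a i
    using y(2) by (simp add: \<phi>_def axis_def)
  have m: "\<phi> \<in> borel_measurable borel" by (rule measurable_additive[of \<phi>, OF add int])
  then have m': "\<phi> \<in> borel_measurable vec_uniform" by (simp add: measurable_cong_sets[OF sets_vec_uniform refl])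
  have surj: "\<exists>a\<in>vpb 0. \<phi> a = b" if b: "b \<in> vpb 0" for b
  proof
    let ?a = "b + b $ l *s y - b $ l *s axis l 1"
    show "?a \<in> vpb 0"
      using b y(1) ax by (intro vpb_add vpb_diff vpb_scale[of _ 0 _ 0]) (auto intro: vpb_nth)
    have al: "(axis l 1 :: 'p padic ^ 'n) $ l = 1" by (simp add: axis_def)
    have l: "?a $ l = b $ l"
      by (simp only: vector_add_component vector_minus_component vector_smult_component y(2) al mult_1_right add_diff_cancel)
    show "\<phi> ?a = b" unfolding \<phi>_def l by simp
  qed
  have eq: "distr vec_uniform borel \<phi> = vec_uniform" by (rule distr_vec_uniform[of \<phi>, OF add int surj])
  have pre: "{a. a $ l \<in> pb (int t) \<and> a - a $ l *s y \<in> vpb (int m)} = \<phi> -` {z. \<forall>i. z $ i - 0 $ i \<in> pb (int (\<kappa> i))}"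
  proof -
    have "a $ l \<in> pb (int t) \<and> a - a $ l *s y \<in> vpb (int m) \<longleftrightarrow> (\<forall>i. \<phi> a $ i - 0 $ i \<in> pb (int (\<kappa> i)))" for a
    proof -
      have "(a - a $ l *s y) $ l = 0" using y by simp
      then show ?thesis unfolding comp vpb_def \<kappa>_def
        by (simp del: vector_minus_component vector_smult_component) (metis pb_0)
    qed
    then show ?thesis by blast
  qed
  show "{a. a $ l \<in> pb (int t) \<and> a - a $ l *s y \<in> vpb (int m)} \<in> sets borel"
    unfolding pre using measurable_sets[OF m box_borel[of 0 \<kappa>]] by simp
  have "(\<Sum>i\<in>UNIV. \<kappa> i) = t + m * (CARD('n) - 1)"
    using sum.remove[of UNIV l \<kappa>] by (simp add: \<kappa>_def card_Diff_singleton mult.commute)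
  moreover have "emeasure vec_uniform {a. a $ l \<in> pb (int t) \<and> a - a $ l *s y \<in> vpb (int m)} =
      emeasure (distr vec_uniform borel \<phi>) {z. \<forall>i. z $ i - 0 $ i \<in> pb (int (\<kappa> i))}"
    unfolding pre by (subst emeasure_distr[OF m' box_borel]) simp
  ultimately show "emeasure vec_uniform {a. a $ l \<in> pb (int t) \<and> a - a $ l *s y \<in> vpb (int m)}
      = ennreal (1 / real CARD('p) ^ (t + m * (CARD('n) - 1)))"
    unfolding eq by (simp only: emeasure_vec_uniform_box[of 0 \<kappa>, OF vpb_0])
qed

lemma pcls_normal_ex:
  assumes "D \<in> pcls m ` proj_space"
  obtains y l where "y \<in> vpb 0" "y $ l = 1" "D = pcls m (proj_class y)"
proof -
  obtain x where x: "x \<noteq> 0" "D = pcls m (proj_class x)" using assms by (auto elim: proj_space_cases)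
  obtain c l where c: "c \<noteq> 0" "(c *s x) $ l = 1" "c *s x \<in> vpb 0" using normalise_ex[OF x(1)] .
  show thesis using c x by (intro that[of "c *s x" l]) (auto simp: proj_class_scale)
qed

lemma sphere_nonzero: "x \<in> unit_sphere \<Longrightarrow> x \<noteq> 0"
  by (auto simp: unit_sphere_iff)

text \<open>In the cone \<open>a\<close> agrees with \<open>a $ l *s y\<close> up to p^-m, so lying
  on the sphere means that \<open>a $ l\<close> is a unit. The condition \<open>m \<ge> 1\<close>
  makes this error smaller than a unit.\<close>

lemma cone_pcls:
  assumes y: "y \<in> vpb 0" "y $ l = 1" and m: "m \<ge> 1"
  shows "{a \<in> unit_sphere. proj_class a \<in> pcls m (proj_class y)} =
    {a. a $ l \<in> pb (int 0) \<and> a - a $ l *s y \<in> vpb (int m)} - {a. a $ l \<in> pb (int 1) \<and> a - a $ l *s y \<in> vpb (int m)}"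
    (is "?L = ?R")
proof -
  have y0: "y \<noteq> 0" using y by auto
  have L: "a \<in> ?L \<longleftrightarrow> a \<in> unit_sphere \<and> a - a $ l *s y \<in> vpb (int m)" for a
    using near_normal[OF y, of a m] pcls_iff[OF y0 sphere_nonzero] near_commute by blast
  have small: "a - a $ l *s y \<in> vpb 1" if "a - a $ l *s y \<in> vpb (int m)" for a
    using vpb_anti[OF that, of 1] m by simp
  show ?thesis
  proof (intro equalityI subsetI)
    fix a assume "a \<in> ?L"
    then have a: "a \<in> vpb 0" "a \<notin> vpb 1" "a - a $ l *s y \<in> vpb (int m)" using L by (auto simp: unit_sphere_iff)
    have "a $ l \<notin> pb 1"
    proof
      assume "a $ l \<in> pb 1"
      then have "a $ l *s y \<in> vpb 1" using y by (intro vpb_scale[of _ 1 _ 0]) auto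
      from vpb_add[OF small[OF a(3)] this] show False using a(2) by simp
    qed
    then show "a \<in> ?R" using a by (auto intro: vpb_nth)
  next
    fix a assume a: "a \<in> ?R"
    then have al: "a $ l \<in> pb 0" "a $ l \<notin> pb 1" "a - a $ l *s y \<in> vpb (int m)" by auto
    have "(a - a $ l *s y) + a $ l *s y \<in> vpb 0"
      using al y small[OF al(3)] by (intro vpb_add vpb_scale[of _ 0 _ 0]) (auto intro: vpb_anti)
    then have "a \<in> unit_sphere" using al by (auto simp: unit_sphere_iff dest: vpb_nth)
    then show "a \<in> ?L" using L al by blast
  qed
qed

lemma measure_cone_pcls:
  fixes D :: "('p::prime_card padic ^ 'n::finite) set set"
  assumes D: "D \<in> pcls m ` proj_space" and m: "m \<ge> 1"
  shows "{a \<in> unit_sphere. proj_class a \<in> D} \<in> sets borel"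
    and "emeasure haar_vec {a \<in> unit_sphere. proj_class a \<in> D}
      = ennreal ((1 - 1 / real CARD('p)) / real CARD('p) ^ (m * (CARD('n) - 1)))"
proof -
  obtain y l where y: "y \<in> vpb 0" "y $ l = 1" "D = pcls m (proj_class y)" using pcls_normal_ex[OF D] .
  interpret prob_space "vec_uniform :: ('p padic ^ 'n) measure" by (rule prob_space_vec_uniform)
  let ?G = "\<lambda>t. {a. a $ l \<in> pb (int t) \<and> a - a $ l *s y \<in> vpb (int m)}"
  note G = emeasure_cone_ball[OF y(1,2), of _ m]
  have eq: "{a \<in> unit_sphere. proj_class a \<in> D} = ?G 0 - ?G 1"
    unfolding y(3) by (rule cone_pcls[OF y(1,2) m])
  show b: "{a \<in> unit_sphere. proj_class a \<in> D} \<in> sets borel"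
    unfolding eq using G(1)[of 0] G(1)[of 1] by (rule sets.Diff)
  have "emeasure haar_vec {a \<in> unit_sphere. proj_class a \<in> D} = emeasure vec_uniform {a \<in> unit_sphere. proj_class a \<in> D}"
    using b by (intro haar_vec_subset) (auto simp: unit_sphere_iff)
  also have "\<dots> = emeasure vec_uniform (?G 0) - emeasure vec_uniform (?G 1)"
    unfolding eq using G(1)[of 0] G(1)[of 1] by (intro emeasure_Diff) (auto intro: pb_anti)
  also have "\<dots> = ennreal (1 / real CARD('p) ^ (0 + m * (CARD('n) - 1)) - 1 / real CARD('p) ^ (1 + m * (CARD('n) - 1)))"
    unfolding G(2) using card_gt_1[where 'p = 'p] by (subst ennreal_minus) auto
  also have "\<dots> = ennreal ((1 - 1 / real CARD('p)) / real CARD('p) ^ (m * (CARD('n) - 1)))"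
    by (simp add: field_simps)
  finally show "emeasure haar_vec {a \<in> unit_sphere. proj_class a \<in> D}
      = ennreal ((1 - 1 / real CARD('p)) / real CARD('p) ^ (m * (CARD('n) - 1)))" .
qed

text \<open>Rounding a normalised representative to a residue vector stays in its ball, so finitely
  many residues reach every ball.\<close>

lemma finite_pcls:
  assumes m: "m \<ge> 1"
  shows "finite (pcls m ` (proj_space :: ('p::prime_card padic ^ 'n::finite) set set))"
proof (rule finite_subset)
  show "finite ((\<lambda>r. pcls m (proj_class r)) ` (residues m :: ('p padic ^ 'n) set))" by simp
  show "pcls m ` (proj_space :: ('p padic ^ 'n) set set) \<subseteq> (\<lambda>r. pcls m (proj_class r)) ` residues m"
  proof
    fix D :: "('p padic ^ 'n) set set" assume "D \<in> pcls m ` proj_space"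
    then obtain y l where y: "y \<in> vpb 0" "y $ l = 1" "D = pcls m (proj_class y)" by (rule pcls_normal_ex)
    obtain r where r: "r \<in> residues m" "y - r \<in> vpb (int m)" using residues_ex[OF y(1)] by blast
    have yS: "y \<in> unit_sphere" using y normal_in_sphere by blast
    have e1: "y - r \<in> vpb 1" using vpb_anti[OF r(2)] m by simp
    then have rS: "r \<in> unit_sphere"
      using yS residues_in_vpb[OF r(1)] vpb_add[OF e1, of r] by (auto simp: unit_sphere_iff)
    have "r - r $ l *s y = (y - r) $ l *s y - (y - r)" using y(2) by (simp add: vec_eq_iff algebra_simps)
    also have "\<dots> \<in> vpb (int m)" by (intro vpb_diff r(2) vpb_scale[OF vpb_nth[OF r(2), of l] y(1)]) simp
    finally have "near m r y" using near_normal[OF y(1,2) rS] by simp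
    then have "D = pcls m (proj_class r)"
      unfolding y(3) using pcls_eq_iff[OF sphere_nonzero[OF yS] sphere_nonzero[OF rS]] near_commute by blast
    then show "D \<in> (\<lambda>r. pcls m (proj_class r)) ` residues m" using r(1) by blast
  qed
qed

lemma pcls_disjoint:
  assumes "D \<in> pcls m ` proj_space" "D' \<in> pcls m ` proj_space" "X \<in> D" "X \<in> D'"
  shows "D = D'"
proof -
  obtain y where y: "y \<noteq> 0" "D = pcls m (proj_class y)" using assms(1) by (auto elim: proj_space_cases)
  obtain z where z: "z \<noteq> 0" "D' = pcls m (proj_class z)" using assms(2) by (auto elim: proj_space_cases)
  have "X \<in> proj_space" using assms(3) y(2) pcls_subset by blast
  then obtain x where x: "x \<noteq> 0" "X = proj_class x" by (rule proj_space_cases)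
  have "near m y x" "near m z x" using assms(3,4) y z x by (simp_all add: pcls_iff)
  then show ?thesis using pcls_eq_iff x y z by metis
qed

text \<open>The factor 1 - 1/p in the mass of a cone over one ball is exactly the normalisation in
  \<open>proj_measure\<close>, so the measure is a weighted count of balls.\<close>

lemma proj_measure_pcls:
  fixes Y :: "('p::prime_card padic ^ 'n::finite) set set"
  assumes Y: "Y \<subseteq> proj_space" and m: "m \<ge> 1"
  shows "proj_measure (\<Union>X\<in>Y. pcls m X) = real (card (pcls m ` Y)) / real CARD('p) ^ (m * (CARD('n) - 1))"
proof -
  let ?Z = "\<lambda>D. {a \<in> unit_sphere. proj_class a \<in> D} :: ('p padic ^ 'n) set"
  define C where "C = (1 - 1 / real CARD('p)) / real CARD('p) ^ (m * (CARD('n) - 1))"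
  have C: "0 \<le> C" using card_gt_1[where 'p = 'p] by (simp add: C_def)
  have fin: "finite (pcls m ` Y)" using finite_pcls[OF m] Y by (meson finite_subset image_mono)
  have sub: "pcls m ` Y \<subseteq> pcls m ` proj_space" using Y by blast
  have "{a \<in> unit_sphere. proj_class a \<in> (\<Union>X\<in>Y. pcls m X)} = (\<Union>D\<in>pcls m ` Y. ?Z D)" by auto
  moreover have "disjoint_family_on ?Z (pcls m ` Y)"
    unfolding disjoint_family_on_def
  proof (intro ballI impI)
    fix D D' assume D: "D \<in> pcls m ` Y" "D' \<in> pcls m ` Y" "D \<noteq> D'"
    have "D \<in> pcls m ` proj_space" "D' \<in> pcls m ` proj_space" using D sub by blast+
    then have "D \<inter> D' = {}" using pcls_disjoint[of D m D'] D(3) by blast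
    then show "?Z D \<inter> ?Z D' = {}" by auto
  qed
  moreover have "?Z ` (pcls m ` Y) \<subseteq> sets haar_vec"
  proof (intro image_subsetI)
    fix D assume "D \<in> pcls m ` Y"
    then have "D \<in> pcls m ` proj_space" using sub by blast
    then show "?Z D \<in> sets haar_vec" using measure_cone_pcls(1)[OF _ m] by simp
  qed
  ultimately have "emeasure haar_vec {a \<in> unit_sphere. proj_class a \<in> (\<Union>X\<in>Y. pcls m X)}
      = (\<Sum>D\<in>pcls m ` Y. emeasure haar_vec (?Z D))"
    using fin by (simp only: sum_emeasure)
  also have "\<dots> = (\<Sum>D\<in>pcls m ` Y. ennreal C)"
  proof (intro sum.cong refl)
    fix D assume "D \<in> pcls m ` Y"
    then have "D \<in> pcls m ` proj_space" using sub by blast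
    then show "emeasure haar_vec (?Z D) = ennreal C"
      unfolding C_def by (rule measure_cone_pcls(2)[OF _ m])
  qed
  also have "\<dots> = ennreal (real (card (pcls m ` Y)) * C)"
    using C by (simp add: ennreal_mult ennreal_of_nat_eq_real_of_nat)
  finally have "measure haar_vec {a \<in> unit_sphere. proj_class a \<in> (\<Union>X\<in>Y. pcls m X)} = real (card (pcls m ` Y)) * C"
    using C by (simp add: measure_def)
  then show ?thesis
    using card_gt_1[where 'p = 'p] unfolding proj_measure_def C_def by simp
qed

text \<open>The power of p attached to the codimension turns the weight of a ball into p^(-mk); what
  remains of the volume is a normalised count.\<close>

lemma proj_vol_eq_lim:
  fixes Y :: "('p::prime_card padic ^ 'n::finite) set set"
  assumes Y: "Y \<subseteq> proj_space"
    and lim: "(\<lambda>m. real (card (pcls m ` Y)) / real CARD('p) ^ (m * k)) \<longlonglongrightarrow> V"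
  shows "proj_vol k Y = V"
proof -
  have "real CARD('p) powi (int m * (int CARD('n) - 1 - int k)) * proj_measure (\<Union>X\<in>Y. proj_ball X (real CARD('p) powi (- int m)))
      = real (card (pcls m ` Y)) / real CARD('p) ^ (m * k)" if m: "m \<ge> 1" for m
  proof -
    have q: "real CARD('p) \<noteq> 0" by simp
    have n: "int (CARD('n) - 1) = int CARD('n) - 1" by (simp add: of_nat_diff)
    have "real CARD('p) powi (int m * (int CARD('n) - 1 - int k))
        = real CARD('p) powi (int (m * (CARD('n) - 1)) - int (m * k))"
      by (simp only: of_nat_mult n) (simp add: algebra_simps)
    also have "\<dots> = real CARD('p) ^ (m * (CARD('n) - 1)) / real CARD('p) ^ (m * k)"
      by (simp only: power_int_diff[OF disjI1[OF q]] power_int_of_nat)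
    finally show ?thesis
      using proj_measure_pcls[OF Y m] by (simp add: pcls_def)
  qed
  then have "eventually (\<lambda>m. real (card (pcls m ` Y)) / real CARD('p) ^ (m * k) =
      real CARD('p) powi (int m * (int CARD('n) - 1 - int k)) * proj_measure (\<Union>X\<in>Y. proj_ball X (real CARD('p) powi (- int m)))) sequentially"
    unfolding eventually_sequentially by (intro exI[of _ 1]) simp
  from Lim_transform_eventually[OF lim this] show ?thesis
    unfolding proj_vol_def by (rule limI)
qed

text \<open>The count is read back from the measure: all balls together have the whole sphere as
  cone, which is the unit polydisc minus the next smaller one.\<close>

lemma card_pcls_proj_space:
  assumes m: "m \<ge> 1"
  shows "real (card (pcls m ` (proj_space :: ('p::prime_card padic ^ 'n::finite) set set))) =
    (1 - 1 / real CARD('p) ^ CARD('n)) / (1 - 1 / real CARD('p)) * real CARD('p) ^ (m * (CARD('n) - 1))"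
proof -
  let ?P = "proj_space :: ('p padic ^ 'n) set set"
  interpret prob_space "vec_uniform :: ('p padic ^ 'n) measure" by (rule prob_space_vec_uniform)
  have "X \<in> pcls m X" if "X \<in> ?P" for X
    using that by (auto elim!: proj_space_cases simp: pcls_iff)
  then have "(\<Union>X\<in>?P. pcls m X) = ?P" using pcls_subset by blast
  then have "{a \<in> unit_sphere. proj_class a \<in> (\<Union>X\<in>?P. pcls m X)} = vpb 0 - (vpb 1 :: ('p padic ^ 'n) set)"
    using proj_class_in_space sphere_nonzero by (auto simp: unit_sphere_iff)
  moreover have "emeasure haar_vec (vpb 0 - vpb 1 :: ('p padic ^ 'n) set) = ennreal (1 - 1 / real CARD('p) ^ CARD('n))"
  proof -
    have "emeasure haar_vec (vpb 0 - vpb 1 :: ('p padic ^ 'n) set)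
        = emeasure vec_uniform (vpb 0 :: ('p padic ^ 'n) set) - emeasure vec_uniform (vpb 1 :: ('p padic ^ 'n) set)"
      by (subst haar_vec_subset, blast, simp, subst emeasure_Diff) (auto intro: vpb_anti)
    also have "emeasure vec_uniform (vpb 1 :: ('p padic ^ 'n) set) = ennreal (1 / real CARD('p) ^ CARD('n))"
    proof -
      have "(vpb 1 :: ('p padic ^ 'n) set) = {x. \<forall>i. x $ i - 0 $ i \<in> pb (int 1)}" by (auto simp: vpb_def)
      then show ?thesis using emeasure_vec_uniform_box[of "0 :: 'p padic ^ 'n" "\<lambda>_. 1"] by simp
    qed
    also have "emeasure vec_uniform (vpb 0 :: ('p padic ^ 'n) set) - ennreal (1 / real CARD('p) ^ CARD('n))
        = ennreal (1 - 1 / real CARD('p) ^ CARD('n))"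
      by (subst vec_uniform_integral, subst ennreal_1[symmetric], subst ennreal_minus) auto
    finally show ?thesis .
  qed
  ultimately have "proj_measure (\<Union>X\<in>?P. pcls m X) = 1 / (1 - 1 / real CARD('p)) * (1 - 1 / real CARD('p) ^ CARD('n))"
    using card_gt_1[where 'p = 'p] by (simp add: proj_measure_def measure_def)
  then have "real (card (pcls m ` ?P)) / real CARD('p) ^ (m * (CARD('n) - 1)) = (1 - 1 / real CARD('p) ^ CARD('n)) / (1 - 1 / real CARD('p))"
    using proj_measure_pcls[of ?P m] m by simp
  moreover have "real CARD('p) ^ (m * (CARD('n) - 1)) > 0" by simp
  ultimately show ?thesis by (metis nonzero_divide_eq_eq less_irrefl)
qed

section \<open>The Veronese embedding as an immersion\<close>

text \<open>Everything the probabilistic part needs to know about the Veronese map, with a single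
  exponent \<open>c\<close> for all losses. In the chart where coordinate \<open>j\<close> is 1,
  \<open>B\<close> is the derivative of \<open>v\<close> with column \<open>j\<close> replaced by
  \<open>v x\<close> itself, so its image is the cone over the projective tangent space. The two
  bounds on \<open>B\<close> limit its distortion to p^c either way. The last clause is a Taylor
  estimate whose remainder is small both in the size of the increments and in their difference, as a
  contraction argument requires.\<close>

locale immersion =
  fixes v :: "'p::prime_card padic ^ 'n::finite \<Rightarrow> 'p padic ^ 'l::finite" and d :: nat and c :: int
  assumes c_nonneg: "0 \<le> c"
    and homogeneous: "v (a *s x) = a ^ d *s v x"
    and bounded: "x \<in> vpb 0 \<Longrightarrow> v x \<in> vpb (- c)"
    and lipschitz: "x \<in> vpb 0 \<Longrightarrow> x' \<in> vpb 0 \<Longrightarrow> x - x' \<in> vpb k \<Longrightarrow> v x - v x' \<in> vpb (k - c)"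
    and lower: "x \<in> unit_sphere \<Longrightarrow> v x \<notin> vpb (c + 1)"
    and injective: "x \<in> vpb 0 \<Longrightarrow> x $ j = 1 \<Longrightarrow> x' \<in> unit_sphere \<Longrightarrow> c < k \<Longrightarrow> v x' - \<mu> *s v x \<in> vpb k \<Longrightarrow>
      x' $ j \<notin> pb 1 \<and> x' - x' $ j *s x \<in> vpb (k - c)"
    and differentiable: "x \<in> vpb 0 \<Longrightarrow> x $ j = 1 \<Longrightarrow> \<exists>B.
      B *v axis j 1 = v x \<and>
      (\<forall>u k. u \<in> vpb k \<longrightarrow> B *v u \<in> vpb (k - c)) \<and>
      (\<forall>u k. B *v u \<in> vpb k \<longrightarrow> u \<in> vpb (k - c)) \<and>
      (\<forall>z z' a b. 0 \<le> a \<longrightarrow> z $ j = 0 \<longrightarrow> z' $ j = 0 \<longrightarrow> z \<in> vpb a \<longrightarrow> z' \<in> vpb a \<longrightarrow> z - z' \<in> vpb b \<longrightarrow>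
         v (x + z) - v (x + z') - B *v (z - z') \<in> vpb (a + b - c))"

section \<open>Strict differentiability with an ultrametric second-order remainder\<close>

definition strictly_diff :: "int \<Rightarrow> ('p::prime_card padic ^ 'n::finite \<Rightarrow> 'p padic) \<Rightarrow> bool" where
  "strictly_diff c g \<longleftrightarrow> (\<forall>x\<in>vpb 0. g x \<in> pb (- c) \<and>
     (\<exists>A\<in>vpb (- c). \<forall>a b z z'. 0 \<le> a \<longrightarrow> z \<in> vpb a \<longrightarrow> z' \<in> vpb a \<longrightarrow> z - z' \<in> vpb b \<longrightarrow>
        g (x + z) - g (x + z') - dot A (z - z') \<in> pb (a + b - c)))"

lemma strictly_diff_const_1: "strictly_diff 0 (\<lambda>x. 1)"
  by (auto simp: strictly_diff_def dot_def intro!: bexI[of _ 0])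

lemma dot_axis_left [simp]: "dot (axis i 1) x = x $ i"
  by (simp add: dot_def axis_def if_distrib[of "\<lambda>y. y * _"] cong: if_cong)

lemma strictly_diff_nth: "strictly_diff 0 (\<lambda>x. x $ i)"
  unfolding strictly_diff_def
proof (intro ballI conjI bexI[of _ "axis i 1"] allI impI)
  show "axis i 1 \<in> (vpb (- 0) :: ('a padic ^ 'b) set)" by (auto simp: vpb_def axis_def)
qed (auto intro: vpb_nth)

text \<open>The form of the remainder survives the product rule. With integral factors nothing is
  lost, so monomials keep exponent 0 and only the coefficients of a polynomial contribute to
  \<open>c\<close>.\<close>

lemma strictly_diff_mult:
  fixes g h :: "'p::prime_card padic ^ 'n::finite \<Rightarrow> 'p padic"
  assumes g: "strictly_diff 0 g" and h: "strictly_diff 0 h"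
  shows "strictly_diff 0 (\<lambda>x. g x * h x)"
  unfolding strictly_diff_def
proof (intro ballI conjI)
  fix x :: "'p padic ^ 'n" assume x: "x \<in> vpb 0"
  show "g x * h x \<in> pb (- 0)"
    using g h x by (intro pb_mult'[of _ 0 _ 0]) (auto simp: strictly_diff_def)
  obtain A where A: "A \<in> vpb 0" and dA: "\<And>a b z z'. 0 \<le> a \<Longrightarrow> z \<in> vpb a \<Longrightarrow> z' \<in> vpb a \<Longrightarrow> z - z' \<in> vpb b \<Longrightarrow>
      g (x + z) - g (x + z') - dot A (z - z') \<in> pb (a + b)"
    using g x unfolding strictly_diff_def by auto
  obtain B where B: "B \<in> vpb 0" and dB: "\<And>a b z z'. 0 \<le> a \<Longrightarrow> z \<in> vpb a \<Longrightarrow> z' \<in> vpb a \<Longrightarrow> z - z' \<in> vpb b \<Longrightarrow>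
      h (x + z) - h (x + z') - dot B (z - z') \<in> pb (a + b)"
    using h x unfolding strictly_diff_def by auto
  show "\<exists>A\<in>vpb (- 0). \<forall>a b z z'. 0 \<le> a \<longrightarrow> z \<in> vpb a \<longrightarrow> z' \<in> vpb a \<longrightarrow> z - z' \<in> vpb b \<longrightarrow>
        g (x + z) * h (x + z) - g (x + z') * h (x + z') - dot A (z - z') \<in> pb (a + b - 0)"
  proof (intro bexI allI impI)
    have gx: "g x \<in> pb 0" and hx: "h x \<in> pb 0" using g h x by (auto simp: strictly_diff_def)
    show "h x *s A + g x *s B \<in> vpb (- 0)"
      using A B gx hx by (auto intro!: vpb_add vpb_scale[of _ 0 _ 0])
    fix a b and z z' :: "'p padic ^ 'n"
    assume a: "0 \<le> a" and z: "z \<in> vpb a" "z' \<in> vpb a" "z - z' \<in> vpb b"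
    define E where "E = g (x + z) - g (x + z') - dot A (z - z')"
    define F where "F = h (x + z) - h (x + z') - dot B (z - z')"
    have E: "E \<in> pb (a + b)" unfolding E_def by (rule dA[OF a z])
    have F: "F \<in> pb (a + b)" unfolding F_def by (rule dB[OF a z])
    have xz: "x + z \<in> vpb 0" "x + z' \<in> vpb 0"
      using x z a by (auto intro!: vpb_add intro: vpb_anti)
    have hz: "h (x + z) \<in> pb 0" and gz: "g (x + z') \<in> pb 0"
      using xz g h by (auto simp: strictly_diff_def)
    have hd: "h (x + z) - h x \<in> pb a"
    proof -
      have "h (x + z) - h (x + 0) - dot B (z - 0) \<in> pb (a + a)" using a z by (intro dB) auto
      moreover have "dot B z \<in> pb a" using B z by (intro dot_pb[of _ 0 _ a]) auto
      ultimately have "h (x + z) - h x - dot B z + dot B z \<in> pb a"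
        using a by (intro pb_add) (auto intro: pb_anti)
      then show ?thesis by simp
    qed
    have gd: "g (x + z') - g x \<in> pb a"
    proof -
      have "g (x + z') - g (x + 0) - dot A (z' - 0) \<in> pb (a + a)" using a z by (intro dA) auto
      moreover have "dot A z' \<in> pb a" using A z by (intro dot_pb[of _ 0 _ a]) auto
      ultimately have "g (x + z') - g x - dot A z' + dot A z' \<in> pb a"
        using a by (intro pb_add) (auto intro: pb_anti)
      then show ?thesis by simp
    qed
    have Az: "dot A (z - z') \<in> pb b" and Bz: "dot B (z - z') \<in> pb b"
      using A B z by (auto intro!: dot_pb[of _ 0 _ b])
    have dl: "dot (h x *s A + g x *s B) (z - z') = h x * dot A (z - z') + g x * dot B (z - z')"
      by (simp add: dot_def sum_distrib_left sum.distrib algebra_simps sum_subtractf)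
    \<comment> \<open>Two terms carry the remainder of a factor; the other two pair a first-order
      difference, of exponent b, with the variation of the other factor, of exponent a.\<close>
    have "g (x + z) * h (x + z) - g (x + z') * h (x + z') - dot (h x *s A + g x *s B) (z - z')
      = E * h (x + z) + dot A (z - z') * (h (x + z) - h x) + g (x + z') * F + (g (x + z') - g x) * dot B (z - z')"
      unfolding dl E_def F_def by (simp add: algebra_simps)
    also have "\<dots> \<in> pb (a + b - 0)"
      using E F hz gz hd gd Az Bz
      by (intro pb_add) (auto intro: pb_mult'[of _ "a + b" _ 0] pb_mult'[of _ 0 _ "a + b"] pb_mult'[of _ a _ b] pb_mult'[of _ b _ a])
    finally show "g (x + z) * h (x + z) - g (x + z') * h (x + z') - dot (h x *s A + g x *s B) (z - z') \<in> pb (a + b - 0)" .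
  qed
qed

lemma strictly_diff_power: "strictly_diff 0 g \<Longrightarrow> strictly_diff 0 (\<lambda>x. g x ^ k)"
  by (induction k) (auto intro: strictly_diff_mult strictly_diff_const_1)

lemma strictly_diff_prod: "(\<And>i. i \<in> I \<Longrightarrow> strictly_diff 0 (g i)) \<Longrightarrow> strictly_diff 0 (\<lambda>x. \<Prod>i\<in>I. g i x)"
  by (induction I rule: infinite_finite_induct) (auto intro: strictly_diff_mult strictly_diff_const_1)

lemma strictly_diff_scale:
  fixes g :: "'p::prime_card padic ^ 'n::finite \<Rightarrow> 'p padic"
  assumes g: "strictly_diff 0 g" and t: "t \<in> pb (- c)"
  shows "strictly_diff c (\<lambda>x. t * g x)"
  unfolding strictly_diff_def
proof (intro ballI conjI)
  fix x :: "'p padic ^ 'n" assume x: "x \<in> vpb 0"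
  show "t * g x \<in> pb (- c)" using g x t by (auto intro!: pb_mult'[of _ "-c" _ 0] simp: strictly_diff_def)
  obtain A where A: "A \<in> vpb 0" and dA: "\<And>a b z z'. 0 \<le> a \<Longrightarrow> z \<in> vpb a \<Longrightarrow> z' \<in> vpb a \<Longrightarrow> z - z' \<in> vpb b \<Longrightarrow>
      g (x + z) - g (x + z') - dot A (z - z') \<in> pb (a + b)"
    using g x unfolding strictly_diff_def by auto
  show "\<exists>A\<in>vpb (- c). \<forall>a b z z'. 0 \<le> a \<longrightarrow> z \<in> vpb a \<longrightarrow> z' \<in> vpb a \<longrightarrow> z - z' \<in> vpb b \<longrightarrow>
        t * g (x + z) - t * g (x + z') - dot A (z - z') \<in> pb (a + b - c)"
  proof (intro bexI[of _ "t *s A"] allI impI)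
    show "t *s A \<in> vpb (- c)" using t A by (auto intro!: vpb_scale[of _ "-c" _ 0])
    fix a b and z z' :: "'p padic ^ 'n"
    assume z: "0 \<le> a" "z \<in> vpb a" "z' \<in> vpb a" "z - z' \<in> vpb b"
    have "t * g (x + z) - t * g (x + z') - dot (t *s A) (z - z') = t * (g (x + z) - g (x + z') - dot A (z - z'))"
      by (simp add: dot_def sum_distrib_left algebra_simps)
    also have "\<dots> \<in> pb (a + b - c)" by (rule pb_mult'[OF t dA[OF z]]) simp
    finally show "t * g (x + z) - t * g (x + z') - dot (t *s A) (z - z') \<in> pb (a + b - c)" .
  qed
qed

lemma strictly_diff_0: "strictly_diff c (\<lambda>x. 0)"
  by (auto simp: strictly_diff_def dot_def intro!: bexI[of _ 0])

lemma strictly_diff_add: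
  fixes g h :: "'p::prime_card padic ^ 'n::finite \<Rightarrow> 'p padic"
  assumes g: "strictly_diff c g" and h: "strictly_diff c h"
  shows "strictly_diff c (\<lambda>x. g x + h x)"
  unfolding strictly_diff_def
proof (intro ballI conjI)
  fix x :: "'p padic ^ 'n" assume x: "x \<in> vpb 0"
  show "g x + h x \<in> pb (- c)" using g h x by (auto intro!: pb_add simp: strictly_diff_def)
  obtain A where A: "A \<in> vpb (- c)" and dA: "\<And>a b z z'. 0 \<le> a \<Longrightarrow> z \<in> vpb a \<Longrightarrow> z' \<in> vpb a \<Longrightarrow> z - z' \<in> vpb b \<Longrightarrow>
      g (x + z) - g (x + z') - dot A (z - z') \<in> pb (a + b - c)"
    using g x unfolding strictly_diff_def by blast
  obtain B where B: "B \<in> vpb (- c)" and dB: "\<And>a b z z'. 0 \<le> a \<Longrightarrow> z \<in> vpb a \<Longrightarrow> z' \<in> vpb a \<Longrightarrow> z - z' \<in> vpb b \<Longrightarrow>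
      h (x + z) - h (x + z') - dot B (z - z') \<in> pb (a + b - c)"
    using h x unfolding strictly_diff_def by blast
  show "\<exists>A\<in>vpb (- c). \<forall>a b z z'. 0 \<le> a \<longrightarrow> z \<in> vpb a \<longrightarrow> z' \<in> vpb a \<longrightarrow> z - z' \<in> vpb b \<longrightarrow>
        g (x + z) + h (x + z) - (g (x + z') + h (x + z')) - dot A (z - z') \<in> pb (a + b - c)"
  proof (intro bexI[of _ "A + B"] allI impI)
    show "A + B \<in> vpb (- c)" using A B by (rule vpb_add)
    fix a b and z z' :: "'p padic ^ 'n"
    assume z: "0 \<le> a" "z \<in> vpb a" "z' \<in> vpb a" "z - z' \<in> vpb b"
    have "g (x + z) + h (x + z) - (g (x + z') + h (x + z')) - dot (A + B) (z - z')
       = (g (x + z) - g (x + z') - dot A (z - z')) + (h (x + z) - h (x + z') - dot B (z - z'))"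
      by (simp add: dot_add_left)
    also have "\<dots> \<in> pb (a + b - c)" by (rule pb_add[OF dA[OF z] dB[OF z]])
    finally show "g (x + z) + h (x + z) - (g (x + z') + h (x + z')) - dot (A + B) (z - z') \<in> pb (a + b - c)" .
  qed
qed

lemma strictly_diff_sum: "(\<And>i. i \<in> I \<Longrightarrow> strictly_diff c (g i)) \<Longrightarrow> strictly_diff c (\<lambda>x. \<Sum>i\<in>I. g i x)"
  by (induction I rule: infinite_finite_induct) (auto intro: strictly_diff_add strictly_diff_0)

lemma pb_bound_finite:
  assumes "finite S"
  shows "\<exists>c\<ge>0. \<forall>s\<in>S. s \<in> pb (- c)"
  using assms
proof induction
  case (insert s S)
  then obtain c where c: "c \<ge> 0" "\<forall>s\<in>S. s \<in> pb (- c)" by blast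
  obtain k where k: "k \<le> 0" "s \<in> pb k" using pb_ex by blast
  show ?case
    using c k by (intro exI[of _ "max c (- k)"]) (auto intro: pb_anti)
qed auto

section \<open>Polynomial evaluation and the Veronese map\<close>

lemma mpoly_eval_superset:
  assumes "finite S" "Poly_Mapping.keys q \<subseteq> S"
  shows "mpoly_eval q x = (\<Sum>m\<in>S. Poly_Mapping.lookup q m * (\<Prod>i\<in>UNIV. x $ i ^ Poly_Mapping.lookup m i))"
  unfolding mpoly_eval_def using assms
  by (intro sum.mono_neutral_left) (auto simp: in_keys_iff)

lemma mpoly_eval_add: "mpoly_eval (q + r) x = mpoly_eval q x + mpoly_eval r x"
proof -
  let ?S = "Poly_Mapping.keys q \<union> Poly_Mapping.keys r"
  have "Poly_Mapping.keys (q + r) \<subseteq> ?S" by (rule Poly_Mapping.keys_add)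
  then show ?thesis
    by (simp add: mpoly_eval_superset[of ?S] lookup_add sum.distrib algebra_simps)
qed

lemma mpoly_eval_scale: "mpoly_eval (mpoly_scale a q) x = a * mpoly_eval q x"
proof -
  have "Poly_Mapping.keys (mpoly_scale a q) \<subseteq> Poly_Mapping.keys q"
    by (auto simp: in_keys_iff lookup_mpoly_scale)
  then show ?thesis
    by (simp add: mpoly_eval_superset[of "Poly_Mapping.keys q"] lookup_mpoly_scale sum_distrib_left algebra_simps)
qed

lemma mpoly_eval_0 [simp]: "mpoly_eval 0 x = 0"
  by (simp add: mpoly_eval_def)

lemma mpoly_eval_sum: "mpoly_eval (\<Sum>k\<in>I. g k) x = (\<Sum>k\<in>I. mpoly_eval (g k) x)"
  by (induction I rule: infinite_finite_induct) (auto simp: mpoly_eval_add)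

definition veronese :: "('l::finite \<Rightarrow> ('a::field, 'n::finite) mpoly) \<Rightarrow> 'a ^ 'n \<Rightarrow> 'a ^ 'l" where
  "veronese f x = (\<chi> k. mpoly_eval (f k) x)"

lemma mpoly_eval_linear_combination:
  "mpoly_eval (\<Sum>k\<in>UNIV. mpoly_scale (a k) (f k)) x = dot (\<chi> k. a k) (veronese f x)"
  by (simp add: mpoly_eval_sum mpoly_eval_scale dot_def veronese_def)

text \<open>Monomials of degree d lie in the span of the f's, so linear functionals on the target
  read them off. Where \<open>x $ j = 1\<close> these particular monomials are the coordinates of
  \<open>x\<close>: the functionals invert the Veronese map on the chart.\<close>

lemma monomial_coordinate:
  fixes f :: "'l::finite \<Rightarrow> ('a::field, 'n::finite) mpoly"
  assumes inj: "inj f" and span: "mpoly.span (range f) = homogeneous d" and d: "d \<ge> 1"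
  shows "\<exists>L. \<forall>x. dot L (veronese f x) = x $ j ^ (d - 1) * x $ i"
proof -
  define m where "m = Poly_Mapping.single j (d - 1) + Poly_Mapping.single i (1 :: nat)"
  have single: "(\<Prod>k\<in>UNIV. x $ k ^ Poly_Mapping.lookup (Poly_Mapping.single l t) k) = x $ l ^ t" for x :: "'a ^ 'n" and l t
    by (subst prod.remove[of _ l]) (auto simp: lookup_single when_def)
  have deg: "(\<Sum>k\<in>UNIV. Poly_Mapping.lookup (Poly_Mapping.single l t) k) = t" for l :: 'n and t :: nat
    by (subst sum.remove[of _ l]) (auto simp: lookup_single when_def)
  have "(\<Sum>k\<in>UNIV. Poly_Mapping.lookup m k) = d"
    using d by (simp add: m_def lookup_add sum.distrib deg)
  then have "Poly_Mapping.single m (1 :: 'a) \<in> homogeneous d" by (simp add: homogeneous_def)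
  then have "Poly_Mapping.single m (1 :: 'a) \<in> mpoly.span (range f)" using span by simp
  then obtain u where "Poly_Mapping.single m (1 :: 'a) = (\<Sum>q\<in>range f. mpoly_scale (u q) q)"
    by (subst (asm) mpoly.span_finite) auto
  also have "\<dots> = (\<Sum>k\<in>UNIV. mpoly_scale (u (f k)) (f k))"
    by (rule sum.reindex_cong[OF inj]) auto
  finally have eq: "Poly_Mapping.single m (1 :: 'a) = (\<Sum>k\<in>UNIV. mpoly_scale (u (f k)) (f k))" .
  have "dot (\<chi> k. u (f k)) (veronese f x) = x $ j ^ (d - 1) * x $ i" for x
  proof -
    have "dot (\<chi> k. u (f k)) (veronese f x) = mpoly_eval (Poly_Mapping.single m 1) x"
      unfolding eq mpoly_eval_linear_combination ..
    also have "\<dots> = (\<Prod>k\<in>UNIV. x $ k ^ Poly_Mapping.lookup m k)" by (simp add: mpoly_eval_def)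
    also have "\<dots> = x $ j ^ (d - 1) * x $ i ^ 1"
      unfolding m_def lookup_add power_add prod.distrib single ..
    finally show ?thesis by simp
  qed
  then show ?thesis by blast
qed

lemma pb_unit_power: "u \<in> pb 0 \<Longrightarrow> u \<notin> pb 1 \<Longrightarrow> u ^ k \<notin> pb 1"
  by (induction k) (auto simp: pb_unit_mult_iff)

lemma matrix_vector_scale: "B *v (a *s x) = a *s (B *v x)" for B :: "'a::comm_ring_1 ^ 'n::finite ^ 'l"
  by (simp add: matrix_vector_mult_def vec_eq_iff sum_distrib_left algebra_simps)

lemma veronese_scale:
  assumes "\<And>k. f k \<in> homogeneous d"
  shows "veronese f (a *s x) = a ^ d *s veronese f x"
  by (simp add: veronese_def vec_eq_iff mpoly_eval_scale_vec[OF assms])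

lemma veronese_strictly_diff:
  fixes f :: "'l::finite \<Rightarrow> ('p::prime_card padic, 'n::finite) mpoly"
  shows "\<exists>c\<ge>0. \<forall>k. strictly_diff c (\<lambda>x. veronese f x $ k)"
proof -
  let ?S = "\<Union>k. Poly_Mapping.lookup (f k) ` Poly_Mapping.keys (f k)"
  have "finite ?S" by auto
  then obtain c where c: "c \<ge> 0" "\<forall>s\<in>?S. s \<in> pb (- c)" using pb_bound_finite by blast
  have "strictly_diff c (\<lambda>x. veronese f x $ k)" for k
    unfolding veronese_def mpoly_eval_def vec_lambda_beta
    using c by (intro strictly_diff_sum strictly_diff_scale strictly_diff_prod strictly_diff_power strictly_diff_nth) blast
  then show ?thesis using c(1) by blast
qed

text \<open>Upper estimates come from the coefficients of the f's, bounded by \<open>c1\<close>;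
  lower estimates and injectivity come from the functionals of \<open>monomial_coordinate\<close>,
  bounded by \<open>c0\<close>. Both families are finite, so one exponent serves all points.\<close>

theorem veronese_immersion:
  fixes f :: "'l::finite \<Rightarrow> ('p::prime_card padic, 'n::finite) mpoly"
  assumes inj: "inj f" and span: "mpoly.span (range f) = homogeneous d" and d: "d \<ge> 1"
  shows "\<exists>c. immersion (veronese f) d c"
proof -
  have hom: "f k \<in> homogeneous d" for k
    using mpoly.span_base[of "f k" "range f"] unfolding span by simp
  obtain c1 where c1: "c1 \<ge> 0" "\<And>k. strictly_diff c1 (\<lambda>x. veronese f x $ k)"
    using veronese_strictly_diff[of f] by blast
  obtain L where L: "\<And>i j x. dot (L i j) (veronese f x) = x $ j ^ (d - 1) * x $ i"
  proof -
    have "\<forall>i j. \<exists>L. \<forall>x. dot L (veronese f x) = x $ j ^ (d - 1) * x $ i"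
      using monomial_coordinate[OF inj span d] by simp
    then show thesis using that by metis
  qed
  have "finite (range (\<lambda>(i, j, k). L i j $ k))" by simp
  from pb_bound_finite[OF this] obtain c0 where c0: "c0 \<ge> 0" "\<forall>s\<in>range (\<lambda>(i, j, k). L i j $ k). s \<in> pb (- c0)"
    by blast
  have Lb: "L i j \<in> vpb (- c0)" for i j
  proof (rule vpbI)
    fix k
    have "(\<lambda>(i, j, k). L i j $ k) (i, j, k) \<in> pb (- c0)" using c0(2) by blast
    then show "L i j $ k \<in> pb (- c0)" by simp
  qed
  let ?v = "veronese f"
  define c where "c = max c0 c1"
  have c: "0 \<le> c" "c0 \<le> c" "c1 \<le> c" using c0 c1 by (auto simp: c_def)
  have dL: "w \<in> vpb k \<Longrightarrow> dot (L i j) w \<in> pb (k - c0)" for w k i j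
    using Lb by (auto intro!: dot_pb[of _ "-c0" _ k])
  have pow: "a ^ d = a ^ (d - 1) * a" for a :: "'p padic"
    using d by (metis power_minus_mult Suc_le_eq One_nat_def)
  have bnd: "?v x \<in> vpb (- c1)" if "x \<in> vpb 0" for x
    using c1(2) that by (auto simp: strictly_diff_def intro!: vpbI)
  have diff: "\<exists>A :: 'p padic ^ 'n ^ 'l. (\<forall>u k. u \<in> vpb k \<longrightarrow> A *v u \<in> vpb (k - c1)) \<and>
      (\<forall>a b z z'. 0 \<le> a \<longrightarrow> z \<in> vpb a \<longrightarrow> z' \<in> vpb a \<longrightarrow> z - z' \<in> vpb b \<longrightarrow>
        ?v (x + z) - ?v (x + z') - A *v (z - z') \<in> vpb (a + b - c1))" if x: "x \<in> vpb 0" for x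
  proof -
    have "\<forall>k. \<exists>A\<in>vpb (- c1). \<forall>a b z z'. 0 \<le> a \<longrightarrow> z \<in> vpb a \<longrightarrow> z' \<in> vpb a \<longrightarrow> z - z' \<in> vpb b \<longrightarrow>
        ?v (x + z) $ k - ?v (x + z') $ k - dot A (z - z') \<in> pb (a + b - c1)"
      using c1(2) x unfolding strictly_diff_def by blast
    then obtain A where A: "\<And>k. A k \<in> vpb (- c1)"
      "\<And>k a b z z'. 0 \<le> a \<Longrightarrow> z \<in> vpb a \<Longrightarrow> z' \<in> vpb a \<Longrightarrow> z - z' \<in> vpb b \<Longrightarrow>
        ?v (x + z) $ k - ?v (x + z') $ k - dot (A k) (z - z') \<in> pb (a + b - c1)" by metis
    have mv: "((\<chi> k. A k) *v u) $ k = dot (A k) u" for u k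
      by (simp add: matrix_vector_mult_def dot_def)
    show ?thesis
    proof (intro exI[of _ "\<chi> k. A k"] conjI allI impI)
      show "(\<chi> k. A k) *v u \<in> vpb (k - c1)" if "u \<in> vpb k" for u k
        using A(1) that by (intro vpbI) (auto simp: mv intro!: dot_pb[of _ "-c1" _ k])
      show "?v (x + z) - ?v (x + z') - (\<chi> k. A k) *v (z - z') \<in> vpb (a + b - c1)"
        if "0 \<le> a" "z \<in> vpb a" "z' \<in> vpb a" "z - z' \<in> vpb b" for a b z z'
        using A(2)[OF that] by (intro vpbI) (simp only: vector_minus_component mv)
    qed
  qed
  have "immersion ?v d c"
  proof
    show "0 \<le> c" by (rule c)
    show "?v (a *s x) = a ^ d *s ?v x" for a x by (rule veronese_scale[OF hom])
    show "?v x \<in> vpb (- c)" if "x \<in> vpb 0" for x using bnd[OF that] c by (auto intro: vpb_anti)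
    show "?v x - ?v x' \<in> vpb (k - c)" if x: "x \<in> vpb 0" "x' \<in> vpb 0" "x - x' \<in> vpb k" for x x' k
    proof -
      obtain A where A: "\<And>u k. u \<in> vpb k \<Longrightarrow> A *v u \<in> vpb (k - c1)"
        "\<And>a b z z'. 0 \<le> a \<Longrightarrow> z \<in> vpb a \<Longrightarrow> z' \<in> vpb a \<Longrightarrow> z - z' \<in> vpb b \<Longrightarrow>
          ?v (x' + z) - ?v (x' + z') - A *v (z - z') \<in> vpb (a + b - c1)"
        using diff[OF x(2)] by blast
      have "?v (x' + (x - x')) - ?v (x' + 0) - A *v (x - x' - 0) \<in> vpb (0 + k - c1)"
        using x by (intro A(2)) (auto intro: vpb_diff)
      moreover have "A *v (x - x') \<in> vpb (k - c1)" by (rule A(1)[OF x(3)])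
      ultimately have "?v x - ?v x' - A *v (x - x') + A *v (x - x') \<in> vpb (k - c1)"
        by (intro vpb_add) simp_all
      then show ?thesis using c by (auto intro: vpb_anti)
    qed
    show "?v x \<notin> vpb (c + 1)" if x: "x \<in> unit_sphere" for x
    proof
      assume v: "?v x \<in> vpb (c + 1)"
      \<comment> \<open>A unit coordinate has a unit d-th power, which a functional reads off the
        image with a loss of at most \<open>c0\<close> digits.\<close>
      obtain i where i: "x $ i \<notin> pb 1" using x by (auto simp: unit_sphere_iff vpb_notin)
      have i0: "x $ i \<in> pb 0" using x by (auto simp: unit_sphere_iff vpb_nth)
      have "x $ i ^ d \<in> pb (c + 1 - c0)" using dL[OF v, of i i] by (simp add: L pow)
      then have "x $ i ^ d \<in> pb 1" using c by (auto intro: pb_anti)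
      then show False using pb_unit_power[OF i0 i] by blast
    qed
    show "x' $ j \<notin> pb 1 \<and> x' - x' $ j *s x \<in> vpb (k - c)"
      if x: "x \<in> vpb 0" "x $ j = 1" and x': "x' \<in> unit_sphere" and k: "c < k" and w: "?v x' - \<mu> *s ?v x \<in> vpb k" for x j x' k \<mu>
    proof -
      have x'0: "x' $ i \<in> pb 0" for i using x' by (auto simp: unit_sphere_iff vpb_nth)
      have *: "x' $ b ^ (d - 1) * x' $ a - \<mu> * (x $ b ^ (d - 1) * x $ a) \<in> pb (k - c0)" for a b
        using dL[OF w, of a b] by (simp add: dot_diff_right dot_scale_right L)
      have **: "x' $ i ^ d - \<mu> * x $ i ^ d \<in> pb 1" for i
        using pb_anti[OF *[of i i], of 1] k c by (simp add: pow)
      obtain i where i: "x' $ i \<notin> pb 1" using x' by (auto simp: unit_sphere_iff vpb_notin)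
      \<comment> \<open>Comparing d-th powers modulo p: \<open>\<mu>\<close> is a unit because some
        coordinate of \<open>x'\<close> is, and \<open>x $ j = 1\<close> transfers this to
        \<open>x' $ j\<close>.\<close>
      have "x' $ i ^ d \<notin> pb 1" by (rule pb_unit_power[OF x'0 i])
      then have "\<mu> * x $ i ^ d \<notin> pb 1" using **[of i] pb_add[of "x' $ i ^ d - \<mu> * x $ i ^ d" 1 "\<mu> * x $ i ^ d"] by auto
      then have "\<mu> \<notin> pb 1"
        using pb_mult'[of \<mu> 1 "x $ i ^ d" 0 1] pb_power[OF vpb_nth[OF x(1)]] by auto
      then have "x' $ j ^ d \<notin> pb 1" using **[of j] x(2) pb_diff[of "x' $ j ^ d" 1 "x' $ j ^ d - \<mu>"] by auto
      then have j: "x' $ j \<notin> pb 1"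
        using pb_mult'[of "x' $ j ^ (d - 1)" 0 "x' $ j" 1 1] pb_power[OF x'0] by (auto simp: pow)
      \<comment> \<open>x'_j^(d-1) x'_i is congruent to \<mu> x_i and x'_j^d to \<mu>; eliminating
        \<mu> and dividing by the unit x'_j^(d-1) leaves the residual.\<close>
      have "(x' - x' $ j *s x) $ i \<in> pb (k - c)" for i
      proof -
        have "x' $ j ^ (d - 1) * x' $ i - \<mu> * x $ i \<in> pb (k - c0)" using *[of j i] x(2) by simp
        moreover have "(x' $ j ^ d - \<mu>) * x $ i \<in> pb (k - c0)"
          using *[of j j] x by (intro pb_mult'[of _ "k - c0" _ 0]) (auto simp: pow vpb_nth)
        ultimately have "(x' $ j ^ (d - 1) * x' $ i - \<mu> * x $ i) - (x' $ j ^ d - \<mu>) * x $ i \<in> pb (k - c0)"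
          by (rule pb_diff)
        also have "(x' $ j ^ (d - 1) * x' $ i - \<mu> * x $ i) - (x' $ j ^ d - \<mu>) * x $ i
            = x' $ j ^ (d - 1) * (x' - x' $ j *s x) $ i"
          by (simp add: pow algebra_simps)
        finally have "(x' - x' $ j *s x) $ i \<in> pb (k - c0)"
          using pb_unit_mult_iff[OF pb_power[OF x'0] pb_unit_power[OF x'0 j]] by blast
        then show ?thesis using c by (auto intro: pb_anti)
      qed
      then show ?thesis using j by (auto intro!: vpbI)
    qed
    show "\<exists>B. B *v axis j 1 = ?v x \<and> (\<forall>u k. u \<in> vpb k \<longrightarrow> B *v u \<in> vpb (k - c)) \<and>
      (\<forall>u k. B *v u \<in> vpb k \<longrightarrow> u \<in> vpb (k - c)) \<and>
      (\<forall>z z' a b. 0 \<le> a \<longrightarrow> z $ j = 0 \<longrightarrow> z' $ j = 0 \<longrightarrow> z \<in> vpb a \<longrightarrow> z' \<in> vpb a \<longrightarrow> z - z' \<in> vpb b \<longrightarrow>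
         ?v (x + z) - ?v (x + z') - B *v (z - z') \<in> vpb (a + b - c))" if x: "x \<in> vpb 0" "x $ j = 1" for x j
    proof -
      obtain A where A: "\<And>u k. u \<in> vpb k \<Longrightarrow> A *v u \<in> vpb (k - c1)"
        "\<And>a b z z'. 0 \<le> a \<Longrightarrow> z \<in> vpb a \<Longrightarrow> z' \<in> vpb a \<Longrightarrow> z - z' \<in> vpb b \<Longrightarrow>
          ?v (x + z) - ?v (x + z') - A *v (z - z') \<in> vpb (a + b - c1)"
        using diff[OF x(1)] by blast
      \<comment> \<open>The derivative along axis \<open>j\<close> is traded for the radial vector
        \<open>v x\<close>, so that \<open>B\<close> acts on homogeneous coordinates and reaches the
        point of the image itself.\<close>
      define B :: "'p padic ^ 'n ^ 'l" where "B = (\<chi> k i. if i = j then ?v x $ k else A $ k $ i)"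
      have B: "B *v u = u $ j *s ?v x + A *v (u - u $ j *s axis j 1)" for u
      proof -
        have "(B *v u) $ k = (u $ j *s ?v x + A *v (u - u $ j *s axis j 1)) $ k" for k
        proof -
          have "(B *v u) $ k = ?v x $ k * u $ j + (\<Sum>i\<in>UNIV - {j}. A $ k $ i * u $ i)"
            unfolding matrix_vector_mult_def B_def vec_lambda_beta
            by (subst sum.remove[of _ j]) (auto intro!: sum.cong)
          moreover have "(A *v (u - u $ j *s axis j 1)) $ k = (\<Sum>i\<in>UNIV - {j}. A $ k $ i * u $ i)"
            unfolding matrix_vector_mult_def vec_lambda_beta
            by (subst sum.remove[of _ j]) (auto intro!: sum.cong simp: axis_def)
          ultimately show ?thesis by (simp add: mult.commute)
        qed
        then show ?thesis by (simp only: vec_eq_iff) blast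
      qed
      have Bz: "B *v z = A *v z" if "z $ j = 0" for z using that by (simp add: B)
      \<comment> \<open>the coordinates \<open>x\<^sub>j\<^sup>d\<^sup>-\<^sup>1 x\<^sub>i\<close> are affine in \<open>z\<close> along \<open>x + z\<close>, so their derivative is read off\<close>
      have LA: "dot (L i j) (A *v z) = z $ i" if z: "z $ j = 0" for i z
      proof -
        obtain e where e: "z \<in> vpb e" using vpb_ex by blast
        \<comment> \<open>Scaling \<open>z\<close> by p^k makes the remainder of order 2k but the
          linear terms only of order k; after division by p^k the error still vanishes as k
          grows.\<close>
        have "dot (L i j) (A *v z) - z $ i \<in> pb (k + e - c1 + e - c0)" if k: "k \<ge> \<bar>e\<bar>" for k
        proof -
          let ?z = "pp powi k *s z"
          have zk: "?z \<in> vpb (k + e)" using e by (simp add: vpb_pp_iff)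
          have "?v (x + ?z) - ?v (x + 0) - A *v (?z - 0) \<in> vpb ((k + e) + (k + e) - c1)"
            using zk k by (intro A(2)) auto
          then have h1: "dot (L i j) (?v (x + ?z) - ?v x - A *v ?z) \<in> pb ((k + e) + (k + e) - c1 - c0)"
            using dL by simp
          have h2: "dot (L i j) (?v (x + ?z)) = x $ i + pp powi k * z $ i"
            using x z by (simp add: L)
          have h3: "dot (L i j) (?v x) = x $ i" using x by (simp add: L)
          have h4: "dot (L i j) (A *v ?z) = pp powi k * dot (L i j) (A *v z)"
            by (simp add: matrix_vector_scale dot_scale_right)
          have "dot (L i j) (?v (x + ?z) - ?v x - A *v ?z) = pp powi k * (z $ i - dot (L i j) (A *v z))"
            by (simp only: dot_diff_right h2 h3 h4) (simp add: algebra_simps)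
          with h1 have "pp powi k * (z $ i - dot (L i j) (A *v z)) \<in> pb ((k + e) + (k + e) - c1 - c0)" by simp
          then have "z $ i - dot (L i j) (A *v z) \<in> pb ((k + e) + (k + e) - c1 - c0 - k)"
            by (simp only: pp_mult_iff)
          then show ?thesis by (subst pb_diff_commute) (auto elim: pb_anti)
        qed
        then have "dot (L i j) (A *v z) - z $ i = 0"
        proof (intro pb_all_zero)
          fix k assume "k \<ge> \<bar>e\<bar> + e - c1 + e - c0"
          then have "k - (e - c1 + e - c0) \<ge> \<bar>e\<bar>" by simp
          then have "dot (L i j) (A *v z) - z $ i \<in> pb (k - (e - c1 + e - c0) + e - c1 + e - c0)"
            by fact
          then show "dot (L i j) (A *v z) - z $ i \<in> pb k" by simp
        qed
        then show ?thesis by simp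
      qed
      \<comment> \<open>The functionals recover \<open>u\<close> from \<open>B *v u\<close>,
        coordinate \<open>j\<close> first and then the others; this gives the lower bound on
        \<open>B\<close>.\<close>
      have LB: "dot (L i j) (B *v u) = u $ j * x $ i + (u - u $ j *s axis j 1) $ i" for i u
      proof -
        have "(u - u $ j *s axis j 1) $ j = 0" by (simp add: axis_def)
        from LA[OF this, of i] show ?thesis
          unfolding B dot_add_right dot_scale_right L using x by simp
      qed
      show ?thesis
      proof (intro exI[of _ B] conjI allI impI)
        show "B *v axis j 1 = ?v x" by (simp add: B axis_def)
        fix u :: "'p padic ^ 'n" and k
        show "B *v u \<in> vpb (k - c)" if u: "u \<in> vpb k"
        proof -
          have uj: "u $ j \<in> pb k" using u by (rule vpb_nth)
          have ax: "axis j 1 \<in> (vpb 0 :: ('p padic ^ 'n) set)" by (auto simp: vpb_def axis_def)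
          have "u - u $ j *s axis j 1 \<in> vpb k"
            using u uj ax by (intro vpb_diff) (auto intro: vpb_scale[of _ k _ 0])
          then have "A *v (u - u $ j *s axis j 1) \<in> vpb (k - c)" using A(1) c by (meson vpb_anti diff_left_mono)
          moreover have "u $ j *s ?v x \<in> vpb (k - c)" using bnd[OF x(1)] uj c by (auto intro: vpb_scale[of _ k _ "-c1"])
          ultimately show ?thesis unfolding B by (rule vpb_add[rotated])
        qed
        show "u \<in> vpb (k - c)" if u: "B *v u \<in> vpb k"
        proof -
          have uj: "u $ j \<in> pb (k - c0)" using dL[OF u, of j j] LB[of j u] x(2) by (simp add: axis_def)
          have "u $ i \<in> pb (k - c0)" for i
          proof (cases "i = j")
            case False
            have "u $ j * x $ i + u $ i \<in> pb (k - c0)" using dL[OF u, of i j] LB[of i u] False by (simp add: axis_def)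
            moreover have "u $ j * x $ i \<in> pb (k - c0)"
              using uj vpb_nth[OF x(1), of i] by (auto intro: pb_mult'[of _ "k - c0" _ 0])
            ultimately have "u $ j * x $ i + u $ i - u $ j * x $ i \<in> pb (k - c0)" by (rule pb_diff)
            then show ?thesis by simp
          qed (use uj in simp)
          moreover have "k - c \<le> k - c0" using c by simp
          ultimately show ?thesis by (meson vpbI pb_anti)
        qed
        fix z z' :: "'p padic ^ 'n" and a b
        assume z: "0 \<le> a" "z $ j = 0" "z' $ j = 0" "z \<in> vpb a" "z' \<in> vpb a" "z - z' \<in> vpb b"
        have "?v (x + z) - ?v (x + z') - A *v (z - z') \<in> vpb (a + b - c1)" using z by (intro A(2))
        then show "?v (x + z) - ?v (x + z') - B *v (z - z') \<in> vpb (a + b - c)"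
          using z c Bz[of "z - z'"] by (auto intro: vpb_anti)
      qed
    qed
  qed
  then show ?thesis by blast
qed

section \<open>Random linear forms\<close>

text \<open>Row \<open>i\<close> holds the coefficients of the i-th polynomial, whose value at x is
  the linear form \<open>dot (\<Xi> i)\<close> at the Veronese image of x.\<close>

definition row_measure :: "nat \<Rightarrow> (nat \<Rightarrow> 'p::prime_card padic ^ 'l::finite) measure" where
  "row_measure n = (\<Pi>\<^sub>M i\<in>{1..n}. vec_uniform)"

definition kills :: "nat \<Rightarrow> (nat \<Rightarrow> 'p::prime_card padic ^ 'l::finite) \<Rightarrow> 'p padic ^ 'l \<Rightarrow> bool" where
  "kills n \<Xi> w \<longleftrightarrow> (\<forall>i\<in>{1..n}. dot (\<Xi> i) w = 0)"

definition integral_rows :: "nat \<Rightarrow> (nat \<Rightarrow> 'p::prime_card padic ^ 'l::finite) \<Rightarrow> bool" where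
  "integral_rows n \<Xi> \<longleftrightarrow> (\<forall>i\<in>{1..n}. \<Xi> i \<in> vpb 0)"

lemma prob_space_rows: "prob_space (row_measure n)"
  unfolding row_measure_def by (intro prob_space_PiM prob_space_vec_uniform)

lemma sets_rows [measurable_cong]: "sets (row_measure n) = sets (\<Pi>\<^sub>M i\<in>{1..n}. borel)"
  unfolding row_measure_def by (intro sets_PiM_cong) auto

lemma space_rows: "space (row_measure n) = {1..n} \<rightarrow>\<^sub>E UNIV"
  by (simp add: row_measure_def space_PiM)

lemma component_measurable_rows [measurable]: "i \<in> {1..n} \<Longrightarrow> (\<lambda>\<Xi>. \<Xi> i) \<in> measurable (row_measure n) borel"
  unfolding row_measure_def using measurable_component_singleton[of i "{1..n}" "\<lambda>_. vec_uniform"] by simp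

lemma rows_box:
  assumes "A \<in> sets borel"
  shows "{\<Xi> \<in> space (row_measure n). \<forall>i\<in>{1..n}. \<Xi> i \<in> A} \<in> sets (row_measure n)"
    and "emeasure (row_measure n) {\<Xi> \<in> space (row_measure n). \<forall>i\<in>{1..n}. \<Xi> i \<in> A} = emeasure vec_uniform A ^ n"
proof -
  interpret V: prob_space "vec_uniform :: ('a padic ^ 'b) measure" by (rule prob_space_vec_uniform)
  interpret P: product_prob_space "\<lambda>_. vec_uniform :: ('a padic ^ 'b) measure" "{1..n}" ..
  show "{\<Xi> \<in> space (row_measure n). \<forall>i\<in>{1..n}. \<Xi> i \<in> A} \<in> sets (row_measure n)"
    using assms by measurable
  show "emeasure (row_measure n) {\<Xi> \<in> space (row_measure n). \<forall>i\<in>{1..n}. \<Xi> i \<in> A} = emeasure vec_uniform A ^ n"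
    unfolding row_measure_def using assms P.emeasure_PiM_Collect[of "{1..n}" "\<lambda>_. A"] by simp
qed

lemma AE_integral_rows: "AE \<Xi> in row_measure n. integral_rows n \<Xi>"
proof -
  interpret prob_space "row_measure n" by (rule prob_space_rows)
  have "emeasure (row_measure n) {\<Xi> \<in> space (row_measure n). integral_rows n \<Xi>} = 1"
    using rows_box(2)[OF vpb_borel[of 0], of n] by (simp add: integral_rows_def vec_uniform_integral)
  then have "prob {\<Xi> \<in> space (row_measure n). integral_rows n \<Xi>} = 1" by (simp add: measure_def)
  then show ?thesis by (rule AE_mp[OF AE_prob_1]) simp
qed

lemma distr_rows:
  fixes \<phi> :: "'p::prime_card padic ^ 'l::finite \<Rightarrow> 'p padic ^ 'm::finite"
  assumes add: "\<And>x y. \<phi> (x + y) = \<phi> x + \<phi> y" and int: "\<And>x s. x \<in> vpb (int s) \<Longrightarrow> \<phi> x \<in> vpb (int s)"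
    and surj: "\<And>b. b \<in> vpb 0 \<Longrightarrow> \<exists>a\<in>vpb 0. \<phi> a = b"
  shows "compose {1..n} \<phi> \<in> measurable (row_measure n) (row_measure n)"
    and "distr (row_measure n) (row_measure n) (compose {1..n} \<phi>) = row_measure n"
proof -
  have m0: "\<phi> \<in> borel_measurable borel" by (rule measurable_additive[of \<phi>, OF add int])
  have m: "\<phi> \<in> measurable vec_uniform vec_uniform"
    using m0 by (simp add: measurable_cong_sets[OF sets_vec_uniform sets_vec_uniform])
  show "compose {1..n} \<phi> \<in> measurable (row_measure n) (row_measure n)"
    unfolding compose_def row_measure_def using m by measurable
  have "distr vec_uniform vec_uniform \<phi> = distr vec_uniform borel \<phi>"
    by (rule distr_cong) auto
  also have "\<dots> = vec_uniform" by (rule distr_vec_uniform[of \<phi>, OF add int surj])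
  finally have eq: "distr vec_uniform vec_uniform \<phi> = vec_uniform" .
  show "distr (row_measure n) (row_measure n) (compose {1..n} \<phi>) = row_measure n"
    unfolding row_measure_def using m
    by (subst distr_PiM_finite_prob_space') (auto intro: prob_space_vec_uniform simp: eq)
qed

lemma dot_pb_borel: "{x :: 'p::prime_card padic ^ 'l::finite. dot x y \<in> pb k} \<in> sets borel"
proof -
  obtain e where e: "y \<in> vpb e" using vpb_ex by blast
  have "open {x :: 'p padic ^ 'l. dot x y \<in> pb k}"
  proof (subst open_subopen, intro ballI)
    fix x :: "'p padic ^ 'l" assume x: "x \<in> {x. dot x y \<in> pb k}"
    have "x' \<in> {x. dot x y \<in> pb k}" if "x' - x \<in> vpb (k - e)" for x'
    proof -
      have "dot (x' - x) y + dot x y \<in> pb k" using that x e by (intro pb_add) (auto intro: dot_pb[of _ "k - e" _ e])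
      then show ?thesis by (simp flip: dot_add_left)
    qed
    then show "\<exists>T. open T \<and> x \<in> T \<and> T \<subseteq> {x. dot x y \<in> pb k}"
      by (intro exI[of _ "{x'. x' - x \<in> vpb (k - e)}"]) (auto intro: open_vec_coset)
  qed
  then show ?thesis by simp
qed

lemma saturated_closed:
  fixes A :: "('p::prime_card padic ^ 'l::finite) set"
  assumes "\<And>x y. x \<in> A \<Longrightarrow> y - x \<in> vpb k \<Longrightarrow> y \<in> A"
  shows "closed A"
  unfolding closed_def
proof (subst open_subopen, intro ballI)
  fix x assume x: "x \<in> - A"
  have "{y. y - x \<in> vpb k} \<subseteq> - A" using assms x vpb_diff_commute by blast
  then show "\<exists>T. open T \<and> x \<in> T \<and> T \<subseteq> - A"
    using open_vec_coset[of x k] by (intro exI[of _ "{y. y - x \<in> vpb k}"]) auto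
qed

text \<open>The existential ranges over an uncountable set. By compactness an exact zero in
  \<open>C\<close> exists as soon as approximate zeros of every precision do, and these can be
  sought in a countable net, so countable operations suffice.\<close>

lemma kills_measurable:
  fixes C :: "('p::prime_card padic ^ 'l::finite) set"
  assumes C: "compact C"
  shows "{\<Xi> \<in> space (row_measure n). \<exists>w\<in>C. kills n \<Xi> w} \<in> sets (row_measure n)"
proof -
  have "\<exists>T. finite T \<and> T \<subseteq> C \<and> (\<forall>w\<in>C. \<exists>t\<in>T. w - t \<in> vpb (int s))" for s
  proof -
    have "C \<subseteq> (\<Union>t\<in>C. {w. w - t \<in> vpb (int s)})"
    proof
      fix w assume "w \<in> C"
      then show "w \<in> (\<Union>t\<in>C. {w. w - t \<in> vpb (int s)})" by (intro UN_I[of w]) simp_all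
    qed
    then obtain T where T: "T \<subseteq> C" "finite T" "C \<subseteq> (\<Union>t\<in>T. {w. w - t \<in> vpb (int s)})"
      using compactE_image[OF C, of C "\<lambda>t. {w. w - t \<in> vpb (int s)}"] open_vec_coset by metis
    show ?thesis
    proof (intro exI[of _ T] conjI T ballI)
      fix w assume "w \<in> C"
      then have "w \<in> (\<Union>t\<in>T. {w. w - t \<in> vpb (int s)})" using T(3) by (rule subsetD[rotated])
      then show "\<exists>t\<in>T. w - t \<in> vpb (int s)" by simp
    qed
  qed
  then obtain T where T: "\<And>s. finite (T s)" "\<And>s. T s \<subseteq> C" "\<And>s w. w \<in> C \<Longrightarrow> \<exists>t\<in>T s. w - t \<in> vpb (int s)"
    by metis
  let ?G = "\<lambda>s t. {\<Xi> \<in> space (row_measure n). \<forall>i\<in>{1..n}. \<Xi> i \<in> {x. dot x t \<in> pb (int s)}}"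
  have bound: "\<exists>e\<ge>0. \<forall>i\<in>{1..n}. \<Xi> i \<in> vpb (- e)" for \<Xi> :: "nat \<Rightarrow> 'p padic ^ 'l"
  proof -
    have "finite ((\<lambda>(i, k). \<Xi> i $ k) ` ({1..n} \<times> UNIV))" by simp
    from pb_bound_finite[OF this] obtain e where "e \<ge> 0" "\<forall>s\<in>(\<lambda>(i, k). \<Xi> i $ k) ` ({1..n} \<times> UNIV). s \<in> pb (- e)" by blast
    then show ?thesis by (intro exI[of _ e]) (auto simp: vpb_def)
  qed
  have "{\<Xi> \<in> space (row_measure n). \<exists>w\<in>C. kills n \<Xi> w} = (\<Inter>s. \<Union>t\<in>(\<Union>s. T s). ?G s t)"
  proof (intro equalityI subsetI)
    fix \<Xi> assume "\<Xi> \<in> {\<Xi> \<in> space (row_measure n). \<exists>w\<in>C. kills n \<Xi> w}"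
    then obtain w where w: "\<Xi> \<in> space (row_measure n)" "w \<in> C" "kills n \<Xi> w" by blast
    obtain e where e: "e \<ge> 0" "\<forall>i\<in>{1..n}. \<Xi> i \<in> vpb (- e)" using bound by blast
    show "\<Xi> \<in> (\<Inter>s. \<Union>t\<in>(\<Union>s. T s). ?G s t)"
    proof
      fix s
      \<comment> \<open>The rows may have denominators up to p^e here, so the net must be finer by
        \<open>e\<close> digits.\<close>
      obtain t where t: "t \<in> T (s + nat e)" "w - t \<in> vpb (int (s + nat e))" using T(3) w(2) by blast
      have "dot (\<Xi> i) t \<in> pb (int s)" if i: "i \<in> {1..n}" for i
      proof -
        have "dot (\<Xi> i) (w - t) \<in> pb (int s)" using e i t(2) by (intro dot_pb[of _ "- e"]) auto
        moreover have "dot (\<Xi> i) w = 0" using w(3) i by (simp add: kills_def)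
        ultimately show ?thesis by (simp add: dot_diff_right)
      qed
      then have "\<Xi> \<in> ?G s t" using w(1) by simp
      moreover have "t \<in> (\<Union>s. T s)" using t(1) by blast
      ultimately show "\<Xi> \<in> (\<Union>t\<in>(\<Union>s. T s). ?G s t)" by (rule UN_I[rotated])
    qed
  next
    fix \<Xi> assume \<Xi>: "\<Xi> \<in> (\<Inter>s. \<Union>t\<in>(\<Union>s. T s). ?G s t)"
    have *: "\<exists>t. t \<in> C \<and> \<Xi> \<in> ?G s t" for s
    proof -
      have "\<Xi> \<in> (\<Union>t\<in>(\<Union>s. T s). ?G s t)" using \<Xi> by (rule INT_D) simp
      then obtain t where "t \<in> (\<Union>s. T s)" "\<Xi> \<in> ?G s t" by (rule UN_E)
      then show ?thesis using T(2) by (intro exI[of _ t]) auto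
    qed
    have sp: "\<Xi> \<in> space (row_measure n)" using *[of 0] by (elim exE conjE CollectE)
    have "\<forall>s. \<exists>t. t \<in> C \<and> (\<forall>i\<in>{1..n}. dot (\<Xi> i) t \<in> pb (int s))"
    proof
      fix s
      obtain t where t: "t \<in> C" "\<Xi> \<in> ?G s t" using *[of s] by (elim exE conjE)
      show "\<exists>t. t \<in> C \<and> (\<forall>i\<in>{1..n}. dot (\<Xi> i) t \<in> pb (int s))"
        using t by (intro exI[of _ t]) simp
    qed
    then obtain t where t: "\<And>s. t s \<in> C" "\<And>s i. i \<in> {1..n} \<Longrightarrow> dot (\<Xi> i) (t s) \<in> pb (int s)" by metis
    \<comment> \<open>A limit point of approximate zeros is an exact zero.\<close>
    obtain w \<rho> where w: "w \<in> C" "strict_mono \<rho>" "(t \<circ> \<rho>) \<longlonglongrightarrow> w"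
      using seq_compactE[OF C[THEN compact_imp_seq_compact], of t] t(1) by blast
    obtain e where e: "e \<ge> 0" "\<forall>i\<in>{1..n}. \<Xi> i \<in> vpb (- e)" using bound by blast
    have "dot (\<Xi> i) w = 0" if i: "i \<in> {1..n}" for i
    proof (rule pb_all_zero[of 0])
      fix k :: int assume k: "0 \<le> k"
      have "eventually (\<lambda>m. (t \<circ> \<rho>) m \<in> {x. x - w \<in> vpb (k + e)}) sequentially"
        by (rule topological_tendstoD[OF w(3) open_vec_coset]) simp
      then obtain N where N: "\<And>m. m \<ge> N \<Longrightarrow> t (\<rho> m) - w \<in> vpb (k + e)" by (auto simp: eventually_sequentially)
      define m where "m = max N (nat k)"
      have "dot (\<Xi> i) (t (\<rho> m) - w) \<in> pb k"
        using e i N[of m] by (intro dot_pb[of _ "- e" _ "k + e"]) (auto simp: m_def)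
      moreover have "dot (\<Xi> i) (t (\<rho> m)) \<in> pb k"
        using t(2)[OF i, of "\<rho> m"] seq_suble[OF w(2), of m] k by (auto elim!: pb_anti simp: m_def)
      ultimately have "dot (\<Xi> i) (t (\<rho> m)) - dot (\<Xi> i) (t (\<rho> m) - w) \<in> pb k" by (intro pb_diff)
      then show "dot (\<Xi> i) w \<in> pb k" by (simp add: dot_diff_right)
    qed
    then show "\<Xi> \<in> {\<Xi> \<in> space (row_measure n). \<exists>w\<in>C. kills n \<Xi> w}"
      using sp w(1) by (intro CollectI conjI bexI[of _ w]) (simp_all add: kills_def)
  qed
  also have "\<dots> \<in> sets (row_measure n)"
  proof (intro sets.countable_INT' sets.countable_UN' image_subsetI)
    show "countable (\<Union>s. T s)" using T(1) by (auto intro: countable_finite)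
  qed (use rows_box(1)[OF dot_pb_borel] in auto)
  finally show ?thesis .
qed

lemma emeasure_rows_dot2:
  fixes y w :: "'p::prime_card padic ^ 'l::finite" and n r k :: nat
  assumes "y \<in> vpb 0" "y $ l = 1" "w \<in> vpb 0" "w $ l = 0" "w $ l' = 1"
  defines "A \<equiv> {\<Xi> \<in> space (row_measure n). \<forall>i\<in>{1..n}. \<Xi> i \<in> {x. dot x y \<in> pb (int r) \<and> dot x w \<in> pb (int k)}}"
  shows "A \<in> sets (row_measure n)" and "emeasure (row_measure n) A = ennreal (1 / real CARD('p) ^ (n * (r + k)))"
proof -
  note * = emeasure_vec_uniform_dot2[OF assms(1-5), of r k]
  show "A \<in> sets (row_measure n)" unfolding A_def by (rule rows_box(1)[OF *(1)])
  show "emeasure (row_measure n) A = ennreal (1 / real CARD('p) ^ (n * (r + k)))"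
    unfolding A_def rows_box(2)[OF *(1)] *(2)
    by (simp add: ennreal_power power_divide mult.commute flip: power_mult)
qed

text \<open>
  Union bound over a net of the directions \<open>z\<close>: there are about \<open>p\<^bsup>k(n-1)\<^esup>\<close> of them, and for each the
  probability of \<open>n\<close> forms being small is about \<open>p\<^bsup>-kn\<^esup>\<close>.
\<close>

lemma degenerate_bound:
  fixes y :: "'p::prime_card padic ^ 'l::finite" and W :: "'p padic ^ 'n::finite ^ 'l" and c k r n :: nat
  assumes card: "CARD('n) = n + 1" and n: "n \<ge> 1" and kc: "c \<le> k"
    and y: "y \<in> vpb 0" "y $ l = 1"
    and W0: "\<And>z. (W *v z) $ l = 0"
    and W1: "\<And>z a. z \<in> vpb a \<Longrightarrow> W *v z \<in> vpb (a - int c)"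
    and W2: "\<And>z a. z $ j = 0 \<Longrightarrow> W *v z \<in> vpb a \<Longrightarrow> z \<in> vpb (a - int c)"
  obtains Bad where "Bad \<in> sets (row_measure n)"
    "emeasure (row_measure n) Bad \<le> ennreal (real n * real CARD('p) ^ (2 * n * c) / real CARD('p) ^ k / real CARD('p) ^ (n * r))"
    "\<And>\<Xi> z a. \<Xi> \<in> space (row_measure n) \<Longrightarrow> \<Xi> \<notin> Bad \<Longrightarrow> integral_rows n \<Xi> \<Longrightarrow> (\<And>i. i \<in> {1..n} \<Longrightarrow> dot (\<Xi> i) y \<in> pb (int r)) \<Longrightarrow>
      z $ j = 0 \<Longrightarrow> (\<And>i. i \<in> {1..n} \<Longrightarrow> dot (\<Xi> i) (W *v z) \<in> pb a) \<Longrightarrow> z \<in> vpb (a - int k)"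
proof -
  let ?q = "real CARD('p)"
  \<comment> \<open>\<open>W\<close> may lose \<open>c\<close> digits, so rounding to
    \<open>s\<close> digits preserves the values of \<open>W\<close> to \<open>k\<close>
    digits.\<close>
  define s where "s = k + c"
  \<comment> \<open>Directions with coordinate \<open>j\<close> zero, normalised at
    \<open>i0\<close>: n - 1 of the n + 1 coordinates stay free, one fewer than the number of forms.
    This deficit is what yields p^-k.\<close>
  define net :: "'n \<Rightarrow> ('p padic ^ 'n) set" where
    "net i0 = (\<lambda>g. \<chi> i. if i = j then 0 else if i = i0 then 1 else of_nat (g i)) ` ((UNIV - {j, i0}) \<rightarrow>\<^sub>E {..<CARD('p) ^ s})" for i0
  have fin: "finite (net i0)" for i0 unfolding net_def by (intro finite_imageI finite_PiE) auto
  have card_net: "card (net i0) \<le> CARD('p) ^ (s * (n - 1))" if "i0 \<noteq> j" for i0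
  proof -
    have "card (net i0) \<le> card ((UNIV - {j, i0}) \<rightarrow>\<^sub>E {..<CARD('p) ^ s})"
      unfolding net_def by (intro card_image_le finite_PiE) auto
    also have "\<dots> = (CARD('p) ^ s) ^ card (UNIV - {j, i0})" by (subst card_PiE) auto
    also have "card (UNIV - {j, i0}) = n - 1" using that card by (subst card_Diff_subset) auto
    finally show ?thesis by (simp add: power_mult)
  qed
  define Net where "Net = (\<Union>i0\<in>UNIV - {j}. net i0)"
  have finN: "finite Net" unfolding Net_def by (intro finite_UN_I fin) simp
  have cardN: "card Net \<le> n * CARD('p) ^ (s * (n - 1))"
  proof -
    have "card Net \<le> (\<Sum>i0\<in>UNIV - {j}. card (net i0))" unfolding Net_def by (rule card_UN_le) simp
    also have "\<dots> \<le> (\<Sum>i0\<in>UNIV - {j}. CARD('p) ^ (s * (n - 1)))" by (intro sum_mono card_net) auto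
    also have "\<dots> = n * CARD('p) ^ (s * (n - 1))" using card by (simp add: card_Diff_singleton)
    finally show ?thesis .
  qed
  \<comment> \<open>By \<open>W2\<close> the vector \<open>W *v z\<close> is not smaller than p^-c,
    so rescaling it to have a coordinate 1 costs at most \<open>c\<close> digits.\<close>
  have "\<exists>u l'. u *s (W *v z) \<in> vpb 0 \<and> (u *s (W *v z)) $ l' = 1 \<and> u \<in> pb (- int c)" if zN: "z \<in> Net" for z
  proof -
    obtain i0 where i0': "i0 \<noteq> j" "z \<in> net i0" using zN unfolding Net_def by blast
    then obtain g where "z = (\<chi> i. if i = j then 0 else if i = i0 then 1 else of_nat (g i))"
      unfolding net_def by (elim imageE)
    then have i0: "i0 \<noteq> j" "z $ i0 = 1" "z $ j = 0" using i0'(1) by simp_all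
    have "z \<notin> vpb 1" using i0(2) vpb_nth[of z 1 i0] by auto
    then have Wz: "W *v z \<notin> vpb (1 + int c)" using W2[OF i0(3), of "1 + int c"] by auto
    then have "W *v z \<noteq> 0" by auto
    then obtain e where e: "\<And>j. W *v z \<in> vpb j \<longleftrightarrow> j \<le> e" using vpb_exact by blast
    obtain l' where l': "(W *v z) $ l' \<notin> pb (e + 1)" using e[of "e + 1"] by (auto simp: vpb_def)
    have u: "inverse ((W *v z) $ l') \<in> pb (- e)" by (rule pb_inverse[OF l'])
    have ec: "e \<le> int c" using Wz e by simp
    have nz: "(W *v z) $ l' \<noteq> 0" using l' by (metis pb_0)
    show ?thesis
    proof (intro exI conjI)
      show "inverse ((W *v z) $ l') *s (W *v z) \<in> vpb 0" using e[of e] by (intro vpb_scale[OF u, of _ e]) auto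
      show "(inverse ((W *v z) $ l') *s (W *v z)) $ l' = 1" using nz by simp
      show "inverse ((W *v z) $ l') \<in> pb (- int c)" using u ec by (auto intro: pb_anti)
    qed
  qed
  then have "\<forall>z\<in>Net. \<exists>ul. fst ul *s (W *v z) \<in> vpb 0 \<and> (fst ul *s (W *v z)) $ snd ul = 1 \<and> fst ul \<in> pb (- int c)"
    by simp
  from bchoice[OF this] obtain U where U: "\<forall>z\<in>Net. fst (U z) *s (W *v z) \<in> vpb 0 \<and>
      (fst (U z) *s (W *v z)) $ snd (U z) = 1 \<and> fst (U z) \<in> pb (- int c)" by blast
  define u l' where "u z = fst (U z)" and "l' z = snd (U z)" for z
  have u: "\<And>z. z \<in> Net \<Longrightarrow> u z *s (W *v z) \<in> vpb 0" "\<And>z. z \<in> Net \<Longrightarrow> (u z *s (W *v z)) $ l' z = 1"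
    "\<And>z. z \<in> Net \<Longrightarrow> u z \<in> pb (- int c)" using U unfolding u_def l'_def by blast+
  \<comment> \<open>The event is joint: smallness at \<open>y\<close> to \<open>r\<close> digits and
    at the rescaled direction to \<open>k - c\<close> digits. Coordinate \<open>l\<close> is 1 at
    \<open>y\<close> and 0 at the direction, so the two are independent and the factor p^(-nr)
    appears.\<close>
  define E where "E z = {\<Xi> \<in> space (row_measure n). \<forall>i\<in>{1..n}. \<Xi> i \<in>
    {x. dot x y \<in> pb (int r) \<and> dot x (u z *s (W *v z)) \<in> pb (int (k - c))}}" for z
  have E: "E z \<in> sets (row_measure n)" "emeasure (row_measure n) (E z) = ennreal (1 / ?q ^ (n * (r + (k - c))))" if "z \<in> Net" for z
  proof -
    have "(u z *s (W *v z)) $ l = 0" using W0 by simp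
    note * = emeasure_rows_dot2[OF y u(1)[OF that] this u(2)[OF that], of n r "k - c"]
    show "E z \<in> sets (row_measure n)" unfolding E_def by (rule *(1))
    show "emeasure (row_measure n) (E z) = ennreal (1 / ?q ^ (n * (r + (k - c))))" unfolding E_def by (rule *(2))
  qed
  show thesis
  proof (rule that)
    show "(\<Union>z\<in>Net. E z) \<in> sets (row_measure n)" using finN E(1) by blast
    have "emeasure (row_measure n) (\<Union>z\<in>Net. E z) \<le> (\<Sum>z\<in>Net. emeasure (row_measure n) (E z))"
      using finN E(1) by (intro emeasure_subadditive_finite) auto
    also have "\<dots> = (\<Sum>z\<in>Net. ennreal (1 / ?q ^ (n * (r + (k - c)))))" by (intro sum.cong refl E(2))
    also have "\<dots> = ennreal (real (card Net) * (1 / ?q ^ (n * (r + (k - c)))))"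
      by (subst ennreal_mult) (simp_all add: ennreal_of_nat_eq_real_of_nat)
    also have "\<dots> \<le> ennreal (real n * ?q ^ (2 * n * c) / ?q ^ k / ?q ^ (n * r))"
    proof (rule ennreal_leI)
      have q: "?q > 1" by (rule card_gt_1)
      have "real (card Net) * (1 / ?q ^ (n * (r + (k - c)))) \<le> real n * ?q ^ (s * (n - 1)) * (1 / ?q ^ (n * (r + (k - c))))"
        using cardN by (intro mult_right_mono) (auto simp flip: of_nat_power of_nat_mult)
      also have "\<dots> \<le> real n * ?q ^ (2 * n * c) / ?q ^ k / ?q ^ (n * r)"
      proof -
        \<comment> \<open>The exponent (k + c)(n - 1) of the net is set against n(r + k - c) from
          the events; the difference is k + nr up to a multiple of c.\<close>
        have "?q ^ (s * (n - 1)) * ?q ^ (k + n * r) \<le> ?q ^ (2 * n * c) * ?q ^ (n * (r + (k - c)))"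
        proof -
          obtain t where t: "k = c + t" using kc le_Suc_ex by blast
          obtain m where m: "n = Suc m" using n by (cases n) auto
          have "s * (n - 1) + (k + n * r) \<le> 2 * n * c + n * (r + (k - c))"
            by (simp add: s_def t m algebra_simps)
          then show ?thesis using q by (simp flip: power_add)
        qed
        then have "?q ^ (s * (n - 1)) / ?q ^ (n * (r + (k - c))) \<le> ?q ^ (2 * n * c) / ?q ^ (k + n * r)"
          using q by (simp add: field_simps)
        then have "real n * (?q ^ (s * (n - 1)) / ?q ^ (n * (r + (k - c)))) \<le> real n * (?q ^ (2 * n * c) / ?q ^ (k + n * r))"
          by (intro mult_left_mono) auto
        then show ?thesis by (simp add: power_add)
      qed
      finally show "real (card Net) * (1 / ?q ^ (n * (r + (k - c)))) \<le> real n * ?q ^ (2 * n * c) / ?q ^ k / ?q ^ (n * r)" .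
    qed
    finally show "emeasure (row_measure n) (\<Union>z\<in>Net. E z) \<le> ennreal (real n * ?q ^ (2 * n * c) / ?q ^ k / ?q ^ (n * r))" .
    fix \<Xi> z a
    assume \<Xi>: "\<Xi> \<in> space (row_measure n)" "\<Xi> \<notin> (\<Union>z\<in>Net. E z)" "integral_rows n \<Xi>" and
      ny: "\<And>i. i \<in> {1..n} \<Longrightarrow> dot (\<Xi> i) y \<in> pb (int r)" and
      z: "z $ j = 0" "\<And>i. i \<in> {1..n} \<Longrightarrow> dot (\<Xi> i) (W *v z) \<in> pb a"
    show "z \<in> vpb (a - int k)"
    proof (rule ccontr)
      assume nz: "z \<notin> vpb (a - int k)"
      then have "z \<noteq> 0" by auto
      then obtain b where b: "\<And>j. z \<in> vpb j \<longleftrightarrow> j \<le> b" using vpb_exact by blast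
      have ba: "b < a - int k" using nz b by simp
      obtain i0 where i0: "z $ i0 \<notin> pb (b + 1)" using b[of "b + 1"] by (auto simp: vpb_def)
      have i0j: "i0 \<noteq> j" using i0 z(1) by auto
      \<comment> \<open>Since \<open>z\<close> has exact exponent \<open>b < a - k\<close>, dividing
        by its leading coordinate leaves form values of exponent at least k. Rounding this unit
        direction to the net then puts \<open>\<Xi>\<close> into a bad event.\<close>
      define t where "t = inverse (z $ i0) *s z"
      have iz: "inverse (z $ i0) \<in> pb (- b)" by (rule pb_inverse[OF i0])
      have nz0: "z $ i0 \<noteq> 0" using i0 by (metis pb_0)
      have "t \<in> vpb 0" unfolding t_def using b[of b] by (intro vpb_scale[OF iz, of _ b]) auto
      then have t: "t \<in> vpb 0" "t $ i0 = 1" "t $ j = 0"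
        using nz0 z(1) by (simp_all add: t_def)
      have dt: "dot (\<Xi> i) (W *v t) \<in> pb (int k)" if "i \<in> {1..n}" for i
        unfolding t_def matrix_vector_scale dot_scale_right
        using z(2)[OF that] ba by (intro pb_mult'[OF iz, of _ a]) auto
      have "\<forall>i. \<exists>m<CARD('p) ^ s. t $ i - of_nat m \<in> pb (int s)"
        using t(1) padic_residue by (auto simp: vpb_def)
      then obtain g where g: "\<And>i. g i < CARD('p) ^ s" "\<And>i. t $ i - of_nat (g i) \<in> pb (int s)" by metis
      define t' :: "'p padic ^ 'n" where "t' = (\<chi> i. if i = j then 0 else if i = i0 then 1 else of_nat (g i))"
      have t'N: "t' \<in> Net"
        unfolding Net_def net_def t'_def using i0j g(1)
        by (intro UN_I[of i0] image_eqI[of _ _ "restrict g (UNIV - {j, i0})"]) (auto simp: vec_eq_iff)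
      have "t' - t \<in> vpb (int s)"
        using g(2) t i0j by (auto simp: t'_def intro!: vpbI) (simp add: pb_diff_commute)
      then have "W *v (t' - t) \<in> vpb (int k)" using W1[of "t' - t" "int s"] by (simp add: s_def)
      then have dd: "dot (\<Xi> i) (W *v (t' - t)) \<in> pb (int k)" if "i \<in> {1..n}" for i
        using \<Xi>(3) that by (intro dot_pb[of _ 0 _ "int k"]) (auto simp: integral_rows_def)
      have "dot (\<Xi> i) (W *v t') \<in> pb (int k)" if i: "i \<in> {1..n}" for i
      proof -
        have "W *v t' = W *v (t' - t) + W *v t" by (simp flip: matrix_vector_right_distrib)
        then show ?thesis using pb_add[OF dd[OF i] dt[OF i]] by (simp add: dot_add_right)
      qed
      then have "dot (\<Xi> i) (u t' *s (W *v t')) \<in> pb (int (k - c))" if "i \<in> {1..n}" for i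
        unfolding dot_scale_right using that kc by (intro pb_mult'[OF u(3)[OF t'N], of _ "int k"]) auto
      then have "\<Xi> \<in> E t'" using \<Xi>(1) ny by (simp add: E_def)
      then show False using \<Xi>(2) t'N by blast
    qed
  qed
qed

text \<open>A vector not smaller than p^-c keeps its projective position up to p^-r under a
  perturbation with c further digits; the extra digit keeps the rescaled vector on the sphere even
  for r = 0.\<close>

lemma near_add:
  fixes w e :: "'p::prime_card padic ^ 'l::finite"
  assumes w: "w \<notin> vpb (c + 1)" and e: "e \<in> vpb (int r + c + 1)"
  shows "near r (w + e) w" and "w + e \<noteq> 0"
proof -
  have "w \<noteq> 0" using w by auto
  then obtain k where k: "\<And>j. w \<in> vpb j \<longleftrightarrow> j \<le> k" using vpb_exact by blast
  have kc: "k \<le> c" using w k by simp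
  obtain l where l: "w $ l \<notin> pb (k + 1)" using k[of "k + 1"] by (auto simp: vpb_def)
  have nz: "w $ l \<noteq> 0" using l by (metis pb_0)
  define t where "t = inverse (w $ l)"
  have tk: "t \<in> pb (- k)" unfolding t_def by (rule pb_inverse[OF l])
  have t0: "t \<noteq> 0" using nz by (simp add: t_def)
  have w1: "t *s w \<in> vpb 0" "(t *s w) $ l = 1"
    using k[of k] nz by (auto simp: t_def intro!: vpb_scale[OF tk[unfolded t_def], of _ k])
  have te: "t *s e \<in> vpb (int r + 1)" using kc by (intro vpb_scale[OF tk e]) simp
  have wS: "t *s w \<in> unit_sphere" by (rule normal_in_sphere[OF w1])
  have e1: "(t *s e) $ l \<in> pb 1" using vpb_nth[OF te, of l] by (rule pb_anti) simp
  have sum0: "t *s w + t *s e \<in> vpb 0" using w1(1) vpb_anti[OF te, of 0] by (intro vpb_add) auto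
  have "t *s w + t *s e \<notin> vpb 1"
  proof
    assume "t *s w + t *s e \<in> vpb 1"
    then have "(t *s w + t *s e) $ l \<in> pb 1" by (rule vpb_nth)
    then have "(t *s w) $ l + (t *s e) $ l - (t *s e) $ l \<in> pb 1" using e1 pb_diff by (metis vector_add_component)
    then have "(t *s w) $ l \<in> pb 1" by (simp only: add_diff_cancel)
    then show False using w1(2) by simp
  qed
  with sum0 have S: "t *s w + t *s e \<in> unit_sphere" by (simp add: unit_sphere_iff)
  have "(t *s w + t *s e) - (t *s w + t *s e) $ l *s (t *s w) = t *s e - (t *s e) $ l *s (t *s w)"
    unfolding vector_add_component w1(2) by (simp add: vec_eq_iff algebra_simps)
  also have "\<dots> \<in> vpb (int r)"
    using w1(1) by (intro vpb_diff vpb_anti[OF te] vpb_scale[OF vpb_nth[OF te], of _ 0]) auto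
  finally have "near r (t *s w + t *s e) (t *s w)" unfolding near_normal[OF w1 S] .
  then show "near r (w + e) w"
    unfolding vector_add_ldistrib[symmetric] near_scale_left[OF t0] near_scale_right[OF t0] .
  show "w + e \<noteq> 0"
    using sphere_nonzero[OF S] unfolding vector_add_ldistrib[symmetric] by (metis vec.scale_zero_right)
qed

lemma near_perturb:
  fixes w e :: "'p::prime_card padic ^ 'l::finite"
  assumes w: "w \<notin> vpb (c + 1)" and e: "e \<in> vpb (int r + c + 1)" and y: "y \<noteq> 0" and near: "near r w y"
  shows "near r (w + e) y"
proof -
  have "w \<noteq> 0" using w by auto
  from near_trans[OF near_add(2)[OF w e] this y near_add(1)[OF w e] near] show ?thesis .
qed

section \<open>Integral matrices with an integral left inverse, as isometric embeddings\<close>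

definition integral_matrix :: "'p::prime_card padic ^ 'n::finite ^ 'l::finite \<Rightarrow> bool" where
  "integral_matrix E \<longleftrightarrow> (\<forall>i j. E $ i $ j \<in> pb 0)"

lemma integral_matrix_mult:
  assumes E: "integral_matrix E" and x: "x \<in> vpb k"
  shows "E *v x \<in> vpb k"
proof (rule vpbI)
  fix i
  have "E $ i $ j * x $ j \<in> pb k" for j
    using E by (intro pb_mult'[of _ 0 _ k] vpb_nth[OF x]) (simp_all add: integral_matrix_def)
  then show "(E *v x) $ i \<in> pb k" unfolding matrix_vector_mult_def vec_lambda_beta by (rule pb_sum)
qed

lemma integral_matrix_sphere:
  assumes "integral_matrix E" "integral_matrix E'" "E' ** E = mat 1" "s \<in> unit_sphere"
  shows "E *v s \<in> unit_sphere"
proof -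
  have "E' *v (E *v s) = s" using assms(3) by (simp add: matrix_vector_mul_assoc)
  then show ?thesis
    using integral_matrix_mult[OF assms(1), of s 0] integral_matrix_mult[OF assms(2), of "E *v s" 1] assms(4)
    by (auto simp: unit_sphere_iff)
qed

lemma near_integral_matrix:
  assumes E: "integral_matrix E" and S: "s \<in> unit_sphere" "t \<in> unit_sphere" "E *v s \<in> unit_sphere" "E *v t \<in> unit_sphere"
    and near: "near r s t"
  shows "near r (E *v s) (E *v t)"
proof -
  obtain c l where c: "c \<noteq> 0" "(c *s t) $ l = 1" "c *s t \<in> vpb 0" using normalise_ex[OF sphere_nonzero[OF S(2)]] .
  define t' where "t' = c *s t"
  note c = c[folded t'_def]
  have "near r s t'" using near c by (simp add: t'_def)
  then have e: "s - s $ l *s t' \<in> vpb (int r)" using near_normal[OF c(3,2) S(1)] by simp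
  have "E *v t' = c *s (E *v t)" by (simp add: t'_def matrix_vector_scale)
  then have Et': "E *v t' \<noteq> 0" using c(1) sphere_nonzero[OF S(4)] by simp
  have Et0: "E *v t' \<in> vpb 0" by (rule integral_matrix_mult[OF E c(3)])
  have tS: "t' \<in> unit_sphere" by (rule normal_in_sphere[OF c(3,2)])
  have "padic_abs c = 1" using tS S(2) by (simp add: t'_def unit_sphere_def vec_abs_scale)
  then have EtS: "E *v t' \<in> unit_sphere"
    using S(4) \<open>E *v t' = c *s (E *v t)\<close> by (simp add: unit_sphere_def vec_abs_scale)
  define \<epsilon> where "\<epsilon> = E *v (s - s $ l *s t')"
  have \<epsilon>: "\<epsilon> \<in> vpb (int r)" unfolding \<epsilon>_def by (rule integral_matrix_mult[OF E e])
  have Es: "E *v s = \<epsilon> + s $ l *s (E *v t')"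
    by (simp add: \<epsilon>_def matrix_vector_mult_diff_distrib matrix_vector_scale)
  have "near r (E *v s) (E *v t')"
    unfolding near_unit[OF S(3) EtS]
  proof (intro allI)
    fix i j
    have "(E *v s) $ i * (E *v t') $ j - (E *v s) $ j * (E *v t') $ i = \<epsilon> $ i * (E *v t') $ j - \<epsilon> $ j * (E *v t') $ i"
      unfolding Es by (simp add: algebra_simps)
    also have "\<dots> \<in> pb (int r)"
      using \<epsilon> Et0 by (intro pb_diff pb_mult'[of _ "int r" _ 0] vpb_nth) auto
    finally show "(E *v s) $ i * (E *v t') $ j - (E *v s) $ j * (E *v t') $ i \<in> pb (int r)" .
  qed
  then show ?thesis using c(1) \<open>E *v t' = c *s (E *v t)\<close> by simp
qed

text \<open>Both \<open>E\<close> and its left inverse are integral, so neither can increase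
  projective distances.\<close>

lemma near_integral_matrix_iff:
  assumes E: "integral_matrix E" "integral_matrix E'" "E' ** E = mat 1" and nz: "s \<noteq> 0" "t \<noteq> 0"
  shows "near r (E *v s) (E *v t) \<longleftrightarrow> near r s t"
proof -
  have inv: "E' *v (E *v x) = x" for x using E(3) by (simp add: matrix_vector_mul_assoc)
  obtain a where a: "a \<noteq> 0" "a *s s \<in> unit_sphere" using unit_representative[OF nz(1)] .
  obtain b where b: "b \<noteq> 0" "b *s t \<in> unit_sphere" using unit_representative[OF nz(2)] .
  note S = a(2) b(2) integral_matrix_sphere[OF E a(2)] integral_matrix_sphere[OF E b(2)]
  have "near r (E *v (a *s s)) (E *v (b *s t)) \<longleftrightarrow> near r (a *s s) (b *s t)"
    using near_integral_matrix[OF E(1) S] near_integral_matrix[OF E(2) S(3,4)] S(1,2) unfolding inv by blast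
  then show ?thesis using a(1) b(1) by (simp add: matrix_vector_scale)
qed

lemma dot_transpose: "dot x (E *v s) = dot (transpose E *v x) s" for E :: "'a::comm_ring_1 ^ 'n::finite ^ 'l::finite"
proof -
  have "dot x (E *v s) = (\<Sum>i\<in>UNIV. \<Sum>j\<in>UNIV. x $ i * (E $ i $ j * s $ j))"
    by (simp add: dot_def matrix_vector_mult_def sum_distrib_left)
  also have "\<dots> = (\<Sum>j\<in>UNIV. \<Sum>i\<in>UNIV. x $ i * (E $ i $ j * s $ j))" by (rule sum.swap)
  also have "\<dots> = dot (transpose E *v x) s"
    by (simp add: dot_def matrix_vector_mult_def transpose_def sum_distrib_left ac_simps)
  finally show ?thesis .
qed

section \<open>Hitting probabilities for systems of linear forms\<close>

definition hits :: "nat \<Rightarrow> nat \<Rightarrow> 'p::prime_card padic ^ 'n::finite \<Rightarrow> (nat \<Rightarrow> 'p padic ^ 'n) set" where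
  "hits n r t = {\<Xi> \<in> space (row_measure n). \<exists>s. s \<noteq> 0 \<and> near r s t \<and> kills n \<Xi> s}"

lemma kills_scale: "a \<noteq> 0 \<Longrightarrow> kills n \<Xi> (a *s w) \<longleftrightarrow> kills n \<Xi> w"
  by (simp add: kills_def dot_scale_right)

lemma compact_sphere_saturated:
  fixes A :: "('p::prime_card padic ^ 'n::finite) set"
  assumes "A \<subseteq> unit_sphere" "\<And>x y. x \<in> A \<Longrightarrow> y - x \<in> vpb k \<Longrightarrow> y \<in> A"
  shows "compact A"
proof -
  have "closed A" using assms(2) by (rule saturated_closed)
  then have "compact (vpb 0 \<inter> A)" using compact_vpb0 by (intro compact_Int_closed)
  moreover have "vpb 0 \<inter> A = A" using assms(1) by (auto simp: unit_sphere_iff)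
  ultimately show ?thesis by simp
qed

lemma sphere_add: "x \<in> unit_sphere \<Longrightarrow> y - x \<in> vpb 1 \<Longrightarrow> y \<in> unit_sphere"
proof -
  assume x: "x \<in> unit_sphere" and y: "y - x \<in> vpb 1"
  have "x + (y - x) \<in> vpb 0" using x vpb_anti[OF y, of 0] by (intro vpb_add) (auto simp: unit_sphere_iff)
  moreover have "y \<in> vpb 1 \<Longrightarrow> x \<in> vpb 1" using vpb_diff[of y 1 "y - x"] y by simp
  ultimately show ?thesis using x by (auto simp: unit_sphere_iff)
qed

lemma hits_measurable:
  assumes t: "t \<noteq> 0"
  shows "hits n r t \<in> sets (row_measure n)"
proof -
  let ?C = "{s \<in> unit_sphere. near r s t}"
  have "compact ?C"
  proof (rule compact_sphere_saturated[where k = "int r + 1"])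
    fix x y assume x: "x \<in> ?C" and y: "y - x \<in> vpb (int r + 1)"
    have "y \<in> unit_sphere" using x vpb_anti[OF y, of 1] by (auto intro: sphere_add)
    moreover have "near r (x + (y - x)) t"
      using x y t by (intro near_perturb[where c = 0]) (auto simp: unit_sphere_iff)
    ultimately show "y \<in> ?C" by simp
  qed auto
  then have "{\<Xi> \<in> space (row_measure n). \<exists>w\<in>?C. kills n \<Xi> w} \<in> sets (row_measure n)" by (rule kills_measurable)
  also have "{\<Xi> \<in> space (row_measure n). \<exists>w\<in>?C. kills n \<Xi> w} = hits n r t"
  proof (intro equalityI subsetI)
    fix \<Xi> assume "\<Xi> \<in> hits n r t"
    then obtain s where s: "\<Xi> \<in> space (row_measure n)" "s \<noteq> 0" "near r s t" "kills n \<Xi> s" by (auto simp: hits_def)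
    obtain a where "a \<noteq> 0" "a *s s \<in> unit_sphere" using unit_representative[OF s(2)] .
    then show "\<Xi> \<in> {\<Xi> \<in> space (row_measure n). \<exists>w\<in>?C. kills n \<Xi> w}"
      using s by (intro CollectI conjI bexI[of _ "a *s s"]) (auto simp: kills_scale)
  next
    fix \<Xi> assume "\<Xi> \<in> {\<Xi> \<in> space (row_measure n). \<exists>w\<in>?C. kills n \<Xi> w}"
    then show "\<Xi> \<in> hits n r t" using sphere_nonzero unfolding hits_def by blast
  qed
  finally show ?thesis .
qed

text \<open>Restricting forms to the image of \<open>E\<close> applies the transpose of
  \<open>E\<close> to their coefficient rows. The transpose is onto integral vectors because
  \<open>E\<close> has an integral left inverse, so the restricted rows are again uniform and a
  linear subspace behaves like the full projective space of its dimension.\<close>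

lemma emeasure_linear_hits:
  fixes E :: "'p::prime_card padic ^ 'n::finite ^ 'l::finite" and n r :: nat
  assumes E: "integral_matrix E" "integral_matrix E'" "E' ** E = mat 1" and t: "t \<noteq> 0"
  defines "A \<equiv> {\<Xi> \<in> space (row_measure n). \<exists>s. s \<noteq> 0 \<and> near r (E *v s) (E *v t) \<and> kills n \<Xi> (E *v s)}"
  shows "A \<in> sets (row_measure n)" and "emeasure (row_measure n) A = emeasure (row_measure n) (hits n r t)"
proof -
  define \<phi> where "\<phi> x = transpose E *v x" for x
  have add: "\<phi> (x + y) = \<phi> x + \<phi> y" for x y by (simp add: \<phi>_def matrix_vector_right_distrib)
  have tr: "integral_matrix (transpose E)" "integral_matrix (transpose E')"
    using E by (auto simp: integral_matrix_def transpose_def)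
  have int: "x \<in> vpb (int s) \<Longrightarrow> \<phi> x \<in> vpb (int s)" for x s
    unfolding \<phi>_def by (rule integral_matrix_mult[OF tr(1)])
  have surj: "\<exists>a\<in>vpb 0. \<phi> a = b" if b: "b \<in> vpb 0" for b
  proof
    have "transpose E ** transpose E' = mat 1"
      using E(3) by (metis matrix_transpose_mul transpose_mat)
    then show "\<phi> (transpose E' *v b) = b"
      unfolding \<phi>_def matrix_vector_mul_assoc by (simp only: matrix_vector_mul_lid)
    show "transpose E' *v b \<in> vpb 0" by (rule integral_matrix_mult[OF tr(2) b])
  qed
  note D = distr_rows[of \<phi> n, OF add int surj]
  have "A = compose {1..n} \<phi> -` hits n r t \<inter> space (row_measure n)"
  proof -
    have "kills n \<Xi> (E *v s) \<longleftrightarrow> kills n (compose {1..n} \<phi> \<Xi>) s" for \<Xi> s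
      by (simp add: kills_def dot_transpose \<phi>_def compose_def)
    moreover have "compose {1..n} \<phi> \<Xi> \<in> space (row_measure n)" for \<Xi>
      by (auto simp: space_rows compose_def)
    ultimately show ?thesis
      unfolding A_def hits_def using near_integral_matrix_iff[OF E _ t] by auto
  qed
  then show "A \<in> sets (row_measure n)" "emeasure (row_measure n) A = emeasure (row_measure n) (hits n r t)"
    using measurable_sets[OF D(1) hits_measurable[OF t]] emeasure_distr[OF D(1) hits_measurable[OF t], of r] D(2)
    by simp_all
qed

definition shear :: "'n::finite \<Rightarrow> 'a::comm_ring_1 ^ 'n \<Rightarrow> 'a ^ 'n ^ 'n" where
  "shear j u = (\<chi> a b. (if a = b then 1 else 0) + (if b = j then u $ a else 0))"

lemma shear_mult: "shear j u *v s = s + s $ j *s u"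
proof -
  have "(shear j u *v s) $ a = s $ a + s $ j * u $ a" for a
  proof -
    have "(shear j u *v s) $ a = (\<Sum>b\<in>UNIV. (if a = b then s $ b else 0) + (if b = j then s $ b * u $ a else 0))"
      unfolding shear_def matrix_vector_mult_def vec_lambda_beta by (intro sum.cong) (auto simp: algebra_simps)
    then show ?thesis by (simp add: sum.distrib)
  qed
  then show ?thesis by (simp add: vec_eq_iff)
qed

lemma shear_inverse: "u $ j = 0 \<Longrightarrow> shear j (- u) ** shear j u = mat 1"
  by (simp add: matrix_eq shear_mult flip: matrix_vector_mul_assoc)

text \<open>The shear moves axis \<open>j\<close> to \<open>t\<close>, preserves distances and the
  law of the rows, and permutes the nonzero vectors among which a zero is sought.\<close>

lemma emeasure_hits_shear:
  fixes t :: "'p::prime_card padic ^ 'n::finite"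
  assumes t: "t \<in> vpb 0" "t $ j = 1"
  shows "emeasure (row_measure n) (hits n r t) = emeasure (row_measure n) (hits n r (axis j 1 :: 'p padic ^ 'n))"
proof -
  define u where "u = t - axis j 1"
  have u: "u $ j = 0" using t by (simp add: u_def axis_def)
  have u0: "u \<in> vpb 0" unfolding u_def using t by (intro vpb_diff) (auto simp: vpb_def axis_def)
  have int: "integral_matrix (shear j u)" "integral_matrix (shear j (- u))"
    using vpb_nth[OF u0] by (auto simp: integral_matrix_def shear_def intro: pb_add pb_diff)
  have inv: "shear j (- u) ** shear j u = mat 1" "shear j u ** shear j (- u) = mat 1"
    using shear_inverse[of u j] shear_inverse[of "- u" j] u by simp_all
  have st: "shear j u *v axis j 1 = t" by (simp add: shear_mult u_def axis_def)
  have ax: "axis j 1 \<noteq> (0 :: 'p padic ^ 'n)" by (simp add: axis_def vec_eq_iff exI[of _ j])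
  have ex: "(\<exists>s. s \<noteq> 0 \<and> P (shear j u *v s)) \<longleftrightarrow> (\<exists>s. s \<noteq> 0 \<and> P s)" for P
  proof
    assume "\<exists>s. s \<noteq> 0 \<and> P (shear j u *v s)"
    then obtain s where s: "s \<noteq> 0" "P (shear j u *v s)" by blast
    have "shear j (- u) *v (shear j u *v s) = s" using inv(1) by (simp add: matrix_vector_mul_assoc)
    then have "shear j u *v s \<noteq> 0" using s(1) by (metis matrix_vector_mult_0_right)
    then show "\<exists>s. s \<noteq> 0 \<and> P s" using s(2) by blast
  next
    assume "\<exists>s. s \<noteq> 0 \<and> P s"
    then obtain s where s: "s \<noteq> 0" "P s" by blast
    have e: "shear j u *v (shear j (- u) *v s) = s" using inv(2) by (simp add: matrix_vector_mul_assoc)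
    then have "shear j (- u) *v s \<noteq> 0" using s(1) by (metis matrix_vector_mult_0_right)
    then show "\<exists>s. s \<noteq> 0 \<and> P (shear j u *v s)" using s(2) e by metis
  qed
  show ?thesis
    using emeasure_linear_hits(2)[OF int inv(1) ax, of n r] ex[of "\<lambda>s. near r s t \<and> kills n \<Xi> s" for \<Xi>]
    unfolding st hits_def by simp
qed

lemma emeasure_hits_const:
  fixes t t' :: "'p::prime_card padic ^ 'n::finite"
  assumes "t \<noteq> 0" "t' \<noteq> 0"
  shows "emeasure (row_measure n) (hits n r t) = emeasure (row_measure n) (hits n r t')"
proof -
  have scale: "hits n r (c *s t) = hits n r t" if "c \<noteq> 0" for c and t :: "'p padic ^ 'n"
    using that by (simp add: hits_def)
  have ax: "emeasure (row_measure n) (hits n r (axis i 1 :: 'p padic ^ 'n)) = emeasure (row_measure n) (hits n r (axis j 1 :: 'p padic ^ 'n))"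
    for i j :: 'n
  proof (cases "i = j")
    case False
    \<comment> \<open>A vector with coordinate 1 at both \<open>i\<close> and \<open>j\<close> lies
      in both charts and so links the two axes.\<close>
    let ?t = "axis i 1 + axis j 1 :: 'p padic ^ 'n"
    have "?t \<in> vpb 0" by (intro vpb_add) (auto simp: vpb_def axis_def)
    moreover have "?t $ i = 1" "?t $ j = 1" using False by (simp_all add: axis_def)
    ultimately show ?thesis using emeasure_hits_shear by metis
  qed simp
  have "\<exists>j. emeasure (row_measure n) (hits n r t) = emeasure (row_measure n) (hits n r (axis j 1 :: 'p padic ^ 'n))"
    if t: "t \<noteq> 0" for t :: "'p padic ^ 'n"
  proof -
    obtain c l where c: "c \<noteq> 0" "(c *s t) $ l = 1" "c *s t \<in> vpb 0" using normalise_ex[OF t] .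
    then show ?thesis using emeasure_hits_shear[OF c(3,2)] scale[OF c(1)] by metis
  qed
  then show ?thesis using assms ax by metis
qed

text \<open>
  Rows of \<open>B\<close> with a minor of maximal absolute value are taken as coordinates; by Cramer's rule the
  remaining entries are then integral.
\<close>

lemma echelon_form:
  fixes B :: "'p::prime_card padic ^ 'n::finite ^ 'l::finite"
  assumes inj: "\<And>u. B *v u = 0 \<Longrightarrow> u = 0"
  obtains E :: "'p padic ^ 'n ^ 'l" and E' :: "'p padic ^ 'l ^ 'n" and C C' :: "'p padic ^ 'n ^ 'n" where "integral_matrix E" "integral_matrix E'" "E' ** E = mat 1"
    "B = E ** C" "C ** C' = mat 1" "C' ** C = mat 1"
proof -
  define sub :: "('n \<Rightarrow> 'l) \<Rightarrow> 'p padic ^ 'n ^ 'n" where "sub \<sigma> = (\<chi> i. B $ \<sigma> i)" for \<sigma>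
  have "\<exists>A. A ** B = mat 1" using inj by (subst matrix_left_invertible_ker) blast
  then have sp: "vec.span (rows B) = UNIV" by (subst (asm) matrix_left_invertible_span_rows_gen)
  obtain T where T: "T \<subseteq> rows B" "vec.independent T" "rows B \<subseteq> vec.span T" "card T = vec.dim (rows B)"
    using vec.basis_exists by blast
  have spT: "vec.span T = UNIV"
    using vec.span_minimal[OF T(3) vec.subspace_span] unfolding sp by (rule top_le)
  have "card T = CARD('n)"
    using T(4) sp by (metis vec.dim_span vec_dim_card)
  moreover have "finite T" using T(2) vec.finiteI_independent by blast
  ultimately obtain g where g: "bij_betw g (UNIV :: 'n set) T"
    using finite_same_card_bij[of "UNIV :: 'n set" T] by auto
  have "\<forall>i. \<exists>k. g i = B $ k"
  proof
    fix i
    have "g i \<in> rows B" using g T(1) by (auto simp: bij_betw_def)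
    then show "\<exists>k. g i = B $ k" by (auto simp: rows_def row_def vec_lambda_eta)
  qed
  then obtain \<sigma>0 where \<sigma>0: "\<And>i. g i = B $ \<sigma>0 i" by metis
  have "rows (sub \<sigma>0) = T"
  proof -
    have "rows (sub \<sigma>0) = range (\<lambda>i. B $ \<sigma>0 i)" by (auto simp: rows_def row_def sub_def vec_lambda_eta)
    also have "\<dots> = T" using g by (simp add: bij_betw_def flip: \<sigma>0)
    finally show ?thesis .
  qed
  then have "\<exists>A. A ** sub \<sigma>0 = mat 1" using spT by (subst matrix_left_invertible_span_rows_gen) simp
  then have "invertible (sub \<sigma>0)" by (simp add: invertible_left_inverse)
  then have det0: "det (sub \<sigma>0) \<noteq> 0" by (simp add: invertible_det_nz)
  obtain \<sigma> where \<sigma>: "\<And>\<tau>. padic_abs (det (sub \<tau>)) \<le> padic_abs (det (sub \<sigma>))"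
  proof -
    let ?S = "range (\<lambda>\<tau>. padic_abs (det (sub \<tau>)))"
    have fin: "finite ?S" by simp
    then have "Max ?S \<in> ?S" by (intro Max_in) auto
    then obtain \<sigma> where "Max ?S = padic_abs (det (sub \<sigma>))" by blast
    then have "padic_abs (det (sub \<tau>)) \<le> padic_abs (det (sub \<sigma>))" for \<tau> using Max_ge[OF fin] by (metis rangeI)
    then show thesis using that by blast
  qed
  define C where "C = sub \<sigma>"
  have "0 < padic_abs (det (sub \<sigma>0))"
    using det0 padic_abs_nonneg[of "det (sub \<sigma>0)"] padic_abs_eq_0[of "det (sub \<sigma>0)"] by linarith
  then have pos: "0 < padic_abs (det C)" unfolding C_def using \<sigma>[of \<sigma>0] by linarith
  then have "det C \<noteq> 0" by auto
  then have "invertible C" by (simp add: invertible_det_nz)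
  then obtain C' where C': "C ** C' = mat 1" "C' ** C = mat 1" unfolding invertible_def by blast
  define E where "E = B ** C'"
  have BE: "B = E ** C" by (simp add: E_def C'(2) flip: matrix_mul_assoc)
  \<comment> \<open>\<open>E'\<close> selects the chosen rows, so that \<open>E'\<close> times
    \<open>B\<close> is \<open>C\<close>; this makes it a left inverse of \<open>E\<close>.\<close>
  define E' :: "'p padic ^ 'l ^ 'n" where "E' = (\<chi> i k. if k = \<sigma> i then 1 else 0)"
  have "E $ k $ i \<in> pb 0" for k i
  proof -
    have eq: "(\<Sum>i\<in>UNIV. (E $ k) $ i *s row i C) = B $ k"
      by (subst BE) (simp add: vec_eq_iff matrix_matrix_mult_def row_def)
    have "det (\<chi> a. if a = i then B $ k else row a C) = E $ k $ i * det C"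
      using cramer_lemma_transpose[of i "E $ k" C] unfolding eq .
    moreover have "(\<chi> a. if a = i then B $ k else row a C) = sub (\<sigma>(i := k))"
      by (simp add: vec_eq_iff sub_def C_def row_def)
    ultimately have "padic_abs (E $ k $ i) * padic_abs (det C) \<le> 1 * padic_abs (det C)"
      using \<sigma>[of "\<sigma>(i := k)"] by (simp add: C_def flip: padic_abs_mult)
    then have "padic_abs (E $ k $ i) \<le> 1" using pos mult_le_cancel_right_pos by blast
    then show ?thesis by (simp add: pb_def)
  qed
  then have 1: "integral_matrix E" by (simp add: integral_matrix_def)
  have 2: "integral_matrix E'" by (simp add: integral_matrix_def E'_def)
  have "(E' ** B) = C"
    by (simp add: vec_eq_iff matrix_matrix_mult_def E'_def C_def sub_def if_distrib[of "\<lambda>x. x * _"] cong: if_cong)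
  then have 3: "E' ** E = mat 1" unfolding E_def by (simp add: C'(1) matrix_mul_assoc)
  show thesis by (rule that[OF 1 2 3 BE C'])
qed

text \<open>The n equations are padded with a zero row to a singular square matrix.\<close>

lemma kernel_nonzero:
  fixes \<Xi> :: "nat \<Rightarrow> 'p::prime_card padic ^ 'n::finite"
  assumes card: "CARD('n) = n + 1"
  shows "\<exists>s. s \<noteq> 0 \<and> kills n \<Xi> s"
proof -
  have "card {0..n} = CARD('n)" using card by simp
  then obtain g where g: "bij_betw g (UNIV :: 'n set) {0..n}"
    using finite_same_card_bij[of "UNIV :: 'n set" "{0..n}"] by auto
  define A :: "'p padic ^ 'n ^ 'n" where "A = (\<chi> a. if g a = 0 then 0 else \<Xi> (g a))"
  obtain a0 where "g a0 = 0" using g by (metis atLeastAtMost_iff bij_betw_iff_bijections le0)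
  then have "row a0 A = 0" by (simp add: row_def A_def vec_eq_iff)
  then have "det A = 0" by (rule det_zero_row(2))
  then have "\<not> (\<exists>B. B ** A = mat 1)" using invertible_det_nz[of A] by (simp add: invertible_left_inverse)
  then obtain s where s: "A *v s = 0" "s \<noteq> 0" by (subst (asm) matrix_left_invertible_ker) blast
  have "dot (\<Xi> i) s = 0" if i: "i \<in> {1..n}" for i
  proof -
    obtain a where a: "g a = i" using g i by (metis atLeastAtMost_iff bij_betw_iff_bijections le0)
    then have "(A *v s) $ a = dot (\<Xi> i) s" using i by (simp add: A_def matrix_vector_mult_def dot_def)
    then show ?thesis using s(1) by simp
  qed
  then show ?thesis using s(2) by (auto simp: kills_def)
qed

text \<open>A kernel vector in a fixed hyperplane solves n equations in n unknowns. This is the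
  extreme case \<open>c = 0\<close>, \<open>r = 0\<close> of \<open>degenerate_bound\<close>, where
  smallness at \<open>y\<close> is automatic for integral rows; the bad events have probability at
  most n/p^k for every k.\<close>

lemma AE_kernel_transverse:
  fixes j :: "'n::finite"
  assumes card: "CARD('n) = n + 1" and n: "n \<ge> 1"
  shows "AE \<Xi> in (row_measure n :: (nat \<Rightarrow> 'p::prime_card padic ^ 'n) measure).
    \<forall>z. z $ j = 0 \<longrightarrow> kills n \<Xi> z \<longrightarrow> z = 0"
proof -
  let ?M = "row_measure n :: (nat \<Rightarrow> 'p padic ^ 'n) measure"
  interpret prob_space ?M by (rule prob_space_rows)
  \<comment> \<open>The shear by the negative axis is not invertible: it is the projection onto the
    hyperplane along axis \<open>j\<close>.\<close>
  define W :: "'p padic ^ 'n ^ 'n" where "W = shear j (- axis j 1)"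
  have W: "W *v z = z - z $ j *s axis j 1" for z by (simp add: W_def shear_mult)
  have "\<exists>Bad. Bad \<in> sets ?M \<and> emeasure ?M Bad \<le> ennreal (real n / real CARD('p) ^ k) \<and>
      (\<forall>\<Xi>\<in>space ?M. \<Xi> \<notin> Bad \<longrightarrow> integral_rows n \<Xi> \<longrightarrow> (\<forall>z a. z $ j = 0 \<longrightarrow> kills n \<Xi> z \<longrightarrow> z \<in> vpb (a - int k)))" for k
  proof (rule degenerate_bound[of n 0 k "axis j 1 :: 'p padic ^ 'n" j W j 0])
    show "axis j 1 \<in> (vpb 0 :: ('p padic ^ 'n) set)" by (auto simp: vpb_def axis_def)
    show "(axis j 1 :: 'p padic ^ 'n) $ j = 1" by (simp add: axis_def)
    show "(W *v z) $ j = 0" for z by (simp add: W axis_def)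
    show "W *v z \<in> vpb (a - int 0)" if "z \<in> vpb a" for z a
      unfolding W using that by (intro vpb_diff vpb_scale[of _ a _ 0]) (auto simp: vpb_def axis_def)
    show "z \<in> vpb (a - int 0)" if "z $ j = 0" "W *v z \<in> vpb a" for z a
      using that by (simp add: W)
    fix Bad
    assume Bad: "Bad \<in> sets ?M"
      "emeasure ?M Bad \<le> ennreal (real n * real CARD('p) ^ (2 * n * 0) / real CARD('p) ^ k / real CARD('p) ^ (n * 0))"
      "\<And>\<Xi> z a. \<Xi> \<in> space ?M \<Longrightarrow> \<Xi> \<notin> Bad \<Longrightarrow> integral_rows n \<Xi> \<Longrightarrow> (\<And>i. i \<in> {1..n} \<Longrightarrow> dot (\<Xi> i) (axis j 1) \<in> pb (int 0)) \<Longrightarrow>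
      z $ j = 0 \<Longrightarrow> (\<And>i. i \<in> {1..n} \<Longrightarrow> dot (\<Xi> i) (W *v z) \<in> pb a) \<Longrightarrow> z \<in> vpb (a - int k)"
    show "\<exists>Bad. Bad \<in> sets ?M \<and> emeasure ?M Bad \<le> ennreal (real n / real CARD('p) ^ k) \<and>
      (\<forall>\<Xi>\<in>space ?M. \<Xi> \<notin> Bad \<longrightarrow> integral_rows n \<Xi> \<longrightarrow> (\<forall>z a. z $ j = 0 \<longrightarrow> kills n \<Xi> z \<longrightarrow> z \<in> vpb (a - int k)))"
    proof (intro exI[of _ Bad] conjI ballI impI allI Bad(1))
      show "emeasure ?M Bad \<le> ennreal (real n / real CARD('p) ^ k)" using Bad(2) by simp
      fix \<Xi> z a assume \<Xi>: "\<Xi> \<in> space ?M" "\<Xi> \<notin> Bad" "integral_rows n \<Xi>" and z: "z $ j = 0" "kills n \<Xi> z"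
      show "z \<in> vpb (a - int k)"
        by (rule Bad(3)[OF \<Xi> _ z(1)]) (use \<Xi>(3) z in \<open>auto simp: W kills_def integral_rows_def vpb_nth\<close>)
    qed
  qed (use card n in auto)
  then obtain Bad where Bad: "\<And>k. Bad k \<in> sets ?M" "\<And>k. emeasure ?M (Bad k) \<le> ennreal (real n / real CARD('p) ^ k)"
    "\<And>k \<Xi> z a. \<Xi> \<in> space ?M \<Longrightarrow> \<Xi> \<notin> Bad k \<Longrightarrow> integral_rows n \<Xi> \<Longrightarrow> z $ j = 0 \<Longrightarrow> kills n \<Xi> z \<Longrightarrow> z \<in> vpb (a - int k)"
    by metis
  have "(\<Inter>k. Bad k) \<in> null_sets ?M"
  proof (rule null_setsI)
    show "(\<Inter>k. Bad k) \<in> sets ?M" using Bad(1) by blast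
    have "measure ?M (\<Inter>k. Bad k) \<le> real n / real CARD('p) ^ k" for k
    proof -
      have "measure ?M (\<Inter>k. Bad k) \<le> measure ?M (Bad k)" using Bad(1) by (intro finite_measure_mono) auto
      also have "\<dots> \<le> real n / real CARD('p) ^ k" using Bad(2)[of k] by (simp add: emeasure_eq_measure)
      finally show ?thesis .
    qed
    moreover have "(\<lambda>k. real n / real CARD('p) ^ k) \<longlonglongrightarrow> 0"
      using tendsto_mult_right_zero[OF LIMSEQ_inverse_realpow_zero[OF card_gt_1[where 'p = 'p]], of "real n"]
      by (simp add: divide_inverse)
    ultimately have "measure ?M (\<Inter>k. Bad k) \<le> 0" by (intro LIMSEQ_le_const) auto
    then show "emeasure ?M (\<Inter>k. Bad k) = 0" by (simp add: emeasure_eq_measure measure_le_0_iff)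
  qed
  then have "AE \<Xi> in ?M. \<Xi> \<notin> (\<Inter>k. Bad k)" by (rule AE_not_in)
  moreover have "AE \<Xi> in ?M. integral_rows n \<Xi>" by (rule AE_integral_rows)
  moreover have "AE \<Xi> in ?M. \<Xi> \<in> space ?M" by (rule AE_space)
  ultimately show ?thesis
  proof eventually_elim
    case (elim \<Xi>)
    then obtain k where k: "\<Xi> \<notin> Bad k" by blast
    show ?case
    proof (intro allI impI)
      fix z assume z: "z $ j = 0" "kills n \<Xi> z"
      \<comment> \<open>The forms vanish exactly at \<open>z\<close>, so the exponent is
        arbitrary.\<close>
      have "z \<in> vpb a" for a using Bad(3)[OF elim(3) k elim(2) z, of "a + int k"] by simp
      then have "z $ i = 0" for i using pb_all_zero[of 0 "z $ i"] vpb_nth by blast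
      then show "z = 0" by (simp add: vec_eq_iff)
    qed
  qed
qed

text \<open>Two different kernel lines span a plane, and a plane meets the hyperplane
  \<open>z $ j = 0\<close> in a nonzero vector.\<close>

lemma AE_kernel_unique:
  assumes card: "CARD('n::finite) = n + 1" and n: "n \<ge> 1"
  shows "AE \<Xi> in (row_measure n :: (nat \<Rightarrow> 'p::prime_card padic ^ 'n) measure).
    \<forall>s s'. s \<noteq> 0 \<longrightarrow> s' \<noteq> 0 \<longrightarrow> kills n \<Xi> s \<longrightarrow> kills n \<Xi> s' \<longrightarrow> proj_class s = proj_class s'"
proof -
  obtain j :: 'n where True by blast
  show ?thesis
    using AE_kernel_transverse[OF card n, of j]
  proof eventually_elim
    case (elim \<Xi>)
    show ?case
    proof (intro allI impI)
      fix s s' :: "'p padic ^ 'n" assume s: "s \<noteq> 0" "s' \<noteq> 0" "kills n \<Xi> s" "kills n \<Xi> s'"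
      have nz: "s $ j \<noteq> 0" "s' $ j \<noteq> 0" using elim s by blast+
      let ?z = "s' - (s' $ j / s $ j) *s s"
      have "?z $ j = 0" using nz by simp
      moreover have "kills n \<Xi> ?z" using s by (simp add: kills_def dot_diff_right dot_scale_right)
      ultimately have "s' = (s' $ j / s $ j) *s s" using elim by fastforce
      moreover have "s' $ j / s $ j \<noteq> 0" using nz by simp
      ultimately show "proj_class s = proj_class s'" by (metis proj_class_scale)
    qed
  qed
qed

text \<open>Almost surely the unique zero lies in exactly one ball, so the hitting probabilities of
  all balls add up to 1; by homogeneity they are equal.\<close>

lemma emeasure_hits:
  fixes t :: "'p::prime_card padic ^ 'n::finite"
  assumes card: "CARD('n) = n + 1" and n: "n \<ge> 1" and r: "r \<ge> 1" and t: "t \<noteq> 0"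
  shows "emeasure (row_measure n) (hits n r t) = ennreal (1 / real (card (pcls r ` (proj_space :: ('p padic ^ 'n) set set))))"
proof -
  let ?M = "row_measure n :: (nat \<Rightarrow> 'p padic ^ 'n) measure"
  let ?D = "pcls r ` (proj_space :: ('p padic ^ 'n) set set)"
  interpret prob_space ?M by (rule prob_space_rows)
  have finD: "finite ?D" by (rule finite_pcls[OF r])
  have "\<forall>D\<in>?D. \<exists>y. y \<noteq> 0 \<and> D = pcls r (proj_class y)" by (auto elim!: proj_space_cases)
  from bchoice[OF this] obtain y where y: "\<And>D. D \<in> ?D \<Longrightarrow> y D \<noteq> 0" "\<And>D. D \<in> ?D \<Longrightarrow> D = pcls r (proj_class (y D))" by blast
  have meas: "hits n r (y D) \<in> sets ?M" if "D \<in> ?D" for D by (rule hits_measurable[OF y(1)[OF that]])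
  have hit_iff: "\<Xi> \<in> hits n r (y D) \<longleftrightarrow> (\<exists>s. s \<noteq> 0 \<and> kills n \<Xi> s \<and> pcls r (proj_class s) = D)"
    if D: "D \<in> ?D" and \<Xi>: "\<Xi> \<in> space ?M" for \<Xi> D
  proof -
    have "near r s (y D) \<longleftrightarrow> pcls r (proj_class s) = D" if "s \<noteq> 0" for s
      using pcls_eq_iff[OF that y(1)[OF D], of r] unfolding y(2)[OF D, symmetric] by blast
    then show ?thesis using \<Xi> unfolding hits_def by blast
  qed
  have "AE \<Xi> in ?M. (\<Sum>D\<in>?D. indicator (hits n r (y D)) \<Xi> :: ennreal) = 1"
    using AE_kernel_unique[OF card n] AE_space
  proof eventually_elim
    case (elim \<Xi>)
    obtain s where s: "s \<noteq> 0" "kills n \<Xi> s" using kernel_nonzero[OF card] by blast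
    let ?Z = "pcls r (proj_class s)"
    have D0: "?Z \<in> ?D" using s(1) proj_class_in_space by blast
    have "indicator (hits n r (y D)) \<Xi> = (if D = ?Z then 1 else 0 :: ennreal)" if D: "D \<in> ?D" for D
    proof -
      have "\<Xi> \<in> hits n r (y D) \<longleftrightarrow> D = ?Z"
        unfolding hit_iff[OF D elim(2)] using s elim(1) by metis
      then show ?thesis unfolding indicator_def by simp
    qed
    then have "(\<Sum>D\<in>?D. indicator (hits n r (y D)) \<Xi> :: ennreal) = (\<Sum>D\<in>?D. if D = ?Z then 1 else 0)"
      by (intro sum.cong) auto
    also have "\<dots> = 1" using finD D0 by (subst sum.delta) auto
    finally show ?case .
  qed
  then have "(\<integral>\<^sup>+\<Xi>. (\<Sum>D\<in>?D. indicator (hits n r (y D)) \<Xi>) \<partial>?M) = (\<integral>\<^sup>+\<Xi>. 1 \<partial>?M)"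
    by (intro nn_integral_cong_AE) simp
  also have "\<dots> = 1" by (simp add: emeasure_space_1)
  also have "(\<integral>\<^sup>+\<Xi>. (\<Sum>D\<in>?D. indicator (hits n r (y D)) \<Xi>) \<partial>?M) = (\<Sum>D\<in>?D. emeasure ?M (hits n r (y D)))"
    using meas by (subst nn_integral_sum) auto
  also have "\<dots> = (\<Sum>D\<in>?D. emeasure ?M (hits n r t))"
    using y(1) t by (intro sum.cong refl emeasure_hits_const) auto
  also have "\<dots> = ennreal (real (card ?D) * measure ?M (hits n r t))"
    by (simp add: emeasure_eq_measure ennreal_mult ennreal_of_nat_eq_real_of_nat)
  finally have "real (card ?D) * measure ?M (hits n r t) = 1" by simp
  moreover from this have "real (card ?D) \<noteq> 0" by (metis mult_zero_left zero_neq_one)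
  ultimately have "measure ?M (hits n r t) = 1 / real (card ?D)" by (metis nonzero_mult_div_cancel_left)
  then show ?thesis by (simp add: emeasure_eq_measure)
qed

section \<open>Comparison with the tangent space\<close>

lemma near_residual:
  fixes y w :: "'p::prime_card padic ^ 'l::finite"
  assumes y: "y \<in> vpb 0" "y $ l = 1" and w: "w \<noteq> 0" "w \<in> vpb e" and near: "near r w y"
  shows "w - w $ l *s y \<in> vpb (int r + e)"
proof -
  obtain k where k: "\<And>j. w \<in> vpb j \<longleftrightarrow> j \<le> k" using vpb_exact[OF w(1)] by blast
  have ek: "e \<le> k" using w(2) k by simp
  define u where "u = (pp powi (- k) :: 'p padic)"
  have u0: "u \<noteq> 0" by (simp add: u_def)
  have "u *s w \<in> unit_sphere" unfolding unit_sphere_iff u_def vpb_pp_iff k by simp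
  moreover have "near r (u *s w) y" using near u0 by simp
  ultimately have "u *s w - (u *s w) $ l *s y \<in> vpb (int r)" using near_normal[OF y] by blast
  moreover have "u *s w - (u *s w) $ l *s y = u *s (w - w $ l *s y)"
    by (simp add: vec_eq_iff algebra_simps)
  ultimately have "u *s (w - w $ l *s y) \<in> vpb (int r)" by metis
  then have "w - w $ l *s y \<in> vpb (int r - (- k))" unfolding u_def vpb_pp_iff .
  then show ?thesis by (rule vpb_anti) (use ek in simp)
qed

text \<open>A zero in the ball around \<open>y\<close> forces every form to be at most p^-r at
  \<open>y\<close> itself. Hence the near-zero condition of \<open>degenerate_bound\<close> holds
  whenever either of the two compared events occurs.\<close>

lemma near_kills:
  fixes y w :: "'p::prime_card padic ^ 'l::finite"
  assumes y: "y \<in> vpb 0" "y $ l = 1" and w: "w \<noteq> 0" and near: "near r w y" and r: "r \<ge> 1"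
    and \<Xi>: "integral_rows n \<Xi>" "kills n \<Xi> w" and i: "i \<in> {1..n}"
  shows "dot (\<Xi> i) y \<in> pb (int r)"
proof -
  obtain u where u: "u \<noteq> 0" "u *s w \<in> unit_sphere" using unit_representative[OF w] .
  define x where "x = u *s w"
  have x: "x \<in> unit_sphere" "near r x y" "dot (\<Xi> i) x = 0"
    using u near \<Xi>(2) i by (simp_all add: x_def kills_def dot_scale_right)
  have e: "x - x $ l *s y \<in> vpb (int r)" using near_normal[OF y x(1)] x(2) by blast
  have x0: "x \<in> vpb 0" "x \<notin> vpb 1" using x(1) by (auto simp: unit_sphere_iff)
  have "x $ l \<notin> pb 1"
  proof
    assume "x $ l \<in> pb 1"
    then have "x $ l *s y \<in> vpb 1" using y(1) by (rule vpb_scale) simp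
    then have "(x - x $ l *s y) + x $ l *s y \<in> vpb 1" using e r by (intro vpb_add) (auto elim: vpb_anti)
    then show False using x0(2) by simp
  qed
  moreover have "x $ l * dot (\<Xi> i) y \<in> pb (int r)"
  proof -
    have "dot (\<Xi> i) (x - x $ l *s y) \<in> pb (int r)"
      using \<Xi>(1) i by (intro dot_pb[OF _ e, of _ 0]) (auto simp: integral_rows_def)
    then show ?thesis using x(3) by (simp add: dot_diff_right dot_scale_right)
  qed
  ultimately show ?thesis using pb_unit_mult_iff[OF vpb_nth[OF x0(1)]] by blast
qed

text \<open>The equation \<open>z $ j = 0\<close> is added as one more row; the system becomes
  square, and injectivity gives solvability.\<close>

lemma solve_linear_system:
  fixes \<eta> :: "nat \<Rightarrow> 'p::prime_card padic ^ 'n::finite"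
  assumes card: "CARD('n) = n + 1"
    and inj: "\<And>z. z $ j = 0 \<Longrightarrow> (\<And>i. i \<in> {1..n} \<Longrightarrow> dot (\<eta> i) z = 0) \<Longrightarrow> z = 0"
  shows "\<exists>z. z $ j = 0 \<and> (\<forall>i\<in>{1..n}. dot (\<eta> i) z = h i)"
proof -
  have "card (UNIV - {j}) = card {1..n}" using card by (simp add: card_Diff_singleton)
  then obtain g where g: "bij_betw g (UNIV - {j}) {1..n}"
    using finite_same_card_bij[of "UNIV - {j}" "{1..n}"] by auto
  define A :: "'p padic ^ 'n ^ 'n" where "A = (\<chi> a. if a = j then axis j 1 else \<eta> (g a))"
  have A: "(A *v z) $ a = (if a = j then z $ j else dot (\<eta> (g a)) z)" for z a
    using dot_axis_left[of j z] by (simp add: A_def matrix_vector_mult_def dot_def)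
  have surj: "\<exists>a. a \<noteq> j \<and> g a = i" if i: "i \<in> {1..n}" for i
  proof -
    have "i \<in> g ` (UNIV - {j})" using g i by (simp add: bij_betw_def)
    then show ?thesis by blast
  qed
  have "z = 0" if z: "A *v z = 0" for z
  proof (rule inj)
    show "z $ j = 0" using A[of z j] z by simp
    fix i assume "i \<in> {1..n}"
    then obtain a where "a \<noteq> j" "g a = i" using surj by blast
    then show "dot (\<eta> i) z = 0" using A[of z a] z by simp
  qed
  then have "\<exists>B. B ** A = mat 1" by (subst matrix_left_invertible_ker) blast
  then obtain B where "A ** B = mat 1" using matrix_left_right_inverse by blast
  define z where "z = B *v (\<chi> a. if a = j then 0 else h (g a))"
  have Az: "A *v z = (\<chi> a. if a = j then 0 else h (g a))"
    unfolding z_def matrix_vector_mul_assoc \<open>A ** B = mat 1\<close> by (rule matrix_vector_mul_lid)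
  have zj: "z $ j = 0" using A[of z j] unfolding Az by simp
  moreover have "dot (\<eta> i) z = h i" if i: "i \<in> {1..n}" for i
  proof -
    obtain a where a: "a \<noteq> j" "g a = i" using surj[OF i] by blast
    then show ?thesis using A[of z a] unfolding Az by simp
  qed
  ultimately show ?thesis by blast
qed

lemma vec_limit:
  fixes X :: "nat \<Rightarrow> 'p::prime_card padic ^ 'n::finite"
  assumes "\<And>m. X (Suc m) - X m \<in> vpb (int m + a)"
  shows "\<exists>L. \<forall>m. L - X m \<in> vpb (int m + a)"
proof -
  have "\<forall>i. \<exists>L. \<forall>m. L - X m $ i \<in> pb (int m + a)"
  proof
    fix i
    have "X (Suc m) $ i - X m $ i \<in> pb (int m + a)" for m using vpb_nth[OF assms[of m], of i] by simp
    then show "\<exists>L. \<forall>m. L - X m $ i \<in> pb (int m + a)" by (rule padic_limit[of "\<lambda>m. X m $ i"])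
  qed
  then obtain L where "\<And>i m. L i - X m $ i \<in> pb (int m + a)" by metis
  then show ?thesis by (intro exI[of _ "\<chi> i. L i"]) (auto intro!: vpbI)
qed

lemma axis_in_vpb: "axis j 1 \<in> vpb 0"
  by (auto simp: vpb_def axis_def)

text \<open>
  Near a point \<open>v x\<^sub>0\<close> the image of \<open>v\<close> is compared with its projective tangent space, the image of the
  matrix \<open>B\<close>: unless the linear forms \<open>\<Xi>\<close> are degenerate in the tangent directions, Newton's iteration
  turns a zero of \<open>\<Xi> \<circ> B\<close> into a zero of \<open>\<Xi> \<circ> v\<close> in the same small ball, and conversely.
\<close>

locale newton =
  fixes v :: "'p::prime_card padic ^ 'n::finite \<Rightarrow> 'p padic ^ 'l::finite" and c :: int
    and x0 :: "'p padic ^ 'n" and j :: 'n and B :: "'p padic ^ 'n ^ 'l"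
    and \<Xi> :: "nat \<Rightarrow> 'p padic ^ 'l" and n k :: nat and a :: int
  assumes c: "0 \<le> c" and card: "CARD('n) = n + 1" and a: "c + int k + 1 \<le> a"
    and B_axis: "B *v axis j 1 = v x0"
    and B_upper: "u \<in> vpb i \<Longrightarrow> B *v u \<in> vpb (i - c)"
    and taylor: "0 \<le> e \<Longrightarrow> z $ j = 0 \<Longrightarrow> z' $ j = 0 \<Longrightarrow> z \<in> vpb e \<Longrightarrow> z' \<in> vpb e \<Longrightarrow> z - z' \<in> vpb b \<Longrightarrow>
         v (x0 + z) - v (x0 + z') - B *v (z - z') \<in> vpb (e + b - c)"
    and int: "integral_rows n \<Xi>"
    and nondegenerate: "z $ j = 0 \<Longrightarrow> (\<And>i. i \<in> {1..n} \<Longrightarrow> dot (\<Xi> i) (B *v z) \<in> pb e) \<Longrightarrow> z \<in> vpb (e - int k)"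
begin

text \<open>The second-order remainder between the curved map and its tangent map in the
  chart.\<close>

definition q :: "'p padic ^ 'n \<Rightarrow> 'p padic ^ 'l" where
  "q z = v (x0 + z) - v x0 - B *v z"

lemma v_eq: "v (x0 + z) = B *v (axis j 1 + z) + q z"
  by (simp add: q_def B_axis matrix_vector_right_distrib)

lemma q_diff:
  assumes "0 \<le> e" "z $ j = 0" "z' $ j = 0" "z \<in> vpb e" "z' \<in> vpb e" "z - z' \<in> vpb b"
  shows "q z - q z' \<in> vpb (e + b - c)"
proof -
  have "q z - q z' = v (x0 + z) - v (x0 + z') - B *v (z - z')"
    by (simp add: q_def matrix_vector_mult_diff_distrib)
  then show ?thesis using taylor[OF assms] by simp
qed

lemma q_small:
  assumes "0 \<le> e" "z $ j = 0" "z \<in> vpb e"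
  shows "q z \<in> vpb (2 * e - c)"
proof -
  have "q 0 = 0" by (simp add: q_def)
  moreover have "q z - q 0 \<in> vpb (e + e - c)" using assms by (intro q_diff) auto
  ultimately show ?thesis by simp
qed

lemma dot_int: "i \<in> {1..n} \<Longrightarrow> w \<in> vpb e \<Longrightarrow> dot (\<Xi> i) w \<in> pb e"
  using int by (intro dot_pb[of _ 0 _ e]) (auto simp: integral_rows_def)

text \<open>The tangent correction whose image under \<open>B\<close> takes the same values as
  \<open>w\<close> under all forms. Nondegeneracy gives existence and limits the loss to
  \<open>k\<close> digits.\<close>

definition S :: "'p padic ^ 'l \<Rightarrow> 'p padic ^ 'n" where
  "S w = (SOME z. z $ j = 0 \<and> (\<forall>i\<in>{1..n}. dot (\<Xi> i) (B *v z) = dot (\<Xi> i) w))"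

lemma S: "S w $ j = 0" "i \<in> {1..n} \<Longrightarrow> dot (\<Xi> i) (B *v S w) = dot (\<Xi> i) w"
proof -
  have "\<exists>z. z $ j = 0 \<and> (\<forall>i\<in>{1..n}. dot (transpose B *v \<Xi> i) z = dot (\<Xi> i) w)"
  proof (rule solve_linear_system[OF card])
    fix z assume z: "z $ j = 0" "\<And>i. i \<in> {1..n} \<Longrightarrow> dot (transpose B *v \<Xi> i) z = 0"
    have "z \<in> vpb e" for e
      using nondegenerate[OF z(1), of "e + int k"] z(2) by (simp add: dot_transpose)
    then have "z $ i = 0" for i using pb_all_zero[of 0 "z $ i"] vpb_nth by blast
    then show "z = 0" by (simp add: vec_eq_iff)
  qed
  then have "\<exists>z. z $ j = 0 \<and> (\<forall>i\<in>{1..n}. dot (\<Xi> i) (B *v z) = dot (\<Xi> i) w)"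
    unfolding dot_transpose .
  from someI_ex[OF this] show "S w $ j = 0" "i \<in> {1..n} \<Longrightarrow> dot (\<Xi> i) (B *v S w) = dot (\<Xi> i) w"
    unfolding S_def by blast+
qed

lemma S_diff:
  assumes "w - w' \<in> vpb e"
  shows "S w - S w' \<in> vpb (e - int k)"
proof (rule nondegenerate)
  show "(S w - S w') $ j = 0" using S(1) by simp
  fix i assume i: "i \<in> {1..n}"
  have "dot (\<Xi> i) (B *v (S w - S w')) = dot (\<Xi> i) (w - w')"
    using S(2)[OF i] by (simp add: matrix_vector_mult_diff_distrib dot_diff_right)
  then show "dot (\<Xi> i) (B *v (S w - S w')) \<in> pb e" using dot_int[OF i assms] by simp
qed

lemma S_small:
  assumes "w \<in> vpb e"
  shows "S w \<in> vpb (e - int k)"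
proof (rule nondegenerate)
  show "S w $ j = 0" by (rule S(1))
  fix i assume i: "i \<in> {1..n}"
  show "dot (\<Xi> i) (B *v S w) \<in> pb e" using dot_int[OF i assms] S(2)[OF i] by simp
qed

text \<open>The target equation is linear, so a single explicit correction suffices:
  \<open>S (q z)\<close> cancels the remainder.\<close>

lemma tangent_zero:
  assumes z: "z $ j = 0" "z \<in> vpb a" and zero: "kills n \<Xi> (v (x0 + z))"
  shows "\<exists>z'. z' $ j = 0 \<and> z' - z \<in> vpb (2 * a - c - int k) \<and> kills n \<Xi> (B *v (axis j 1 + z'))"
proof (intro exI conjI)
  have a0: "0 \<le> a" using a c by simp
  show "(z + S (q z)) $ j = 0" using z S(1) by simp
  have "S (q z) \<in> vpb (2 * a - c - int k)" by (rule S_small[OF q_small[OF a0 z]])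
  then show "z + S (q z) - z \<in> vpb (2 * a - c - int k)" by simp
  have "B *v (axis j 1 + (z + S (q z))) = v (x0 + z) - q z + B *v S (q z)"
    unfolding v_eq by (simp add: matrix_vector_right_distrib)
  then show "kills n \<Xi> (B *v (axis j 1 + (z + S (q z))))"
    using zero S(2) by (simp add: kills_def dot_add_right dot_diff_right)
qed

text \<open>The sought increment is a fixed point of \<open>y \<mapsto> z - S (q y)\<close>. By the
  strict Taylor estimate the map gains a - c - k digits on differences, at least one by the locale
  assumption.\<close>

lemma curved_zero:
  assumes z: "z $ j = 0" "z \<in> vpb a" and zero: "kills n \<Xi> (B *v (axis j 1 + z))"
  shows "\<exists>z'. z' $ j = 0 \<and> z' \<in> vpb a \<and> z' - z \<in> vpb (2 * a - c - int k) \<and> kills n \<Xi> (v (x0 + z'))"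
proof -
  define X where "X m = ((\<lambda>y. z - S (q y)) ^^ m) z" for m
  have X0: "X 0 = z" and XS: "X (Suc m) = z - S (q (X m))" for m by (simp_all add: X_def)
  have a0: "0 \<le> a" using a c by simp
  define b where "b = 2 * a - c - int k"
  have ab: "a \<le> b" using a by (simp add: b_def)
  have Xj: "X m $ j = 0" for m using z(1) S(1) by (cases m) (simp_all add: X0 XS)
  have Xa: "X m \<in> vpb a" for m
  proof (induction m)
    case (Suc m)
    have "S (q (X m)) \<in> vpb b" unfolding b_def by (rule S_small[OF q_small[OF a0 Xj Suc]])
    then show ?case unfolding XS using z(2) ab by (intro vpb_diff) (auto elim: vpb_anti)
  qed (use z X0 in simp)
  have step: "X (Suc m) - X m \<in> vpb (int m + b)" for m
  proof (induction m)
    case 0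
    have "S (q z) \<in> vpb b" unfolding b_def by (rule S_small[OF q_small[OF a0 z]])
    then show ?case by (simp add: XS X0)
  next
    case (Suc m)
    have "q (X (Suc m)) - q (X m) \<in> vpb (a + (int m + b) - c)" by (rule q_diff[OF a0 Xj Xj Xa Xa Suc])
    then have "S (q (X (Suc m))) - S (q (X m)) \<in> vpb (a + (int m + b) - c - int k)" by (rule S_diff)
    then have "S (q (X (Suc m))) - S (q (X m)) \<in> vpb (int (Suc m) + b)" by (rule vpb_anti) (use a in simp)
    moreover have "X (Suc (Suc m)) - X (Suc m) = - (S (q (X (Suc m))) - S (q (X m)))"
      unfolding XS[of "Suc m"] by (simp add: XS)
    ultimately show ?case by (simp only: vpb_minus)
  qed
  then obtain L where L: "\<And>m. L - X m \<in> vpb (int m + b)" using vec_limit[OF step] by blast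
  have Lz: "L - z \<in> vpb b" using L[of 0] by (simp add: X0)
  have La: "L \<in> vpb a"
    using vpb_add[OF vpb_anti[OF Lz ab] z(2)] by simp
  have Lj: "L $ j = 0"
  proof (rule pb_all_zero[of 0])
    fix m :: int assume "0 \<le> m"
    then have "L - X (nat m) \<in> vpb m" using L[of "nat m"] a0 ab by (auto elim: vpb_anti)
    then show "L $ j \<in> pb m" using vpb_nth[of _ m j] Xj by fastforce
  qed
  have "dot (\<Xi> i) (v (x0 + L)) = 0" if i: "i \<in> {1..n}" for i
  proof (rule pb_all_zero[of 0])
    fix m :: int assume m: "0 \<le> m"
    \<comment> \<open>\<open>B\<close> and the remainder lose at most \<open>c\<close> digits, so
      the iterate at m + c is precise enough.\<close>
    define M where "M = nat (m + c)"
    have M: "m + c \<le> int M" by (simp add: M_def)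
    have bc: "0 \<le> b" using a0 ab by simp
    \<comment> \<open>Consecutive iterates satisfy the equation exactly when the linear part is
      taken at the newer and the remainder at the older one.\<close>
    have "dot (\<Xi> i) (B *v (axis j 1 + X (Suc M)) + q (X M)) = dot (\<Xi> i) (B *v (axis j 1 + z))"
      unfolding XS using S(2)[OF i] by (simp add: matrix_vector_right_distrib matrix_vector_mult_diff_distrib dot_add_right dot_diff_right)
    also have "\<dots> = 0" using zero i by (simp add: kills_def)
    finally have 0: "dot (\<Xi> i) (B *v (axis j 1 + X (Suc M)) + q (X M)) = 0" .
    have eq: "v (x0 + L) = (B *v (axis j 1 + X (Suc M)) + q (X M)) + (B *v (L - X (Suc M)) + (q L - q (X M)))"
      unfolding v_eq by (simp add: matrix_vector_right_distrib matrix_vector_mult_diff_distrib)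
    have "B *v (L - X (Suc M)) \<in> vpb m"
      by (rule vpb_anti[OF B_upper[OF L]]) (use M bc in simp)
    moreover have "q L - q (X M) \<in> vpb m"
      by (rule vpb_anti[OF q_diff[OF a0 Lj Xj La Xa L]]) (use M bc a0 in simp)
    ultimately have "dot (\<Xi> i) (B *v (L - X (Suc M)) + (q L - q (X M))) \<in> pb m"
      by (intro dot_int[OF i] vpb_add)
    then show "dot (\<Xi> i) (v (x0 + L)) \<in> pb m" unfolding eq dot_add_right[of _ "B *v (axis j 1 + X (Suc M)) + q (X M)"] 0 by simp
  qed
  then show ?thesis using Lj La Lz unfolding b_def kills_def by blast
qed

end

lemma near_line:
  fixes y w :: "'p::prime_card padic ^ 'l::finite"
  assumes y: "y \<noteq> 0" and w: "w \<noteq> 0" "w \<in> vpb e" and near: "near r w y"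
  shows "\<exists>\<mu>. w - \<mu> *s y \<in> vpb (int r + e)"
proof -
  obtain t l where t: "t \<noteq> 0" "(t *s y) $ l = 1" "t *s y \<in> vpb 0" using normalise_ex[OF y] .
  have "near r w (t *s y)" using near t(1) by simp
  from near_residual[OF t(3,2) w this] have "w - w $ l *s (t *s y) \<in> vpb (int r + e)" .
  then have "w - (w $ l * t) *s y \<in> vpb (int r + e)" unfolding vector_smult_assoc .
  then show ?thesis by blast
qed

section \<open>Zeros of random forms on the image, compared with the tangent space\<close>

context immersion
begin

lemma sphere_image: "x \<in> unit_sphere \<Longrightarrow> v x \<noteq> 0"
  using lower by fastforce

lemma continuous_image: "continuous_on (vpb 0) v"
  unfolding continuous_on_iff
proof (intro ballI allI impI)
  fix x e assume x: "x \<in> (vpb 0 :: ('p padic ^ 'n) set)" and e: "(0::real) < e"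
  then obtain s where s: "\<And>x y :: 'p padic ^ 'l. x - y \<in> vpb (int s) \<Longrightarrow> dist x y < e" using vpb_small by blast
  show "\<exists>d>0. \<forall>x'\<in>vpb 0. dist x' x < d \<longrightarrow> dist (v x') (v x) < e"
  proof (intro exI[of _ "real CARD('p) powi (- (int s + c))"] conjI ballI impI)
    fix x' assume x': "x' \<in> vpb 0" "dist x' x < real CARD('p) powi (- (int s + c))"
    have "x' $ i - x $ i \<in> pb (int s + c)" for i
      unfolding dist_padic_pb using dist_vec_nth_le[of x' i x] x'(2) by linarith
    then have "x' - x \<in> vpb (int s + c)" by (intro vpbI) simp
    from lipschitz[OF x'(1) x this] show "dist (v x') (v x) < e" by (intro s) simp
  qed simp
qed

definition image_hits :: "nat \<Rightarrow> nat \<Rightarrow> 'p padic ^ 'l \<Rightarrow> (nat \<Rightarrow> 'p padic ^ 'l) set" where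
  "image_hits n r y = {\<Xi> \<in> space (row_measure n). \<exists>x\<in>unit_sphere. near r (v x) y \<and> kills n \<Xi> (v x)}"

lemma image_hits_measurable:
  assumes y: "y \<noteq> 0"
  shows "image_hits n r y \<in> sets (row_measure n)"
proof -
  let ?C = "{x \<in> unit_sphere. near r (v x) y}"
  have "compact ?C"
  \<comment> \<open>\<open>v\<close> loses \<open>c\<close> digits, and \<open>near_perturb\<close>
    asks for r + c + 1 of the remaining ones.\<close>
  proof (rule compact_sphere_saturated[where k = "int r + 2 * c + 1"])
    fix x x' assume x: "x \<in> ?C" and d: "x' - x \<in> vpb (int r + 2 * c + 1)"
    have xS: "x \<in> unit_sphere" "near r (v x) y" using x by auto
    have x'S: "x' \<in> unit_sphere" by (rule sphere_add[OF xS(1) vpb_anti[OF d]]) (use c_nonneg in simp)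
    have "v x' - v x \<in> vpb (int r + 2 * c + 1 - c)"
      using xS x'S by (intro lipschitz[OF _ _ d]) (auto simp: unit_sphere_iff)
    then have "v x' - v x \<in> vpb (int r + c + 1)" by (simp add: algebra_simps)
    from near_perturb[OF lower[OF xS(1)] this y xS(2)] show "x' \<in> ?C" using x'S by simp
  qed auto
  moreover have "continuous_on ?C v"
    by (rule continuous_on_subset[OF continuous_image]) (auto simp: unit_sphere_iff)
  ultimately have "compact (v ` ?C)" by (intro compact_continuous_image)
  from kills_measurable[OF this, of n] show ?thesis
    unfolding image_hits_def by (simp add: conj_assoc Bex_def)
qed

text \<open>A zero near \<open>v x0\<close> is brought into the chart of \<open>x0\<close>:
  \<open>injective\<close> makes coordinate \<open>j\<close> a unit, and division by it gives the
  increment. One \<open>c\<close> is lost because \<open>v x\<close> may have denominators, another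
  in passing back through \<open>injective\<close>.\<close>

lemma image_hits_normalise:
  assumes j: "x0 $ j = 1" "x0 \<in> vpb 0" and r: "3 * c + 1 \<le> int r" and x: "x \<in> unit_sphere" and near: "near r (v x) (v x0)"
    and kills: "kills n \<Xi> (v x)"
  shows "\<exists>z. z $ j = 0 \<and> z \<in> vpb (int r - 2 * c) \<and> near r (v (x0 + z)) (v x0) \<and> kills n \<Xi> (v (x0 + z))"
proof -
  have x0S: "x0 \<in> unit_sphere" using normal_in_sphere j by blast
  have xv: "x \<in> vpb 0" using x by (simp add: unit_sphere_iff)
  obtain \<mu> where "v x - \<mu> *s v x0 \<in> vpb (int r + (- c))"
    using near_line[OF sphere_image[OF x0S] sphere_image[OF x] bounded[OF xv] near] by blast
  then have m: "v x - \<mu> *s v x0 \<in> vpb (int r - c)" by simp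
  have "x $ j \<notin> pb 1 \<and> x - x $ j *s x0 \<in> vpb (int r - c - c)"
    by (rule injective[OF j(2,1) x _ m]) (use r c_nonneg in simp)
  then have xj: "x $ j \<notin> pb 1" "x - x $ j *s x0 \<in> vpb (int r - 2 * c)" by (simp_all add: algebra_simps)
  have nz: "x $ j \<noteq> 0" using xj(1) by (metis pb_0)
  define t where "t = inverse (x $ j)"
  have t: "t \<in> pb 0" "t \<noteq> 0" "t * x $ j = 1" using pb_inverse[of "x $ j" 0] xj(1) nz by (simp_all add: t_def)
  define z where "z = t *s (x - x $ j *s x0)"
  have "x0 + z = t *s x"
  proof -
    have "(x0 + z) $ i = (t *s x) $ i" for i
    proof -
      have "(x0 + z) $ i = x0 $ i + t * x $ i - (t * x $ j) * x0 $ i" by (simp add: z_def algebra_simps)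
      then show ?thesis by (simp add: t(3))
    qed
    then show ?thesis unfolding vec_eq_iff by blast
  qed
  then have vz: "v (x0 + z) = t ^ d *s v x" by (simp add: homogeneous)
  have td: "t ^ d \<noteq> 0" using t(2) by simp
  show ?thesis
  proof (intro exI[of _ z] conjI)
    show "z $ j = 0" using j(1) by (simp add: z_def)
    show "z \<in> vpb (int r - 2 * c)" unfolding z_def by (rule vpb_scale[OF t(1) xj(2)]) simp
    show "near r (v (x0 + z)) (v x0)" unfolding vz near_scale_left[OF td] by (rule near)
    show "kills n \<Xi> (v (x0 + z))" unfolding vz kills_scale[OF td] by (rule kills)
  qed
qed

lemma sphere_plus_axis:
  assumes "z $ j = 0" "z \<in> vpb 0"
  shows "axis j 1 + z \<in> unit_sphere"
  using vpb_add[OF axis_in_vpb assms(2)] assms(1) by (intro normal_in_sphere[of _ j]) (simp_all add: axis_def)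

text \<open>Off the exceptional event the curved and the tangent event agree almost surely, so their
  probabilities differ by at most its own. The threshold for \<open>r\<close> stems from the Newton
  correction: with a = r - 2c it has exponent 2a - c - k, \<open>B\<close> costs c more, and r + c +
  1 must remain for the point to stay in its ball.\<close>

lemma tangent_comparison:
  fixes n k r :: nat
  assumes card: "CARD('n) = n + 1" and n: "n \<ge> 1" and kc: "nat c \<le> k"
    and r: "7 * c + int k + 2 \<le> int r" and x0: "x0 \<in> vpb 0" "x0 $ j = 1"
  shows "\<bar>measure (row_measure n) (image_hits n r (v x0)) - 1 / real (card (pcls r ` (proj_space :: ('p padic ^ 'n) set set)))\<bar>
    \<le> real n * real CARD('p) ^ (2 * n * nat c) / real CARD('p) ^ k / real CARD('p) ^ (n * r)"
proof -
  let ?M = "row_measure n :: (nat \<Rightarrow> 'p padic ^ 'l) measure"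
  let ?err = "real n * real CARD('p) ^ (2 * n * nat c) / real CARD('p) ^ k / real CARD('p) ^ (n * r)"
  interpret prob_space ?M by (rule prob_space_rows)
  have x0S: "x0 \<in> unit_sphere" using normal_in_sphere x0 by blast
  note v0 = sphere_image[OF x0S]
  obtain B where B: "B *v axis j 1 = v x0" "\<And>u k. u \<in> vpb k \<Longrightarrow> B *v u \<in> vpb (k - c)"
    "\<And>u k. B *v u \<in> vpb k \<Longrightarrow> u \<in> vpb (k - c)"
    "\<And>z z' a b. 0 \<le> a \<Longrightarrow> z $ j = 0 \<Longrightarrow> z' $ j = 0 \<Longrightarrow> z \<in> vpb a \<Longrightarrow> z' \<in> vpb a \<Longrightarrow> z - z' \<in> vpb b \<Longrightarrow>
         v (x0 + z) - v (x0 + z') - B *v (z - z') \<in> vpb (a + b - c)"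
    using differentiable[OF x0] by blast
  have B_inj: "u = 0" if "B *v u = 0" for u
  proof -
    have "u \<in> vpb k" for k using B(3)[of u "k + c"] that by simp
    then have "u $ i = 0" for i using pb_all_zero[of 0 "u $ i"] vpb_nth by blast
    then show ?thesis by (simp add: vec_eq_iff)
  qed
  have B_lower: "B *v u \<notin> vpb (c + 1)" if "u \<in> unit_sphere" for u
    using B(3)[of u "c + 1"] that by (auto simp: unit_sphere_iff)
  \<comment> \<open>\<open>s\<close> ranges over all nonzero vectors, so the tangent space is taken
    as a whole and not only in the chart around \<open>x0\<close>.\<close>
  define L where "L = {\<Xi> \<in> space ?M. \<exists>s. s \<noteq> 0 \<and> near r (B *v s) (v x0) \<and> kills n \<Xi> (B *v s)}"
  have L: "L \<in> sets ?M" "emeasure ?M L = ennreal (1 / real (card (pcls r ` (proj_space :: ('p padic ^ 'n) set set))))"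
  proof -
    \<comment> \<open>\<open>B\<close> distorts distances; its isometric factor \<open>E\<close> has
      the same image, and \<open>C\<close> only reparametrises it.\<close>
    obtain E :: "'p padic ^ 'n ^ 'l" and E' C C' where E: "integral_matrix E" "integral_matrix E'" "E' ** E = mat 1"
      "B = E ** C" "C ** C' = mat 1" "C' ** C = mat 1" using echelon_form[OF B_inj] by metis
    have Bu: "B *v u = E *v (C *v u)" for u unfolding E(4) by (simp add: matrix_vector_mul_assoc)
    have inv: "C *v (C' *v u) = u" "C' *v (C *v u) = u" for u using E(5,6) by (simp_all add: matrix_vector_mul_assoc)
    have C0: "C *v u = 0 \<longleftrightarrow> u = 0" "C' *v u = 0 \<longleftrightarrow> u = 0" for u using inv by (metis matrix_vector_mult_0_right)+
    have t: "C *v axis j 1 \<noteq> 0" unfolding C0 by (simp add: axis_eq_0_iff)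
    have "L = {\<Xi> \<in> space ?M. \<exists>s. s \<noteq> 0 \<and> near r (E *v s) (E *v (C *v axis j 1)) \<and> kills n \<Xi> (E *v s)}"
    proof -
      have "(\<exists>s. s \<noteq> 0 \<and> P (B *v s)) \<longleftrightarrow> (\<exists>s. s \<noteq> 0 \<and> P (E *v s))" for P
        unfolding Bu using inv C0 by metis
      from this[of "\<lambda>w. near r w (v x0) \<and> kills n \<Xi> w" for \<Xi>] show ?thesis
        unfolding L_def by (simp add: B(1)[symmetric] Bu)
    qed
    then show "L \<in> sets ?M" "emeasure ?M L = ennreal (1 / real (card (pcls r ` (proj_space :: ('p padic ^ 'n) set set))))"
      using emeasure_linear_hits[OF E(1-3) t, of n r] emeasure_hits[OF card n _ t, of r] r c_nonneg by simp_all
  qed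
  let ?X = "image_hits n r (v x0)"
  have X: "?X \<in> sets ?M" by (rule image_hits_measurable[OF v0])
  obtain t l where t: "t \<noteq> 0" "(t *s v x0) $ l = 1" "t *s v x0 \<in> vpb 0" using normalise_ex[OF v0] .
  define y where "y = t *s v x0"
  note y = t(3,2)[folded y_def]
  have near_y: "near r w (v x0) \<longleftrightarrow> near r w y" for w using t(1) by (simp add: y_def)
  \<comment> \<open>\<open>B\<close> followed by the projection along \<open>y\<close> that clears
    coordinate \<open>l\<close>. This removes the radial direction and gives the normal form
    demanded by \<open>degenerate_bound\<close>.\<close>
  define W :: "'p padic ^ 'n ^ 'l" where "W = (\<chi> a b. B $ a $ b - B $ l $ b * y $ a)"
  have W: "W *v z = B *v z - (B *v z) $ l *s y" for z
    by (simp add: W_def vec_eq_iff matrix_vector_mult_def sum_subtractf sum_distrib_left algebra_simps)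
  have W0: "(W *v z) $ l = 0" for z using y(2) by (simp add: W)
  have W1: "W *v z \<in> vpb (a - int (nat c))" if z: "z \<in> vpb a" for z a
  proof -
    have Bz: "B *v z \<in> vpb (a - c)" by (rule B(2)[OF z])
    have "(B *v z) $ l *s y \<in> vpb (a - c)" by (rule vpb_scale[OF vpb_nth[OF Bz] y(1)]) simp
    then show ?thesis unfolding W using Bz c_nonneg by (simp add: vpb_diff)
  qed
  \<comment> \<open>\<open>y\<close> is a multiple of the image of axis \<open>j\<close>, so the
    projection only alters coordinate \<open>j\<close> of the argument, and the lower bound on
    \<open>B\<close> still controls the others.\<close>
  have W2: "z \<in> vpb (a - int (nat c))" if zj: "z $ j = 0" and Wz: "W *v z \<in> vpb a" for z a
  proof -
    have "W *v z = B *v (z - ((B *v z) $ l * t) *s axis j 1)"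
      unfolding W y_def by (simp add: matrix_vector_mult_diff_distrib matrix_vector_scale B(1))
    then have *: "z - ((B *v z) $ l * t) *s axis j 1 \<in> vpb (a - c)" using B(3) Wz by metis
    have "z $ i \<in> pb (a - c)" for i
    proof (cases "i = j")
      case False
      then show ?thesis using vpb_nth[OF *, of i] by (simp add: axis_def)
    qed (use zj in simp)
    then show ?thesis using c_nonneg by (intro vpbI) simp
  qed
  obtain Bad where Bad: "Bad \<in> sets ?M" "emeasure ?M Bad \<le> ennreal ?err"
    "\<And>\<Xi> z a. \<Xi> \<in> space ?M \<Longrightarrow> \<Xi> \<notin> Bad \<Longrightarrow> integral_rows n \<Xi> \<Longrightarrow> (\<And>i. i \<in> {1..n} \<Longrightarrow> dot (\<Xi> i) y \<in> pb (int r)) \<Longrightarrow>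
      z $ j = 0 \<Longrightarrow> (\<And>i. i \<in> {1..n} \<Longrightarrow> dot (\<Xi> i) (W *v z) \<in> pb a) \<Longrightarrow> z \<in> vpb (a - int k)"
  proof (rule degenerate_bound[where n = n and c = "nat c" and k = k and y = y and l = l and W = W and j = j and r = r])
    show "CARD('n) = n + 1" "n \<ge> 1" "nat c \<le> k" "y \<in> vpb 0" "y $ l = 1" by fact+
    show "(W *v z) $ l = 0" for z by (rule W0)
    show "W *v z \<in> vpb (e - int (nat c))" if "z \<in> vpb e" for z e using that by (rule W1)
    show "z \<in> vpb (e - int (nat c))" if "z $ j = 0" "W *v z \<in> vpb e" for z e using that by (rule W2)
  qed (rule that, assumption, assumption, blast)
  have r1: "r \<ge> 1" using r c_nonneg by simp
  \<comment> \<open>The exponent of the chart increments supplied by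
    \<open>image_hits_normalise\<close>.\<close>
  define a where "a = int r - 2 * c"
  have newton: "newton v c x0 j B \<Xi> n k a"
    if \<Xi>: "\<Xi> \<in> space ?M" "\<Xi> \<notin> Bad" "integral_rows n \<Xi>" and ny: "\<And>i. i \<in> {1..n} \<Longrightarrow> dot (\<Xi> i) y \<in> pb (int r)" for \<Xi>
  proof
    show "0 \<le> c" by (rule c_nonneg)
    show "CARD('n) = n + 1" by (rule card)
    show "c + int k + 1 \<le> a" using r c_nonneg by (simp add: a_def)
    show "integral_rows n \<Xi>" by (rule \<Xi>(3))
    fix z e assume z: "z $ j = 0" "\<And>i. i \<in> {1..n} \<Longrightarrow> dot (\<Xi> i) (B *v z) \<in> pb e"
    show "z \<in> vpb (e - int k)"
    proof (rule ccontr)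
      assume nz: "z \<notin> vpb (e - int k)"
      then have "z \<noteq> 0" by auto
      then obtain b where b: "\<And>j. z \<in> vpb j \<longleftrightarrow> j \<le> b" using vpb_exact by blast
      have be: "b < e - int k" using nz b by simp
      \<comment> \<open>\<open>W *v z\<close> differs from \<open>B *v z\<close> by a multiple of
        \<open>y\<close>, where the forms are at most p^-r; the minimum covers both contributions.
        For large \<open>r\<close> the second one cannot be binding, which contradicts the size of
        \<open>z\<close>.\<close>
      define m where "m = min e (b - c + int r)"
      have "dot (\<Xi> i) (W *v z) \<in> pb m" if i: "i \<in> {1..n}" for i
      proof -
        have "(B *v z) $ l \<in> pb (b - c)" using vpb_nth[OF B(2)[of z b]] b[of b] by simp
        then have "(B *v z) $ l * dot (\<Xi> i) y \<in> pb m" by (rule pb_mult'[OF _ ny[OF i]]) (simp add: m_def)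
        moreover have "dot (\<Xi> i) (B *v z) \<in> pb m" by (rule pb_anti[OF z(2)[OF i]]) (simp add: m_def)
        ultimately show ?thesis unfolding W dot_diff_right dot_scale_right by (rule pb_diff[rotated])
      qed
      then have "z \<in> vpb (m - int k)" using Bad(3)[OF \<Xi> ny z(1)] by blast
      then have "m - int k \<le> b" using b by simp
      then show False using be r c_nonneg by (simp add: m_def min_def split: if_splits)
    qed
  qed (use B in auto)
  have iff: "\<Xi> \<in> ?X \<longleftrightarrow> \<Xi> \<in> L" if \<Xi>: "\<Xi> \<in> space ?M" "\<Xi> \<notin> Bad" "integral_rows n \<Xi>" for \<Xi>
  proof
    assume "\<Xi> \<in> ?X"
    then obtain x where x: "x \<in> unit_sphere" "near r (v x) (v x0)" "kills n \<Xi> (v x)" by (auto simp: image_hits_def)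
    have ny: "dot (\<Xi> i) y \<in> pb (int r)" if "i \<in> {1..n}" for i
      by (rule near_kills[OF y sphere_image[OF x(1)] x(2)[unfolded near_y] r1 \<Xi>(3) x(3) that])
    interpret newton v c x0 j B \<Xi> n k a by (rule newton[OF \<Xi> ny])
    obtain z where z: "z $ j = 0" "z \<in> vpb (int r - 2 * c)" "near r (v (x0 + z)) (v x0)" "kills n \<Xi> (v (x0 + z))"
      using image_hits_normalise[OF x0(2,1) _ x] r c_nonneg by auto
    have za: "z \<in> vpb a" using z(2) by (simp add: a_def)
    obtain z' where z': "z' $ j = 0" "z' - z \<in> vpb (2 * a - c - int k)" "kills n \<Xi> (B *v (axis j 1 + z'))"
      using tangent_zero[OF z(1) za z(4)] by blast
    have a0: "0 \<le> a" using r c_nonneg by (simp add: a_def)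
    have xzS: "x0 + z \<in> unit_sphere"
      by (rule normal_in_sphere[of _ j]) (use x0 z(1) vpb_anti[OF za a0] in \<open>auto intro: vpb_add\<close>)
    have eq: "B *v (axis j 1 + z') = v (x0 + z) + (B *v (z' - z) - q z)"
      unfolding v_eq by (simp add: matrix_vector_right_distrib matrix_vector_mult_diff_distrib)
    \<comment> \<open>The tangent zero differs from \<open>v (x0 + z)\<close> by less than the ball
      can resolve.\<close>
    have "B *v (z' - z) - q z \<in> vpb (int r + c + 1)"
      by (intro vpb_diff vpb_anti[OF B_upper[OF z'(2)]] vpb_anti[OF q_small[OF a0 z(1) za]])
        (use r c_nonneg in \<open>simp_all add: a_def\<close>)
    from near_perturb[OF lower[OF xzS] this v0 z(3)] have "near r (B *v (axis j 1 + z')) (v x0)" unfolding eq .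
    moreover have "(axis j 1 + z') $ j = 1" using z'(1) by (simp add: axis_def)
    then have "axis j 1 + z' \<noteq> 0" by (metis zero_index zero_neq_one)
    ultimately show "\<Xi> \<in> L" unfolding L_def using \<Xi>(1) z'(3) by blast
  next
    assume "\<Xi> \<in> L"
    then obtain s' where s': "s' \<noteq> 0" "near r (B *v s') (v x0)" "kills n \<Xi> (B *v s')" by (auto simp: L_def)
    obtain u where u: "u \<noteq> 0" "u *s s' \<in> unit_sphere" using unit_representative[OF s'(1)] .
    define s where "s = u *s s'"
    have s: "s \<in> unit_sphere" "near r (B *v s) (v x0)" "kills n \<Xi> (B *v s)"
      using u s'(2,3) by (simp_all add: s_def matrix_vector_scale kills_scale)
    have sv: "s \<in> vpb 0" "s \<notin> vpb 1" using s(1) by (auto simp: unit_sphere_iff)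
    have Bs0: "B *v s \<noteq> 0" using B_lower[OF s(1)] by auto
    have ny: "dot (\<Xi> i) y \<in> pb (int r)" if "i \<in> {1..n}" for i
      by (rule near_kills[OF y Bs0 s(2)[unfolded near_y] r1 \<Xi>(3) s(3) that])
    interpret newton v c x0 j B \<Xi> n k a by (rule newton[OF \<Xi> ny])
    have "B *v s \<in> vpb (- c)" using B(2)[OF sv(1)] by simp
    from near_line[OF v0 Bs0 this s(2)] obtain \<mu> where "B *v s - \<mu> *s v x0 \<in> vpb (int r - c)" by auto
    then have "B *v (s - \<mu> *s axis j 1) \<in> vpb (int r - c)"
      by (simp add: matrix_vector_mult_diff_distrib matrix_vector_scale B(1))
    from B(3)[OF this] have *: "s - \<mu> *s axis j 1 \<in> vpb a" by (simp add: a_def algebra_simps)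
    \<comment> \<open>Away from \<open>j\<close> the coordinates of \<open>s\<close> are small, so
      \<open>s $ j\<close> is a unit and \<open>s\<close> can be moved into the chart.\<close>
    have si: "s $ i \<in> pb a" if "i \<noteq> j" for i using vpb_nth[OF *, of i] that by (simp add: axis_def)
    have a1: "1 \<le> a" using r c_nonneg by (simp add: a_def)
    have sj: "s $ j \<notin> pb 1"
    proof
      assume "s $ j \<in> pb 1"
      then have "s $ i \<in> pb 1" for i using pb_anti[OF si a1] by (cases "i = j") auto
      then show False using sv(2) by (auto simp: vpb_def)
    qed
    have nz: "s $ j \<noteq> 0" using sj by (metis pb_0)
    define h where "h = inverse (s $ j)"
    have h: "h \<in> pb 0" "h \<noteq> 0" "h * s $ j = 1" using pb_inverse[of "s $ j" 0] sj nz by (simp_all add: h_def)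
    define z where "z = h *s s - axis j 1"
    have zj: "z $ j = 0" using h(3) by (simp add: z_def axis_def)
    have "z $ i \<in> pb a" for i
    proof (cases "i = j")
      case False
      then have "z $ i = h * s $ i" by (simp add: z_def axis_def)
      then show ?thesis using pb_mult'[OF h(1) si[OF False], of a] by simp
    qed (use zj in simp)
    then have za: "z \<in> vpb a" by (rule vpbI)
    have ez: "axis j 1 + z = h *s s" by (simp add: z_def)
    have z: "near r (B *v (axis j 1 + z)) (v x0)" "kills n \<Xi> (B *v (axis j 1 + z))"
      unfolding ez matrix_vector_scale using h(2) s(2,3) by (simp_all add: kills_scale)
    obtain z' where z': "z' $ j = 0" "z' \<in> vpb a" "z' - z \<in> vpb (2 * a - c - int k)" "kills n \<Xi> (v (x0 + z'))"
      using curved_zero[OF zj za z(2)] by blast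
    have a0: "0 \<le> a" using a1 by simp
    have ezS: "axis j 1 + z \<in> unit_sphere" by (rule sphere_plus_axis[OF zj vpb_anti[OF za a0]])
    have eq: "v (x0 + z') = B *v (axis j 1 + z) + (B *v (z' - z) + q z')"
      unfolding v_eq by (simp add: matrix_vector_right_distrib matrix_vector_mult_diff_distrib)
    have "B *v (z' - z) + q z' \<in> vpb (int r + c + 1)"
      by (intro vpb_add vpb_anti[OF B_upper[OF z'(3)]] vpb_anti[OF q_small[OF a0 z'(1,2)]])
        (use r c_nonneg in \<open>simp_all add: a_def\<close>)
    from near_perturb[OF B_lower[OF ezS] this v0 z(1)] have "near r (v (x0 + z')) (v x0)" unfolding eq .
    moreover have "x0 + z' \<in> unit_sphere"
      by (rule normal_in_sphere[of _ j]) (use x0 z'(1) vpb_anti[OF z'(2) a0] in \<open>auto intro: vpb_add\<close>)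
    ultimately show "\<Xi> \<in> ?X" unfolding image_hits_def using \<Xi>(1) z'(4) by blast
  qed
  have AE: "AE \<Xi> in ?M. \<Xi> \<notin> Bad \<longrightarrow> (\<Xi> \<in> ?X \<longleftrightarrow> \<Xi> \<in> L)"
    using AE_integral_rows AE_space by eventually_elim (use iff in blast)
  have "0 \<le> ?err" by simp
  then have bad: "measure ?M Bad \<le> ?err" using Bad(2) by (simp add: emeasure_eq_measure)
  have le: "measure ?M P \<le> measure ?M R + ?err"
    if "P \<in> sets ?M" "R \<in> sets ?M" "AE \<Xi> in ?M. \<Xi> \<in> P \<longrightarrow> \<Xi> \<in> R \<union> Bad" for P R
  proof -
    have "measure ?M P \<le> measure ?M (R \<union> Bad)" using that Bad(1) by (intro finite_measure_mono_AE) auto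
    also have "\<dots> \<le> measure ?M R + measure ?M Bad" using that(2) Bad(1) by (rule measure_Un_le)
    finally show ?thesis using bad by linarith
  qed
  have "measure ?M ?X \<le> measure ?M L + ?err"
    by (rule le[OF X L(1)]) (use AE in \<open>auto elim: eventually_mono\<close>)
  moreover have "measure ?M L \<le> measure ?M ?X + ?err"
    by (rule le[OF L(1) X]) (use AE in \<open>auto elim: eventually_mono\<close>)
  moreover have "measure ?M L = 1 / real (card (pcls r ` (proj_space :: ('p padic ^ 'n) set set)))"
    using L(2) by (simp add: emeasure_eq_measure)
  ultimately show ?thesis by linarith
qed

end

section \<open>The expected number of zeros\<close>

text \<open>Counts a possibly infinite set through maps of finite image that eventually separate any
  two points: every finite subset is fully resolved at some level, so the image sizes exhaust the
  cardinality.\<close>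

lemma emeasure_count_space_eq_SUP:
  assumes fin: "\<And>m. finite (g m ` Z)"
    and sep: "\<And>x y. x \<in> Z \<Longrightarrow> y \<in> Z \<Longrightarrow> x \<noteq> y \<Longrightarrow> \<exists>m0. \<forall>m\<ge>m0. g m x \<noteq> g m y"
  shows "emeasure (count_space UNIV) Z = (SUP m::nat. of_nat (card (g m ` Z)))"
proof -
  have fin_le: "of_nat (card F) \<le> (SUP m. of_nat (card (g m ` Z)) :: ennreal)" if F: "F \<subseteq> Z" "finite F" for F
  proof -
    have "\<forall>p\<in>F \<times> F. \<exists>m0. fst p \<noteq> snd p \<longrightarrow> (\<forall>m\<ge>m0. g m (fst p) \<noteq> g m (snd p))"
      using sep F(1) by (metis mem_Times_iff subsetD)
    then obtain m0 where m0: "\<And>x y m. x \<in> F \<Longrightarrow> y \<in> F \<Longrightarrow> x \<noteq> y \<Longrightarrow> m \<ge> m0 (x, y) \<Longrightarrow> g m x \<noteq> g m y"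
      by (metis fst_conv snd_conv mem_Sigma_iff)
    \<comment> \<open>The sum of all pairwise thresholds dominates each of them.\<close>
    define m where "m = (\<Sum>p\<in>F \<times> F. m0 p)"
    have "m0 p \<le> m" if "p \<in> F \<times> F" for p
      unfolding m_def using that F(2) by (intro member_le_sum) auto
    then have "inj_on (g m) F" using m0 by (intro inj_onI) (metis mem_Sigma_iff)
    then have "card F = card (g m ` F)" by (simp add: card_image)
    also have "\<dots> \<le> card (g m ` Z)" using fin F(1) by (intro card_mono image_mono)
    finally have "(of_nat (card F) :: ennreal) \<le> of_nat (card (g m ` Z))" by (simp add: of_nat_mono)
    also have "\<dots> \<le> (SUP m. of_nat (card (g m ` Z)))" by (rule SUP_upper) simp
    finally show ?thesis .
  qed
  show ?thesis
  proof (cases "finite Z")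
    case True
    have "(SUP m. of_nat (card (g m ` Z)) :: ennreal) \<le> of_nat (card Z)"
      using True by (intro SUP_least of_nat_mono card_image_le)
    moreover have "emeasure (count_space UNIV) Z = of_nat (card Z)" using True by simp
    ultimately show ?thesis using fin_le[OF subset_refl True] by (simp add: antisym)
  next
    case False
    have le: "of_nat k \<le> (SUP m. of_nat (card (g m ` Z)) :: ennreal)" for k
    proof -
      obtain F where "F \<subseteq> Z" "finite F" "card F = k" using infinite_arbitrarily_large[OF False] by blast
      then show ?thesis using fin_le by blast
    qed
    have "(SUP m. of_nat (card (g m ` Z)) :: ennreal) = \<infinity>"
    proof (rule ccontr)
      assume "(SUP m. of_nat (card (g m ` Z)) :: ennreal) \<noteq> \<infinity>"
      then have "(SUP m. of_nat (card (g m ` Z)) :: ennreal) < top"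
        unfolding infinity_ennreal_def by (simp only: top.not_eq_extremum)
      from ennreal_Ex_less_of_nat[OF this] obtain k where "(SUP m. of_nat (card (g m ` Z)) :: ennreal) < of_nat k" ..
      then show False using leD[OF le[of k]] by (rule notE[rotated])
    qed
    moreover have "emeasure (count_space UNIV) Z = \<infinity>" using False by simp
    ultimately show ?thesis by (simp only:)
  qed
qed

lemma near_mono:
  fixes x y :: "'p::prime_card padic ^ 'n::finite"
  assumes "near m x y" "k \<le> m"
  shows "near k x y"
proof -
  have "0 \<le> vec_abs z" for z :: "'p padic ^ 'n" using vec_abs_attained[of z] by auto
  then have "real CARD('p) powi (- int m) * vec_abs x * vec_abs y \<le> real CARD('p) powi (- int k) * vec_abs x * vec_abs y"
    using assms(2) by (intro mult_right_mono) auto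
  then show ?thesis using assms(1) unfolding near_def by linarith
qed

text \<open>If two points shared balls of arbitrarily small radius, the residual against a
  normalised representative would be divisible by every power of p.\<close>

lemma pcls_separate:
  fixes X Y :: "('p::prime_card padic ^ 'n::finite) set"
  assumes XY: "X \<in> proj_space" "Y \<in> proj_space" "X \<noteq> Y"
  shows "\<exists>m0. \<forall>m\<ge>m0. pcls m X \<noteq> pcls m Y"
proof (rule ccontr)
  assume "\<nexists>m0. \<forall>m\<ge>m0. pcls m X \<noteq> pcls m Y"
  then have ex: "\<And>m0. \<exists>m\<ge>m0. pcls m X = pcls m Y" by blast
  obtain x where x: "x \<in> unit_sphere" "X = proj_class x" using XY(1) unfolding proj_space_eq_sphere by blast
  obtain y' where y': "y' \<noteq> 0" "Y = proj_class y'" using XY(2) by (rule proj_space_cases)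
  obtain c l where c: "c \<noteq> 0" "(c *s y') $ l = 1" "c *s y' \<in> vpb 0" using normalise_ex[OF y'(1)] .
  define y where "y = c *s y'"
  note y = c(3,2)[folded y_def]
  have Y: "Y = proj_class y" using c(1) y'(2) by (simp add: y_def proj_class_scale)
  have y0: "y \<noteq> 0" using sphere_nonzero[OF normal_in_sphere[OF y]] .
  have res: "x - x $ l *s y \<in> vpb (int k)" for k
  proof -
    obtain m where m: "m \<ge> k" "pcls m X = pcls m Y" using ex by blast
    then have "near m x y" using pcls_eq_iff[OF sphere_nonzero[OF x(1)] y0] x(2) Y by simp
    then have "near k x y" using m(1) by (rule near_mono)
    then show ?thesis unfolding near_normal[OF y x(1)] .
  qed
  have "(x - x $ l *s y) $ i = 0" for i
  proof (rule pb_all_zero[of 0])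
    fix k :: int assume "0 \<le> k"
    then show "(x - x $ l *s y) $ i \<in> pb k" using vpb_nth[OF res[of "nat k"], of i] by simp
  qed
  then have "x - x $ l *s y = 0" unfolding vec_eq_iff zero_index by blast
  then have eq: "x = x $ l *s y" unfolding right_minus_eq .
  have "x $ l \<noteq> 0"
  proof
    assume "x $ l = 0"
    with eq have "x = 0 *s y" by (simp only:)
    then have "x = 0" by simp
    then show False using sphere_nonzero[OF x(1)] by simp
  qed
  then have "proj_class (x $ l *s y) = Y" unfolding Y by (rule proj_class_scale)
  then have "X = Y" unfolding x(2) eq[symmetric] .
  then show False using XY(3) by simp
qed

section \<open>Counting zeros through the balls that meet the image\<close>

locale immersion_count = immersion v d c
  for v :: "'p::prime_card padic ^ 'n::finite \<Rightarrow> 'p padic ^ 'l::finite" and d :: nat and c :: int +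
  fixes \<nu> :: "('p padic ^ 'n) set \<Rightarrow> ('p padic ^ 'l) set" and n :: nat
  assumes \<nu>: "\<nu> (proj_class x) = proj_class (v x)"
    and card: "CARD('n) = n + 1" and n: "n \<ge> 1"
begin

definition zeros :: "(nat \<Rightarrow> 'p padic ^ 'l) \<Rightarrow> ('p padic ^ 'n) set set" where
  "zeros \<Xi> = {X \<in> proj_space. \<forall>x\<in>X. kills n \<Xi> (v x)}"

lemma zeros_iff:
  assumes x: "x \<in> unit_sphere"
  shows "proj_class x \<in> zeros \<Xi> \<longleftrightarrow> kills n \<Xi> (v x)"
proof
  assume "proj_class x \<in> zeros \<Xi>"
  moreover have "x \<in> proj_class x" by (auto simp: proj_class_def intro!: exI[of _ 1])
  ultimately show "kills n \<Xi> (v x)" by (auto simp: zeros_def)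
next
  assume "kills n \<Xi> (v x)"
  then have "kills n \<Xi> (v (a *s x))" if "a \<noteq> 0" for a
    using that by (simp add: homogeneous kills_scale)
  then show "proj_class x \<in> zeros \<Xi>"
    using proj_class_in_space[OF sphere_nonzero[OF x]] by (auto simp: zeros_def proj_class_def)
qed

lemma \<nu>_in_space: "X \<in> proj_space \<Longrightarrow> \<nu> X \<in> proj_space"
  unfolding proj_space_eq_sphere[where 'n = 'n] using sphere_image \<nu> proj_class_in_space by fastforce

text \<open>Zeros live in the source but balls in the target; injectivity lets small balls separate
  zeros. Under exact equality \<open>injective\<close> applies at every precision.\<close>

lemma \<nu>_inj: "inj_on \<nu> proj_space"
proof (rule inj_onI)
  fix X Y assume XY: "X \<in> proj_space" "Y \<in> proj_space" and eq: "\<nu> X = \<nu> Y"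
  obtain x where x: "x \<in> unit_sphere" "X = proj_class x" using XY(1) unfolding proj_space_eq_sphere by blast
  obtain y' where y': "y' \<noteq> 0" "Y = proj_class y'" using XY(2) by (rule proj_space_cases)
  obtain b j where b: "b \<noteq> 0" "(b *s y') $ j = 1" "b *s y' \<in> vpb 0" using normalise_ex[OF y'(1)] .
  define y where "y = b *s y'"
  note y = b(3,2)[folded y_def]
  have Y: "Y = proj_class y" using b(1) y'(2) by (simp add: y_def proj_class_scale)
  have "proj_class (v x) = proj_class (v y)" using eq x(2) Y by (simp add: \<nu>)
  then obtain \<mu> where \<mu>: "v x = \<mu> *s v y" unfolding proj_class_eq_iff by blast
  have res: "x $ j \<notin> pb 1 \<and> x - x $ j *s y \<in> vpb (k - c)" if "c < k" for k
    by (rule injective[where \<mu> = \<mu>, OF y x(1) that]) (simp add: \<mu>)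
  have "(x - x $ j *s y) $ i = 0" for i
  proof (rule pb_all_zero[of 1])
    fix k :: int assume "1 \<le> k"
    then show "(x - x $ j *s y) $ i \<in> pb k" using vpb_nth[of "x - x $ j *s y" k i] res[of "k + c"] by simp
  qed
  then have "x - x $ j *s y = 0" unfolding vec_eq_iff zero_index by blast
  then have eq: "x = x $ j *s y" unfolding right_minus_eq .
  have "x $ j \<noteq> 0" using res[of "c + 1"] by auto
  then have "proj_class (x $ j *s y) = Y" unfolding Y by (rule proj_class_scale)
  then show "X = Y" unfolding x(2) eq[symmetric] .
qed

definition cells :: "nat \<Rightarrow> ('p padic ^ 'l) set set set" where
  "cells m = pcls m ` \<nu> ` proj_space"

lemma cells_subset: "cells m \<subseteq> pcls m ` proj_space"
  unfolding cells_def using \<nu>_in_space by (intro image_mono) blast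

lemma finite_cells: "m \<ge> 1 \<Longrightarrow> finite (cells m)"
  using finite_subset[OF cells_subset finite_pcls] .

definition count :: "nat \<Rightarrow> (nat \<Rightarrow> 'p padic ^ 'l) \<Rightarrow> nat" where
  "count m \<Xi> = card (pcls m ` \<nu> ` zeros \<Xi>)"

lemma zeros_subset: "zeros \<Xi> \<subseteq> proj_space"
  by (auto simp: zeros_def)

lemma finite_count: "m \<ge> 1 \<Longrightarrow> finite (pcls m ` \<nu> ` zeros \<Xi>)"
  using finite_cells[of m] zeros_subset unfolding cells_def by (meson finite_subset image_mono)

text \<open>The shift to \<open>Suc m\<close> avoids radius 1: finiteness of the set of balls is
  available for exponents from 1 on.\<close>

lemma card_zeros: "emeasure (count_space UNIV) (zeros \<Xi>) = (SUP m. of_nat (count (Suc m) \<Xi>))"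
proof -
  have "emeasure (count_space UNIV) (zeros \<Xi>) = (SUP m. of_nat (card ((\<lambda>X. pcls (Suc m) (\<nu> X)) ` zeros \<Xi>)))"
  proof (rule emeasure_count_space_eq_SUP)
    show "finite ((\<lambda>X. pcls (Suc m) (\<nu> X)) ` zeros \<Xi>)" for m
      using finite_count[of "Suc m" \<Xi>] by (simp add: image_image)
    fix X Y assume XY: "X \<in> zeros \<Xi>" "Y \<in> zeros \<Xi>" "X \<noteq> Y"
    then have "\<nu> X \<noteq> \<nu> Y" using \<nu>_inj zeros_subset by (meson inj_onD subsetD)
    then obtain m0 where "\<forall>m\<ge>m0. pcls m (\<nu> X) \<noteq> pcls m (\<nu> Y)"
      using pcls_separate[of "\<nu> X" "\<nu> Y"] \<nu>_in_space zeros_subset XY by blast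
    then show "\<exists>m0. \<forall>m\<ge>m0. pcls (Suc m) (\<nu> X) \<noteq> pcls (Suc m) (\<nu> Y)" using le_Suc_eq by blast
  qed
  then show ?thesis by (simp add: count_def image_image)
qed

text \<open>The coarse ball of a point is determined by its fine ball, so the coarse balls are an
  image of the fine ones.\<close>

lemma count_mono: "1 \<le> m \<Longrightarrow> m \<le> m' \<Longrightarrow> count m \<Xi> \<le> count m' \<Xi>"
proof -
  assume m: "1 \<le> m" "m \<le> m'"
  define h where "h D = pcls m (SOME X. X \<in> \<nu> ` zeros \<Xi> \<and> pcls m' X = D)" for D
  have "h (pcls m' X) = pcls m X" if X: "X \<in> \<nu> ` zeros \<Xi>" for X
  proof -
    have "\<exists>X'. X' \<in> \<nu> ` zeros \<Xi> \<and> pcls m' X' = pcls m' X" using X by blast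
    from someI_ex[OF this] obtain X' where X': "X' \<in> \<nu> ` zeros \<Xi>" "pcls m' X' = pcls m' X" "h (pcls m' X) = pcls m X'"
      unfolding h_def by blast
    have sp: "X \<in> proj_space" "X' \<in> proj_space" using X X'(1) \<nu>_in_space zeros_subset by blast+
    obtain x where x: "x \<noteq> 0" "X = proj_class x" using sp(1) by (rule proj_space_cases)
    obtain x' where x': "x' \<noteq> 0" "X' = proj_class x'" using sp(2) by (rule proj_space_cases)
    have "near m' x' x" using X'(2) pcls_eq_iff[OF x'(1) x(1)] x x' by simp
    then have "near m x' x" using m(2) by (rule near_mono)
    then show ?thesis using X'(3) pcls_eq_iff[OF x'(1) x(1)] x x' by simp
  qed
  then have "pcls m ` \<nu> ` zeros \<Xi> = h ` pcls m' ` \<nu> ` zeros \<Xi>" by (force simp: image_image)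
  moreover have "finite (pcls m' ` \<nu> ` zeros \<Xi>)" by (rule finite_count) (use m in simp)
  ultimately show ?thesis unfolding count_def by (simp add: card_image_le)
qed

lemma cell_representative:
  assumes "D \<in> cells m"
  shows "\<exists>x j. x \<in> vpb 0 \<and> x $ j = 1 \<and> D = pcls m (proj_class (v x))"
proof -
  obtain x' where x': "x' \<noteq> 0" "D = pcls m (\<nu> (proj_class x'))"
    using assms unfolding cells_def by (auto elim: proj_space_cases)
  obtain b j where b: "b \<noteq> 0" "(b *s x') $ j = 1" "b *s x' \<in> vpb 0" using normalise_ex[OF x'(1)] .
  have "D = pcls m (\<nu> (proj_class (b *s x')))" using x'(2) b(1) by (simp add: proj_class_scale)
  then show ?thesis using b unfolding \<nu> by blast
qed

lemma image_hits_iff: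
  assumes x0: "x0 \<in> unit_sphere" and \<Xi>: "\<Xi> \<in> space (row_measure n)"
  shows "\<Xi> \<in> image_hits n m (v x0) \<longleftrightarrow> pcls m (proj_class (v x0)) \<in> pcls m ` \<nu> ` zeros \<Xi>"
proof
  assume "\<Xi> \<in> image_hits n m (v x0)"
  then obtain x where x: "x \<in> unit_sphere" "near m (v x) (v x0)" "kills n \<Xi> (v x)" by (auto simp: image_hits_def)
  have "proj_class x \<in> zeros \<Xi>" using zeros_iff[OF x(1)] x(3) by simp
  moreover have "pcls m (proj_class (v x0)) = pcls m (\<nu> (proj_class x))"
    unfolding \<nu> using pcls_eq_iff[OF sphere_image[OF x(1)] sphere_image[OF x0], of m] x(2) by simp
  ultimately show "pcls m (proj_class (v x0)) \<in> pcls m ` \<nu> ` zeros \<Xi>" by blast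
next
  assume "pcls m (proj_class (v x0)) \<in> pcls m ` \<nu> ` zeros \<Xi>"
  then obtain X where X: "X \<in> zeros \<Xi>" "pcls m (proj_class (v x0)) = pcls m (\<nu> X)" by blast
  then have "X \<in> proj_space" using zeros_subset by blast
  then obtain x where x: "x \<in> unit_sphere" "X = proj_class x" unfolding proj_space_eq_sphere by blast
  have "near m (v x) (v x0)"
    using X(2) pcls_eq_iff[OF sphere_image[OF x(1)] sphere_image[OF x0], of m] unfolding x(2) \<nu> by simp
  then show "\<Xi> \<in> image_hits n m (v x0)"
    using x X(1) zeros_iff[OF x(1)] \<Xi> by (auto simp: image_hits_def)
qed

abbreviation Q :: "(nat \<Rightarrow> 'p padic ^ 'l) measure" where "Q \<equiv> row_measure n"

definition ball_count :: "nat \<Rightarrow> nat" where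
  "ball_count m = card (pcls m ` (proj_space :: ('p padic ^ 'n) set set))"

definition unit_volume :: real where
  "unit_volume = (1 - 1 / real CARD('p) ^ CARD('n)) / (1 - 1 / real CARD('p))"

lemma unit_volume_pos: "0 < unit_volume"
  unfolding unit_volume_def using card_gt_1[where 'p = 'p]
  by (intro divide_pos_pos) (simp_all add: one_less_power)

lemma ball_count: "m \<ge> 1 \<Longrightarrow> real (ball_count m) = unit_volume * real CARD('p) ^ (m * n)"
  unfolding ball_count_def unit_volume_def using card_pcls_proj_space[of m, where 'p = 'p and 'n = 'n] card by simp

text \<open>\<open>\<nu>\<close> sends each ball of exponent m + 2c + 1 in the source into a single
  ball of exponent m. One \<open>c\<close> is the Lipschitz loss; the other c + 1 digits are what
  \<open>near_add\<close> asks for.\<close>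

lemma cells_bound:
  assumes "m \<ge> 1"
  shows "real (card (cells m)) \<le> unit_volume * real CARD('p) ^ ((m + nat (2 * c + 1)) * n)"
proof -
  let ?m = "m + nat (2 * c + 1)"
  have cong: "pcls m (\<nu> X) = pcls m (\<nu> Y)" if XY: "X \<in> proj_space" "Y \<in> proj_space" "pcls ?m X = pcls ?m Y" for X Y
  proof -
    obtain x where x: "x \<in> unit_sphere" "X = proj_class x" using XY(1) unfolding proj_space_eq_sphere by blast
    obtain y' where y': "y' \<noteq> 0" "Y = proj_class y'" using XY(2) by (rule proj_space_cases)
    obtain b j where b: "b \<noteq> 0" "(b *s y') $ j = 1" "b *s y' \<in> vpb 0" using normalise_ex[OF y'(1)] .
    define y where "y = b *s y'"
    note y = b(3,2)[folded y_def]
    have Y: "Y = proj_class y" using b(1) y'(2) by (simp add: y_def proj_class_scale)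
    have yS: "y \<in> unit_sphere" by (rule normal_in_sphere[OF y])
    have "near ?m x y" using XY(3) pcls_eq_iff[OF sphere_nonzero[OF x(1)] sphere_nonzero[OF yS]] x(2) Y by simp
    then have e: "x - x $ j *s y \<in> vpb (int ?m)" using near_normal[OF y x(1)] by blast
    have xv: "x \<in> vpb 0" using x(1) by (simp add: unit_sphere_iff)
    have xy0: "x $ j *s y \<in> vpb 0" by (rule vpb_scale[OF vpb_nth[OF xv] y(1)]) simp
    have xyS: "x $ j *s y \<in> unit_sphere"
      by (rule sphere_add[OF x(1)]) (use vpb_anti[OF e, of 1] c_nonneg in \<open>simp add: vpb_diff_commute\<close>)
    have "v x - v (x $ j *s y) \<in> vpb (int ?m - c)" by (rule lipschitz[OF xv xy0 e])
    then have "v x - v (x $ j *s y) \<in> vpb (int m + c + 1)" by (rule vpb_anti) (use c_nonneg in simp)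
    from near_add(1)[OF lower[OF xyS] this] have "near m (v x) (v (x $ j *s y))" by simp
    moreover have "x $ j \<noteq> 0" using sphere_nonzero[OF xyS] by (metis vec.scale_zero_left)
    ultimately have "near m (v x) (v y)" by (simp add: homogeneous)
    then show ?thesis
      unfolding x(2) Y \<nu> using pcls_eq_iff[OF sphere_image[OF x(1)] sphere_image[OF yS]] by blast
  qed
  define h where "h D = pcls m (\<nu> (SOME X. X \<in> proj_space \<and> pcls ?m X = D))" for D
  have h: "h (pcls ?m X) = pcls m (\<nu> X)" if X: "X \<in> proj_space" for X
  proof -
    have "\<exists>X'. X' \<in> proj_space \<and> pcls ?m X' = pcls ?m X" using X by blast
    from someI_ex[OF this] show ?thesis unfolding h_def using cong[OF _ X] by blast
  qed
  have "cells m = h ` pcls ?m ` proj_space" unfolding cells_def image_image using h by force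
  then have "card (cells m) \<le> ball_count ?m"
    unfolding ball_count_def using finite_pcls[of ?m, where 'p = 'p and 'n = 'n] assms by (simp add: card_image_le)
  then show ?thesis using ball_count[of ?m] assms by simp
qed

definition mean_count :: "nat \<Rightarrow> real" where
  "mean_count m = (\<Sum>D\<in>cells m. measure Q {\<Xi> \<in> space Q. D \<in> pcls m ` \<nu> ` zeros \<Xi>})"

lemma cell_event:
  assumes D: "D \<in> cells m"
  shows "{\<Xi> \<in> space Q. D \<in> pcls m ` \<nu> ` zeros \<Xi>} \<in> sets Q"
    and "nat c \<le> k \<Longrightarrow> 7 * c + int k + 2 \<le> int m \<Longrightarrow>
      \<bar>measure Q {\<Xi> \<in> space Q. D \<in> pcls m ` \<nu> ` zeros \<Xi>} - 1 / real (ball_count m)\<bar>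
      \<le> real n * real CARD('p) ^ (2 * n * nat c) / real CARD('p) ^ k / real CARD('p) ^ (n * m)"
proof -
  obtain x j where x: "x \<in> vpb 0" "x $ j = 1" "D = pcls m (proj_class (v x))" using cell_representative[OF D] by blast
  have xS: "x \<in> unit_sphere" by (rule normal_in_sphere[OF x(1,2)])
  have eq: "{\<Xi> \<in> space Q. D \<in> pcls m ` \<nu> ` zeros \<Xi>} = image_hits n m (v x)"
  proof (intro equalityI subsetI)
    fix \<Xi> assume "\<Xi> \<in> {\<Xi> \<in> space Q. D \<in> pcls m ` \<nu> ` zeros \<Xi>}"
    then show "\<Xi> \<in> image_hits n m (v x)" using image_hits_iff[OF xS] x(3) by simp
  next
    fix \<Xi> assume h: "\<Xi> \<in> image_hits n m (v x)"
    then have "\<Xi> \<in> space Q" by (simp add: image_hits_def)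
    then show "\<Xi> \<in> {\<Xi> \<in> space Q. D \<in> pcls m ` \<nu> ` zeros \<Xi>}" using image_hits_iff[OF xS] h x(3) by simp
  qed
  show "{\<Xi> \<in> space Q. D \<in> pcls m ` \<nu> ` zeros \<Xi>} \<in> sets Q"
    unfolding eq by (rule image_hits_measurable[OF sphere_image[OF xS]])
  show "\<bar>measure Q {\<Xi> \<in> space Q. D \<in> pcls m ` \<nu> ` zeros \<Xi>} - 1 / real (ball_count m)\<bar>
      \<le> real n * real CARD('p) ^ (2 * n * nat c) / real CARD('p) ^ k / real CARD('p) ^ (n * m)"
    if "nat c \<le> k" "7 * c + int k + 2 \<le> int m"
    unfolding eq ball_count_def by (rule tangent_comparison[OF card n that x(1,2)])
qed

lemma count_eq_sum:
  assumes m: "m \<ge> 1" and \<Xi>: "\<Xi> \<in> space Q"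
  shows "of_nat (count m \<Xi>) = (\<Sum>D\<in>cells m. indicator {\<Xi> \<in> space Q. D \<in> pcls m ` \<nu> ` zeros \<Xi>} \<Xi> :: ennreal)"
proof -
  have "pcls m ` \<nu> ` zeros \<Xi> \<subseteq> cells m" unfolding cells_def using zeros_subset by (intro image_mono)
  then have "cells m \<inter> pcls m ` \<nu> ` zeros \<Xi> = pcls m ` \<nu> ` zeros \<Xi>" by blast
  moreover have "indicator {\<Xi> \<in> space Q. D \<in> pcls m ` \<nu> ` zeros \<Xi>} \<Xi> = (indicator (pcls m ` \<nu> ` zeros \<Xi>) D :: ennreal)" for D
    using \<Xi> by (simp add: indicator_def)
  ultimately show ?thesis
    using finite_cells[OF m] by (simp add: count_def indicator_def sum.If_cases)
qed

lemma count_measurable: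
  assumes m: "m \<ge> 1"
  shows "(\<lambda>\<Xi>. of_nat (count m \<Xi>) :: ennreal) \<in> borel_measurable Q"
    and "(\<integral>\<^sup>+\<Xi>. of_nat (count m \<Xi>) \<partial>Q) = ennreal (mean_count m)"
proof -
  interpret prob_space Q by (rule prob_space_rows)
  let ?A = "\<lambda>D. {\<Xi> \<in> space Q. D \<in> pcls m ` \<nu> ` zeros \<Xi>}"
  have A: "?A D \<in> sets Q" if "D \<in> cells m" for D by (rule cell_event(1)[OF that])
  have "(\<lambda>\<Xi>. \<Sum>D\<in>cells m. indicator (?A D) \<Xi> :: ennreal) \<in> borel_measurable Q"
    using A by (intro borel_measurable_sum borel_measurable_indicator)
  then show "(\<lambda>\<Xi>. of_nat (count m \<Xi>) :: ennreal) \<in> borel_measurable Q"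
    using count_eq_sum[OF m] by (subst measurable_cong) auto
  have "(\<integral>\<^sup>+\<Xi>. of_nat (count m \<Xi>) \<partial>Q) = (\<integral>\<^sup>+\<Xi>. (\<Sum>D\<in>cells m. indicator (?A D) \<Xi>) \<partial>Q)"
    using count_eq_sum[OF m] by (intro nn_integral_cong) auto
  also have "\<dots> = (\<Sum>D\<in>cells m. \<integral>\<^sup>+\<Xi>. indicator (?A D) \<Xi> \<partial>Q)"
    using A by (intro nn_integral_sum borel_measurable_indicator)
  also have "\<dots> = (\<Sum>D\<in>cells m. emeasure Q (?A D))"
    using A by (intro sum.cong refl nn_integral_indicator)
  also have "\<dots> = ennreal (mean_count m)"
    unfolding mean_count_def by (simp add: emeasure_eq_measure sum_ennreal)
  finally show "(\<integral>\<^sup>+\<Xi>. of_nat (count m \<Xi>) \<partial>Q) = ennreal (mean_count m)" .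
qed

text \<open>The number of balls is at most of order p^(mn) and each contributes an error of order
  p^(-mn) p^-k; the powers of p^m cancel and the bound depends on k alone.\<close>

lemma mean_count_approx:
  assumes k: "nat c \<le> k" and m: "7 * c + int k + 2 \<le> int m"
  shows "\<bar>mean_count m - real (card (cells m)) / real (ball_count m)\<bar>
    \<le> unit_volume * real CARD('p) ^ (nat (2 * c + 1) * n) * real n * real CARD('p) ^ (2 * n * nat c) / real CARD('p) ^ k"
proof -
  let ?q = "real CARD('p)"
  let ?err = "real n * ?q ^ (2 * n * nat c) / ?q ^ k / ?q ^ (n * m)"
  have m1: "m \<ge> 1" using m c_nonneg by simp
  have "mean_count m - real (card (cells m)) / real (ball_count m)
      = (\<Sum>D\<in>cells m. measure Q {\<Xi> \<in> space Q. D \<in> pcls m ` \<nu> ` zeros \<Xi>} - 1 / real (ball_count m))"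
    by (simp add: mean_count_def sum_subtractf)
  also have "\<bar>\<dots>\<bar> \<le> (\<Sum>D\<in>cells m. ?err)"
    using cell_event(2)[OF _ k m] by (intro order_trans[OF sum_abs] sum_mono)
  also have "\<dots> = real (card (cells m)) * ?err" by simp
  also have "\<dots> \<le> unit_volume * ?q ^ ((m + nat (2 * c + 1)) * n) * ?err"
    by (rule mult_right_mono[OF cells_bound[OF m1]]) simp
  also have "\<dots> = unit_volume * ?q ^ (nat (2 * c + 1) * n) * real n * ?q ^ (2 * n * nat c) / ?q ^ k"
    by (simp add: power_add add_mult_distrib mult.commute[of n m])
  finally show ?thesis .
qed

theorem expectation:
  defines "E \<equiv> proj_vol n (\<nu> ` proj_space) / proj_vol n (proj_space :: ('p padic ^ 'n) set set)"
  shows "(\<lambda>\<Xi>. emeasure (count_space UNIV) (zeros \<Xi>)) \<in> borel_measurable Q"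
    and "(\<integral>\<^sup>+\<Xi>. emeasure (count_space UNIV) (zeros \<Xi>) \<partial>Q) = ennreal E"
proof -
  let ?q = "real CARD('p)"
  show "(\<lambda>\<Xi>. emeasure (count_space UNIV) (zeros \<Xi>)) \<in> borel_measurable Q"
    unfolding card_zeros using count_measurable(1) by (intro borel_measurable_SUP) auto
  have inc: "incseq (\<lambda>m. \<lambda>\<Xi>. of_nat (count (Suc m) \<Xi>) :: ennreal)"
    by (intro incseq_SucI le_funI of_nat_mono count_mono) auto
  have int: "(\<integral>\<^sup>+\<Xi>. emeasure (count_space UNIV) (zeros \<Xi>) \<partial>Q) = (SUP m. ennreal (mean_count (Suc m)))"
    unfolding card_zeros
    by (subst nn_integral_monotone_convergence_SUP[OF inc]) (auto simp: count_measurable)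
  have nonneg: "0 \<le> mean_count m" for m by (simp add: mean_count_def sum_nonneg)
  have mono: "incseq (\<lambda>m. mean_count (Suc m))"
  proof (rule incseq_SucI)
    fix m
    have "ennreal (mean_count (Suc m)) \<le> ennreal (mean_count (Suc (Suc m)))"
      unfolding count_measurable(2)[of "Suc m", simplified, symmetric] count_measurable(2)[of "Suc (Suc m)", simplified, symmetric]
      by (intro nn_integral_mono of_nat_mono count_mono) auto
    then show "mean_count (Suc m) \<le> mean_count (Suc (Suc m))" using nonneg by simp
  qed
  define \<rho> where "\<rho> m = real (card (cells m)) / real (ball_count m)" for m
  define K where "K = unit_volume * ?q ^ (nat (2 * c + 1) * n) * real n * ?q ^ (2 * n * nat c)"
  have approx: "\<bar>mean_count m - \<rho> m\<bar> \<le> K / ?q ^ k" if "nat c \<le> k" "7 * c + int k + 2 \<le> int m" for m k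
    unfolding \<rho>_def K_def by (rule mean_count_approx[OF that])
  have \<rho>_le: "\<rho> m \<le> ?q ^ (nat (2 * c + 1) * n)" if "m \<ge> 1" for m
  proof -
    have "?q ^ ((m + nat (2 * c + 1)) * n) = ?q ^ (m * n) * ?q ^ (nat (2 * c + 1) * n)"
      by (simp add: power_add add_mult_distrib)
    then have "real (card (cells m)) \<le> ?q ^ (nat (2 * c + 1) * n) * (unit_volume * ?q ^ (m * n))"
      using cells_bound[OF that] by (simp only: mult_ac)
    then show ?thesis
      unfolding \<rho>_def ball_count[OF that] using unit_volume_pos by (simp add: pos_divide_le_eq)
  qed
  have K0: "0 \<le> K" unfolding K_def using unit_volume_pos by simp
  obtain e where e: "(\<lambda>m. mean_count (Suc m)) \<longlonglongrightarrow> e"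
  proof (rule incseq_convergent[OF mono])
    show "\<forall>m. mean_count (Suc m) \<le> ?q ^ (nat (2 * c + 1) * n) + K"
    proof
      fix m
      \<comment> \<open>The comparison holds only at high resolution, so a low index is bounded
        through a later one by monotonicity.\<close>
      define m' where "m' = Suc m + nat (7 * c) + nat c + 2"
      have "mean_count (Suc m) \<le> mean_count m'"
        using incseqD[OF mono, of m "m' - 1"] by (simp add: m'_def)
      moreover have "\<bar>mean_count m' - \<rho> m'\<bar> \<le> K / ?q ^ nat c"
        by (rule approx) (use c_nonneg in \<open>simp_all add: m'_def\<close>)
      moreover have "K / ?q ^ nat c \<le> K / 1"
        using K0 card_gt_1[where 'p = 'p] by (intro divide_left_mono) (auto simp: one_le_power)
      moreover have "\<rho> m' \<le> ?q ^ (nat (2 * c + 1) * n)" by (rule \<rho>_le) (simp add: m'_def)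
      ultimately show "mean_count (Suc m) \<le> ?q ^ (nat (2 * c + 1) * n) + K" by simp
    qed
  qed
  have lim: "\<rho> \<longlonglongrightarrow> e"
  proof -
    have "(\<lambda>m. mean_count m - \<rho> m) \<longlonglongrightarrow> 0"
    proof (rule LIMSEQ_I)
      fix r :: real assume r: "0 < r"
      have "(\<lambda>k. K / ?q ^ k) \<longlonglongrightarrow> 0"
        using tendsto_mult_right_zero[OF LIMSEQ_inverse_realpow_zero[OF card_gt_1[where 'p = 'p]], of K]
        by (simp add: divide_inverse)
      from LIMSEQ_D[OF this r] obtain k0 where k0': "\<And>k. k \<ge> k0 \<Longrightarrow> norm (K / ?q ^ k - 0) < r" by blast
      then have k0: "K / ?q ^ k < r" if "k \<ge> k0" for k using k0'[OF that] K0 by simp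
      \<comment> \<open>\<open>k\<close> is fixed first to make the relative error small; the
        comparison then holds for all sufficiently large m.\<close>
      define k where "k = max k0 (nat c)"
      have "norm (mean_count m - \<rho> m - 0) < r" if m: "m \<ge> nat (7 * c) + k + 2" for m
      proof -
        have "7 * c + int k + 2 \<le> int m" using m c_nonneg by linarith
        then have "\<bar>mean_count m - \<rho> m\<bar> \<le> K / ?q ^ k" by (intro approx) (simp_all add: k_def)
        moreover have "K / ?q ^ k < r" by (rule k0) (simp add: k_def)
        ultimately show ?thesis by simp
      qed
      then show "\<exists>m0. \<forall>m\<ge>m0. norm (mean_count m - \<rho> m - 0) < r" by blast
    qed
    moreover have "mean_count \<longlonglongrightarrow> e" using e by (rule LIMSEQ_imp_Suc)
    ultimately have "(\<lambda>m. mean_count m - (mean_count m - \<rho> m)) \<longlonglongrightarrow> e - 0" by (intro tendsto_diff)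
    then show ?thesis by simp
  qed
  \<comment> \<open>The normalised count of all balls is the constant \<open>unit_volume\<close>
    from m = 1 on, so multiplying the ratio by it gives the sequence whose limit is the
    volume.\<close>
  have V1: "proj_vol n (\<nu> ` proj_space) = e * unit_volume"
  proof (rule proj_vol_eq_lim)
    show "\<nu> ` proj_space \<subseteq> proj_space" using \<nu>_in_space by blast
    have "(\<lambda>m. \<rho> m * unit_volume) \<longlonglongrightarrow> e * unit_volume" by (intro tendsto_mult lim tendsto_const)
    moreover have "eventually (\<lambda>m. \<rho> m * unit_volume = real (card (pcls m ` \<nu> ` proj_space)) / ?q ^ (m * n)) sequentially"
      unfolding eventually_sequentially
      using unit_volume_pos by (intro exI[of _ 1]) (auto simp: \<rho>_def ball_count cells_def)
    ultimately show "(\<lambda>m. real (card (pcls m ` \<nu> ` proj_space)) / ?q ^ (m * n)) \<longlonglongrightarrow> e * unit_volume"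
      by (rule Lim_transform_eventually)
  qed
  have V2: "proj_vol n (proj_space :: ('p padic ^ 'n) set set) = unit_volume"
  proof (rule proj_vol_eq_lim[OF subset_refl])
    have "eventually (\<lambda>m. unit_volume = real (card (pcls m ` (proj_space :: ('p padic ^ 'n) set set))) / ?q ^ (m * n)) sequentially"
      unfolding eventually_sequentially ball_count_def[symmetric] by (intro exI[of _ 1]) (auto simp: ball_count)
    then show "(\<lambda>m. real (card (pcls m ` (proj_space :: ('p padic ^ 'n) set set))) / ?q ^ (m * n)) \<longlonglongrightarrow> unit_volume"
      by (rule Lim_transform_eventually[OF tendsto_const])
  qed
  have "E = e" unfolding E_def V1 V2 using unit_volume_pos by simp
  moreover have "(SUP m. ennreal (mean_count (Suc m))) = ennreal e"
  proof (rule LIMSEQ_unique[OF LIMSEQ_SUP])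
    show "incseq (\<lambda>m. ennreal (mean_count (Suc m)))" using mono by (auto simp: incseq_def intro: ennreal_leI)
    show "(\<lambda>m. ennreal (mean_count (Suc m))) \<longlonglongrightarrow> ennreal e" using e by (rule tendsto_ennrealI)
  qed
  ultimately show "(\<integral>\<^sup>+\<Xi>. emeasure (count_space UNIV) (zeros \<Xi>) \<partial>Q) = ennreal E" using int by simp
qed

end

text \<open>Independence of all entries is used twice: within a row it makes the coefficient vector
  uniform, and after grouping the entries by rows it makes the rows independent.\<close>

lemma (in prob_space) distr_rows_uniform:
  fixes \<xi> :: "nat \<Rightarrow> 'l::finite \<Rightarrow> 'a \<Rightarrow> 'p::prime_card padic"
  assumes n: "n \<ge> 1"
    and indep: "indep_vars (\<lambda>_. borel) (\<lambda>(i, k). \<xi> i k) ({1..n} \<times> UNIV)"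
    and uniform: "\<And>i k. i \<in> {1..n} \<Longrightarrow> distr M borel (\<xi> i k) = padic_uniform"
  defines "X \<equiv> \<lambda>\<omega>. \<lambda>i\<in>{1..n}. \<chi> k. \<xi> i k \<omega>"
  shows "X \<in> measurable M (row_measure n)" and "distr M (row_measure n) X = row_measure n"
proof -
  have rv: "random_variable borel (\<xi> i k)" if "i \<in> {1..n}" for i k
    using indep that unfolding indep_vars_def by (auto dest!: bspec[of _ _ "(i, k)"])
  have row_rv: "random_variable borel (\<lambda>\<omega>. \<chi> k. \<xi> i k \<omega>)" if i: "i \<in> {1..n}" for i
  proof -
    have "(\<lambda>\<omega> k. \<xi> i k \<omega>) \<in> measurable M (\<Pi>\<^sub>M k\<in>UNIV. borel)"
      using rv[OF i] by (intro measurable_PiM_single') auto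
    from measurable_compose[OF this measurable_vec_lambda_padic] show ?thesis .
  qed
  have row_distr: "distr M borel (\<lambda>\<omega>. \<chi> k. \<xi> i k \<omega>) = vec_uniform" if i: "i \<in> {1..n}" for i
  proof (rule pvec.uniform_unique[OF _ uniform_vec_uniform])
    show "pvec.uniform (distr M borel (\<lambda>\<omega>. \<chi> k. \<xi> i k \<omega>))"
      unfolding pvec.uniform_def
    proof (intro conjI ballI allI prob_space_distr row_rv i)
      fix a :: "'p padic ^ 'l" and s
      assume a: "a \<in> vpb (int 0)"
      let ?A = "\<lambda>k. {x. x - a $ k \<in> pb (int s)}"
      have pre: "(\<lambda>\<omega>. \<chi> k. \<xi> i k \<omega>) -` pvec.coset a s \<inter> space M = (\<Inter>p\<in>{i} \<times> UNIV. (\<lambda>(i, k). \<xi> i k) p -` ?A (snd p) \<inter> space M)"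
        by (auto simp: pvec_coset_eq)
      have "prob (\<Inter>p\<in>{i} \<times> (UNIV :: 'l set). (\<lambda>(i, k). \<xi> i k) p -` ?A (snd p) \<inter> space M)
          = (\<Prod>p\<in>{i} \<times> (UNIV :: 'l set). prob ((\<lambda>(i, k). \<xi> i k) p -` ?A (snd p) \<inter> space M))"
        by (rule indep_varsD[OF indep]) (use i in auto)
      also have "\<dots> = (\<Prod>p\<in>{i} \<times> (UNIV :: 'l set). 1 / real CARD('p) ^ s)"
      proof (intro prod.cong refl)
        fix p :: "nat \<times> 'l" assume p: "p \<in> {i} \<times> UNIV"
        then obtain k where k: "p = (i, k)" by auto
        have "emeasure M (\<xi> i k -` ?A k \<inter> space M) = emeasure (distr M borel (\<xi> i k)) (?A k)"
          by (rule emeasure_distr[OF rv[OF i], symmetric]) simp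
        also have "\<dots> = ennreal (1 / real CARD('p) ^ s)"
          unfolding uniform[OF i] using a by (intro emeasure_padic_uniform) (simp add: vpb_nth)
        finally have "prob (\<xi> i k -` ?A k \<inter> space M) = 1 / real CARD('p) ^ s" by (simp add: emeasure_eq_measure)
        then show "prob ((\<lambda>(i, k). \<xi> i k) p -` ?A (snd p) \<inter> space M) = 1 / real CARD('p) ^ s" by (simp add: k)
      qed
      also have "\<dots> = 1 / real (card (residues s :: ('p padic ^ 'l) set))"
        by (simp add: card_residues card_cartesian_product power_mult power_divide)
      finally have "prob ((\<lambda>\<omega>. \<chi> k. \<xi> i k \<omega>) -` pvec.coset a s \<inter> space M) = 1 / real (card (residues s :: ('p padic ^ 'l) set))"
        unfolding pre .
      then show "emeasure (distr M borel (\<lambda>\<omega>. \<chi> k. \<xi> i k \<omega>)) (pvec.coset a s) = ennreal (1 / real (card (residues s :: ('p padic ^ 'l) set)))"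
        by (simp add: emeasure_distr[OF row_rv[OF i]] emeasure_eq_measure)
    qed simp
  qed
  have "indep_vars (\<lambda>i. \<Pi>\<^sub>M p\<in>{i} \<times> UNIV. borel) (\<lambda>i \<omega>. restrict (\<lambda>p. (\<lambda>(i, k). \<xi> i k) p \<omega>) ({i} \<times> UNIV)) {1..n}"
    by (rule indep_vars_restrict[OF indep]) (auto simp: disjoint_family_on_def)
  moreover have "(\<lambda>g. \<chi> k. g (i, k)) \<in> borel_measurable (\<Pi>\<^sub>M p\<in>{i} \<times> (UNIV :: 'l set). (borel :: 'p padic measure))" for i :: nat
  proof -
    have "(\<lambda>g k. g (i, k)) \<in> measurable (\<Pi>\<^sub>M p\<in>{i} \<times> (UNIV :: 'l set). (borel :: 'p padic measure)) (\<Pi>\<^sub>M k\<in>UNIV. borel)"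
      by (intro measurable_PiM_single') auto
    from measurable_compose[OF this measurable_vec_lambda_padic] show ?thesis .
  qed
  ultimately have "indep_vars (\<lambda>_. borel) (\<lambda>i \<omega>. \<chi> k. restrict (\<lambda>p. (\<lambda>(i, k). \<xi> i k) p \<omega>) ({i} \<times> UNIV) (i, k)) {1..n}"
    by (rule indep_vars_compose2)
  then have "indep_vars (\<lambda>_. borel) (\<lambda>i \<omega>. \<chi> k. \<xi> i k \<omega>) {1..n}" by simp
  then have eq: "distr M (\<Pi>\<^sub>M i\<in>{1..n}. borel) X = (\<Pi>\<^sub>M i\<in>{1..n}. distr M borel (\<lambda>\<omega>. \<chi> k. \<xi> i k \<omega>))"
    unfolding X_def using n row_rv by (subst (asm) indep_vars_iff_distr_eq_PiM') auto
  have "X \<in> measurable M (\<Pi>\<^sub>M i\<in>{1..n}. borel)"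
    unfolding X_def by (intro measurable_restrict row_rv)
  then show "X \<in> measurable M (row_measure n)" by (simp add: measurable_cong_sets[OF refl sets_rows])
  have "distr M (row_measure n) X = distr M (\<Pi>\<^sub>M i\<in>{1..n}. borel) X"
    by (rule distr_cong) (simp_all add: sets_rows)
  also have "\<dots> = row_measure n"
    unfolding eq row_measure_def using row_distr by (intro PiM_cong) auto
  finally show "distr M (row_measure n) X = row_measure n" .
qed

theorem theorem36:
  fixes n d :: nat
    and f :: "'l::finite \<Rightarrow> ('p::prime_card padic, 'n::finite) mpoly"
    and M :: "'w measure"
    and \<xi> :: "nat \<Rightarrow> 'l \<Rightarrow> 'w \<Rightarrow> 'p padic"
  defines "F \<equiv> \<lambda>\<omega> i. \<Sum>k\<in>UNIV. mpoly_scale (\<xi> i k \<omega>) (f k)"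
  defines "N \<equiv> \<lambda>\<omega>. emeasure (count_space UNIV) (proj_zeros {1..n} (F \<omega>))"
  assumes n: "n \<ge> 1" and d: "d \<ge> 1"
    and vars: "CARD('n) = n + 1"
    and basis: "inj f" "mpoly.independent (range f)" "mpoly.span (range f) = homogeneous d"
    and M: "prob_space M"
    and indep: "prob_space.indep_vars M (\<lambda>_. borel) (\<lambda>(i, k). \<xi> i k) ({1..n} \<times> UNIV)"
    and uniform: "\<And>i k. i \<in> {1..n} \<Longrightarrow> distr M borel (\<xi> i k) = padic_uniform"
  shows "N \<in> borel_measurable M \<and>
    (\<integral>\<^sup>+\<omega>. N \<omega> \<partial>M) = ennreal (proj_vol n (proj_map f ` proj_space) /
                          proj_vol n (proj_space :: ('p padic ^ 'n) set set))"
proof -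
  obtain c where "immersion (veronese f) d c" using veronese_immersion[OF basis(1,3) d] by blast
  then interpret immersion "veronese f" d c .
  have hom: "f k \<in> homogeneous d" for k
    using mpoly.span_base[of "f k" "range f"] unfolding basis(3) by simp
  interpret immersion_count "veronese f" d c "proj_map f" n
    using n by unfold_locales (simp_all add: proj_map_eq[OF hom] veronese_def vars)
  define X where "X = (\<lambda>\<omega>. \<lambda>i\<in>{1..n}. \<chi> k. \<xi> i k \<omega>)"
  have X: "X \<in> measurable M (row_measure n)" "distr M (row_measure n) X = row_measure n"
    unfolding X_def by (rule prob_space.distr_rows_uniform[OF M n indep uniform], assumption)+
  \<comment> \<open>The number of zeros depends on the random variables only through the rows, so
    measurability and the integral transfer from the law of the rows.\<close>
  have eq: "N \<omega> = emeasure (count_space UNIV) (zeros (X \<omega>))" for \<omega>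
  proof -
    have "proj_zeros {1..n} (F \<omega>) = zeros (X \<omega>)"
      by (simp add: proj_zeros_def zeros_def kills_def X_def F_def mpoly_eval_linear_combination)
    then show ?thesis by (simp add: N_def)
  qed
  have meas: "(\<lambda>\<Xi>. emeasure (count_space UNIV) (zeros \<Xi>)) \<in> borel_measurable (distr M (row_measure n) X)"
    unfolding X(2) by (rule expectation(1))
  have "N \<in> borel_measurable M"
    unfolding eq[abs_def] using measurable_compose[OF X(1) expectation(1)] .
  moreover have "(\<integral>\<^sup>+\<omega>. N \<omega> \<partial>M) = (\<integral>\<^sup>+\<Xi>. emeasure (count_space UNIV) (zeros \<Xi>) \<partial>distr M (row_measure n) X)"
    unfolding eq by (rule nn_integral_distr[OF X(1) meas, symmetric])
  ultimately show ?thesis unfolding X(2) expectation(2) by simp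
qed

end
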